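(* Let $n\ge 2$ and $k\ge 1$ be integers. Let $X$ be the $n$-adic Cantor space, $S_k=\{0,1,\dots,k-1\}$, $Y=X\times S_k$, $G=\mathbb{Q}_n\times_\delta\mathbb{Z}$ and $H=G\times\mathbb{Z}$ (as defined in the context). Let $\beta$ be the partial action of $H$ on $Y$ given by $$\beta_{(r,j,p)}(x,t)=\left(\frac{x}{n^j}+r,\; t+p\right),\qquad \operatorname{dom}\beta_{(r,j,p)}=\left\{(x,t)\in Y : \tfrac{x}{n^j}+r\in X \text{ and } t+p\in S_k\right\},$$ and let $\alpha$ be the induced partial action of $H$ on $C(Y)$. Then $$C(Y)\times_\alpha H\cong M_k(O_n)$$ as $C^*$-algebras.
   Context: $O_n$ is the Cuntz algebra, i.e. the universal unital $C^*$-algebra generated by $n$ isometries $S_1,\dots,S_n$ with $\sum_{i=1}^n S_iS_i^*=I$, and $M_k(O_n)$ is the algebra of $k\times k$ matrices over it. $\mathbb{Q}_n$ denotes the additive group of $n$-adic rationals, $\mathbb{Q}_n=\{m/n^j : m\in\mathbb{Z}, j\ge 0\}$. The space $X$: the Cantor set obtained from $[0,1]$ by replacing each $n$-adic rational $r\in(0,1)$ by a pair $r^-<r^+$, with $r^-$ the immediate predecessor of $r^+$; $X$ carries the order topology. The endpoints are not doubled: $0$ is regarded as $0^+$ and $1$ as $1^-$, and $0^-$, $1^+$ do not belong to $X$. The map $x\mapsto \frac{x}{n^j}+r$ preserves superscripts: for $x$ $n$-adic, $x^{\pm}\mapsto(\frac{x}{n^j}+r)^{\pm}$. $S_k$ is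 discrete and $Y=X\times S_k$ has the product topology. The group $G=\mathbb{Q}_n\times_\delta\mathbb{Z}$ (discrete): the set $\mathbb{Q}_n\times\mathbb{Z}$, formed using the action $\delta_k(r)=r/n^k$ of $\mathbb{Z}$ on $\mathbb{Q}_n$, with $(s,i)(r,j)=\left(\frac{r}{n^i}+s, i+j\right)$ and $(r,j)^{-1}=(-n^jr,-j)$. $H=G\times\mathbb{Z}$ is the direct product group, with elements written $(r,j,p)$, $(r,j)\in G$, $p\in\mathbb{Z}$. The induced partial action $\alpha$ of $H$ on $C(Y)$: $\alpha_h: C_0(\operatorname{dom}\beta_h)\to C_0(\operatorname{ran}\beta_h)$, $\alpha_h(f)=f\circ\beta_h^{-1}$, where for an open set $V\subseteq Y$, $C_0(V)$ is the ideal of functions in $C(Y)$ vanishing off $V$. The partial crossed product: for a partial action $\alpha$ of a discrete group $K$ on a $C^*$-algebra $C$ (isomorphisms $\alpha_g:\operatorname{dom}\alpha_g\to\operatorname{ran}\alpha_g$ between closed two-sided ideals of $C$, with $\operatorname{dom}\alpha_g=\operatorname{ran}\alpha_{g^{-1}}$, $\alpha_e=\mathrm{id}_C$, and $\alpha_{gh}$ extending $\alpha_g\circ\alpha_h$ on its natural domain), $C\times_\alpha K$ is the (full) $C^*$-algebra obtained as the enveloping $C^*$-algebra of the $*$-algebra of finite formal sums $\sum_g f_gU^g$ with $f_g\in\operatorname{ran}\alpha_g$, with operations determined by $$(eU^g)(fU^h)=\alpha_g(\alpha_{g^{-1}}(e)f)\,U^{gh},\qquad (fU^g)^*=\alpha_{g^{-1}}(f^*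 )\,U^{g^{-1}}.$$ *)

theory Defs
  imports "HOL-Analysis.Analysis" "HOL-Algebra.Module" "HOL-Algebra.QuotRing"
    "HOL-Algebra.Elementary_Groups"
begin

section \<open>Unital *-algebras and C*-algebras\<close>

record 'a star_ops = "(complex, 'a) module" +
  star :: "'a \<Rightarrow> 'a"

record 'a cstar_ops = "'a star_ops" +
  cnorm :: "'a \<Rightarrow> real"

locale star_algebra = ring A for A :: "('a, 'm) star_ops_scheme" (structure) +
  assumes scale_closed: "x \<in> carrier A \<Longrightarrow> c \<odot> x \<in> carrier A"
    and scale_add_left: "x \<in> carrier A \<Longrightarrow> (c + d) \<odot> x = c \<odot> x \<oplus> d \<odot> x"
    and scale_add_right:
      "\<lbrakk>x \<in> carrier A; y \<in> carrier A\<rbrakk> \<Longrightarrow> c \<odot> (x \<oplus> y) = c \<odot> x \<oplus> c \<odot> y"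
    and scale_scale: "x \<in> carrier A \<Longrightarrow> c \<odot> (d \<odot> x) = (c * d) \<odot> x"
    and scale_one: "x \<in> carrier A \<Longrightarrow> 1 \<odot> x = x"
    and scale_mult_left:
      "\<lbrakk>x \<in> carrier A; y \<in> carrier A\<rbrakk> \<Longrightarrow> (c \<odot> x) \<otimes> y = c \<odot> (x \<otimes> y)"
    and scale_mult_right:
      "\<lbrakk>x \<in> carrier A; y \<in> carrier A\<rbrakk> \<Longrightarrow> x \<otimes> (c \<odot> y) = c \<odot> (x \<otimes> y)"
    and star_closed: "x \<in> carrier A \<Longrightarrow> star A x \<in> carrier A"
    and star_star: "x \<in> carrier A \<Longrightarrow> star A (star A x) = x"
    and star_add:
      "\<lbrakk>x \<in> carrier A; y \<in> carrier A\<rbrakk> \<Longrightarrow> star A (x \<oplus> y) = star A x \<oplus> star A y"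
    and star_scale: "x \<in> carrier A \<Longrightarrow> star A (c \<odot> x) = cnj c \<odot> star A x"
    and star_mult:
      "\<lbrakk>x \<in> carrier A; y \<in> carrier A\<rbrakk> \<Longrightarrow> star A (x \<otimes> y) = star A y \<otimes> star A x"

definition cstar_seminorm :: "('a, 'm) star_ops_scheme \<Rightarrow> ('a \<Rightarrow> real) \<Rightarrow> bool" where
  "cstar_seminorm A p \<longleftrightarrow>
     (\<forall>x\<in>carrier A. 0 \<le> p x) \<and>
     (\<forall>x\<in>carrier A. \<forall>y\<in>carrier A. p (x \<oplus>\<^bsub>A\<^esub> y) \<le> p x + p y) \<and>
     (\<forall>c. \<forall>x\<in>carrier A. p (c \<odot>\<^bsub>A\<^esub> x) = cmod c * p x) \<and>
     (\<forall>x\<in>carrier A. \<forall>y\<in>carrier A. p (x \<otimes>\<^bsub>A\<^esub> y) \<le> p x * p y) \<and>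
     (\<forall>x\<in>carrier A. p (star A x) = p x) \<and>
     (\<forall>x\<in>carrier A. p (star A x \<otimes>\<^bsub>A\<^esub> x) = (p x)\<^sup>2)"

definition cauchy_in :: "('a, 'm) ring_scheme \<Rightarrow> ('a \<Rightarrow> real) \<Rightarrow> (nat \<Rightarrow> 'a) \<Rightarrow> bool" where
  "cauchy_in A N x \<longleftrightarrow> (\<forall>i. x i \<in> carrier A) \<and>
     (\<forall>e>0. \<exists>M. \<forall>i\<ge>M. \<forall>j\<ge>M. N (x i \<ominus>\<^bsub>A\<^esub> x j) < e)"

locale cstar_algebra = star_algebra A for A :: "('a, 'm) cstar_ops_scheme" (structure) +
  assumes cstar_seminorm_cnorm: "cstar_seminorm A (cnorm A)"
    and cnorm_eq_0: "\<lbrakk>x \<in> carrier A; cnorm A x = 0\<rbrakk> \<Longrightarrow> x = \<zero>"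
    and complete:
      "cauchy_in A (cnorm A) s \<Longrightarrow> \<exists>x\<in>carrier A. (\<lambda>i. cnorm A (s i \<ominus> x)) \<longlonglongrightarrow> 0"

definition cstar_isomorphic ::
    "('a, 'm) cstar_ops_scheme \<Rightarrow> ('b, 'n) cstar_ops_scheme \<Rightarrow> bool" where
  "cstar_isomorphic A B \<longleftrightarrow> cstar_algebra A \<and> cstar_algebra B \<and>
     (\<exists>\<phi>\<in>ring_iso A B. \<forall>x\<in>carrier A.
        (\<forall>c. \<phi> (c \<odot>\<^bsub>A\<^esub> x) = c \<odot>\<^bsub>B\<^esub> \<phi> x) \<and>
        \<phi> (star A x) = star B (\<phi> x) \<and>
        cnorm B (\<phi> x) = cnorm A x)"


section \<open>Universal and enveloping C*-algebras\<close>

text \<open>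
  C*-seminorms on a *-algebra are exactly the functions \<open>\<lambda>x. \<parallel>\<pi> x\<parallel>\<close> for *-homomorphisms \<open>\<pi>\<close> into
  C*-algebras.  Hence the supremum of all C*-seminorms that vanish on a set \<open>R\<close> of relators is the
  norm of the universal C*-algebra given by the *-algebra \<open>A\<close> subject to the relations \<open>R\<close>; for
  \<open>R = {}\<close> this is the enveloping C*-algebra of \<open>A\<close>.
\<close>

definition max_cstar_seminorm :: "('a, 'm) star_ops_scheme \<Rightarrow> 'a set \<Rightarrow> 'a \<Rightarrow> real" where
  "max_cstar_seminorm A R x =
     (SUP p\<in>{p. cstar_seminorm A p \<and> (\<forall>r\<in>R. p r = 0)}. p x)"

definition cauchy_ring :: "('a, 'm) ring_scheme \<Rightarrow> ('a \<Rightarrow> real) \<Rightarrow> (nat \<Rightarrow> 'a) ring" where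
  "cauchy_ring A N = \<lparr>carrier = {x. cauchy_in A N x},
     mult = (\<lambda>x y i. x i \<otimes>\<^bsub>A\<^esub> y i), one = (\<lambda>i. \<one>\<^bsub>A\<^esub>),
     ring.zero = (\<lambda>i. \<zero>\<^bsub>A\<^esub>), add = (\<lambda>x y i. x i \<oplus>\<^bsub>A\<^esub> y i)\<rparr>"

definition null_seqs :: "('a, 'm) ring_scheme \<Rightarrow> ('a \<Rightarrow> real) \<Rightarrow> (nat \<Rightarrow> 'a) set" where
  "null_seqs A N = {x. cauchy_in A N x \<and> (\<lambda>i. N (x i)) \<longlonglongrightarrow> 0}"

text \<open>The Hausdorff completion of \<open>A\<close> for the seminorm \<open>N\<close>: Cauchy sequences modulo null sequences.\<close>

definition hausdorff_completion ::
    "('a, 'm) star_ops_scheme \<Rightarrow> ('a \<Rightarrow> real) \<Rightarrow> (nat \<Rightarrow> 'a) set cstar_ops" where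
  "hausdorff_completion A N =
     (let S = cauchy_ring A N; Z = null_seqs A N; Q = S Quot Z in
        \<lparr>carrier = carrier Q, mult = mult Q, one = one Q, ring.zero = ring.zero Q, add = add Q,
         smult = (\<lambda>c P. \<Union>x\<in>P. Z +>\<^bsub>S\<^esub> (\<lambda>i. c \<odot>\<^bsub>A\<^esub> x i)),
         star = (\<lambda>P. \<Union>x\<in>P. Z +>\<^bsub>S\<^esub> (\<lambda>i. star A (x i))),
         cnorm = (\<lambda>P. THE l. \<forall>x\<in>P. (\<lambda>i. N (x i)) \<longlonglongrightarrow> l)\<rparr>)"

definition universal_cstar ::
    "('a, 'm) star_ops_scheme \<Rightarrow> 'a set \<Rightarrow> (nat \<Rightarrow> 'a) set cstar_ops" where
  "universal_cstar A R = hausdorff_completion A (max_cstar_seminorm A R)"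

abbreviation enveloping_cstar :: "('a, 'm) star_ops_scheme \<Rightarrow> (nat \<Rightarrow> 'a) set cstar_ops" where
  "enveloping_cstar A \<equiv> universal_cstar A {}"


section \<open>The Cuntz algebras\<close>

text \<open>
  The free unital *-algebra on \<open>S\<^sub>1, \<dots>, S\<^sub>n\<close>: finitely supported functions on words, where the letter
  \<open>(i, False)\<close> stands for \<open>S\<^sub>i\<close> and \<open>(i, True)\<close> for its adjoint.
\<close>

type_synonym word = "(nat \<times> bool) list"

definition word_fun :: "word \<Rightarrow> word \<Rightarrow> complex" where
  "word_fun v w = (if w = v then 1 else 0)"

definition free_star_algebra :: "nat \<Rightarrow> (word \<Rightarrow> complex) star_ops" where
  "free_star_algebra n =
     \<lparr>carrier = {a. finite {w. a w \<noteq> 0} \<and> (\<forall>w. a w \<noteq> 0 \<longrightarrow> set w \<subseteq> {1..n} \<times> UNIV)},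
      mult = (\<lambda>a b w. \<Sum>i\<le>length w. a (take i w) * b (drop i w)),
      one = word_fun [],
      ring.zero = (\<lambda>w. 0),
      add = (\<lambda>a b w. a w + b w),
      smult = (\<lambda>c a w. c * a w),
      star = (\<lambda>a w. cnj (a (rev (map (\<lambda>(i, s). (i, \<not> s)) w))))\<rparr>"

definition cuntz_generator :: "nat \<Rightarrow> word \<Rightarrow> complex" where
  "cuntz_generator i = word_fun [(i, False)]"

definition cuntz_relators :: "nat \<Rightarrow> (word \<Rightarrow> complex) set" where
  "cuntz_relators n =
     (let F = free_star_algebra n; S = cuntz_generator in
      {star F (S i) \<otimes>\<^bsub>F\<^esub> S i \<ominus>\<^bsub>F\<^esub> \<one>\<^bsub>F\<^esub> | i. i \<in> {1..n}} \<union>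
      {(\<Oplus>\<^bsub>F\<^esub>i\<in>{1..n}. S i \<otimes>\<^bsub>F\<^esub> star F (S i)) \<ominus>\<^bsub>F\<^esub> \<one>\<^bsub>F\<^esub>})"

definition cuntz_algebra :: "nat \<Rightarrow> (nat \<Rightarrow> word \<Rightarrow> complex) set cstar_ops" where
  "cuntz_algebra n = universal_cstar (free_star_algebra n) (cuntz_relators n)"


section \<open>Matrix algebras\<close>

text \<open>Matrices are indexed by \<open>{..<k}\<close> and padded with zeros outside the index range.\<close>

definition mk_matrix ::
    "nat \<Rightarrow> ('a, 'm) ring_scheme \<Rightarrow> (nat \<Rightarrow> nat \<Rightarrow> 'a) \<Rightarrow> nat \<Rightarrow> nat \<Rightarrow> 'a" where
  "mk_matrix k A f = (\<lambda>i j. if i < k \<and> j < k then f i j else \<zero>\<^bsub>A\<^esub>)"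

definition matrix_star_algebra ::
    "nat \<Rightarrow> ('a, 'm) star_ops_scheme \<Rightarrow> (nat \<Rightarrow> nat \<Rightarrow> 'a) star_ops" where
  "matrix_star_algebra k A =
     \<lparr>carrier = {mk_matrix k A f | f. \<forall>i<k. \<forall>j<k. f i j \<in> carrier A},
      mult = (\<lambda>a b. mk_matrix k A (\<lambda>i j. \<Oplus>\<^bsub>A\<^esub>l\<in>{..<k}. a i l \<otimes>\<^bsub>A\<^esub> b l j)),
      one = mk_matrix k A (\<lambda>i j. if i = j then \<one>\<^bsub>A\<^esub> else \<zero>\<^bsub>A\<^esub>),
      ring.zero = mk_matrix k A (\<lambda>i j. \<zero>\<^bsub>A\<^esub>),
      add = (\<lambda>a b. mk_matrix k A (\<lambda>i j. a i j \<oplus>\<^bsub>A\<^esub> b i j)),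
      smult = (\<lambda>c a. mk_matrix k A (\<lambda>i j. c \<odot>\<^bsub>A\<^esub> a i j)),
      star = (\<lambda>a. mk_matrix k A (\<lambda>i j. star A (a j i)))\<rparr>"

text \<open>
  For a C*-algebra \<open>A\<close>, the *-algebra of matrices over \<open>A\<close> has exactly one C*-norm (it is complete);
  it is the largest of all C*-seminorms, and this is how it is singled out here.
\<close>

definition matrix_cstar ::
    "nat \<Rightarrow> ('a, 'm) star_ops_scheme \<Rightarrow> (nat \<Rightarrow> nat \<Rightarrow> 'a) cstar_ops" where
  "matrix_cstar k A =
     (let M = matrix_star_algebra k A in
      star_ops.extend M (cstar_ops.fields (max_cstar_seminorm M {})))"


section \<open>Partial crossed products\<close>

text \<open>
  A partial action of a discrete group \<open>K\<close> on a unital C*-algebra \<open>C\<close> is given by the ideals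
  \<open>D g = ran \<alpha>\<^sub>g = dom \<alpha>\<^bsub>g\<inverse>\<^esub>\<close> and the maps \<open>\<alpha> g\<close>, of which only the values on \<open>D g\<inverse>\<close> matter.
  A function \<open>a\<close> represents the formal sum of the terms \<open>a g U\<^sup>g\<close>.  Collecting the terms of a product at
  \<open>U\<^sup>l\<close> gives a sum over pairs \<open>(g, h)\<close> with \<open>g h = l\<close>, that is, \<open>h = g\<inverse> l\<close>.
\<close>

definition partial_crossed_star_algebra ::
    "('c, 'm) star_ops_scheme \<Rightarrow> ('g, 'k) monoid_scheme \<Rightarrow> ('g \<Rightarrow> 'c set) \<Rightarrow> ('g \<Rightarrow> 'c \<Rightarrow> 'c)
      \<Rightarrow> ('g \<Rightarrow> 'c) star_ops" where
  "partial_crossed_star_algebra C K D \<alpha> =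
     \<lparr>carrier = {a. (\<forall>g\<in>carrier K. a g \<in> D g) \<and> (\<forall>g. g \<notin> carrier K \<longrightarrow> a g = \<zero>\<^bsub>C\<^esub>) \<and>
                    finite {g. a g \<noteq> \<zero>\<^bsub>C\<^esub>}},
      mult = (\<lambda>a b l. if l \<in> carrier K
                then \<Oplus>\<^bsub>C\<^esub>g\<in>{g. a g \<noteq> \<zero>\<^bsub>C\<^esub>}.
                       \<alpha> g (\<alpha> (inv\<^bsub>K\<^esub> g) (a g) \<otimes>\<^bsub>C\<^esub> b (inv\<^bsub>K\<^esub> g \<otimes>\<^bsub>K\<^esub> l))
                else \<zero>\<^bsub>C\<^esub>),
      one = (\<lambda>g. if g = \<one>\<^bsub>K\<^esub> then \<one>\<^bsub>C\<^esub> else \<zero>\<^bsub>C\<^esub>),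
      ring.zero = (\<lambda>g. \<zero>\<^bsub>C\<^esub>),
      add = (\<lambda>a b g. a g \<oplus>\<^bsub>C\<^esub> b g),
      smult = (\<lambda>c a g. c \<odot>\<^bsub>C\<^esub> a g),
      star = (\<lambda>a g. if g \<in> carrier K then \<alpha> g (star C (a (inv\<^bsub>K\<^esub> g))) else \<zero>\<^bsub>C\<^esub>)\<rparr>"

definition partial_crossed_product ::
    "('c, 'm) star_ops_scheme \<Rightarrow> ('g, 'k) monoid_scheme \<Rightarrow> ('g \<Rightarrow> 'c set) \<Rightarrow> ('g \<Rightarrow> 'c \<Rightarrow> 'c)
      \<Rightarrow> (nat \<Rightarrow> 'g \<Rightarrow> 'c) set cstar_ops" where
  "partial_crossed_product C K D \<alpha> = enveloping_cstar (partial_crossed_star_algebra C K D \<alpha>)"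


section \<open>Continuous functions on a compact space\<close>

text \<open>Functions are extended by zero off the space.\<close>

definition cont_fun_algebra :: "'y topology \<Rightarrow> ('y \<Rightarrow> complex) cstar_ops" where
  "cont_fun_algebra Y =
     \<lparr>carrier = {f. continuous_map Y euclidean f \<and> (\<forall>y. y \<notin> topspace Y \<longrightarrow> f y = 0)},
      mult = (\<lambda>f g y. f y * g y),
      one = (\<lambda>y. if y \<in> topspace Y then 1 else 0),
      ring.zero = (\<lambda>y. 0),
      add = (\<lambda>f g y. f y + g y),
      smult = (\<lambda>c f y. c * f y),
      star = (\<lambda>f y. cnj (f y)),
      cnorm = (\<lambda>f. SUP y\<in>topspace Y. cmod (f y))\<rparr>"

definition C0_ideal :: "'y topology \<Rightarrow> 'y set \<Rightarrow> ('y \<Rightarrow> complex) set" where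
  "C0_ideal Y V = {f \<in> carrier (cont_fun_algebra Y). \<forall>y. y \<notin> V \<longrightarrow> f y = 0}"

definition induced_map :: "'y set \<Rightarrow> ('y \<Rightarrow> 'y) \<Rightarrow> ('y \<Rightarrow> complex) \<Rightarrow> 'y \<Rightarrow> complex" where
  "induced_map V b f = (\<lambda>y. if y \<in> b ` V then f (inv_into V b y) else 0)"


section \<open>The n-adic Cantor space\<close>

text \<open>
  \<open>Pt x (-1)\<close> and \<open>Pt x 1\<close> are the lower and upper copies of an n-adic \<open>x\<close>, and \<open>Pt x 0\<close> is a point
  that is not doubled.
\<close>

datatype point = Pt (val: real) (side: int)

instantiation point :: linorder
begin

definition less_eq_point :: "point \<Rightarrow> point \<Rightarrow> bool" where
  "x \<le> y \<longleftrightarrow> val x < val y \<or> val x = val y \<and> side x \<le> side y"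

definition less_point :: "point \<Rightarrow> point \<Rightarrow> bool" where
  "x < y \<longleftrightarrow> val x < val y \<or> val x = val y \<and> side x < side y"

instance
  by standard (auto simp: less_eq_point_def less_point_def point.expand)

end

definition nadic :: "nat \<Rightarrow> real set" where
  "nadic n = {of_int m / real n ^ j | m j. True}"

definition cantor_points :: "nat \<Rightarrow> point set" where
  "cantor_points n =
     {Pt x 0 | x. 0 < x \<and> x < 1 \<and> x \<notin> nadic n} \<union>
     {Pt x s | x s. 0 < x \<and> x < 1 \<and> x \<in> nadic n \<and> s \<in> {-1, 1}} \<union>
     {Pt 0 1, Pt 1 (-1)}"

definition order_topology_on :: "'a::linorder set \<Rightarrow> 'a topology" where
  "order_topology_on P = topology_generated_by
     (insert P ({{y \<in> P. y < a} | a. a \<in> P} \<union> {{y \<in> P. a < y} | a. a \<in> P}))"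

definition cantor_space :: "nat \<Rightarrow> point topology" where
  "cantor_space n = order_topology_on (cantor_points n)"

definition Y_space :: "nat \<Rightarrow> nat \<Rightarrow> (point \<times> int) topology" where
  "Y_space n k = prod_topology (cantor_space n) (discrete_topology {0..<int k})"


section \<open>The group and its partial action\<close>

definition G_group :: "nat \<Rightarrow> (real \<times> int) monoid" where
  "G_group n = \<lparr>carrier = nadic n \<times> UNIV,
     mult = (\<lambda>(s, i) (r, j). (r / real n powi i + s, i + j)), one = (0, 0)\<rparr>"

definition H_group :: "nat \<Rightarrow> ((real \<times> int) \<times> int) monoid" where
  "H_group n = G_group n \<times>\<times> integer_group"

fun beta :: "nat \<Rightarrow> (real \<times> int) \<times> int \<Rightarrow> point \<times> int \<Rightarrow> point \<times> int" where
  "beta n ((r, j), p) (Pt x s, t) = (Pt (x / real n powi j + r) s, t + p)"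

definition beta_domain :: "nat \<Rightarrow> nat \<Rightarrow> (real \<times> int) \<times> int \<Rightarrow> (point \<times> int) set" where
  "beta_domain n k h = {y \<in> topspace (Y_space n k). beta n h y \<in> topspace (Y_space n k)}"

definition alpha ::
    "nat \<Rightarrow> nat \<Rightarrow> (real \<times> int) \<times> int \<Rightarrow> (point \<times> int \<Rightarrow> complex) \<Rightarrow> point \<times> int \<Rightarrow> complex" where
  "alpha n k h = induced_map (beta_domain n k h) (beta n h)"

definition alpha_ran ::
    "nat \<Rightarrow> nat \<Rightarrow> (real \<times> int) \<times> int \<Rightarrow> (point \<times> int \<Rightarrow> complex) set" where
  "alpha_ran n k h = C0_ideal (Y_space n k) (beta n h ` beta_domain n k h)"

end

theory Submission
  imports Defs "HOL-Library.Function_Algebras"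
begin

text \<open>
  Let \<open>B\<close> be the algebraic partial crossed product, \<open>E\<close> its enveloping C*-algebra, and \<open>p\<close> the indicator
  function of the sheet \<open>X \<times> {0}\<close>.  The monomials of the \<open>n\<close> contractions \<open>x \<mapsto> (x + a) / n\<close> of the sheet satisfy
  the Cuntz relations with \<open>p\<close> as unit, and every element of \<open>H\<close> that preserves the sheet is, on a small
  cylinder, a quotient of two products of such contractions.  So the corner \<open>pEp\<close> should be the
  Cuntz algebra \<open>O\<^sub>n\<close>; since the translations of the sheets are matrix units over this corner, \<open>E\<close> should be
  \<open>M\<^sub>k(O\<^sub>n)\<close>.  The monomials of the contractions are words in the generators (\<open>cyl_mono_mult\<close>), and with their
  adjoints they span all monomials with locally constant coefficients (\<open>cyl_mono_pair\<close>).  These are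
  dense, because continuity on the Cantor space means that the oscillation on the cylinders of level
  \<open>M\<close> becomes uniformly small (\<open>continuous_iff_oscillation\<close>) and because \<open>f U\<^sup>g\<close> has norm at most
  the supremum of \<open>f\<close> (\<open>mono_seminorm_le\<close>).

  The norm on the corner is at most that of \<open>O\<^sub>n\<close> by the universal property of \<open>O\<^sub>n\<close>.  Instead of the simplicity
  of \<open>O\<^sub>n\<close>, a homomorphism from \<open>B\<close> to \<open>O\<^sub>n\<close> gives the other bound (\<open>crossed_to_cuntz\<close>).  For a
  locally constant \<open>f\<close> it sends \<open>f U\<^sup>g\<close> to the sum of \<open>f(y) W(y) W(g\<^sup>-\<^sup>1y)\<^sup>*\<close> over the cylinders of a fine level,
  where \<open>W(y)\<close> is the product of the generators along the digits of the cylinder of \<open>y\<close>, preceded by one of \<open>k\<close>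
  isometries with orthogonal ranges that tells the sheet; for general \<open>f\<close> it is a limit of such sums.  The
  composition with the map from the generators to the corner is \<open>x \<mapsto> T x T\<^sup>*\<close> for an isometry \<open>T\<close>.

  All norms are handled through one fact: a C*-seminorm on a C*-algebra is at most the norm
  (\<open>cstar_seminorm_le_cnorm\<close>).  For self-adjoint \<open>h\<close> with \<open>\<parallel>h\<parallel> < 1\<close> it follows from the unitary
  \<open>h + i (1 - h\<^sup>2)\<^bsup>1/2\<^esup>\<close>, whose square root is the limit of an iteration, without spectral theory.  So
  the norm of a C*-algebra is the largest C*-seminorm, and an algebraic *-isomorphism from \<open>E\<close> onto the matrices
  over \<open>O\<^sub>n\<close> is isometric (\<open>cstar_isomorphic_max_seminorm\<close>); it is given by matrix units
  (\<open>cstar_isomorphic_matrix_corner\<close>).  In the same elementary way \<open>projections_orthogonal\<close> shows that isometries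
  whose range projections add up to the unit have orthogonal ranges.
\<close>

section \<open>Star algebras, seminorms and limits\<close>

context star_algebra
begin

lemma scale_zero_right [simp]: "c \<odot> \<zero> = \<zero>"
  using scale_add_right[of \<zero> \<zero> c] scale_closed[of \<zero> c] by simp

lemma scale_zero_left [simp]: "x \<in> carrier A \<Longrightarrow> 0 \<odot> x = \<zero>"
  using scale_add_left[of x 0 0] scale_closed[of x 0] by simp

lemma scale_minus_one: "x \<in> carrier A \<Longrightarrow> (-1) \<odot> x = \<ominus> x"
  by (metis scale_add_left scale_closed scale_one scale_zero_left add.inv_equality ab_left_minus)

lemma scale_minus_right: "x \<in> carrier A \<Longrightarrow> c \<odot> (\<ominus> x) = \<ominus> (c \<odot> x)"
  by (metis mult.commute scale_closed scale_minus_one scale_scale)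

lemma scale_minus_left: "x \<in> carrier A \<Longrightarrow> (- c) \<odot> x = \<ominus> (c \<odot> x)"
  by (metis mult_minus1 scale_closed scale_minus_one scale_scale)

lemma scale_diff_right:
  "\<lbrakk>x \<in> carrier A; y \<in> carrier A\<rbrakk> \<Longrightarrow> c \<odot> (x \<ominus> y) = c \<odot> x \<ominus> c \<odot> y"
  by (simp add: minus_eq scale_add_right scale_minus_right)

lemma star_zero [simp]: "star A \<zero> = \<zero>"
  using star_scale[of \<zero> 0] star_closed[of \<zero>] by simp

lemma star_minus: "x \<in> carrier A \<Longrightarrow> star A (\<ominus> x) = \<ominus> star A x"
  using star_scale[of x "-1"] by (simp add: scale_minus_one star_closed)

lemma star_diff:
  "\<lbrakk>x \<in> carrier A; y \<in> carrier A\<rbrakk> \<Longrightarrow> star A (x \<ominus> y) = star A x \<ominus> star A y"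
  by (simp add: minus_eq star_add star_minus)

lemma star_one [simp]: "star A \<one> = \<one>"
  by (metis l_one one_closed r_one star_closed star_mult star_star)

lemma scale_finsum:
  assumes "finite I" "f \<in> I \<rightarrow> carrier A"
  shows "c \<odot> (\<Oplus>i\<in>I. f i) = (\<Oplus>i\<in>I. c \<odot> f i)"
  using assms
  by (induction I) (auto simp: scale_add_right scale_closed Pi_iff finsum_closed)

lemma star_finsum:
  assumes "finite I" "f \<in> I \<rightarrow> carrier A"
  shows "star A (\<Oplus>i\<in>I. f i) = (\<Oplus>i\<in>I. star A (f i))"
  using assms
  by (induction I) (auto simp: star_add star_closed Pi_iff finsum_closed)

lemma finsum_mono_neutral:
  assumes "finite J" "I \<subseteq> J" "\<And>i. i \<in> J \<Longrightarrow> i \<notin> I \<Longrightarrow> f i = \<zero>" "f \<in> I \<rightarrow> carrier A"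
  shows "(\<Oplus>i\<in>I. f i) = (\<Oplus>i\<in>J. f i)"
  using assms by (intro add.finprod_mono_neutral_cong_left) force+

lemma finsum_single:
  assumes "finite I" "j \<in> I" "f j \<in> carrier A" "\<And>i. i \<in> I \<Longrightarrow> i \<noteq> j \<Longrightarrow> f i = \<zero>"
  shows "(\<Oplus>i\<in>I. f i) = f j"
  using finsum_mono_neutral[of I "{j}" f] assms by simp

lemma finsum_Times:
  assumes "finite I" "finite J" "\<And>i j. i \<in> I \<Longrightarrow> j \<in> J \<Longrightarrow> f i j \<in> carrier A"
  shows "(\<Oplus>i\<in>I. \<Oplus>j\<in>J. f i j) = (\<Oplus>p\<in>I \<times> J. f (fst p) (snd p))"
  using assms(1,3)
proof (induction I)
  case empty then show ?case by simp
next
  case (insert i I)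
  have "{i} \<times> J = Pair i ` J" by auto
  then have "(\<Oplus>p\<in>{i} \<times> J. f (fst p) (snd p)) = (\<Oplus>j\<in>J. f i j)"
    using finsum_reindex[of "\<lambda>p. f (fst p) (snd p)" "Pair i" J] insert.prems
    by (simp add: inj_on_def Pi_iff)
  moreover have "insert i I \<times> J = ({i} \<times> J) \<union> (I \<times> J)" by auto
  moreover have "(\<Oplus>p\<in>({i} \<times> J) \<union> (I \<times> J). f (fst p) (snd p)) =
      (\<Oplus>p\<in>{i} \<times> J. f (fst p) (snd p)) \<oplus> (\<Oplus>p\<in>I \<times> J. f (fst p) (snd p))"
    by (rule finsum_Un_disjoint) (use insert assms(2) in auto)
  ultimately show ?case
    using insert by (simp add: finsum_closed Pi_iff)
qed

end

text \<open>Star homomorphisms need not be unital: corners are the main source of examples below.\<close>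
definition star_hom :: "('a, 'm) star_ops_scheme \<Rightarrow> ('b, 'l) star_ops_scheme \<Rightarrow> ('a \<Rightarrow> 'b) \<Rightarrow> bool"
  where "star_hom A B h \<longleftrightarrow> (\<forall>x\<in>carrier A. h x \<in> carrier B \<and> h (star A x) = star B (h x) \<and>
     (\<forall>c. h (c \<odot>\<^bsub>A\<^esub> x) = c \<odot>\<^bsub>B\<^esub> h x) \<and>
     (\<forall>y\<in>carrier A. h (x \<oplus>\<^bsub>A\<^esub> y) = h x \<oplus>\<^bsub>B\<^esub> h y \<and> h (x \<otimes>\<^bsub>A\<^esub> y) = h x \<otimes>\<^bsub>B\<^esub> h y))"

lemma star_homD:
  assumes "star_hom A B h" "x \<in> carrier A"
  shows "h x \<in> carrier B" "h (star A x) = star B (h x)" "h (c \<odot>\<^bsub>A\<^esub> x) = c \<odot>\<^bsub>B\<^esub> h x"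
    "y \<in> carrier A \<Longrightarrow> h (x \<oplus>\<^bsub>A\<^esub> y) = h x \<oplus>\<^bsub>B\<^esub> h y"
    "y \<in> carrier A \<Longrightarrow> h (x \<otimes>\<^bsub>A\<^esub> y) = h x \<otimes>\<^bsub>B\<^esub> h y"
  using assms unfolding star_hom_def by auto

lemma star_hom_compose:
  "star_hom A B h \<Longrightarrow> star_hom B C g \<Longrightarrow> star_hom A C (\<lambda>x. g (h x))"
  unfolding star_hom_def by auto

lemma
  assumes h: "star_hom A B h" and A: "star_algebra A" and B: "star_algebra B"
  shows star_hom_zero: "h \<zero>\<^bsub>A\<^esub> = \<zero>\<^bsub>B\<^esub>"
    and star_hom_diff: "\<lbrakk>x \<in> carrier A; y \<in> carrier A\<rbrakk> \<Longrightarrow> h (x \<ominus>\<^bsub>A\<^esub> y) = h x \<ominus>\<^bsub>B\<^esub> h y"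
    and star_hom_finsum: "\<lbrakk>finite I; f \<in> I \<rightarrow> carrier A\<rbrakk> \<Longrightarrow>
      h (\<Oplus>\<^bsub>A\<^esub>i\<in>I. f i) = (\<Oplus>\<^bsub>B\<^esub>i\<in>I. h (f i))"
proof -
  interpret A: star_algebra A by fact
  interpret B: star_algebra B by fact
  note hD = star_homD[OF h]
  show 0: "h \<zero>\<^bsub>A\<^esub> = \<zero>\<^bsub>B\<^esub>"
    using hD(3)[of "\<zero>\<^bsub>A\<^esub>" 0] hD(1) by simp
  show "h (x \<ominus>\<^bsub>A\<^esub> y) = h x \<ominus>\<^bsub>B\<^esub> h y" if "x \<in> carrier A" "y \<in> carrier A"
    using that hD(3)[of y "-1"]
    by (simp add: A.minus_eq B.minus_eq hD A.scale_minus_one B.scale_minus_one)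
  show "h (\<Oplus>\<^bsub>A\<^esub>i\<in>I. f i) = (\<Oplus>\<^bsub>B\<^esub>i\<in>I. h (f i))" if "finite I" "f \<in> I \<rightarrow> carrier A"
    using that
  proof (induction I)
    case empty then show ?case by (simp add: 0)
  next
    case (insert i I)
    then have "f i \<in> carrier A" "f \<in> I \<rightarrow> carrier A" by auto
    moreover have "(\<lambda>i. h (f i)) \<in> I \<rightarrow> carrier B" using insert hD(1) by auto
    ultimately show ?case
      using insert by (simp add: hD A.finsum_closed)
  qed
qed

locale seminormed_star_algebra = star_algebra A for A :: "('a, 'm) star_ops_scheme" (structure) +
  fixes N :: "'a \<Rightarrow> real"
  assumes seminorm: "cstar_seminorm A N"
begin

lemma N_nonneg [simp]: "x \<in> carrier A \<Longrightarrow> 0 \<le> N x"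
  and N_triangle: "\<lbrakk>x \<in> carrier A; y \<in> carrier A\<rbrakk> \<Longrightarrow> N (x \<oplus> y) \<le> N x + N y"
  and N_scale: "x \<in> carrier A \<Longrightarrow> N (c \<odot> x) = cmod c * N x"
  and N_mult: "\<lbrakk>x \<in> carrier A; y \<in> carrier A\<rbrakk> \<Longrightarrow> N (x \<otimes> y) \<le> N x * N y"
  and N_star: "x \<in> carrier A \<Longrightarrow> N (star A x) = N x"
  and N_cstar: "x \<in> carrier A \<Longrightarrow> N (star A x \<otimes> x) = (N x)\<^sup>2"
  using seminorm unfolding cstar_seminorm_def by auto

lemma N_cstar': "x \<in> carrier A \<Longrightarrow> N (x \<otimes> star A x) = (N x)\<^sup>2"
  using N_cstar[of "star A x"] by (simp add: N_star star_closed star_star)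

lemma N_zero [simp]: "N \<zero> = 0"
  using N_scale[of \<zero> 0] by simp

lemma N_uminus [simp]: "x \<in> carrier A \<Longrightarrow> N (\<ominus> x) = N x"
  using N_scale[of x "-1"] by (simp add: scale_minus_one)

lemma N_projection:
  assumes "x \<in> carrier A" "star A x = x" "x \<otimes> x = x"
  shows "N x \<le> 1"
proof -
  have "N x = (N x)\<^sup>2" using N_cstar[OF assms(1)] assms by simp
  then have "N x = 0 \<or> N x = 1" by (auto simp: power2_eq_square)
  then show ?thesis by auto
qed

text \<open>A partial isometry is a contraction, whatever its initial projection.\<close>
lemma N_partial_isometry:
  assumes "x \<in> carrier A" "p \<in> carrier A" "star A p = p" "p \<otimes> p = p" "star A x \<otimes> x = p"
  shows "N x \<le> 1"
proof -
  have "(N x)\<^sup>2 \<le> 1" using N_cstar[OF assms(1)] N_projection[of p] assms by simp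
  then show ?thesis by (simp add: power2_le_iff_abs_le[of 1, simplified])
qed

lemma N_one: "N \<one> \<le> 1"
  by (rule N_projection) auto

lemma N_diff: "\<lbrakk>x \<in> carrier A; y \<in> carrier A\<rbrakk> \<Longrightarrow> N (x \<ominus> y) \<le> N x + N y"
  using N_triangle[of x "\<ominus> y"] by (simp add: minus_eq)

lemma diff_split:
  "\<lbrakk>x \<in> carrier A; y \<in> carrier A; z \<in> carrier A\<rbrakk> \<Longrightarrow> x \<ominus> y = (x \<ominus> z) \<oplus> (z \<ominus> y)"
  by algebra

lemma N_diff_triangle:
  "\<lbrakk>x \<in> carrier A; y \<in> carrier A; z \<in> carrier A\<rbrakk> \<Longrightarrow> N (x \<ominus> y) \<le> N (x \<ominus> z) + N (z \<ominus> y)"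
  using diff_split[of x y z] N_triangle[of "x \<ominus> z" "z \<ominus> y"] by simp

lemma N_diff_commute: "\<lbrakk>x \<in> carrier A; y \<in> carrier A\<rbrakk> \<Longrightarrow> N (x \<ominus> y) = N (y \<ominus> x)"
proof -
  assume xy: "x \<in> carrier A" "y \<in> carrier A"
  then have "\<ominus> (x \<ominus> y) = y \<ominus> x" by algebra
  then show ?thesis using N_uminus[of "x \<ominus> y"] xy by simp
qed

lemma N_diff_abs: "\<lbrakk>x \<in> carrier A; y \<in> carrier A\<rbrakk> \<Longrightarrow> \<bar>N x - N y\<bar> \<le> N (x \<ominus> y)"
proof -
  assume xy: "x \<in> carrier A" "y \<in> carrier A"
  have "x = (x \<ominus> y) \<oplus> y" "y = (y \<ominus> x) \<oplus> x" using xy by algebra+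
  then have "N x \<le> N (x \<ominus> y) + N y" "N y \<le> N (y \<ominus> x) + N x"
    using N_triangle[of "x \<ominus> y" y] N_triangle[of "y \<ominus> x" x] xy by auto
  then show ?thesis using N_diff_commute[OF xy] by simp
qed

lemma N_mult_diff:
  assumes "x \<in> carrier A" "y \<in> carrier A" "x' \<in> carrier A" "y' \<in> carrier A"
  shows "N (x \<otimes> y \<ominus> x' \<otimes> y') \<le> N (x \<ominus> x') * N y + N x' * N (y \<ominus> y')"
proof -
  have "x \<otimes> y \<ominus> x' \<otimes> y' = ((x \<ominus> x') \<otimes> y) \<oplus> (x' \<otimes> (y \<ominus> y'))"
    using assms by algebra
  then show ?thesis
    using N_triangle[of "(x \<ominus> x') \<otimes> y" "x' \<otimes> (y \<ominus> y')"]
      N_mult[of "x \<ominus> x'" y] N_mult[of x' "y \<ominus> y'"] assms by simp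
qed

lemma N_add_diff:
  assumes "x \<in> carrier A" "y \<in> carrier A" "x' \<in> carrier A" "y' \<in> carrier A"
  shows "N ((x \<oplus> y) \<ominus> (x' \<oplus> y')) \<le> N (x \<ominus> x') + N (y \<ominus> y')"
proof -
  have "(x \<oplus> y) \<ominus> (x' \<oplus> y') = (x \<ominus> x') \<oplus> (y \<ominus> y')"
    using assms by algebra
  then show ?thesis
    using N_triangle[of "(x \<ominus> x')" "(y \<ominus> y')"] assms by simp
qed

definition tends :: "(nat \<Rightarrow> 'a) \<Rightarrow> 'a \<Rightarrow> bool" where
  "tends s x \<longleftrightarrow> (\<forall>i. s i \<in> carrier A) \<and> x \<in> carrier A \<and> (\<lambda>i. N (s i \<ominus> x)) \<longlonglongrightarrow> 0"

lemma tendsD: "tends s x \<Longrightarrow> s i \<in> carrier A" "tends s x \<Longrightarrow> x \<in> carrier A"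
  unfolding tends_def by auto

lemma tendsI:
  assumes "\<And>i. s i \<in> carrier A" "x \<in> carrier A" "\<And>i. N (s i \<ominus> x) \<le> e i" "e \<longlonglongrightarrow> 0"
  shows "tends s x"
  unfolding tends_def
proof (intro conjI allI)
  show "(\<lambda>i. N (s i \<ominus> x)) \<longlonglongrightarrow> 0"
    using assms by (intro tendsto_sandwich[OF _ _ tendsto_const[of 0] assms(4)] always_eventually) simp_all
qed (use assms in simp_all)

lemma tends_const: "x \<in> carrier A \<Longrightarrow> tends (\<lambda>_. x) x"
  unfolding tends_def by (simp add: minus_eq r_neg)

lemma tends_norm: "tends s x \<Longrightarrow> (\<lambda>i. N (s i)) \<longlonglongrightarrow> N x"
proof -
  assume s: "tends s x"
  have "(\<lambda>i. N (s i) - N x) \<longlonglongrightarrow> 0"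
  proof (rule Lim_null_comparison)
    show "\<forall>\<^sub>F i in sequentially. norm (N (s i) - N x) \<le> N (s i \<ominus> x)"
      using N_diff_abs tendsD[OF s] by (intro always_eventually) simp
  qed (use s in \<open>simp add: tends_def\<close>)
  then show ?thesis by (simp add: LIM_zero_iff)
qed

lemma tends_add:
  assumes "tends s x" "tends t y"
  shows "tends (\<lambda>i. s i \<oplus> t i) (x \<oplus> y)"
proof (rule tendsI[where e = "\<lambda>i. N (s i \<ominus> x) + N (t i \<ominus> y)"])
  show "(\<lambda>i. N (s i \<ominus> x) + N (t i \<ominus> y)) \<longlonglongrightarrow> 0"
    by (rule tendsto_add_zero) (use assms in \<open>simp_all add: tends_def\<close>)
  show "N (s i \<oplus> t i \<ominus> (x \<oplus> y)) \<le> N (s i \<ominus> x) + N (t i \<ominus> y)" for i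
    by (intro N_add_diff tendsD[OF assms(1)] tendsD[OF assms(2)])
qed (use tendsD[OF assms(1)] tendsD[OF assms(2)] in simp_all)

lemma tends_star:
  assumes "tends s x" shows "tends (\<lambda>i. star A (s i)) (star A x)"
proof -
  note c = tendsD[OF assms]
  have "N (star A (s i) \<ominus> star A x) = N (s i \<ominus> x)" for i
    using star_diff[OF c] N_star[of "s i \<ominus> x"] c by simp
  then show ?thesis using assms star_closed c unfolding tends_def by simp
qed

lemma tends_scale:
  assumes "tends s x" shows "tends (\<lambda>i. c \<odot> s i) (c \<odot> x)"
proof -
  note c = tendsD[OF assms]
  have "N (c \<odot> s i \<ominus> c \<odot> x) = cmod c * N (s i \<ominus> x)" for i
    using scale_diff_right[OF c] N_scale[of "s i \<ominus> x" c] c by simp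
  then show ?thesis using assms scale_closed c unfolding tends_def
    by (simp add: tendsto_mult_right_zero)
qed

lemma tends_minus: "tends s x \<Longrightarrow> tends (\<lambda>i. \<ominus> s i) (\<ominus> x)"
  using tends_scale[of s x "-1"] tendsD[of s x] by (simp add: scale_minus_one)

lemma tends_diff: "tends s x \<Longrightarrow> tends t y \<Longrightarrow> tends (\<lambda>i. s i \<ominus> t i) (x \<ominus> y)"
  using tends_add[OF _ tends_minus] by (simp add: minus_eq)

lemma tends_mult:
  assumes "tends s x" "tends t y"
  shows "tends (\<lambda>i. s i \<otimes> t i) (x \<otimes> y)"
proof (rule tendsI[where e = "\<lambda>i. N (s i \<ominus> x) * N (t i) + N x * N (t i \<ominus> y)"])
  have "(\<lambda>i. N (s i \<ominus> x) * N (t i) + N x * N (t i \<ominus> y)) \<longlonglongrightarrow> 0 * N y + N x * 0"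
    by (rule tendsto_add[OF tendsto_mult[OF _ tends_norm[OF assms(2)]] tendsto_mult[OF tendsto_const]])
      (use assms in \<open>simp_all add: tends_def\<close>)
  then show "(\<lambda>i. N (s i \<ominus> x) * N (t i) + N x * N (t i \<ominus> y)) \<longlonglongrightarrow> 0" by simp
next
  show "N (s i \<otimes> t i \<ominus> x \<otimes> y) \<le> N (s i \<ominus> x) * N (t i) + N x * N (t i \<ominus> y)" for i
    by (intro N_mult_diff tendsD[OF assms(1)] tendsD[OF assms(2)])
qed (use tendsD[OF assms(1)] tendsD[OF assms(2)] in simp_all)

lemma tends_unique: "tends s x \<Longrightarrow> tends s y \<Longrightarrow> N (x \<ominus> y) = 0"
  using tends_norm[OF tends_diff, of s x s y] tendsD(1)[of s x]
  by (simp add: minus_eq r_neg LIMSEQ_const_iff)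

lemma cauchy_inD:
  assumes "cauchy_in A N s"
  shows "s i \<in> carrier A" "e > 0 \<Longrightarrow> \<exists>M. \<forall>i\<ge>M. \<forall>j\<ge>M. N (s i \<ominus> s j) < e"
  using assms unfolding cauchy_in_def by blast+

lemma cauchy_inI:
  assumes "\<And>i. s i \<in> carrier A" "\<And>e. e > 0 \<Longrightarrow> \<exists>M. \<forall>i\<ge>M. \<forall>j\<ge>M. N (s i \<ominus> s j) < e"
  shows "cauchy_in A N s"
  using assms unfolding cauchy_in_def by blast

lemma tends_cauchy:
  assumes s: "tends s x"
  shows "cauchy_in A N s"
proof (rule cauchy_inI)
  fix e :: real assume e: "e > 0"
  have "\<forall>\<^sub>F i in sequentially. N (s i \<ominus> x) < e / 2"
    using s e unfolding tends_def by (intro order_tendstoD) auto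
  then obtain M where M: "\<forall>i\<ge>M. N (s i \<ominus> x) < e / 2"
    unfolding eventually_sequentially by blast
  have "N (s i \<ominus> s j) < e" if "i \<ge> M" "j \<ge> M" for i j
  proof -
    have "N (s i \<ominus> s j) \<le> N (s i \<ominus> x) + N (s j \<ominus> x)"
      using N_diff_triangle[of "s i" "s j" x] N_diff_commute[of x "s j"] tendsD[OF s] by simp
    moreover have "N (s i \<ominus> x) < e / 2" "N (s j \<ominus> x) < e / 2" using M that by auto
    ultimately show ?thesis by simp
  qed
  then show "\<exists>M. \<forall>i\<ge>M. \<forall>j\<ge>M. N (s i \<ominus> s j) < e" by blast
qed (rule tendsD[OF s])

lemma cauchy_bounded:
  assumes "cauchy_in A N s"
  obtains B where "B > 0" "\<And>i. N (s i) \<le> B"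
proof -
  have c: "s i \<in> carrier A" for i using assms unfolding cauchy_in_def by auto
  obtain M where M: "\<forall>i\<ge>M. \<forall>j\<ge>M. N (s i \<ominus> s j) < 1"
    using cauchy_inD(2)[OF assms, of 1] by auto
  define B where "B = 1 + (\<Sum>i\<le>M. N (s i))"
  have *: "N (s i) \<le> (\<Sum>i\<le>M. N (s i))" if "i \<le> M" for i
    using that c by (intro member_le_sum) auto
  have "N (s i) \<le> B" for i
  proof (cases "i \<le> M")
    case True then show ?thesis using *[of i] by (simp add: B_def)
  next
    case False
    then have "\<bar>N (s i) - N (s M)\<bar> < 1"
      using M N_diff_abs[OF c c, of i M] by (metis le_less_trans nat_le_linear order_refl)
    then show ?thesis using *[of M] by (simp add: B_def)
  qed
  moreover have "B > 0" using c unfolding B_def by (intro add_pos_nonneg sum_nonneg) auto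
  ultimately show ?thesis using that by blast
qed

lemma cauchy_norm_convergent:
  assumes "cauchy_in A N s" shows "convergent (\<lambda>i. N (s i))"
proof -
  have c: "s i \<in> carrier A" for i using assms unfolding cauchy_in_def by auto
  have "Cauchy (\<lambda>i. N (s i))"
    unfolding Cauchy_def
  proof (intro allI impI)
    fix e :: real assume "e > 0"
    then obtain M where M: "\<forall>i\<ge>M. \<forall>j\<ge>M. N (s i \<ominus> s j) < e"
      using cauchy_inD(2)[OF assms] by blast
    have "dist (N (s i)) (N (s j)) < e" if "i \<ge> M" "j \<ge> M" for i j
      using le_less_trans[OF N_diff_abs[OF c c, of i j]] M that by (simp add: dist_real_def)
    then show "\<exists>M. \<forall>m\<ge>M. \<forall>n\<ge>M. dist (N (s m)) (N (s n)) < e" by blast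
  qed
  then show ?thesis by (rule Cauchy_convergent)
qed

lemma tends_cong:
  assumes s: "tends s x" and t: "\<And>i. t i \<in> carrier A" and eq: "\<And>i. M \<le> i \<Longrightarrow> t i = s i"
  shows "tends t x"
proof -
  have "(\<lambda>i. N (t i \<ominus> x)) \<longlonglongrightarrow> 0"
  proof (rule Lim_transform_eventually)
    show "(\<lambda>i. N (s i \<ominus> x)) \<longlonglongrightarrow> 0" using s by (simp add: tends_def)
    show "\<forall>\<^sub>F i in sequentially. N (s i \<ominus> x) = N (t i \<ominus> x)"
      using eventually_ge_at_top[of M] by eventually_elim (simp add: eq)
  qed
  then show ?thesis using t tendsD(2)[OF s] by (simp add: tends_def)
qed

lemma tends_subseq:
  assumes s: "tends s x" and \<phi>: "filterlim \<phi> sequentially sequentially"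
  shows "tends (\<lambda>i. s (\<phi> i)) x"
  using s filterlim_compose[of "\<lambda>i. N (s i \<ominus> x)" "nhds 0" sequentially \<phi> sequentially] \<phi>
  unfolding tends_def by simp

end

lemma cstar_seminorm_pullback:
  assumes h: "star_hom A B h" and q: "cstar_seminorm B q" and A: "star_algebra A"
  shows "cstar_seminorm A (\<lambda>x. q (h x))"
proof -
  note hD = star_homD[OF h]
  interpret A: star_algebra A by fact
  show ?thesis using q unfolding cstar_seminorm_def by (simp add: hD A.star_closed)
qed

lemma (in cstar_algebra) seminormed: "seminormed_star_algebra A (cnorm A)"
  by unfold_locales (rule cstar_seminorm_cnorm)

sublocale cstar_algebra \<subseteq> seminormed_star_algebra A "cnorm A"
  by (rule seminormed)

context cstar_algebra
begin

lemma tends_eq: "tends s x \<Longrightarrow> tends s y \<Longrightarrow> x = y"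
proof -
  assume s: "tends s x" "tends s y"
  then have xy: "x \<in> carrier A" "y \<in> carrier A" by (auto simp: tends_def)
  then have "x \<ominus> y = \<zero>" using tends_unique[OF s] cnorm_eq_0 by simp
  moreover have "x = (x \<ominus> y) \<oplus> y" using xy by algebra
  ultimately show "x = y" using xy by simp
qed

lemma cauchy_tends: "cauchy_in A (cnorm A) s \<Longrightarrow> \<exists>x. tends s x"
  using complete[of s] unfolding tends_def cauchy_in_def by blast

end

section \<open>Contractivity of C*-seminorms\<close>

context seminormed_star_algebra
begin

lemma tends_Suc: "tends s x \<Longrightarrow> tends (\<lambda>i. s (Suc i)) x"
  unfolding tends_def using LIMSEQ_Suc[of "\<lambda>i. N (s i \<ominus> x)" 0] by simp

lemma cauchy_in_geometric:
  assumes c: "\<And>i. s i \<in> carrier A" and r: "0 \<le> r" "r < 1"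
    and d: "\<And>l d. N (s (l + d) \<ominus> s l) \<le> r ^ l"
  shows "cauchy_in A N s"
proof (rule cauchy_inI)
  fix e :: real assume "e > 0"
  then obtain M where M: "r ^ M < e" using real_arch_pow_inv[of e r] r by blast
  have *: "N (s i \<ominus> s j) < e" if "M \<le> j" "j \<le> i" for i j
  proof -
    have "N (s i \<ominus> s j) \<le> r ^ j" using d[of j "i - j"] that by simp
    also have "\<dots> \<le> r ^ M" using r that by (intro power_decreasing) auto
    finally show ?thesis using M by simp
  qed
  have "N (s i \<ominus> s j) < e" if "M \<le> i" "M \<le> j" for i j
    using *[of j i] *[of i j] N_diff_commute[OF c c, of i j] that by (cases "j \<le> i") auto
  then show "\<exists>M. \<forall>i\<ge>M. \<forall>j\<ge>M. N (s i \<ominus> s j) < e" by blast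
qed (rule c)

end

context cstar_algebra
begin

text \<open>
  The iteration \<open>w \<mapsto> (h\<^sup>2 + w\<^sup>2) / 2\<close> is a contraction on the ball of radius
  \<open>1 - (1 - \<parallel>h\<parallel>\<^sup>2)\<^bsup>1/2\<^esup>\<close>, and \<open>1 - w\<close> is the wanted root for its fixed point \<open>w\<close>.
\<close>
lemma sqrt_one_minus_square:
  assumes h: "h \<in> carrier A" "star A h = h" "cnorm A h < 1"
  obtains y where "y \<in> carrier A" "star A y = y" "y \<otimes> y = \<one> \<ominus> h \<otimes> h" "h \<otimes> y = y \<otimes> h"
proof -
  define a where "a = h \<otimes> h"
  define \<rho> where "\<rho> = (cnorm A h)\<^sup>2"
  define r where "r = 1 - sqrt (1 - \<rho>)"
  have n0: "0 \<le> cnorm A h" using h by simp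
  have \<rho>: "0 \<le> \<rho>" "\<rho> < 1"
    unfolding \<rho>_def using h n0 by (auto simp: abs_square_less_1)
  have r: "0 \<le> r" "r < 1" using \<rho> by (auto simp: r_def)
  have rr: "(\<rho> + r * r) / 2 = r"
  proof -
    define t where "t = sqrt (1 - \<rho>)"
    have "t * t = 1 - \<rho>" using \<rho> by (simp add: t_def)
    then show ?thesis unfolding r_def t_def[symmetric] by (simp add: field_simps)
  qed
  have a: "a \<in> carrier A" "star A a = a" "cnorm A a \<le> \<rho>" "h \<otimes> a = a \<otimes> h"
    unfolding a_def \<rho>_def using h N_mult[of h h] by (auto simp: star_mult power2_eq_square m_assoc)
  define w where "w = rec_nat \<zero> (\<lambda>_ w. (1/2) \<odot> (a \<oplus> w \<otimes> w))"
  have w0: "w 0 = \<zero>" and wS: "w (Suc i) = (1/2) \<odot> (a \<oplus> w i \<otimes> w i)" for i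
    by (simp_all add: w_def)
  have w: "w i \<in> carrier A \<and> star A (w i) = w i \<and> h \<otimes> w i = w i \<otimes> h \<and> cnorm A (w i) \<le> r" for i
  proof (induction i)
    case 0 then show ?case using h r by (simp add: w0)
  next
    case (Suc i)
    then have c: "w i \<in> carrier A" "a \<oplus> w i \<otimes> w i \<in> carrier A" using a by auto
    have "h \<otimes> (w i \<otimes> w i) = (w i \<otimes> w i) \<otimes> h"
      using Suc h by (metis m_assoc)
    then have 1: "h \<otimes> w (Suc i) = w (Suc i) \<otimes> h"
      unfolding wS using a c h by (simp add: scale_mult_left scale_mult_right l_distr r_distr)
    have "cnorm A (w i \<otimes> w i) \<le> r * r"
      using N_mult[OF c(1) c(1)] mult_mono[of "cnorm A (w i)" r "cnorm A (w i)" r] Suc c r by simp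
    then have "cnorm A (a \<oplus> w i \<otimes> w i) \<le> \<rho> + r * r"
      using N_triangle[of a "w i \<otimes> w i"] a c by simp
    then have "cnorm A (w (Suc i)) \<le> r"
      unfolding wS using rr c by (simp add: N_scale)
    then show ?case using 1 Suc c a by (simp add: wS scale_closed star_scale star_add star_mult)
  qed
  have wc: "w i \<in> carrier A" for i using w by blast
  have d: "cnorm A (w (l + d) \<ominus> w l) \<le> r ^ l" for l d
  proof (induction l)
    case 0 then show ?case using w[of d] r by (simp add: w0 minus_eq)
  next
    case (Suc l)
    let ?u = "w (l + d)" and ?v = "w l"
    have "w (Suc l + d) \<ominus> w (Suc l) = (1/2) \<odot> ((a \<oplus> ?u \<otimes> ?u) \<ominus> (a \<oplus> ?v \<otimes> ?v))"
      using wc a by (simp add: wS scale_diff_right)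
    also have "(a \<oplus> ?u \<otimes> ?u) \<ominus> (a \<oplus> ?v \<otimes> ?v) = ?u \<otimes> ?u \<ominus> ?v \<otimes> ?v"
    proof -
      have "?u \<otimes> ?u \<in> carrier A" "?v \<otimes> ?v \<in> carrier A" using wc by auto
      then show ?thesis using a(1) by algebra
    qed
    finally have "cnorm A (w (Suc l + d) \<ominus> w (Suc l)) = cnorm A (?u \<otimes> ?u \<ominus> ?v \<otimes> ?v) / 2"
      using wc by (simp add: N_scale)
    also have "\<dots> \<le> (cnorm A (?u \<ominus> ?v) * cnorm A ?u + cnorm A ?v * cnorm A (?u \<ominus> ?v)) / 2"
      using N_mult_diff[OF wc wc wc wc] by simp
    also have "\<dots> \<le> (cnorm A (?u \<ominus> ?v) * r + r * cnorm A (?u \<ominus> ?v)) / 2"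
      using w wc by (intro divide_right_mono add_mono mult_left_mono mult_right_mono) auto
    also have "\<dots> = r * cnorm A (?u \<ominus> ?v)" by simp
    also have "\<dots> \<le> r * r ^ l" using Suc r by (intro mult_left_mono) auto
    finally show ?case by simp
  qed
  obtain W where W: "tends w W"
    using cauchy_tends[OF cauchy_in_geometric[OF wc r d]] by blast
  have Wc: "W \<in> carrier A" by (rule tendsD[OF W])
  have "tends (\<lambda>i. (1/2) \<odot> (a \<oplus> w i \<otimes> w i)) ((1/2) \<odot> (a \<oplus> W \<otimes> W))"
    by (intro tends_scale tends_add tends_const tends_mult W a)
  then have fp: "W = (1/2) \<odot> (a \<oplus> W \<otimes> W)"
    using tends_Suc[OF W] tends_eq by (simp add: wS)
  have "2 \<odot> W = 2 \<odot> ((1/2) \<odot> (a \<oplus> W \<otimes> W))"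
    using fp by (rule arg_cong)
  also have "\<dots> = a \<oplus> W \<otimes> W"
    using a Wc by (simp add: scale_scale scale_one)
  finally have "2 \<odot> W = a \<oplus> W \<otimes> W" .
  then have WW: "W \<oplus> W = a \<oplus> W \<otimes> W"
    using scale_add_left[OF Wc, of 1 1] Wc by (simp add: scale_one)
  have sW: "star A W = W" using tends_star[OF W] W tends_eq w by simp
  have hW: "h \<otimes> W = W \<otimes> h"
    using tends_mult[OF tends_const[OF h(1)] W] tends_mult[OF W tends_const[OF h(1)]] tends_eq w by simp
  have "(\<one> \<ominus> W) \<otimes> (\<one> \<ominus> W) = \<one> \<ominus> (W \<oplus> W) \<oplus> W \<otimes> W"
    using Wc by (simp add: minus_eq l_distr r_distr l_minus r_minus minus_add a_assoc)
  also have "\<dots> = \<one> \<ominus> a"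
  proof -
    have "W \<otimes> W \<in> carrier A" using Wc by simp
    then show ?thesis unfolding WW using a(1) by algebra
  qed
  finally have "(\<one> \<ominus> W) \<otimes> (\<one> \<ominus> W) = \<one> \<ominus> h \<otimes> h" by (simp add: a_def)
  moreover have "h \<otimes> (\<one> \<ominus> W) = (\<one> \<ominus> W) \<otimes> h"
    using h(1) Wc hW by (simp add: minus_eq l_distr r_distr l_minus r_minus)
  moreover have "star A (\<one> \<ominus> W) = \<one> \<ominus> W"
    using star_diff[OF one_closed Wc] sW by simp
  ultimately show thesis
    using that[of "\<one> \<ominus> W"] Wc by blast
qed

text \<open>
  A self-adjoint \<open>h\<close> with \<open>\<parallel>h\<parallel> < 1\<close> is the real part of the unitary \<open>h + i (1 - h\<^sup>2)\<^bsup>1/2\<^esup>\<close>, and every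
  C*-seminorm is at most one on unitaries.
\<close>
theorem cstar_seminorm_le_cnorm:
  assumes q: "cstar_seminorm A q" and x: "x \<in> carrier A"
  shows "q x \<le> cnorm A x"
proof -
  interpret Q: seminormed_star_algebra A q by unfold_locales (rule q)
  have less: "q h \<le> 1" if h: "h \<in> carrier A" "star A h = h" "cnorm A h < 1" for h
  proof -
    obtain y where y: "y \<in> carrier A" "star A y = y" "y \<otimes> y = \<one> \<ominus> h \<otimes> h" "h \<otimes> y = y \<otimes> h"
      using sqrt_one_minus_square[OF h] by blast
    define z where "z = \<i> \<odot> y"
    have z: "z \<in> carrier A" "star A z = \<ominus> z" "h \<otimes> z = z \<otimes> h" "z \<otimes> z = \<ominus> (\<one> \<ominus> h \<otimes> h)"
      unfolding z_def using y h(1)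
      by (simp_all add: scale_closed star_scale scale_mult_left scale_mult_right scale_scale
          scale_minus_left scale_minus_one scale_one)
    have u: "h \<oplus> z \<in> carrier A" using h z by simp
    have s: "star A (h \<oplus> z) = h \<ominus> z" using h z by (simp add: star_add minus_eq)
    have "(h \<ominus> z) \<otimes> (h \<oplus> z) = h \<otimes> h \<oplus> h \<otimes> z \<ominus> z \<otimes> h \<ominus> z \<otimes> z"
      using h(1) z(1) by algebra
    also have "\<dots> = h \<otimes> h \<ominus> \<ominus> (\<one> \<ominus> h \<otimes> h)"
    proof -
      have "z \<otimes> h \<in> carrier A" "h \<otimes> h \<in> carrier A" using h z by auto
      then show ?thesis unfolding z(3,4) by algebra
    qed
    also have "\<dots> = \<one>"
    proof -
      have "h \<otimes> h \<in> carrier A" using h by auto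
      then show ?thesis by algebra
    qed
    finally have "star A (h \<oplus> z) \<otimes> (h \<oplus> z) = \<one>" by (simp add: s)
    then have u1: "q (h \<oplus> z) \<le> 1"
      using Q.N_partial_isometry[OF u, of \<one>] by simp
    then have u2: "q (h \<ominus> z) \<le> 1" using Q.N_star[OF u] s by simp
    have "2 \<odot> h = (h \<oplus> z) \<oplus> (h \<ominus> z)"
    proof -
      have "2 \<odot> h = h \<oplus> h" using scale_add_left[OF h(1), of 1 1] h by (simp add: scale_one)
      also have "\<dots> = (h \<oplus> z) \<oplus> (h \<ominus> z)" using h(1) z(1) by algebra
      finally show ?thesis .
    qed
    then have "2 * q h \<le> 2"
      using Q.N_scale[OF h(1), of 2] Q.N_triangle[of "h \<oplus> z" "h \<ominus> z"] u1 u2 h z by simp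
    then show ?thesis by simp
  qed
  have sa: "q h \<le> cnorm A h" if h: "h \<in> carrier A" "star A h = h" for h
  proof (rule field_le_epsilon)
    fix e :: real assume e: "e > 0"
    define t where "t = cnorm A h + e"
    have t: "t > 0" using e N_nonneg[OF h(1)] unfolding t_def by linarith
    have "cnorm A (complex_of_real (1/t) \<odot> h) = cnorm A h / t"
      using N_scale[OF h(1), of "complex_of_real (1/t)"] t by (simp add: norm_divide)
    also have "\<dots> < 1" using t e by (simp add: t_def)
    finally have "q (complex_of_real (1/t) \<odot> h) \<le> 1"
      using h by (intro less) (simp_all add: scale_closed star_scale)
    then have "q h / t \<le> 1"
      using Q.N_scale[OF h(1), of "complex_of_real (1/t)"] t by (simp add: norm_divide)
    then show "q h \<le> cnorm A h + e"
      using t by (simp add: t_def)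
  qed
  have "(q x)\<^sup>2 \<le> (cnorm A x)\<^sup>2"
    using sa[of "star A x \<otimes> x"] x
    by (simp add: star_closed star_mult star_star Q.N_cstar N_cstar)
  then show ?thesis using N_nonneg[OF x] by (rule power2_le_imp_le)
qed

end

section \<open>Universal seminorms\<close>

lemma cstar_seminorm_zero: "cstar_seminorm A (\<lambda>_. 0)"
  unfolding cstar_seminorm_def by simp

context star_algebra
begin

context
  fixes R
  assumes bounded: "\<And>x. x \<in> carrier A \<Longrightarrow>
    \<exists>B. \<forall>p. cstar_seminorm A p \<longrightarrow> (\<forall>r\<in>R. p r = 0) \<longrightarrow> p x \<le> B"
begin

lemma max_cstar_seminorm_upper:
  assumes "cstar_seminorm A p" "\<And>r. r \<in> R \<Longrightarrow> p r = 0" "x \<in> carrier A"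
  shows "p x \<le> max_cstar_seminorm A R x"
proof -
  obtain B where "\<forall>p. cstar_seminorm A p \<longrightarrow> (\<forall>r\<in>R. p r = 0) \<longrightarrow> p x \<le> B"
    using bounded[OF assms(3)] by blast
  then have "bdd_above ((\<lambda>p. p x) ` {p. cstar_seminorm A p \<and> (\<forall>r\<in>R. p r = 0)})"
    by (auto intro!: bdd_aboveI[of _ B])
  then show ?thesis
    unfolding max_cstar_seminorm_def using assms by (intro cSUP_upper) auto
qed

lemma max_cstar_seminorm_least:
  assumes "\<And>p. cstar_seminorm A p \<Longrightarrow> (\<And>r. r \<in> R \<Longrightarrow> p r = 0) \<Longrightarrow> p x \<le> b"
  shows "max_cstar_seminorm A R x \<le> b"
  unfolding max_cstar_seminorm_def
  using cstar_seminorm_zero[of A] assms by (intro cSUP_least) auto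

lemma max_cstar_seminorm_relator: "r \<in> R \<Longrightarrow> r \<in> carrier A \<Longrightarrow> max_cstar_seminorm A R r = 0"
  using max_cstar_seminorm_upper[OF cstar_seminorm_zero, of r]
  by (intro antisym max_cstar_seminorm_least) auto

lemma cstar_seminorm_max: "cstar_seminorm A (max_cstar_seminorm A R)" (is "cstar_seminorm A ?m")
proof -
  note up = max_cstar_seminorm_upper and least = max_cstar_seminorm_least
  have sn: "seminormed_star_algebra A p" if "cstar_seminorm A p" for p
    by unfold_locales (rule that)
  have nn: "0 \<le> ?m x" if "x \<in> carrier A" for x
    using up[OF cstar_seminorm_zero _ that] by simp
  have scale: "?m (c \<odot> x) \<le> cmod c * ?m x" if x: "x \<in> carrier A" for c x
  proof (rule least)
    fix p assume p: "cstar_seminorm A p" "\<And>r. r \<in> R \<Longrightarrow> p r = 0"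
    then have "p (c \<odot> x) = cmod c * p x"
      using seminormed_star_algebra.N_scale[OF sn x] by simp
    then show "p (c \<odot> x) \<le> cmod c * ?m x"
      using up[OF p x] by (simp add: mult_left_mono)
  qed
  show ?thesis
    unfolding cstar_seminorm_def
  proof (intro conjI ballI allI)
    fix x y assume xy: "x \<in> carrier A" "y \<in> carrier A"
    show "?m (x \<oplus> y) \<le> ?m x + ?m y"
    proof (rule least)
      fix p assume p: "cstar_seminorm A p" "\<And>r. r \<in> R \<Longrightarrow> p r = 0"
      then show "p (x \<oplus> y) \<le> ?m x + ?m y"
        using up[OF p xy(1)] up[OF p xy(2)] seminormed_star_algebra.N_triangle[OF sn xy] by fastforce
    qed
    show "?m (x \<otimes> y) \<le> ?m x * ?m y"
    proof (rule least)
      fix p assume p: "cstar_seminorm A p" "\<And>r. r \<in> R \<Longrightarrow> p r = 0"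
      interpret seminormed_star_algebra A p using sn p by simp
      have "p x * p y \<le> ?m x * ?m y"
        using up[OF p xy(1)] up[OF p xy(2)] nn xy by (intro mult_mono) auto
      then show "p (x \<otimes> y) \<le> ?m x * ?m y"
        using N_mult[OF xy] by simp
    qed
  next
    fix c x assume x: "x \<in> carrier A"
    show "?m (c \<odot> x) = cmod c * ?m x"
    proof (cases "c = 0")
      case True then show ?thesis using scale[OF x, of 0] nn[of "0 \<odot> x"] x by simp
    next
      case False
      have "?m x = ?m (inverse c \<odot> (c \<odot> x))" using x False by (simp add: scale_scale scale_one)
      also have "\<dots> \<le> cmod (inverse c) * ?m (c \<odot> x)" using x by (intro scale scale_closed)
      finally have "cmod c * ?m x \<le> ?m (c \<odot> x)"
        using False by (simp add: norm_divide field_simps)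
      then show ?thesis using scale[OF x, of c] by simp
    qed
  next
    fix x assume x: "x \<in> carrier A"
    show "?m (star A x) = ?m x"
      unfolding max_cstar_seminorm_def using seminormed_star_algebra.N_star[OF sn x]
      by (intro SUP_cong) auto
    have *: "(p x)\<^sup>2 = p (star A x \<otimes> x)" if "cstar_seminorm A p" for p
      using seminormed_star_algebra.N_cstar[OF sn[OF that] x] by simp
    have xx: "star A x \<otimes> x \<in> carrier A" using x by (simp add: star_closed)
    show "?m (star A x \<otimes> x) = (?m x)\<^sup>2"
    proof (rule antisym)
      show "?m (star A x \<otimes> x) \<le> (?m x)\<^sup>2"
      proof (rule least)
        fix p assume p: "cstar_seminorm A p" "\<And>r. r \<in> R \<Longrightarrow> p r = 0"
        have "(p x)\<^sup>2 \<le> (?m x)\<^sup>2" using up[OF p x] seminormed_star_algebra.N_nonneg[OF sn x] p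
          by (intro power_mono) auto
        then show "p (star A x \<otimes> x) \<le> (?m x)\<^sup>2" using * p by simp
      qed
      have "?m x \<le> sqrt (?m (star A x \<otimes> x))"
      proof (rule least)
        fix p assume p: "cstar_seminorm A p" "\<And>r. r \<in> R \<Longrightarrow> p r = 0"
        show "p x \<le> sqrt (?m (star A x \<otimes> x))"
          using up[OF p xx] *[OF p(1)] by (intro real_le_rsqrt) simp
      qed
      then show "(?m x)\<^sup>2 \<le> ?m (star A x \<otimes> x)"
        using nn[OF x] nn[OF xx] by (metis power_mono real_sqrt_pow2)
    qed
  qed (rule nn)
qed

end

end

section \<open>Transport of structure along surjections\<close>

text \<open>
  Quotients and isomorphic copies inherit the axioms together, because each axiom is an identity
  whose variables can be lifted along the surjection.
\<close>
lemma star_algebra_image: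
  fixes A :: "('a, 'm) star_ops_scheme" and B :: "('b, 'l) star_ops_scheme"
  assumes A: "star_algebra A" and surj: "f ` carrier A = carrier B"
    and add: "\<And>x y. x \<in> carrier A \<Longrightarrow> y \<in> carrier A \<Longrightarrow> f (x \<oplus>\<^bsub>A\<^esub> y) = f x \<oplus>\<^bsub>B\<^esub> f y"
    and mult: "\<And>x y. x \<in> carrier A \<Longrightarrow> y \<in> carrier A \<Longrightarrow> f (x \<otimes>\<^bsub>A\<^esub> y) = f x \<otimes>\<^bsub>B\<^esub> f y"
    and one: "f \<one>\<^bsub>A\<^esub> = \<one>\<^bsub>B\<^esub>" and zero: "f \<zero>\<^bsub>A\<^esub> = \<zero>\<^bsub>B\<^esub>"
    and scale: "\<And>c x. x \<in> carrier A \<Longrightarrow> f (c \<odot>\<^bsub>A\<^esub> x) = c \<odot>\<^bsub>B\<^esub> f x"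
    and star: "\<And>x. x \<in> carrier A \<Longrightarrow> f (star A x) = star B (f x)"
  shows "star_algebra B"
proof -
  interpret A: star_algebra A by fact
  have closed: "f x \<in> carrier B" if "x \<in> carrier A" for x using surj that by blast
  have ex: "\<exists>a\<in>carrier A. x = f a" if "x \<in> carrier B" for x using surj that by blast
  note ops = add[symmetric] mult[symmetric] one[symmetric] zero[symmetric] scale[symmetric]
    star[symmetric] A.scale_closed A.star_closed
  have "ring B"
  proof (rule ringI)
    show "abelian_group B"
    proof (rule abelian_groupI)
      fix x assume "x \<in> carrier B"
      then obtain a where a: "a \<in> carrier A" "x = f a" using ex by blast
      then have "f (\<ominus>\<^bsub>A\<^esub> a) \<oplus>\<^bsub>B\<^esub> x = \<zero>\<^bsub>B\<^esub>" by (simp add: ops A.l_neg)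
      then show "\<exists>y\<in>carrier B. y \<oplus>\<^bsub>B\<^esub> x = \<zero>\<^bsub>B\<^esub>" using closed a by blast
    qed (auto dest!: ex simp: ops closed A.a_ac)
    show "monoid B"
      by (rule monoidI) (auto dest!: ex simp: ops closed A.m_assoc)
  qed (auto dest!: ex simp: ops closed A.l_distr A.r_distr)
  moreover have "star_algebra_axioms B"
    by unfold_locales
      (auto dest!: ex simp: ops closed A.scale_add_left A.scale_add_right A.scale_scale A.scale_one
        A.scale_mult_left A.scale_mult_right A.star_star A.star_add A.star_scale A.star_mult)
  ultimately show ?thesis by (simp add: star_algebra_def)
qed

text \<open>
  The norm of a C*-algebra is determined by its *-algebra structure, as the largest C*-seminorm.
  So a bijection that preserves the algebraic structure is already an isometric isomorphism once
  the target carries its largest C*-seminorm.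
\<close>
theorem cstar_isomorphic_max_seminorm:
  fixes E :: "('a, 'm) cstar_ops_scheme" and M :: "'b star_ops"
  assumes E: "cstar_algebra E" and bij: "bij_betw f (carrier E) (carrier M)"
    and add: "\<And>x y. x \<in> carrier E \<Longrightarrow> y \<in> carrier E \<Longrightarrow> f (x \<oplus>\<^bsub>E\<^esub> y) = f x \<oplus>\<^bsub>M\<^esub> f y"
    and mult: "\<And>x y. x \<in> carrier E \<Longrightarrow> y \<in> carrier E \<Longrightarrow> f (x \<otimes>\<^bsub>E\<^esub> y) = f x \<otimes>\<^bsub>M\<^esub> f y"
    and one: "f \<one>\<^bsub>E\<^esub> = \<one>\<^bsub>M\<^esub>" and zero: "f \<zero>\<^bsub>E\<^esub> = \<zero>\<^bsub>M\<^esub>"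
    and scale: "\<And>c x. x \<in> carrier E \<Longrightarrow> f (c \<odot>\<^bsub>E\<^esub> x) = c \<odot>\<^bsub>M\<^esub> f x"
    and star: "\<And>x. x \<in> carrier E \<Longrightarrow> f (star E x) = star M (f x)"
  shows "cstar_isomorphic E (star_ops.extend M (cstar_ops.fields (max_cstar_seminorm M {})))"
    (is "cstar_isomorphic E ?M")
proof -
  interpret E: cstar_algebra E by fact
  have surj: "f ` carrier E = carrier M" and inj: "inj_on f (carrier E)"
    using bij by (auto simp: bij_betw_def)
  have closed: "f x \<in> carrier M" if "x \<in> carrier E" for x using surj that by blast
  have M: "star_algebra M"
    by (rule star_algebra_image[OF E.star_algebra_axioms surj]) (fact add mult one zero scale star)+
  interpret M: star_algebra M by fact
  define g where "g = inv_into (carrier E) f"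
  have gf: "g (f x) = x" if "x \<in> carrier E" for x using inj that by (simp add: g_def)
  have ex: "\<exists>a\<in>carrier E. x = f a" if "x \<in> carrier M" for x using surj that by blast
  have f: "star_hom E M f" using closed add mult scale star by (simp add: star_hom_def)
  have g: "star_hom M E g"
    unfolding star_hom_def
    by (auto dest!: ex simp: gf E.star_closed E.scale_closed simp flip: add mult scale star)
  have norm: "max_cstar_seminorm M {} (f x) = cnorm E x" if x: "x \<in> carrier E" for x
    unfolding max_cstar_seminorm_def
  proof (rule cSup_eq_maximum)
    have "cstar_seminorm M (\<lambda>y. cnorm E (g y))"
      by (rule cstar_seminorm_pullback[OF g E.cstar_seminorm_cnorm M])
    then show "cnorm E x \<in> (\<lambda>p. p (f x)) ` {p. cstar_seminorm M p \<and> (\<forall>r\<in>{}. p r = 0)}"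
      using gf[OF x] by (intro image_eqI[of _ _ "\<lambda>y. cnorm E (g y)"]) auto
  next
    fix b assume "b \<in> (\<lambda>p. p (f x)) ` {p. cstar_seminorm M p \<and> (\<forall>r\<in>{}. p r = 0)}"
    then show "b \<le> cnorm E x"
      using E.cstar_seminorm_le_cnorm[OF cstar_seminorm_pullback[OF f _ E.star_algebra_axioms] x] by auto
  qed
  have sel: "carrier ?M = carrier M" "add ?M = add M" "mult ?M = mult M" "one ?M = one M"
    "ring.zero ?M = ring.zero M" "smult ?M = smult M" "star ?M = star M"
    "cnorm ?M = max_cstar_seminorm M {}"
    by (simp_all add: star_ops.defs cstar_ops.defs)
  have M': "star_algebra ?M"
    by (rule star_algebra_image[OF E.star_algebra_axioms, of f])
      (simp_all add: sel surj add mult one zero scale star)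
  interpret M': star_algebra ?M by fact
  have diff: "f (x \<ominus>\<^bsub>E\<^esub> y) = f x \<ominus>\<^bsub>?M\<^esub> f y" if "x \<in> carrier E" "y \<in> carrier E" for x y
    using star_hom_diff[OF _ E.star_algebra_axioms M', of f] f that by (simp add: star_hom_def sel)
  have "cstar_algebra ?M"
  proof
    show "cstar_seminorm ?M (cnorm ?M)"
      unfolding cstar_seminorm_def sel
      by (auto dest!: ex simp: norm E.star_closed E.scale_closed E.N_triangle E.N_scale E.N_mult
          E.N_star E.N_cstar simp flip: add mult scale star)
    show "x = \<zero>\<^bsub>?M\<^esub>" if "x \<in> carrier ?M" "cnorm ?M x = 0" for x
      using that E.cnorm_eq_0 zero unfolding sel by (auto dest!: ex simp: norm)
    show "\<exists>x\<in>carrier ?M. (\<lambda>i. cnorm ?M (s i \<ominus>\<^bsub>?M\<^esub> x)) \<longlonglongrightarrow> 0"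
      if s: "cauchy_in ?M (cnorm ?M) s" for s
    proof -
      have "\<forall>i. \<exists>a\<in>carrier E. s i = f a" using s ex unfolding cauchy_in_def sel by blast
      then obtain t where t: "\<And>i. t i \<in> carrier E" "\<And>i. s i = f (t i)" by metis
      have n: "cnorm ?M (f x \<ominus>\<^bsub>?M\<^esub> f y) = cnorm E (x \<ominus>\<^bsub>E\<^esub> y)"
        if "x \<in> carrier E" "y \<in> carrier E" for x y
        using that by (simp add: sel norm flip: diff)
      have "cauchy_in E (cnorm E) t"
        using s t(1) unfolding cauchy_in_def t(2) n[OF t(1) t(1)] by simp
      then obtain x where x: "E.tends t x" using E.cauchy_tends by blast
      then have "(\<lambda>i. cnorm ?M (s i \<ominus>\<^bsub>?M\<^esub> f x)) \<longlonglongrightarrow> 0"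
        unfolding E.tends_def by (simp add: t n)
      then show ?thesis using closed E.tendsD[OF x] unfolding sel by blast
    qed
  qed
  moreover have "f \<in> ring_iso E ?M"
    using closed add mult one bij by (auto simp: ring_iso_def ring_hom_def sel)
  ultimately show ?thesis
    unfolding cstar_isomorphic_def using E scale star norm by (auto simp: sel intro!: bexI[of _ f])
qed

section \<open>Hausdorff completions\<close>

definition cauchy_star_algebra ::
    "('a, 'm) star_ops_scheme \<Rightarrow> ('a \<Rightarrow> real) \<Rightarrow> (nat \<Rightarrow> 'a) star_ops" where
  "cauchy_star_algebra A N = \<lparr>carrier = {x. cauchy_in A N x},
     mult = (\<lambda>x y i. x i \<otimes>\<^bsub>A\<^esub> y i), one = (\<lambda>i. \<one>\<^bsub>A\<^esub>),
     ring.zero = (\<lambda>i. \<zero>\<^bsub>A\<^esub>), add = (\<lambda>x y i. x i \<oplus>\<^bsub>A\<^esub> y i),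
     smult = (\<lambda>c x i. c \<odot>\<^bsub>A\<^esub> x i), star = (\<lambda>x i. star A (x i))\<rparr>"

definition completion_class :: "('a, 'm) ring_scheme \<Rightarrow> ('a \<Rightarrow> real) \<Rightarrow> (nat \<Rightarrow> 'a) \<Rightarrow> (nat \<Rightarrow> 'a) set"
  where "completion_class A N x = null_seqs A N +>\<^bsub>cauchy_ring A N\<^esub> x"

definition completion_embed :: "('a, 'm) ring_scheme \<Rightarrow> ('a \<Rightarrow> real) \<Rightarrow> 'a \<Rightarrow> (nat \<Rightarrow> 'a) set"
  where "completion_embed A N a = completion_class A N (\<lambda>_. a)"

context seminormed_star_algebra
begin

abbreviation "Cau \<equiv> cauchy_star_algebra A N"
abbreviation "cls \<equiv> completion_class A N"
abbreviation "Com \<equiv> hausdorff_completion A N"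

lemma Cau_simps [simp]:
  "x \<in> carrier Cau \<longleftrightarrow> cauchy_in A N x"
  "x \<otimes>\<^bsub>Cau\<^esub> y = (\<lambda>i. x i \<otimes> y i)" "\<one>\<^bsub>Cau\<^esub> = (\<lambda>i. \<one>)"
  "\<zero>\<^bsub>Cau\<^esub> = (\<lambda>i. \<zero>)" "x \<oplus>\<^bsub>Cau\<^esub> y = (\<lambda>i. x i \<oplus> y i)"
  "c \<odot>\<^bsub>Cau\<^esub> x = (\<lambda>i. c \<odot> x i)" "star Cau x = (\<lambda>i. star A (x i))"
  by (simp_all add: cauchy_star_algebra_def)

lemma cauchy_const: "a \<in> carrier A \<Longrightarrow> cauchy_in A N (\<lambda>_. a)"
  by (rule tends_cauchy[OF tends_const])

lemma cauchy_by_bound: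
  assumes "cauchy_in A N x" "\<And>i. z i \<in> carrier A" "K > 0"
    "\<And>i j. N (z i \<ominus> z j) \<le> K * N (x i \<ominus> x j)"
  shows "cauchy_in A N z"
proof (rule cauchy_inI)
  fix e :: real assume "e > 0"
  then obtain M where M: "\<forall>i\<ge>M. \<forall>j\<ge>M. N (x i \<ominus> x j) < e / K"
    using cauchy_inD(2)[OF assms(1), of "e / K"] assms(3) by auto
  have "N (z i \<ominus> z j) < e" if "i \<ge> M" "j \<ge> M" for i j
  proof -
    have "N (x i \<ominus> x j) < e / K" using M that by blast
    then have "K * N (x i \<ominus> x j) < e" using assms(3) by (simp add: field_simps)
    then show ?thesis using assms(4)[of i j] by simp
  qed
  then show "\<exists>M. \<forall>i\<ge>M. \<forall>j\<ge>M. N (z i \<ominus> z j) < e" by blast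
qed (rule assms)

lemma cauchy_by_bound2:
  assumes "cauchy_in A N x" "cauchy_in A N y" "\<And>i. z i \<in> carrier A" "K > 0"
    "\<And>i j. N (z i \<ominus> z j) \<le> K * N (x i \<ominus> x j) + K * N (y i \<ominus> y j)"
  shows "cauchy_in A N z"
proof (rule cauchy_inI)
  fix e :: real assume "e > 0"
  then obtain M L where M: "\<forall>i\<ge>M. \<forall>j\<ge>M. N (x i \<ominus> x j) < e / (2 * K)"
    and L: "\<forall>i\<ge>L. \<forall>j\<ge>L. N (y i \<ominus> y j) < e / (2 * K)"
    using cauchy_inD(2)[OF assms(1), of "e / (2 * K)"] cauchy_inD(2)[OF assms(2), of "e / (2 * K)"]
      assms(4) by auto
  have "N (z i \<ominus> z j) < e" if "i \<ge> max M L" "j \<ge> max M L" for i j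
  proof -
    have "N (x i \<ominus> x j) < e / (2 * K)" "N (y i \<ominus> y j) < e / (2 * K)" using M L that by auto
    then have "K * N (x i \<ominus> x j) < e / 2" "K * N (y i \<ominus> y j) < e / 2"
      using assms(4) by (simp_all add: field_simps)
    then show ?thesis using assms(5)[of i j] by simp
  qed
  then show "\<exists>M. \<forall>i\<ge>M. \<forall>j\<ge>M. N (z i \<ominus> z j) < e" by blast
qed (rule assms)

lemma cauchy_add:
  assumes x: "cauchy_in A N x" and y: "cauchy_in A N y"
  shows "cauchy_in A N (\<lambda>i. x i \<oplus> y i)"
proof (rule cauchy_by_bound2[OF assms, of _ 1])
  show "N ((x i \<oplus> y i) \<ominus> (x j \<oplus> y j)) \<le> 1 * N (x i \<ominus> x j) + 1 * N (y i \<ominus> y j)" for i j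
    using N_add_diff[of "x i" "y i" "x j" "y j"] cauchy_inD(1)[OF x] cauchy_inD(1)[OF y] by simp
qed (use cauchy_inD(1)[OF x] cauchy_inD(1)[OF y] in auto)

lemma cauchy_scale:
  assumes x: "cauchy_in A N x"
  shows "cauchy_in A N (\<lambda>i. c \<odot> x i)"
proof (rule cauchy_by_bound[OF assms, of _ "cmod c + 1"])
  note c = cauchy_inD(1)[OF x]
  show "N (c \<odot> x i \<ominus> c \<odot> x j) \<le> (cmod c + 1) * N (x i \<ominus> x j)" for i j
    using scale_diff_right[OF c c, of c i j] N_scale[of "x i \<ominus> x j" c] c by (simp add: algebra_simps)
  show "cmod c + 1 > 0" by (rule add_nonneg_pos) auto
qed (use cauchy_inD(1)[OF x] scale_closed in auto)

lemma cauchy_star: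
  assumes x: "cauchy_in A N x"
  shows "cauchy_in A N (\<lambda>i. star A (x i))"
proof (rule cauchy_by_bound[OF assms, of _ 1])
  note c = cauchy_inD(1)[OF x]
  show "N (star A (x i) \<ominus> star A (x j)) \<le> 1 * N (x i \<ominus> x j)" for i j
    using star_diff[OF c c, of i j] N_star[of "x i \<ominus> x j"] c by simp
qed (use cauchy_inD(1)[OF x] star_closed in auto)

lemma cauchy_uminus: "cauchy_in A N x \<Longrightarrow> cauchy_in A N (\<lambda>i. \<ominus> x i)"
  using cauchy_scale[of x "-1"] cauchy_inD(1)[of x] by (simp add: scale_minus_one)

lemma cauchy_diff: "cauchy_in A N x \<Longrightarrow> cauchy_in A N y \<Longrightarrow> cauchy_in A N (\<lambda>i. x i \<ominus> y i)"
  using cauchy_add[OF _ cauchy_uminus, of x y] by (simp add: minus_eq)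

lemma cauchy_mult:
  assumes x: "cauchy_in A N x" and y: "cauchy_in A N y"
  shows "cauchy_in A N (\<lambda>i. x i \<otimes> y i)"
proof -
  note c = cauchy_inD(1)[OF x] cauchy_inD(1)[OF y]
  obtain B where B: "B > 0" "\<And>i. N (x i) \<le> B" using cauchy_bounded[OF x] by blast
  obtain B' where B': "B' > 0" "\<And>i. N (y i) \<le> B'" using cauchy_bounded[OF y] by blast
  show ?thesis
  proof (rule cauchy_by_bound2[OF assms, of _ "B + B'"])
    fix i j
    have "N (x i \<otimes> y i \<ominus> x j \<otimes> y j) \<le> N (x i \<ominus> x j) * N (y i) + N (x j) * N (y i \<ominus> y j)"
      by (intro N_mult_diff c)
    also have "\<dots> \<le> N (x i \<ominus> x j) * (B + B') + (B + B') * N (y i \<ominus> y j)"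
    proof (intro add_mono mult_left_mono mult_right_mono)
      show "N (y i) \<le> B + B'" using B(1) B'(2)[of i] by linarith
      show "N (x j) \<le> B + B'" using B'(1) B(2)[of j] by linarith
    qed (intro N_nonneg minus_closed c)+
    finally show "N (x i \<otimes> y i \<ominus> x j \<otimes> y j) \<le>
        (B + B') * N (x i \<ominus> x j) + (B + B') * N (y i \<ominus> y j)"
      by (simp add: mult.commute)
  next
    show "0 < B + B'" using B(1) B'(1) by linarith
    show "x i \<otimes> y i \<in> carrier A" for i by (intro m_closed c)
  qed
qed

lemma star_algebra_Cau: "star_algebra Cau"
proof -
  have "ring Cau"
  proof (rule ringI)
    show "abelian_group Cau"
    proof (rule abelian_groupI)
      fix x assume x: "x \<in> carrier Cau"
      then show "\<exists>y\<in>carrier Cau. y \<oplus>\<^bsub>Cau\<^esub> x = \<zero>\<^bsub>Cau\<^esub>"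
        using cauchy_uminus[of x] cauchy_inD(1)[of x] by (intro bexI[of _ "\<lambda>i. \<ominus> x i"]) (simp_all add: l_neg)
      show "\<zero>\<^bsub>Cau\<^esub> \<oplus>\<^bsub>Cau\<^esub> x = x" using x by (simp add: cauchy_inD(1))
      fix y assume y: "y \<in> carrier Cau"
      show "x \<oplus>\<^bsub>Cau\<^esub> y \<in> carrier Cau" using x y by (simp add: cauchy_add)
      show "x \<oplus>\<^bsub>Cau\<^esub> y = y \<oplus>\<^bsub>Cau\<^esub> x" using x y a_comm by (simp add: cauchy_inD(1) fun_eq_iff)
      fix z assume z: "z \<in> carrier Cau"
      show "x \<oplus>\<^bsub>Cau\<^esub> y \<oplus>\<^bsub>Cau\<^esub> z = x \<oplus>\<^bsub>Cau\<^esub> (y \<oplus>\<^bsub>Cau\<^esub> z)"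
        using x y z by (simp add: cauchy_inD(1) a_assoc)
    qed (simp add: cauchy_const)
    show "monoid Cau"
      by (rule monoidI) (simp_all add: cauchy_mult cauchy_const m_assoc cauchy_inD(1))
  qed (simp_all add: l_distr r_distr cauchy_inD(1))
  moreover have "star_algebra_axioms Cau"
    by unfold_locales
      (simp_all add: cauchy_inD(1) cauchy_scale cauchy_star scale_add_left scale_add_right scale_scale
        scale_one scale_mult_left scale_mult_right star_star star_add star_scale star_mult)
  ultimately show ?thesis by (simp add: star_algebra_def)
qed

lemma mem_cls:
  assumes x: "cauchy_in A N x"
  shows "y \<in> cls x \<longleftrightarrow> cauchy_in A N y \<and> (\<lambda>i. N (y i \<ominus> x i)) \<longlonglongrightarrow> 0"
proof
  assume "y \<in> cls x"
  then obtain h where h: "cauchy_in A N h" "(\<lambda>i. N (h i)) \<longlonglongrightarrow> 0" "y = (\<lambda>i. h i \<oplus> x i)"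
    by (auto simp: completion_class_def a_r_coset_def' null_seqs_def cauchy_ring_def)
  have "(h i \<oplus> x i) \<ominus> x i = h i" for i
    using cauchy_inD(1)[OF x, of i] cauchy_inD(1)[OF h(1), of i] by algebra
  then show "cauchy_in A N y \<and> (\<lambda>i. N (y i \<ominus> x i)) \<longlonglongrightarrow> 0"
    using h cauchy_add[OF h(1) x] by simp
next
  assume y: "cauchy_in A N y \<and> (\<lambda>i. N (y i \<ominus> x i)) \<longlonglongrightarrow> 0"
  have "y = (\<lambda>i. (y i \<ominus> x i) \<oplus> x i)"
  proof
    fix i show "y i = (y i \<ominus> x i) \<oplus> x i"
      using cauchy_inD(1)[OF x, of i] cauchy_inD(1)[of y i] y by algebra
  qed
  moreover have "(\<lambda>i. y i \<ominus> x i) \<in> null_seqs A N"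
    using y x cauchy_diff by (simp add: null_seqs_def)
  ultimately show "y \<in> cls x"
    unfolding completion_class_def a_r_coset_def' cauchy_ring_def by auto
qed

lemma null_trans:
  assumes "\<And>i. x i \<in> carrier A" "\<And>i. y i \<in> carrier A" "\<And>i. z i \<in> carrier A"
    "(\<lambda>i. N (x i \<ominus> y i)) \<longlonglongrightarrow> 0" "(\<lambda>i. N (y i \<ominus> z i)) \<longlonglongrightarrow> 0"
  shows "(\<lambda>i. N (x i \<ominus> z i)) \<longlonglongrightarrow> 0"
proof (rule tendsto_sandwich[OF _ _ tendsto_const])
  show "(\<lambda>i. N (x i \<ominus> y i) + N (y i \<ominus> z i)) \<longlonglongrightarrow> 0"
    by (rule tendsto_add_zero) (use assms in auto)
  show "\<forall>\<^sub>F i in sequentially. N (x i \<ominus> z i) \<le> N (x i \<ominus> y i) + N (y i \<ominus> z i)"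
    using N_diff_triangle assms by (intro always_eventually) auto
  show "\<forall>\<^sub>F i in sequentially. 0 \<le> N (x i \<ominus> z i)"
    using assms by (intro always_eventually) auto
qed

lemma cls_eq_iff:
  assumes x: "cauchy_in A N x" and y: "cauchy_in A N y"
  shows "cls x = cls y \<longleftrightarrow> (\<lambda>i. N (x i \<ominus> y i)) \<longlonglongrightarrow> 0"
proof
  have "x \<in> cls x" using x cauchy_inD(1)[OF x] by (simp add: mem_cls minus_eq r_neg)
  then show "cls x = cls y \<Longrightarrow> (\<lambda>i. N (x i \<ominus> y i)) \<longlonglongrightarrow> 0" using mem_cls[OF y] by blast
next
  assume n: "(\<lambda>i. N (x i \<ominus> y i)) \<longlonglongrightarrow> 0"
  then have n': "(\<lambda>i. N (y i \<ominus> x i)) \<longlonglongrightarrow> 0"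
    using N_diff_commute[OF cauchy_inD(1)[OF x] cauchy_inD(1)[OF y]] by simp
  show "cls x = cls y"
    using null_trans[of _ x y, OF _ _ _ _ n] null_trans[of _ y x, OF _ _ _ _ n']
      cauchy_inD(1)[OF x] cauchy_inD(1)[OF y] cauchy_inD(1)
    by (auto simp: mem_cls x y)
qed

lemma cls_self: "cauchy_in A N x \<Longrightarrow> x \<in> cls x"
  using cauchy_inD(1)[of x] by (simp add: mem_cls minus_eq r_neg)

lemma UN_cls:
  assumes x: "cauchy_in A N x" and "\<And>y. y \<in> cls x \<Longrightarrow> g y = S"
  shows "(\<Union>y\<in>cls x. g y) = S"
  using cls_self[OF x] assms by auto

lemma null_add:
  assumes "x' \<in> cls x" "y' \<in> cls y" "cauchy_in A N x" "cauchy_in A N y"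
  shows "(\<lambda>i. N ((x' i \<oplus> y' i) \<ominus> (x i \<oplus> y i))) \<longlonglongrightarrow> 0"
proof (rule tendsto_sandwich[OF _ _ tendsto_const])
  have c: "cauchy_in A N x'" "cauchy_in A N y'" using assms by (auto simp: mem_cls)
  note cc = cauchy_inD(1)[OF c(1)] cauchy_inD(1)[OF c(2)] cauchy_inD(1)[OF assms(3)]
    cauchy_inD(1)[OF assms(4)]
  show "(\<lambda>i. N (x' i \<ominus> x i) + N (y' i \<ominus> y i)) \<longlonglongrightarrow> 0"
    by (rule tendsto_add_zero) (use assms in \<open>auto simp: mem_cls\<close>)
  show "\<forall>\<^sub>F i in sequentially. N ((x' i \<oplus> y' i) \<ominus> (x i \<oplus> y i)) \<le> N (x' i \<ominus> x i) + N (y' i \<ominus> y i)"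
    using cc by (intro always_eventually allI N_add_diff)
  show "\<forall>\<^sub>F i in sequentially. 0 \<le> N ((x' i \<oplus> y' i) \<ominus> (x i \<oplus> y i))"
    using cc by (intro always_eventually allI N_nonneg) simp
qed

text \<open>
  The null sequences form an ideal because Cauchy sequences are bounded.
\<close>
lemma null_mult:
  assumes "x' \<in> cls x" "y' \<in> cls y" "cauchy_in A N x" "cauchy_in A N y"
  shows "(\<lambda>i. N ((x' i \<otimes> y' i) \<ominus> (x i \<otimes> y i))) \<longlonglongrightarrow> 0"
proof (rule tendsto_sandwich[OF _ _ tendsto_const])
  have c: "cauchy_in A N x'" "cauchy_in A N y'" using assms by (auto simp: mem_cls)
  note cc = cauchy_inD(1)[OF c(1)] cauchy_inD(1)[OF c(2)] cauchy_inD(1)[OF assms(3)]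
    cauchy_inD(1)[OF assms(4)]
  obtain K where K: "(\<lambda>i. N (y' i)) \<longlonglongrightarrow> K"
    using cauchy_norm_convergent[OF c(2)] by (auto simp: convergent_def)
  obtain L where L: "(\<lambda>i. N (x i)) \<longlonglongrightarrow> L"
    using cauchy_norm_convergent[OF assms(3)] by (auto simp: convergent_def)
  have "(\<lambda>i. N (x' i \<ominus> x i) * N (y' i) + N (x i) * N (y' i \<ominus> y i)) \<longlonglongrightarrow> 0 * K + L * 0"
    by (rule tendsto_add[OF tendsto_mult[OF _ K] tendsto_mult[OF L]])
      (use assms in \<open>auto simp: mem_cls\<close>)
  then show "(\<lambda>i. N (x' i \<ominus> x i) * N (y' i) + N (x i) * N (y' i \<ominus> y i)) \<longlonglongrightarrow> 0" by simp
  show "\<forall>\<^sub>F i in sequentially. N ((x' i \<otimes> y' i) \<ominus> (x i \<otimes> y i))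
      \<le> N (x' i \<ominus> x i) * N (y' i) + N (x i) * N (y' i \<ominus> y i)"
    using cc by (intro always_eventually allI N_mult_diff)
  show "\<forall>\<^sub>F i in sequentially. 0 \<le> N ((x' i \<otimes> y' i) \<ominus> (x i \<otimes> y i))"
    using cc by (intro always_eventually allI N_nonneg) simp
qed

lemma carrier_Com: "carrier Com = cls ` {x. cauchy_in A N x}"
  unfolding hausdorff_completion_def Let_def FactRing_def A_RCOSETS_def' completion_class_def
  by (auto simp: cauchy_ring_def)

lemma one_Com: "\<one>\<^bsub>Com\<^esub> = cls (\<lambda>i. \<one>)"
  unfolding hausdorff_completion_def Let_def FactRing_def completion_class_def
  by (simp add: cauchy_ring_def)

lemma zero_Com: "\<zero>\<^bsub>Com\<^esub> = cls (\<lambda>i. \<zero>)"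
proof -
  have "null_seqs A N = cls (\<lambda>i. \<zero>)"
    by (auto simp: mem_cls cauchy_const null_seqs_def cauchy_inD(1) minus_eq)
  then show ?thesis unfolding hausdorff_completion_def Let_def FactRing_def by simp
qed

lemma mult_Com:
  assumes x: "cauchy_in A N x" and y: "cauchy_in A N y"
  shows "cls x \<otimes>\<^bsub>Com\<^esub> cls y = cls (\<lambda>i. x i \<otimes> y i)"
proof -
  have "cls x \<otimes>\<^bsub>Com\<^esub> cls y = (\<Union>a\<in>cls x. \<Union>b\<in>cls y. cls (\<lambda>i. a i \<otimes> b i))"
    unfolding hausdorff_completion_def Let_def FactRing_def rcoset_mult_def completion_class_def
    by (simp add: cauchy_ring_def)
  also have "\<dots> = cls (\<lambda>i. x i \<otimes> y i)"
    using x y null_mult cauchy_mult by (intro UN_cls) (auto simp: cls_eq_iff mem_cls)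
  finally show ?thesis .
qed

lemma add_Com:
  assumes x: "cauchy_in A N x" and y: "cauchy_in A N y"
  shows "cls x \<oplus>\<^bsub>Com\<^esub> cls y = cls (\<lambda>i. x i \<oplus> y i)"
proof -
  have "cls x \<oplus>\<^bsub>Com\<^esub> cls y = (\<Union>a\<in>cls x. \<Union>b\<in>cls y. {\<lambda>i. a i \<oplus> b i})"
    unfolding hausdorff_completion_def Let_def FactRing_def set_add_def' completion_class_def
    by (simp add: cauchy_ring_def)
  also have "\<dots> = cls (\<lambda>i. x i \<oplus> y i)"
  proof (intro equalityI subsetI)
    fix z assume "z \<in> (\<Union>a\<in>cls x. \<Union>b\<in>cls y. {\<lambda>i. a i \<oplus> b i})"
    then show "z \<in> cls (\<lambda>i. x i \<oplus> y i)"
      using x y null_add cauchy_add by (auto simp: mem_cls)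
  next
    fix z assume "z \<in> cls (\<lambda>i. x i \<oplus> y i)"
    then have z: "cauchy_in A N z" "(\<lambda>i. N (z i \<ominus> (x i \<oplus> y i))) \<longlonglongrightarrow> 0"
      using x y cauchy_add by (auto simp: mem_cls)
    note c = cauchy_inD(1)[OF x] cauchy_inD(1)[OF y] cauchy_inD(1)[OF z(1)]
    have eq: "(z i \<ominus> y i) \<ominus> x i = z i \<ominus> (x i \<oplus> y i)" "(z i \<ominus> y i) \<oplus> y i = z i" for i
      using c[of i] by algebra+
    have "(\<lambda>i. z i \<ominus> y i) \<in> cls x"
      using x cauchy_diff[OF z(1) y] z(2) by (simp add: mem_cls eq)
    then show "z \<in> (\<Union>a\<in>cls x. \<Union>b\<in>cls y. {\<lambda>i. a i \<oplus> b i})"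
      using cls_self[OF y] eq(2) by (intro UN_I[of "\<lambda>i. z i \<ominus> y i"] UN_I[of y]) simp_all
  qed
  finally show ?thesis .
qed

lemma scale_Com:
  assumes x: "cauchy_in A N x"
  shows "c \<odot>\<^bsub>Com\<^esub> cls x = cls (\<lambda>i. c \<odot> x i)"
proof -
  have "c \<odot>\<^bsub>Com\<^esub> cls x = (\<Union>a\<in>cls x. cls (\<lambda>i. c \<odot> a i))"
    unfolding hausdorff_completion_def Let_def completion_class_def by simp
  also have "\<dots> = cls (\<lambda>i. c \<odot> x i)"
  proof (rule UN_cls[OF x])
    fix a assume a: "a \<in> cls x"
    then have a': "cauchy_in A N a" "(\<lambda>i. N (a i \<ominus> x i)) \<longlonglongrightarrow> 0" using x by (auto simp: mem_cls)
    have "N (c \<odot> a i \<ominus> c \<odot> x i) = cmod c * N (a i \<ominus> x i)" for i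
      using scale_diff_right N_scale cauchy_inD(1)[OF x] cauchy_inD(1)[OF a'(1)]
      by (metis minus_closed)
    then have "(\<lambda>i. N (c \<odot> a i \<ominus> c \<odot> x i)) \<longlonglongrightarrow> 0"
      using tendsto_mult_right_zero[OF a'(2)] by simp
    then show "cls (\<lambda>i. c \<odot> a i) = cls (\<lambda>i. c \<odot> x i)"
      using x a' cauchy_scale by (simp add: cls_eq_iff)
  qed
  finally show ?thesis .
qed

lemma star_Com:
  assumes x: "cauchy_in A N x"
  shows "star Com (cls x) = cls (\<lambda>i. star A (x i))"
proof -
  have "star Com (cls x) = (\<Union>a\<in>cls x. cls (\<lambda>i. star A (a i)))"
    unfolding hausdorff_completion_def Let_def completion_class_def by simp
  also have "\<dots> = cls (\<lambda>i. star A (x i))"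
  proof (rule UN_cls[OF x])
    fix a assume a: "a \<in> cls x"
    then have a': "cauchy_in A N a" "(\<lambda>i. N (a i \<ominus> x i)) \<longlonglongrightarrow> 0" using x by (auto simp: mem_cls)
    have "N (star A (a i) \<ominus> star A (x i)) = N (a i \<ominus> x i)" for i
      using star_diff N_star cauchy_inD(1)[OF x] cauchy_inD(1)[OF a'(1)] by (metis minus_closed)
    then have "(\<lambda>i. N (star A (a i) \<ominus> star A (x i))) \<longlonglongrightarrow> 0"
      using a'(2) by simp
    then show "cls (\<lambda>i. star A (a i)) = cls (\<lambda>i. star A (x i))"
      using x a' cauchy_star by (simp add: cls_eq_iff)
  qed
  finally show ?thesis .
qed

lemma cnorm_Com:
  assumes x: "cauchy_in A N x"
  shows "(\<lambda>i. N (x i)) \<longlonglongrightarrow> cnorm Com (cls x)"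
proof -
  obtain L where L: "(\<lambda>i. N (x i)) \<longlonglongrightarrow> L"
    using cauchy_norm_convergent[OF x] by (auto simp: convergent_def)
  have "(THE l. \<forall>y\<in>cls x. (\<lambda>i. N (y i)) \<longlonglongrightarrow> l) = L"
  proof (rule the_equality)
    show "\<forall>y\<in>cls x. (\<lambda>i. N (y i)) \<longlonglongrightarrow> L"
    proof
      fix y assume "y \<in> cls x"
      then have y: "cauchy_in A N y" "(\<lambda>i. N (y i \<ominus> x i)) \<longlonglongrightarrow> 0" using x by (auto simp: mem_cls)
      have "(\<lambda>i. N (y i) - N (x i)) \<longlonglongrightarrow> 0"
      proof (rule Lim_null_comparison[OF _ y(2)])
        show "\<forall>\<^sub>F i in sequentially. norm (N (y i) - N (x i)) \<le> N (y i \<ominus> x i)"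
          using N_diff_abs[OF cauchy_inD(1)[OF y(1)] cauchy_inD(1)[OF x]]
          by (intro always_eventually) simp
      qed
      from tendsto_add[OF this L] show "(\<lambda>i. N (y i)) \<longlonglongrightarrow> L" by simp
    qed
    show "l = L" if "\<forall>y\<in>cls x. (\<lambda>i. N (y i)) \<longlonglongrightarrow> l" for l
      using that cls_self[OF x] LIMSEQ_unique[OF _ L] by blast
  qed
  then have "cnorm Com (cls x) = L"
    unfolding hausdorff_completion_def Let_def by simp
  then show ?thesis using L by simp
qed

lemma star_algebra_Com: "star_algebra Com"
  by (rule star_algebra_image[OF star_algebra_Cau, of cls])
    (auto simp: carrier_Com add_Com mult_Com one_Com zero_Com scale_Com star_Com)

lemma diff_Com:
  assumes x: "cauchy_in A N x" and y: "cauchy_in A N y"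
  shows "cls x \<ominus>\<^bsub>Com\<^esub> cls y = cls (\<lambda>i. x i \<ominus> y i)"
proof -
  interpret C: star_algebra Com by (rule star_algebra_Com)
  have "\<ominus>\<^bsub>Com\<^esub> cls y = (-1) \<odot>\<^bsub>Com\<^esub> cls y"
    using C.scale_minus_one[of "cls y"] y by (simp add: carrier_Com)
  also have "\<dots> = cls (\<lambda>i. \<ominus> y i)"
    using scale_Com[OF y, of "-1"] cauchy_inD(1)[OF y] by (simp add: scale_minus_one)
  finally show ?thesis
    using add_Com[OF x cauchy_uminus[OF y]] by (simp add: C.minus_eq minus_eq)
qed

lemma cstar_seminorm_Com: "cstar_seminorm Com (cnorm Com)"
proof -
  have ex: "\<exists>y. cauchy_in A N y \<and> x = cls y" if "x \<in> carrier Com" for x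
    using that by (auto simp: carrier_Com)
  note lim = LIMSEQ_le[OF cnorm_Com] LIMSEQ_unique[OF cnorm_Com]
  show ?thesis
    unfolding cstar_seminorm_def
  proof (intro conjI ballI allI)
    fix x assume "x \<in> carrier Com"
    then obtain y where y: "cauchy_in A N y" "x = cls y" using ex by blast
    note c = cauchy_inD(1)[OF y(1)]
    show "0 \<le> cnorm Com x"
      using c unfolding y(2) by (intro LIMSEQ_le_const[OF cnorm_Com[OF y(1)]]) auto
    show "cnorm Com (star Com x) = cnorm Com x"
      using LIMSEQ_unique[OF cnorm_Com[OF cauchy_star[OF y(1)]], of "cnorm Com x"]
        cnorm_Com[OF y(1)] c by (simp add: y star_Com N_star)
    have "(\<lambda>i. N (star A (y i) \<otimes> y i)) \<longlonglongrightarrow> (cnorm Com x)\<^sup>2"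
      using tendsto_power[OF cnorm_Com[OF y(1)], of 2] c by (simp add: N_cstar y)
    then show "cnorm Com (star Com x \<otimes>\<^bsub>Com\<^esub> x) = (cnorm Com x)\<^sup>2"
      using LIMSEQ_unique[OF cnorm_Com[OF cauchy_mult[OF cauchy_star[OF y(1)] y(1)]]]
      by (simp add: y star_Com mult_Com cauchy_star)
    fix c :: complex
    have "(\<lambda>i. N (c \<odot> y i)) \<longlonglongrightarrow> cmod c * cnorm Com x"
      using tendsto_mult_left[OF cnorm_Com[OF y(1)], of "cmod c"] \<open>\<And>i. y i \<in> carrier A\<close>
      by (simp add: N_scale y)
    then show "cnorm Com (c \<odot>\<^bsub>Com\<^esub> x) = cmod c * cnorm Com x"
      using LIMSEQ_unique[OF cnorm_Com[OF cauchy_scale[OF y(1), of c]]]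
      by (simp add: y scale_Com)
  next
    fix x x' assume "x \<in> carrier Com" "x' \<in> carrier Com"
    then obtain y y' where y: "cauchy_in A N y" "x = cls y" "cauchy_in A N y'" "x' = cls y'"
      using ex by metis
    note c = cauchy_inD(1)[OF y(1)] cauchy_inD(1)[OF y(3)]
    have "cnorm Com (cls (\<lambda>i. y i \<oplus> y' i)) \<le> cnorm Com x + cnorm Com x'"
      using c N_triangle unfolding y(2,4)
      by (intro LIMSEQ_le[OF cnorm_Com[OF cauchy_add[OF y(1,3)]]
            tendsto_add[OF cnorm_Com[OF y(1)] cnorm_Com[OF y(3)]]]) auto
    then show "cnorm Com (x \<oplus>\<^bsub>Com\<^esub> x') \<le> cnorm Com x + cnorm Com x'"
      using y by (simp add: add_Com)
    have "cnorm Com (cls (\<lambda>i. y i \<otimes> y' i)) \<le> cnorm Com x * cnorm Com x'"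
      using c N_mult unfolding y(2,4)
      by (intro LIMSEQ_le[OF cnorm_Com[OF cauchy_mult[OF y(1,3)]]
            tendsto_mult[OF cnorm_Com[OF y(1)] cnorm_Com[OF y(3)]]]) auto
    then show "cnorm Com (x \<otimes>\<^bsub>Com\<^esub> x') \<le> cnorm Com x * cnorm Com x'"
      using y by (simp add: mult_Com)
  qed
qed

abbreviation "emb \<equiv> completion_embed A N"

lemma star_hom_emb: "star_hom A Com emb"
  unfolding star_hom_def completion_embed_def
  by (simp add: carrier_Com cauchy_const star_Com scale_Com add_Com mult_Com)

lemma emb_one: "emb \<one> = \<one>\<^bsub>Com\<^esub>"
  by (simp add: one_Com completion_embed_def)

lemma cnorm_emb: "a \<in> carrier A \<Longrightarrow> cnorm Com (emb a) = N a"
  using LIMSEQ_unique[OF cnorm_Com[OF cauchy_const] tendsto_const, of a]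
  by (simp add: completion_embed_def)

lemma seminormed_Com: "seminormed_star_algebra Com (cnorm Com)"
  by (intro seminormed_star_algebra.intro seminormed_star_algebra_axioms.intro
      star_algebra_Com cstar_seminorm_Com)

lemma tends_emb:
  assumes x: "cauchy_in A N x"
  shows "seminormed_star_algebra.tends Com (cnorm Com) (\<lambda>i. emb (x i)) (cls x)"
proof -
  interpret C: seminormed_star_algebra Com "cnorm Com" by (rule seminormed_Com)
  note c = cauchy_inD(1)[OF x]
  have cx: "cls x \<in> carrier Com" using x by (simp add: carrier_Com)
  have "(\<lambda>i. cnorm Com (emb (x i) \<ominus>\<^bsub>Com\<^esub> cls x)) \<longlonglongrightarrow> 0"
  proof (rule LIMSEQ_I)
    fix e :: real assume e: "e > 0"
    then obtain M where M: "\<forall>i\<ge>M. \<forall>j\<ge>M. N (x i \<ominus> x j) < e / 2"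
      using cauchy_inD(2)[OF x, of "e / 2"] by auto
    have "cnorm Com (emb (x i) \<ominus>\<^bsub>Com\<^esub> cls x) \<le> e / 2" if i: "i \<ge> M" for i
    proof -
      have "(\<lambda>j. N (x i \<ominus> x j)) \<longlonglongrightarrow> cnorm Com (emb (x i) \<ominus>\<^bsub>Com\<^esub> cls x)"
        using cnorm_Com[OF cauchy_diff[OF cauchy_const[OF c[of i]] x]] x c
        by (simp add: completion_embed_def diff_Com cauchy_const)
      then show ?thesis
        by (rule LIMSEQ_le_const2) (use M i less_imp_le in blast)
    qed
    then have "norm (cnorm Com (emb (x i) \<ominus>\<^bsub>Com\<^esub> cls x) - 0) < e" if "i \<ge> M" for i
      using that e C.N_nonneg[OF C.minus_closed[OF star_homD(1)[OF star_hom_emb c[of i]] cx]]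
      by fastforce
    then show "\<exists>M. \<forall>i\<ge>M. norm (cnorm Com (emb (x i) \<ominus>\<^bsub>Com\<^esub> cls x) - 0) < e" by blast
  qed
  then show ?thesis
    unfolding C.tends_def using cx star_homD(1)[OF star_hom_emb c] by blast
qed

lemma emb_dense:
  assumes "X \<in> carrier Com" "e > 0"
  obtains a where "a \<in> carrier A" "cnorm Com (emb a \<ominus>\<^bsub>Com\<^esub> X) < e"
proof -
  interpret C: seminormed_star_algebra Com "cnorm Com" by (rule seminormed_Com)
  obtain x where x: "cauchy_in A N x" "X = cls x" using assms by (auto simp: carrier_Com)
  have "\<forall>\<^sub>F i in sequentially. cnorm Com (emb (x i) \<ominus>\<^bsub>Com\<^esub> X) < e"
    using tends_emb[OF x(1)] assms(2) x(2) unfolding C.tends_def by (intro order_tendstoD) auto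
  then obtain i where "cnorm Com (emb (x i) \<ominus>\<^bsub>Com\<^esub> X) < e"
    unfolding eventually_sequentially by blast
  then show thesis using that cauchy_inD(1)[OF x(1)] by blast
qed

text \<open>
  For completeness, the term number \<open>i\<close> of a Cauchy sequence of classes is approximated up to
  \<open>1 / (i + 1)\<close> by an embedded element \<open>a\<^sub>i\<close>.  The sequence of the \<open>a\<^sub>i\<close> is Cauchy for the original seminorm,
  and its class is the limit.
\<close>
theorem cstar_algebra_Com: "cstar_algebra Com"
proof -
  interpret C: seminormed_star_algebra Com "cnorm Com" by (rule seminormed_Com)
  show ?thesis
  proof unfold_locales
    fix X assume "X \<in> carrier Com" "cnorm Com X = 0"
    then obtain x where x: "cauchy_in A N x" "X = cls x" by (auto simp: carrier_Com)
    moreover have "(\<lambda>i. N (x i)) \<longlonglongrightarrow> 0"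
      using cnorm_Com[OF x(1)] x(2) \<open>cnorm Com X = 0\<close> by simp
    ultimately show "X = \<zero>\<^bsub>Com\<^esub>"
      using cauchy_const[OF zero_closed] cauchy_inD(1)[OF x(1)] by (simp add: zero_Com cls_eq_iff minus_eq)
  next
    fix S assume S: "cauchy_in Com (cnorm Com) S"
    note Sc = C.cauchy_inD(1)[OF S]
    have "\<exists>a\<in>carrier A. cnorm Com (emb a \<ominus>\<^bsub>Com\<^esub> S i) < inverse (real (Suc i))" for i
      using emb_dense[OF Sc, of "inverse (real (Suc i))" i] by (metis inverse_positive_iff_positive of_nat_0_less_iff zero_less_Suc)
    then obtain a where a: "\<And>i. a i \<in> carrier A"
      "\<And>i. cnorm Com (emb (a i) \<ominus>\<^bsub>Com\<^esub> S i) < inverse (real (Suc i))" by metis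
    note ec = star_homD(1)[OF star_hom_emb a(1)]
    have Na: "N (a i \<ominus> a j) = cnorm Com (emb (a i) \<ominus>\<^bsub>Com\<^esub> emb (a j))" for i j
      using cnorm_emb[of "a i \<ominus> a j"] star_hom_diff[OF star_hom_emb star_algebra_axioms star_algebra_Com a(1) a(1)] a(1)
      by simp
    have "cauchy_in A N a"
    proof (rule cauchy_inI)
      fix e :: real assume e: "e > 0"
      obtain M where M: "\<forall>i\<ge>M. \<forall>j\<ge>M. cnorm Com (S i \<ominus>\<^bsub>Com\<^esub> S j) < e / 3"
        using C.cauchy_inD(2)[OF S, of "e/3"] e by auto
      obtain L where L: "inverse (real (Suc L)) < e / 3"
        using reals_Archimedean[of "e/3"] e by auto
      have "N (a i \<ominus> a j) < e" if "i \<ge> max M L" "j \<ge> max M L" for i j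
      proof -
        have 1: "inverse (real (Suc i)) \<le> inverse (real (Suc L))"
          "inverse (real (Suc j)) \<le> inverse (real (Suc L))"
          using that by (auto intro!: le_imp_inverse_le)
        have "cnorm Com (emb (a i) \<ominus>\<^bsub>Com\<^esub> emb (a j)) \<le>
            cnorm Com (emb (a i) \<ominus>\<^bsub>Com\<^esub> S i) + cnorm Com (S i \<ominus>\<^bsub>Com\<^esub> S j) +
            cnorm Com (emb (a j) \<ominus>\<^bsub>Com\<^esub> S j)"
          using C.N_diff_triangle[OF ec ec Sc, of i j i] C.N_diff_triangle[OF Sc ec Sc, of i j j]
            C.N_diff_commute[OF Sc ec, of j j] by linarith
        moreover have "cnorm Com (S i \<ominus>\<^bsub>Com\<^esub> S j) < e / 3" using M that by simp
        ultimately show ?thesis using a(2)[of i] a(2)[of j] 1 L unfolding Na by linarith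
      qed
      then show "\<exists>M. \<forall>i\<ge>M. \<forall>j\<ge>M. N (a i \<ominus> a j) < e" by blast
    qed (rule a)
    then have lim: "C.tends (\<lambda>i. emb (a i)) (cls a)" by (rule tends_emb)
    have "C.tends S (cls a)"
    proof (rule C.tendsI)
      show "cnorm Com (S i \<ominus>\<^bsub>Com\<^esub> cls a) \<le>
          inverse (real (Suc i)) + cnorm Com (emb (a i) \<ominus>\<^bsub>Com\<^esub> cls a)" for i
        using C.N_diff_triangle[OF Sc C.tendsD(2)[OF lim] ec, of i i] C.N_diff_commute[OF Sc ec, of i i] a(2)[of i]
        by linarith
      show "(\<lambda>i. inverse (real (Suc i)) + cnorm Com (emb (a i) \<ominus>\<^bsub>Com\<^esub> cls a)) \<longlonglongrightarrow> 0"
        by (rule tendsto_add_zero[OF LIMSEQ_inverse_real_of_nat]) (use lim in \<open>simp add: C.tends_def\<close>)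
    qed (use Sc C.tendsD(2)[OF lim] in auto)
    then show "\<exists>X\<in>carrier Com. (\<lambda>i. cnorm Com (S i \<ominus>\<^bsub>Com\<^esub> X)) \<longlonglongrightarrow> 0"
      unfolding C.tends_def by blast
  qed (rule cstar_seminorm_Com)
qed

theorem extend_to_completion:
  fixes E :: "('e, 'f) cstar_ops_scheme"
  assumes E: "cstar_algebra E" and h: "star_hom A E h"
    and norm: "\<And>a. a \<in> carrier A \<Longrightarrow> cnorm E (h a) = N a"
  obtains \<phi> where "star_hom Com E \<phi>" "\<And>a. a \<in> carrier A \<Longrightarrow> \<phi> (emb a) = h a"
    "\<And>X. X \<in> carrier Com \<Longrightarrow> cnorm E (\<phi> X) = cnorm Com X"
proof -
  interpret E: cstar_algebra E by fact
  have diff: "cnorm E (h a \<ominus>\<^bsub>E\<^esub> h b) = N (a \<ominus> b)" if "a \<in> carrier A" "b \<in> carrier A" for a b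
    using norm[of "a \<ominus> b"] star_hom_diff[OF h star_algebra_axioms E.star_algebra_axioms that] that
    by simp
  have "\<exists>l. E.tends (\<lambda>i. h (x i)) l" if x: "cauchy_in A N x" for x
  proof (rule E.cauchy_tends)
    show "cauchy_in E (cnorm E) (\<lambda>i. h (x i))"
      using x unfolding cauchy_in_def by (simp add: diff star_homD(1)[OF h])
  qed
  then obtain L where L: "\<And>x. cauchy_in A N x \<Longrightarrow> E.tends (\<lambda>i. h (x i)) (L x)" by metis
  define \<phi> where "\<phi> X = L (SOME x. x \<in> X)" for X
  have \<phi>: "E.tends (\<lambda>i. h (x i)) (\<phi> (cls x))" if x: "cauchy_in A N x" for x
  proof -
    define y where "y = (SOME y. y \<in> cls x)"
    have "y \<in> cls x" unfolding y_def by (rule someI[where P = "\<lambda>y. y \<in> cls x", OF cls_self[OF x]])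
    then have y: "cauchy_in A N y" "(\<lambda>i. N (y i \<ominus> x i)) \<longlonglongrightarrow> 0" using x by (auto simp: mem_cls)
    note c = cauchy_inD(1)[OF x] cauchy_inD(1)[OF y(1)]
    note hc = star_homD(1)[OF h c(1)] star_homD(1)[OF h c(2)]
    have Ly: "E.tends (\<lambda>i. h (y i)) (L y)" by (rule L[OF y(1)])
    have "E.tends (\<lambda>i. h (x i)) (L y)"
    proof (rule E.tendsI)
      show "cnorm E (h (x i) \<ominus>\<^bsub>E\<^esub> L y) \<le> N (y i \<ominus> x i) + cnorm E (h (y i) \<ominus>\<^bsub>E\<^esub> L y)" for i
        using E.N_diff_triangle[OF hc(1) E.tendsD(2)[OF Ly] hc(2), of i i]
          diff[OF c(1) c(2), of i i] N_diff_commute[OF c(1) c(2), of i i] by simp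
      show "(\<lambda>i. N (y i \<ominus> x i) + cnorm E (h (y i) \<ominus>\<^bsub>E\<^esub> L y)) \<longlonglongrightarrow> 0"
        by (rule tendsto_add_zero[OF y(2)]) (use Ly in \<open>simp add: E.tends_def\<close>)
    qed (use hc E.tendsD(2)[OF Ly] in auto)
    then show ?thesis by (simp add: \<phi>_def y_def)
  qed
  have eq: "\<phi> (cls x) = l" if "cauchy_in A N x" "E.tends (\<lambda>i. h (x i)) l" for x l
    using E.tends_eq[OF \<phi>[OF that(1)] that(2)] .
  note hD = star_homD[OF h]
  show thesis
  proof
    show "star_hom Com E \<phi>"
      unfolding star_hom_def
    proof (intro ballI conjI allI)
      fix X assume "X \<in> carrier Com"
      then obtain x where x: "cauchy_in A N x" "X = cls x" by (auto simp: carrier_Com)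
      note c = cauchy_inD(1)[OF x(1)]
      show "\<phi> X \<in> carrier E" using E.tendsD(2)[OF \<phi>[OF x(1)]] x by simp
      show "\<phi> (star Com X) = star E (\<phi> X)"
        using eq[OF cauchy_star[OF x(1)]] E.tends_star[OF \<phi>[OF x(1)]] x c by (simp add: star_Com hD)
      show "\<phi> (k \<odot>\<^bsub>Com\<^esub> X) = k \<odot>\<^bsub>E\<^esub> \<phi> X" for k
        using eq[OF cauchy_scale[OF x(1)]] E.tends_scale[OF \<phi>[OF x(1)]] x c by (simp add: scale_Com hD)
      fix Y assume "Y \<in> carrier Com"
      then obtain y where y: "cauchy_in A N y" "Y = cls y" by (auto simp: carrier_Com)
      note c' = cauchy_inD(1)[OF y(1)]
      show "\<phi> (X \<oplus>\<^bsub>Com\<^esub> Y) = \<phi> X \<oplus>\<^bsub>E\<^esub> \<phi> Y"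
        using eq[OF cauchy_add[OF x(1) y(1)]] E.tends_add[OF \<phi>[OF x(1)] \<phi>[OF y(1)]] x y c c'
        by (simp add: add_Com hD)
      show "\<phi> (X \<otimes>\<^bsub>Com\<^esub> Y) = \<phi> X \<otimes>\<^bsub>E\<^esub> \<phi> Y"
        using eq[OF cauchy_mult[OF x(1) y(1)]] E.tends_mult[OF \<phi>[OF x(1)] \<phi>[OF y(1)]] x y c c'
        by (simp add: mult_Com hD)
    qed
    show "\<phi> (emb a) = h a" if "a \<in> carrier A" for a
      unfolding completion_embed_def
      using that by (intro eq cauchy_const E.tends_const) (simp_all add: hD)
    show "cnorm E (\<phi> X) = cnorm Com X" if "X \<in> carrier Com" for X
    proof -
      obtain x where x: "cauchy_in A N x" "X = cls x" using \<open>X \<in> carrier Com\<close> by (auto simp: carrier_Com)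
      show ?thesis
        using LIMSEQ_unique[OF E.tends_norm[OF \<phi>[OF x(1)]]] cnorm_Com[OF x(1)] cauchy_inD(1)[OF x(1)] x
        by (simp add: norm)
    qed
  qed
qed

end

section \<open>Finitely supported families\<close>

lemma finite_support_induct [consumes 1, case_names zero update]:
  fixes x :: "'i \<Rightarrow> 'v::zero"
  assumes "finite {i. x i \<noteq> 0}" and zero: "P (\<lambda>_. 0)"
    and upd: "\<And>x i v. finite {i. x i \<noteq> 0} \<Longrightarrow> x i = 0 \<Longrightarrow> v \<noteq> 0 \<Longrightarrow> P x \<Longrightarrow> P (x(i := v))"
  shows "P x"
proof -
  have "\<forall>x. {i. x i \<noteq> 0} = J \<longrightarrow> P x" if "finite J" for J
    using that
  proof (induction J)
    case empty
    show ?case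
    proof (intro allI impI)
      fix x :: "'i \<Rightarrow> 'v" assume "{i. x i \<noteq> 0} = {}"
      then have "x = (\<lambda>_. 0)" by auto
      then show "P x" using zero by simp
    qed
  next
    case (insert j J)
    show ?case
    proof (intro allI impI)
      fix x :: "'i \<Rightarrow> 'v" assume x: "{i. x i \<noteq> 0} = insert j J"
      define y where "y = x(j := 0)"
      have y: "{i. y i \<noteq> 0} = J" using x insert.hyps by (auto simp: y_def)
      then have "P (y(j := x j))"
        using insert x by (intro upd) (auto simp: y_def)
      then show "P x" by (simp add: y_def)
    qed
  qed
  then show ?thesis using assms(1) by blast
qed

context star_algebra
begin

text \<open>The additive extension of a family of maps to finitely supported families of arguments.\<close>
definition fin_ext :: "('i \<Rightarrow> 'v::comm_monoid_add \<Rightarrow> 'a) \<Rightarrow> ('i \<Rightarrow> 'v) \<Rightarrow> 'a" where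
  "fin_ext \<Theta> x = (\<Oplus>i\<in>{i. x i \<noteq> 0}. \<Theta> i (x i))"

lemma fin_ext_superset:
  assumes "finite J" "{i. x i \<noteq> 0} \<subseteq> J" "\<And>i. \<Theta> i 0 = \<zero>" "\<And>i. x i \<noteq> 0 \<Longrightarrow> \<Theta> i (x i) \<in> carrier A"
  shows "fin_ext \<Theta> x = (\<Oplus>i\<in>J. \<Theta> i (x i))"
  unfolding fin_ext_def using assms by (intro finsum_mono_neutral) auto

lemma fin_ext_closed:
  "(\<And>i. x i \<noteq> 0 \<Longrightarrow> \<Theta> i (x i) \<in> carrier A) \<Longrightarrow> fin_ext \<Theta> x \<in> carrier A"
  unfolding fin_ext_def by (intro finsum_closed) auto

lemma fin_ext_add:
  assumes fin: "finite {i. x i \<noteq> 0}" "finite {i. y i \<noteq> 0}" and 0: "\<And>i. \<Theta> i 0 = \<zero>"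
    and c: "\<And>i. \<Theta> i (x i) \<in> carrier A" "\<And>i. \<Theta> i (y i) \<in> carrier A"
    and add: "\<And>i. \<Theta> i (x i + y i) = \<Theta> i (x i) \<oplus> \<Theta> i (y i)"
  shows "fin_ext \<Theta> (\<lambda>i. x i + y i) = fin_ext \<Theta> x \<oplus> fin_ext \<Theta> y"
proof -
  let ?J = "{i. x i \<noteq> 0} \<union> {i. y i \<noteq> 0}"
  have "fin_ext \<Theta> (\<lambda>i. x i + y i) = (\<Oplus>i\<in>?J. \<Theta> i (x i + y i))"
    by (rule fin_ext_superset) (use fin 0 c add in auto)
  also have "\<dots> = (\<Oplus>i\<in>?J. \<Theta> i (x i) \<oplus> \<Theta> i (y i))" by (simp add: add)
  also have "\<dots> = (\<Oplus>i\<in>?J. \<Theta> i (x i)) \<oplus> (\<Oplus>i\<in>?J. \<Theta> i (y i))"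
    using c by (intro finsum_addf) auto
  also have "(\<Oplus>i\<in>?J. \<Theta> i (x i)) = fin_ext \<Theta> x"
    by (rule fin_ext_superset[symmetric]) (use fin 0 c in auto)
  also have "(\<Oplus>i\<in>?J. \<Theta> i (y i)) = fin_ext \<Theta> y"
    by (rule fin_ext_superset[symmetric]) (use fin 0 c in auto)
  finally show ?thesis .
qed

lemma fin_ext_single:
  assumes "\<Theta> j 0 = \<zero>" "\<Theta> j v \<in> carrier A"
  shows "fin_ext \<Theta> (\<lambda>i. if i = j then v else 0) = \<Theta> j v"
proof (cases "v = 0")
  case False
  then have "{i. (if i = j then v else 0) \<noteq> 0} = {j}" by auto
  then show ?thesis using assms by (simp add: fin_ext_def)
qed (use assms in \<open>simp add: fin_ext_def\<close>)

end

section \<open>The free star algebra\<close>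

definition flip :: "word \<Rightarrow> word" where
  "flip w = rev (map (\<lambda>(i, s). (i, \<not> s)) w)"

lemma flip_flip [simp]: "flip (flip w) = w"
  by (simp add: flip_def rev_map map_idI case_prod_beta comp_def)

lemma flip_simps [simp]: "flip [] = []" "flip (u @ v) = flip v @ flip u" "length (flip w) = length w"
  "flip [(i, s)] = [(i, \<not> s)]"
  by (simp_all add: flip_def)

lemma set_flip: "set (flip w) \<subseteq> {1..n} \<times> UNIV \<longleftrightarrow> set w \<subseteq> {1..n} \<times> UNIV"
  by (auto simp: flip_def)

lemma take_flip: "take i (flip w) = flip (drop (length w - i) w)"
  and drop_flip: "drop i (flip w) = flip (take (length w - i) w)"
  by (simp_all add: flip_def take_rev drop_rev drop_map take_map)

abbreviation "FA \<equiv> free_star_algebra"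
abbreviation "letters (n::nat) \<equiv> {1..n} \<times> (UNIV :: bool set)"

lemma FA_simps [simp]:
  "\<one>\<^bsub>FA n\<^esub> = word_fun []" "\<zero>\<^bsub>FA n\<^esub> = (\<lambda>w. 0)" "a \<oplus>\<^bsub>FA n\<^esub> b = (\<lambda>w. a w + b w)"
  "c \<odot>\<^bsub>FA n\<^esub> a = (\<lambda>w. c * a w)" "star (FA n) a = (\<lambda>w. cnj (a (flip w)))"
  by (simp_all add: free_star_algebra_def flip_def)

lemma FA_mult: "(a \<otimes>\<^bsub>FA n\<^esub> b) w = (\<Sum>i\<le>length w. a (take i w) * b (drop i w))"
  by (simp add: free_star_algebra_def)

lemma FA_carrier:
  "a \<in> carrier (FA n) \<longleftrightarrow> finite {w. a w \<noteq> 0} \<and> (\<forall>w. a w \<noteq> 0 \<longrightarrow> set w \<subseteq> letters n)"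
  by (simp add: free_star_algebra_def)

lemma word_fun_closed: "set w \<subseteq> letters n \<Longrightarrow> word_fun w \<in> carrier (FA n)"
proof -
  have "{v. word_fun w v \<noteq> 0} = {w}" by (auto simp: word_fun_def)
  then show "set w \<subseteq> letters n \<Longrightarrow> word_fun w \<in> carrier (FA n)"
    by (auto simp: FA_carrier word_fun_def)
qed

lemma FA_mult_closed:
  assumes a: "a \<in> carrier (FA n)" and b: "b \<in> carrier (FA n)"
  shows "a \<otimes>\<^bsub>FA n\<^esub> b \<in> carrier (FA n)"
proof -
  have *: "\<exists>u v. w = u @ v \<and> a u \<noteq> 0 \<and> b v \<noteq> 0" if "(a \<otimes>\<^bsub>FA n\<^esub> b) w \<noteq> 0" for w
  proof -
    obtain i where "a (take i w) * b (drop i w) \<noteq> 0"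
      using \<open>(a \<otimes>\<^bsub>FA n\<^esub> b) w \<noteq> 0\<close> unfolding FA_mult by (meson sum.not_neutral_contains_not_neutral)
    then show ?thesis by (intro exI[of _ "take i w"] exI[of _ "drop i w"]) auto
  qed
  have "{w. (a \<otimes>\<^bsub>FA n\<^esub> b) w \<noteq> 0} \<subseteq> (\<lambda>(u, v). u @ v) ` ({u. a u \<noteq> 0} \<times> {v. b v \<noteq> 0})"
    using * by fastforce
  moreover have "finite ((\<lambda>(u, v). u @ v) ` ({u. a u \<noteq> 0} \<times> {v. b v \<noteq> 0}))"
    using a b by (auto simp: FA_carrier)
  ultimately have "finite {w. (a \<otimes>\<^bsub>FA n\<^esub> b) w \<noteq> 0}" by (rule finite_subset)
  moreover have "set w \<subseteq> letters n" if "(a \<otimes>\<^bsub>FA n\<^esub> b) w \<noteq> 0" for w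
    using *[OF that] a b by (fastforce simp: FA_carrier)
  ultimately show ?thesis by (simp add: FA_carrier)
qed

lemma FA_mult_assoc: "(a \<otimes>\<^bsub>FA n\<^esub> b) \<otimes>\<^bsub>FA n\<^esub> c = a \<otimes>\<^bsub>FA n\<^esub> (b \<otimes>\<^bsub>FA n\<^esub> c)"
proof
  fix w :: word
  let ?L = "length w"
  define f where "f p q r = a (take p w) * b (take q (drop p w)) * c (drop (p + q) w)" for p q and r :: nat
  have "((a \<otimes>\<^bsub>FA n\<^esub> b) \<otimes>\<^bsub>FA n\<^esub> c) w = (\<Sum>j=0..?L. \<Sum>i=0..j. f i (j - i) (?L - j))"
    unfolding FA_mult f_def sum_distrib_right atLeast0AtMost
    by (intro sum.cong refl) (auto simp: min_def drop_take)
  also have "\<dots> = (\<Sum>j=0..?L. \<Sum>i=0..?L - j. f j i (?L - j - i))"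
    by (rule fps_mult_assoc_lemma)
  also have "\<dots> = (a \<otimes>\<^bsub>FA n\<^esub> (b \<otimes>\<^bsub>FA n\<^esub> c)) w"
    unfolding FA_mult f_def sum_distrib_left atLeast0AtMost
    by (intro sum.cong refl) (auto simp: add.commute mult.assoc)
  finally show "((a \<otimes>\<^bsub>FA n\<^esub> b) \<otimes>\<^bsub>FA n\<^esub> c) w = (a \<otimes>\<^bsub>FA n\<^esub> (b \<otimes>\<^bsub>FA n\<^esub> c)) w" .
qed

lemma FA_one_left: "word_fun [] \<otimes>\<^bsub>FA n\<^esub> a = a"
proof
  fix w :: word
  have "(word_fun [] \<otimes>\<^bsub>FA n\<^esub> a) w = (\<Sum>i\<le>length w. if i = 0 then a w else 0)"
    unfolding FA_mult by (intro sum.cong) (auto simp: word_fun_def)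
  then show "(word_fun [] \<otimes>\<^bsub>FA n\<^esub> a) w = a w" by simp
qed

lemma FA_one_right: "a \<otimes>\<^bsub>FA n\<^esub> word_fun [] = a"
proof
  fix w :: word
  have "(a \<otimes>\<^bsub>FA n\<^esub> word_fun []) w = (\<Sum>i\<le>length w. if i = length w then a w else 0)"
    unfolding FA_mult by (intro sum.cong) (auto simp: word_fun_def)
  then show "(a \<otimes>\<^bsub>FA n\<^esub> word_fun []) w = a w" by simp
qed

lemma FA_star_mult: "star (FA n) (a \<otimes>\<^bsub>FA n\<^esub> b) = star (FA n) b \<otimes>\<^bsub>FA n\<^esub> star (FA n) a"
proof
  fix w :: word
  have "star (FA n) (a \<otimes>\<^bsub>FA n\<^esub> b) w =
      (\<Sum>i\<le>length w. cnj (a (flip (drop (length w - i) w))) * cnj (b (flip (take (length w - i) w))))"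
    by (simp add: FA_mult take_flip drop_flip)
  also have "\<dots> = (\<Sum>i\<le>length w. cnj (a (flip (drop i w))) * cnj (b (flip (take i w))))"
    by (rule sum.reindex_bij_witness[of _ "\<lambda>i. length w - i" "\<lambda>i. length w - i"]) auto
  finally show "star (FA n) (a \<otimes>\<^bsub>FA n\<^esub> b) w = (star (FA n) b \<otimes>\<^bsub>FA n\<^esub> star (FA n) a) w"
    by (simp add: FA_mult mult.commute)
qed

lemma FA_add_closed:
  assumes a: "a \<in> carrier (FA n)" and b: "b \<in> carrier (FA n)"
  shows "(\<lambda>w. a w + b w) \<in> carrier (FA n)"
proof -
  have "{w. a w + b w \<noteq> 0} \<subseteq> {w. a w \<noteq> 0} \<union> {w. b w \<noteq> 0}" by auto
  then have "finite {w. a w + b w \<noteq> 0}" using a b by (auto simp: FA_carrier intro: finite_subset)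
  moreover have "a w \<noteq> 0 \<or> b w \<noteq> 0" if "a w + b w \<noteq> 0" for w using that by auto
  ultimately show ?thesis using a b by (fastforce simp: FA_carrier)
qed

lemma FA_scale_closed: "a \<in> carrier (FA n) \<Longrightarrow> (\<lambda>w. c * a w) \<in> carrier (FA n)"
  by (cases "c = 0") (auto simp: FA_carrier)

lemma FA_star_closed:
  assumes a: "a \<in> carrier (FA n)"
  shows "(\<lambda>w. cnj (a (flip w))) \<in> carrier (FA n)"
proof -
  have "{w. cnj (a (flip w)) \<noteq> 0} = flip ` {w. a w \<noteq> 0}"
    by (auto simp: image_iff intro!: exI[of _ "flip _"])
  then have "finite {w. cnj (a (flip w)) \<noteq> 0}" using a by (simp add: FA_carrier)
  moreover have "set w \<subseteq> letters n" if "cnj (a (flip w)) \<noteq> 0" for w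
  proof -
    have "a (flip w) \<noteq> 0" using that by simp
    then have "set (flip w) \<subseteq> letters n" using a unfolding FA_carrier by blast
    then show ?thesis by (simp only: set_flip)
  qed
  ultimately show ?thesis by (simp add: FA_carrier)
qed

lemma star_algebra_FA: "star_algebra (FA n)"
proof -
  have "ring (FA n)"
  proof (rule ringI)
    show "abelian_group (FA n)"
    proof (rule abelian_groupI)
      fix x assume x: "x \<in> carrier (FA n)"
      then have "(\<lambda>w. (-1) * x w) \<in> carrier (FA n)" by (rule FA_scale_closed)
      then show "\<exists>y\<in>carrier (FA n). y \<oplus>\<^bsub>FA n\<^esub> x = \<zero>\<^bsub>FA n\<^esub>" by (intro bexI) auto
    qed (auto simp: FA_add_closed add_ac FA_carrier[of "\<lambda>_. 0"])
    show "monoid (FA n)"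
      by (rule monoidI) (auto simp: FA_mult_closed word_fun_closed FA_mult_assoc FA_one_left FA_one_right)
  qed (auto simp: FA_mult fun_eq_iff sum.distrib distrib_left distrib_right)
  moreover have "star_algebra_axioms (FA n)"
  proof
    fix x y assume "x \<in> carrier (FA n)" "y \<in> carrier (FA n)"
    show "star (FA n) (x \<otimes>\<^bsub>FA n\<^esub> y) = star (FA n) y \<otimes>\<^bsub>FA n\<^esub> star (FA n) x" by (rule FA_star_mult)
    fix c :: complex
    show "c \<odot>\<^bsub>FA n\<^esub> x \<otimes>\<^bsub>FA n\<^esub> y = c \<odot>\<^bsub>FA n\<^esub> (x \<otimes>\<^bsub>FA n\<^esub> y)"
      by (simp add: fun_eq_iff FA_mult sum_distrib_left mult_ac)
    show "x \<otimes>\<^bsub>FA n\<^esub> (c \<odot>\<^bsub>FA n\<^esub> y) = c \<odot>\<^bsub>FA n\<^esub> (x \<otimes>\<^bsub>FA n\<^esub> y)"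
      by (simp add: fun_eq_iff FA_mult sum_distrib_left mult_ac)
  qed (auto simp: FA_scale_closed FA_star_closed algebra_simps)
  ultimately show ?thesis by (simp add: star_algebra_def)
qed

lemma FA_induct [consumes 1, case_names zero add]:
  assumes "x \<in> carrier (FA n)" "P (\<lambda>_. 0)"
    and step: "\<And>c w x. set w \<subseteq> letters n \<Longrightarrow> x \<in> carrier (FA n) \<Longrightarrow> P x \<Longrightarrow>
      P ((c \<odot>\<^bsub>FA n\<^esub> word_fun w) \<oplus>\<^bsub>FA n\<^esub> x)"
  shows "P x"
proof -
  have "finite {w. x w \<noteq> 0}" using assms by (simp add: FA_carrier)
  then have "(\<forall>w. x w \<noteq> 0 \<longrightarrow> set w \<subseteq> letters n) \<longrightarrow> P x"
  proof (induction rule: finite_support_induct)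
    case zero then show ?case using assms by simp
  next
    case (update x w v)
    show ?case
    proof
      assume *: "\<forall>u. (x(w := v)) u \<noteq> 0 \<longrightarrow> set u \<subseteq> letters n"
      then have w: "set w \<subseteq> letters n" and x: "x \<in> carrier (FA n)"
        using update by (auto simp: FA_carrier split: if_splits)
      have "x(w := v) = (v \<odot>\<^bsub>FA n\<^esub> word_fun w) \<oplus>\<^bsub>FA n\<^esub> x"
        using update by (auto simp: word_fun_def)
      then show "P (x(w := v))" using step[OF w x] update x by (simp add: FA_carrier)
    qed
  qed
  then show ?thesis using assms by (simp add: FA_carrier)
qed

lemma word_fun_mult: "word_fun u \<otimes>\<^bsub>FA n\<^esub> word_fun v = word_fun (u @ v)"
proof
  fix w
  have "(word_fun u \<otimes>\<^bsub>FA n\<^esub> word_fun v) w =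
      (\<Sum>i\<le>length w. if i = length u then word_fun (u @ v) w else 0)"
    unfolding FA_mult
  proof (rule sum.cong)
    fix i assume i: "i \<in> {..length w}"
    have "take i w = u \<and> drop i w = v \<longleftrightarrow> w = u @ v \<and> i = length u"
    proof
      assume t: "take i w = u \<and> drop i w = v"
      have "length (take i w) = i" using i by simp
      then have "i = length u" using t by simp
      moreover have "w = take i w @ drop i w" by simp
      then have "w = u @ v" using t by (simp only:)
      ultimately show "w = u @ v \<and> i = length u" by blast
    qed simp
    moreover have "word_fun u (take i w) * word_fun v (drop i w) =
        (if take i w = u \<and> drop i w = v then 1 else 0)"
      by (simp add: word_fun_def)
    moreover have "(if i = length u then word_fun (u @ v) w else 0) =
        (if w = u @ v \<and> i = length u then 1 else 0)"
      by (simp add: word_fun_def)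
    ultimately show "word_fun u (take i w) * word_fun v (drop i w) =
        (if i = length u then word_fun (u @ v) w else 0)"
      by (simp only:)
  qed simp
  also have "\<dots> = word_fun (u @ v) w" by (auto simp: word_fun_def)
  finally show "(word_fun u \<otimes>\<^bsub>FA n\<^esub> word_fun v) w = word_fun (u @ v) w" .
qed

lemma star_word_fun: "star (FA n) (word_fun w) = word_fun (flip w)"
  by (auto simp: word_fun_def fun_eq_iff)

text \<open>
  The universal property.  The unit is allowed to go to any projection \<open>p\<close> that is a unit for the
  images of the generators, so that the free algebra can be mapped into corners.
\<close>
lemma free_star_hom_exists:
  fixes B :: "('b, 'l) star_ops_scheme" (structure)
  assumes B: "star_algebra B" and p: "p \<in> carrier B" "star B p = p" "p \<otimes> p = p"
    and v: "\<And>i. i \<in> {1..n} \<Longrightarrow> v i \<in> carrier B \<and> p \<otimes> v i = v i \<and> v i \<otimes> p = v i"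
  obtains h where "star_hom (FA n) B h" "h \<one>\<^bsub>FA n\<^esub> = p"
    "\<And>i. i \<in> {1..n} \<Longrightarrow> h (cuntz_generator i) = v i"
proof -
  interpret star_algebra B by fact
  interpret F: star_algebra "FA n" by (rule star_algebra_FA)
  define l where "l = (\<lambda>(i, s). if s then star B (v i) else v i)"
  define ev where "ev w = foldr (\<lambda>a b. l a \<otimes> b) w p" for w
  have vs: "star B (v i) \<in> carrier B \<and> p \<otimes> star B (v i) = star B (v i) \<and> star B (v i) \<otimes> p = star B (v i)"
    if "i \<in> {1..n}" for i
    using v[OF that] p star_mult[of "v i" p] star_mult[of p "v i"] by (auto simp: star_closed)
  have l: "l a \<in> carrier B \<and> p \<otimes> l a = l a \<and> l a \<otimes> p = l a" if "a \<in> letters n" for a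
    using that v vs by (auto simp: l_def)
  have ev0: "ev [] = p" and evC: "ev (a # w) = l a \<otimes> ev w" for a w by (simp_all add: ev_def)
  have ev: "ev w \<in> carrier B \<and> p \<otimes> ev w = ev w \<and> ev w \<otimes> p = ev w" if "set w \<subseteq> letters n" for w
    using that
  proof (induction w)
    case Nil then show ?case using p by (simp add: ev0)
  next
    case (Cons a w)
    then have w: "ev w \<in> carrier B" "p \<otimes> ev w = ev w" "ev w \<otimes> p = ev w" by auto
    have a: "l a \<in> carrier B" "p \<otimes> l a = l a" "l a \<otimes> p = l a" using l[of a] Cons.prems by auto
    show ?case unfolding evC using w a p m_assoc[of p "l a" "ev w"] m_assoc[of "l a" "ev w" p] by simp
  qed
  have evc: "ev w \<in> carrier B" if "set w \<subseteq> letters n" for w using ev[OF that] by blast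
  have ev_append: "ev (u @ w) = ev u \<otimes> ev w" if "set u \<subseteq> letters n" "set w \<subseteq> letters n" for u w
    using that(1)
  proof (induction u)
    case Nil then show ?case using ev[OF that(2)] by (simp add: ev0)
  next
    case (Cons a u)
    then show ?case using l[of a] evc[of u] evc[OF that(2)] by (simp add: evC m_assoc)
  qed
  have ev1: "ev [a] = l a" if "a \<in> letters n" for a using l[OF that] by (simp add: evC ev0)
  have lflip: "star B (l (i, s)) = l (i, \<not> s)" if "i \<in> {1..n}" for i s
    using v[OF that] by (simp add: l_def star_star)
  have ev_flip: "ev (flip w) = star B (ev w)" if "set w \<subseteq> letters n" for w
    using that
  proof (induction w)
    case Nil then show ?case using p by (simp add: ev0)
  next
    case (Cons a w)
    obtain i s where a: "a = (i, s)" by (cases a)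
    have i: "i \<in> {1..n}" and w: "set w \<subseteq> letters n" using Cons.prems a by auto
    have "flip (a # w) = flip w @ [(i, \<not> s)]" by (simp add: flip_def a)
    then have "ev (flip (a # w)) = star B (ev w) \<otimes> l (i, \<not> s)"
      using Cons.IH[OF w] ev_append[of "flip w" "[(i, \<not> s)]"] ev1[of "(i, \<not> s)"] set_flip[of w n] w i by auto
    then show ?case using lflip[OF i] star_mult[of "l a" "ev w"] evc[OF w] l[of a] i by (simp add: evC a)
  qed
  define h where "h x = fin_ext (\<lambda>w c. if set w \<subseteq> letters n then c \<odot> ev w else \<zero>) x" for x
  have hc: "h x \<in> carrier B" if "x \<in> carrier (FA n)" for x
    unfolding h_def by (intro fin_ext_closed) (auto simp: evc scale_closed)
  have hadd: "h (x \<oplus>\<^bsub>FA n\<^esub> y) = h x \<oplus> h y" if "x \<in> carrier (FA n)" "y \<in> carrier (FA n)" for x y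
    unfolding h_def FA_simps
    by (rule fin_ext_add) (use that in \<open>auto simp: FA_carrier evc scale_closed scale_add_left\<close>)
  have hword: "h (c \<odot>\<^bsub>FA n\<^esub> word_fun w) = c \<odot> ev w" if w: "set w \<subseteq> letters n" for c w
  proof -
    have "c \<odot>\<^bsub>FA n\<^esub> word_fun w = (\<lambda>i. if i = w then c else 0)" by (auto simp: word_fun_def)
    then show ?thesis
      unfolding h_def using w
        fin_ext_single[of "\<lambda>w c. if set w \<subseteq> letters n then c \<odot> ev w else \<zero>" w c]
      by (simp add: evc scale_closed)
  qed
  have hword1: "h (word_fun w) = ev w" if w: "set w \<subseteq> letters n" for w
    using hword[OF w, of 1] evc[OF w] by (simp add: scale_one)
  have h0: "h (\<lambda>_. 0) = \<zero>" by (simp add: h_def fin_ext_def)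
  have wc: "c \<odot>\<^bsub>FA n\<^esub> word_fun w \<in> carrier (FA n)" if "set w \<subseteq> letters n" for c w
    using F.scale_closed[OF word_fun_closed[OF that]] .
  have hscale: "h (k \<odot>\<^bsub>FA n\<^esub> x) = k \<odot> h x" if "x \<in> carrier (FA n)" for k x
    using that
  proof (induction x rule: FA_induct)
    case zero then show ?case by (simp add: h0)
  next
    case (add c w x)
    have "k \<odot>\<^bsub>FA n\<^esub> (c \<odot>\<^bsub>FA n\<^esub> word_fun w \<oplus>\<^bsub>FA n\<^esub> x) =
        (k * c) \<odot>\<^bsub>FA n\<^esub> word_fun w \<oplus>\<^bsub>FA n\<^esub> k \<odot>\<^bsub>FA n\<^esub> x"
      by (simp add: fun_eq_iff algebra_simps)
    then show ?case
      using add hadd[OF wc F.scale_closed[OF add(2)]] hadd[OF wc add(2)] hc evc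
      by (simp del: FA_simps add: hword scale_add_right scale_scale scale_closed)
  qed
  have hstar: "h (star (FA n) x) = star B (h x)" if "x \<in> carrier (FA n)" for x
    using that
  proof (induction x rule: FA_induct)
    case zero then show ?case by (simp add: h0)
  next
    case (add c w x)
    have f: "set (flip w) \<subseteq> letters n" using add(1) set_flip by blast
    have "star (FA n) (c \<odot>\<^bsub>FA n\<^esub> word_fun w \<oplus>\<^bsub>FA n\<^esub> x) =
        cnj c \<odot>\<^bsub>FA n\<^esub> word_fun (flip w) \<oplus>\<^bsub>FA n\<^esub> star (FA n) x"
      using star_word_fun[of n w] by (simp add: fun_eq_iff)
    then show ?case
      using add hadd[OF wc[OF f] F.star_closed[OF add(2)]] hadd[OF wc add(2)] hc evc f
      by (simp del: FA_simps add: hword star_add star_scale scale_closed ev_flip)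
  qed
  have hmult1: "h ((c \<odot>\<^bsub>FA n\<^esub> word_fun u) \<otimes>\<^bsub>FA n\<^esub> y) = (c \<odot> ev u) \<otimes> h y"
    if u: "set u \<subseteq> letters n" and y: "y \<in> carrier (FA n)" for c u y
    using y
  proof (induction y rule: FA_induct)
    case zero
    have "(c \<odot>\<^bsub>FA n\<^esub> word_fun u) \<otimes>\<^bsub>FA n\<^esub> (\<lambda>_. 0) = (\<lambda>_. 0)" by (simp add: FA_mult fun_eq_iff)
    then show ?case using evc[OF u] by (simp del: FA_simps add: h0 scale_closed)
  next
    case (add d w x)
    have "(c \<odot>\<^bsub>FA n\<^esub> word_fun u) \<otimes>\<^bsub>FA n\<^esub> (d \<odot>\<^bsub>FA n\<^esub> word_fun w) = (d * c) \<odot>\<^bsub>FA n\<^esub> word_fun (u @ w)"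
    proof -
      have c: "word_fun (u @ w) \<in> carrier (FA n)" using u add(1) by (intro word_fun_closed) simp
      show ?thesis
        unfolding F.scale_mult_left[OF word_fun_closed[OF u] wc[OF add(1)]]
          F.scale_mult_right[OF word_fun_closed[OF u] word_fun_closed[OF add(1)]] word_fun_mult
          F.scale_scale[OF c] by (simp only: mult.commute)
    qed
    then have "h ((c \<odot>\<^bsub>FA n\<^esub> word_fun u) \<otimes>\<^bsub>FA n\<^esub> ((d \<odot>\<^bsub>FA n\<^esub> word_fun w) \<oplus>\<^bsub>FA n\<^esub> x)) =
        h ((d * c) \<odot>\<^bsub>FA n\<^esub> word_fun (u @ w)) \<oplus> h ((c \<odot>\<^bsub>FA n\<^esub> word_fun u) \<otimes>\<^bsub>FA n\<^esub> x)"
      using F.r_distr[OF wc[OF add(1)] add(2) wc[OF u]] hadd[OF wc F.m_closed[OF wc[OF u] add(2)]] u add(1)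
      by (simp del: FA_simps)
    also have "h ((d * c) \<odot>\<^bsub>FA n\<^esub> word_fun (u @ w)) = (c \<odot> ev u) \<otimes> (d \<odot> ev w)"
      using u add(1) evc by (simp del: FA_simps add: hword ev_append scale_mult_left scale_mult_right scale_scale scale_closed)
    finally show ?case
      using add evc u hadd[OF wc add(2)] hc r_distr
      by (simp del: FA_simps add: hword scale_closed)
  qed
  have hmult: "h (x \<otimes>\<^bsub>FA n\<^esub> y) = h x \<otimes> h y" if "x \<in> carrier (FA n)" and y: "y \<in> carrier (FA n)" for x y
    using that(1)
  proof (induction x rule: FA_induct)
    case zero
    have "(\<lambda>_. 0) \<otimes>\<^bsub>FA n\<^esub> y = (\<lambda>_. 0)" by (simp add: FA_mult fun_eq_iff)
    then show ?case using hc[OF y] by (simp del: FA_simps add: h0)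
  next
    case (add c w x)
    have "h (((c \<odot>\<^bsub>FA n\<^esub> word_fun w) \<oplus>\<^bsub>FA n\<^esub> x) \<otimes>\<^bsub>FA n\<^esub> y) =
        h ((c \<odot>\<^bsub>FA n\<^esub> word_fun w) \<otimes>\<^bsub>FA n\<^esub> y) \<oplus> h (x \<otimes>\<^bsub>FA n\<^esub> y)"
      using F.l_distr[OF wc[OF add(1)] add(2) y] hadd[OF F.m_closed[OF wc y] F.m_closed[OF add(2) y]] add(1)
      by (simp del: FA_simps)
    then show ?case
      using add hmult1[OF add(1) y] hadd[OF wc add(2)] hc y evc l_distr
      by (simp del: FA_simps add: hword scale_closed)
  qed
  show thesis
  proof
    show "star_hom (FA n) B h" unfolding star_hom_def
      by (intro ballI conjI allI) (fact hc hstar hscale hadd hmult)+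
    show "h \<one>\<^bsub>FA n\<^esub> = p" using hword1[of "[]"] by (simp add: ev0)
    show "h (cuntz_generator i) = v i" if "i \<in> {1..n}" for i
      using that hword1[of "[(i, False)]"] ev1[of "(i, False)"] by (simp add: cuntz_generator_def l_def)
  qed
qed

lemma generator_closed: "i \<in> {1..n} \<Longrightarrow> cuntz_generator i \<in> carrier (FA n)"
  by (simp add: cuntz_generator_def word_fun_closed)

lemma free_star_hom_unique:
  assumes A: "star_algebra A" and h: "star_hom (FA n) A h" and g: "star_hom (FA n) A g"
    and one: "h \<one>\<^bsub>FA n\<^esub> = g \<one>\<^bsub>FA n\<^esub>"
    and gen: "\<And>i. i \<in> {1..n} \<Longrightarrow> h (cuntz_generator i) = g (cuntz_generator i)"
    and x: "x \<in> carrier (FA n)"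
  shows "h x = g x"
proof -
  interpret F: star_algebra "FA n" by (rule star_algebra_FA)
  have letter: "h (word_fun [a]) = g (word_fun [a])" if al: "a \<in> letters n" for a
  proof -
    obtain i s where a: "a = (i, s)" "i \<in> {1..n}" using al by (cases a) auto
    have "word_fun [a] = (if s then star (FA n) (cuntz_generator i) else cuntz_generator i)"
      using star_word_fun[of n "[(i, False)]"] by (auto simp: a cuntz_generator_def simp del: FA_simps)
    then show ?thesis
      using gen[OF a(2)] star_homD(2)[OF h generator_closed[OF a(2)]] star_homD(2)[OF g generator_closed[OF a(2)]]
      by (cases s) auto
  qed
  have word: "h (word_fun w) = g (word_fun w)" if "set w \<subseteq> letters n" for w
    using that
  proof (induction w)
    case Nil then show ?case using one by simp
  next
    case (Cons a w)
    have c: "word_fun [a] \<in> carrier (FA n)" "word_fun w \<in> carrier (FA n)"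
      using Cons.prems word_fun_closed[of "[a]" n] word_fun_closed[of w n] by auto
    have "word_fun (a # w) = word_fun [a] \<otimes>\<^bsub>FA n\<^esub> word_fun w" by (simp add: word_fun_mult)
    then show ?case
      using Cons letter[of a] star_homD(5)[OF h c] star_homD(5)[OF g c] by simp
  qed
  show ?thesis
    using x
  proof (induction x rule: FA_induct)
    case zero
    show ?case using star_hom_zero[OF h star_algebra_FA A] star_hom_zero[OF g star_algebra_FA A] by simp
  next
    case (add c w x)
    note wc = word_fun_closed[OF add(1)]
    note sc = F.scale_closed[OF wc]
    show ?case
      using star_homD(4)[OF h sc add(2)] star_homD(4)[OF g sc add(2)] star_homD(3)[OF h wc]
        star_homD(3)[OF g wc] word[OF add(1)] add(3) by (simp del: FA_simps)
  qed
qed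

section \<open>The Cuntz algebra as a completion\<close>

text \<open>
  Wherever the relations hold, the generators are partial isometries, hence contractions; so a word has
  seminorm at most \<open>1\<close>, and an element of the free algebra at most the sum of the moduli of its coefficients.
\<close>
lemma cuntz_seminorms_bounded:
  assumes "x \<in> carrier (FA n)"
  shows "\<exists>B. \<forall>p. cstar_seminorm (FA n) p \<longrightarrow> (\<forall>r\<in>cuntz_relators n. p r = 0) \<longrightarrow> p x \<le> B"
  using assms
proof (induction x rule: FA_induct)
  case zero
  interpret F: star_algebra "FA n" by (rule star_algebra_FA)
  have "p (\<lambda>_. 0) \<le> 0" if "cstar_seminorm (FA n) p" for p
  proof -
    interpret P: seminormed_star_algebra "FA n" p by unfold_locales (rule that)
    show ?thesis using P.N_zero by simp
  qed
  then show ?case by blast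
next
  case (add c w x)
  then obtain B where B: "\<forall>p. cstar_seminorm (FA n) p \<longrightarrow> (\<forall>r\<in>cuntz_relators n. p r = 0) \<longrightarrow> p x \<le> B"
    by blast
  interpret F: star_algebra "FA n" by (rule star_algebra_FA)
  have "p (c \<odot>\<^bsub>FA n\<^esub> word_fun w \<oplus>\<^bsub>FA n\<^esub> x) \<le> cmod c + B"
    if p: "cstar_seminorm (FA n) p" "\<forall>r\<in>cuntz_relators n. p r = 0" for p
  proof -
    interpret P: seminormed_star_algebra "FA n" p by unfold_locales (rule p)
    have gen: "p (cuntz_generator i) \<le> 1" if i: "i \<in> {1..n}" for i
    proof -
      let ?S = "cuntz_generator i"
      have S: "?S \<in> carrier (FA n)" by (rule generator_closed[OF i])
      have "star (FA n) ?S \<otimes>\<^bsub>FA n\<^esub> ?S \<ominus>\<^bsub>FA n\<^esub> \<one>\<^bsub>FA n\<^esub> \<in> cuntz_relators n"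
        unfolding cuntz_relators_def Let_def using i by blast
      then have "p (star (FA n) ?S \<otimes>\<^bsub>FA n\<^esub> ?S \<ominus>\<^bsub>FA n\<^esub> \<one>\<^bsub>FA n\<^esub>) = 0" using p by blast
      then have "(p ?S)\<^sup>2 \<le> 1"
        using P.N_diff_abs[OF F.m_closed[OF F.star_closed[OF S] S] F.one_closed] P.N_one P.N_cstar[OF S]
        by linarith
      then show ?thesis by (simp add: power2_le_iff_abs_le[of 1, simplified])
    qed
    have letter: "p (word_fun [a]) \<le> 1" if al: "a \<in> letters n" for a
    proof -
      obtain i s where a: "a = (i, s)" "i \<in> {1..n}" using al by (cases a) auto
      have "word_fun [a] = (if s then star (FA n) (cuntz_generator i) else cuntz_generator i)"
        using star_word_fun[of n "[(i, False)]"] by (auto simp: a cuntz_generator_def simp del: FA_simps)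
      then show ?thesis
        using gen[OF a(2)] P.N_star[OF generator_closed[OF a(2)]] by (cases s) auto
    qed
    have "p (word_fun w) \<le> 1" using add(1)
    proof (induction w)
      case Nil show ?case using P.N_one by simp
    next
      case (Cons a w)
      have c: "word_fun [a] \<in> carrier (FA n)" "word_fun w \<in> carrier (FA n)"
        using Cons.prems word_fun_closed[of "[a]" n] word_fun_closed[of w n] by auto
      have "p (word_fun (a # w)) \<le> p (word_fun [a]) * p (word_fun w)"
        using P.N_mult[OF c] by (simp add: word_fun_mult)
      also have "\<dots> \<le> 1 * 1" using letter[of a] Cons c by (intro mult_mono) auto
      finally show ?case by simp
    qed
    then have "cmod c * p (word_fun w) \<le> cmod c" by (simp add: mult_left_le)
    moreover have "p x \<le> B" using B p by blast
    ultimately show ?thesis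
      using P.N_triangle[OF F.scale_closed[OF word_fun_closed[OF add(1)]] add(2), of c]
        P.N_scale[OF word_fun_closed[OF add(1)], of c] by linarith
  qed
  then show ?case by blast
qed

abbreviation "cuntz_seminorm n \<equiv> max_cstar_seminorm (FA n) (cuntz_relators n)"

lemma seminormed_cuntz: "seminormed_star_algebra (FA n) (cuntz_seminorm n)"
  by (intro seminormed_star_algebra.intro seminormed_star_algebra_axioms.intro star_algebra_FA
      star_algebra.cstar_seminorm_max[OF star_algebra_FA] cuntz_seminorms_bounded)

section \<open>Projections with sum one are orthogonal\<close>

context seminormed_star_algebra
begin

lemma N_midpoint:
  assumes "x \<in> carrier A" "y \<in> carrier A" "0 \<le> t" "t \<le> 1" "N x \<le> 1" "N y \<le> 1"
  shows "N (complex_of_real t \<odot> x \<oplus> complex_of_real (1 - t) \<odot> y) \<le> 1"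
proof -
  have "N (complex_of_real t \<odot> x \<oplus> complex_of_real (1 - t) \<odot> y) \<le> t * N x + (1 - t) * N y"
    using N_triangle[OF scale_closed[OF assms(1), of "complex_of_real t"]
        scale_closed[OF assms(2), of "complex_of_real (1 - t)"]] assms(3,4)
      N_scale[OF assms(1), of "complex_of_real t"] N_scale[OF assms(2), of "complex_of_real (1 - t)"]
    by (simp del: of_real_diff)
  also have "\<dots> \<le> t * 1 + (1 - t) * 1"
    using assms by (intro add_mono mult_left_mono) auto
  finally show ?thesis by simp
qed

context
  fixes p c
  assumes p: "p \<in> carrier A" "p \<otimes> p = p" and c: "c \<in> carrier A" "p \<otimes> c = c" "c \<otimes> p = c"
begin

lemma line_mult:
  "(p \<oplus> a \<odot> c) \<otimes> (p \<oplus> b \<odot> c) = p \<oplus> (a + b) \<odot> c \<oplus> (a * b) \<odot> (c \<otimes> c)"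
proof -
  have ac: "a \<odot> c \<in> carrier A" "b \<odot> c \<in> carrier A" using c scale_closed by auto
  have "(p \<oplus> a \<odot> c) \<otimes> (p \<oplus> b \<odot> c) = (p \<otimes> p \<oplus> a \<odot> c \<otimes> p) \<oplus> (p \<otimes> (b \<odot> c) \<oplus> (a \<odot> c) \<otimes> (b \<odot> c))"
    using ac p(1) by (simp add: l_distr r_distr)
  also have "\<dots> = (p \<oplus> a \<odot> c) \<oplus> (b \<odot> c \<oplus> (a * b) \<odot> (c \<otimes> c))"
    using p c by (simp add: scale_mult_left scale_mult_right scale_scale scale_closed mult.commute)
  also have "\<dots> = p \<oplus> (a \<odot> c \<oplus> b \<odot> c) \<oplus> (a * b) \<odot> (c \<otimes> c)"
    using p c ac by (simp add: a_assoc scale_closed)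
  finally show ?thesis using c by (simp add: scale_add_left)
qed

text \<open>
  The two squares in \<open>p + \<lambda>c = ((p + \<lambda>\<^sub>1c)\<^sup>2 + (p + \<lambda>\<^sub>2c)\<^sup>2) / 2\<close> with \<open>\<lambda>\<^sub>1 = \<lambda>(1 + i)/2\<close> and
  \<open>\<lambda>\<^sub>2 = \<lambda>(1 - i)/2\<close> have opposite terms in \<open>c\<^sup>2\<close>, and both \<open>\<lambda>\<^sub>1\<close> and \<open>\<lambda>\<^sub>2\<close> are smaller than \<open>\<lambda>\<close> by
  a factor \<open>\<surd>2\<close>.
\<close>
lemma disc_grows:
  assumes disc: "\<And>l. cmod l \<le> r \<Longrightarrow> N (p \<oplus> l \<odot> c) \<le> 1" and l: "cmod l \<le> sqrt 2 * r"
  shows "N (p \<oplus> l \<odot> c) \<le> 1"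
proof -
  define a where "a = l * (1 + \<i>) / 2"
  define b where "b = l * (1 - \<i>) / 2"
  have cm: "cmod (1 + \<i>) = sqrt 2" "cmod (1 - \<i>) = sqrt 2" by (simp_all add: cmod_def)
  have "cmod l * sqrt 2 \<le> sqrt 2 * r * sqrt 2" using l by (rule mult_right_mono) simp
  moreover have "sqrt 2 * r * sqrt 2 = 2 * r" by (simp add: mult.commute mult.left_commute)
  ultimately have "cmod l * sqrt 2 / 2 \<le> r" by simp
  then have ab: "cmod a \<le> r" "cmod b \<le> r"
    using cm by (simp_all add: a_def b_def norm_mult norm_divide)
  have ab2: "a + b = l" "a * a = - (b * b)"
    by (simp_all add: a_def b_def field_simps)
  have sq: "N ((p \<oplus> z \<odot> c) \<otimes> (p \<oplus> z \<odot> c)) \<le> 1" if "cmod z \<le> r" for z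
  proof -
    have zc: "p \<oplus> z \<odot> c \<in> carrier A" using p c scale_closed by simp
    have "N ((p \<oplus> z \<odot> c) \<otimes> (p \<oplus> z \<odot> c)) \<le> N (p \<oplus> z \<odot> c) * N (p \<oplus> z \<odot> c)" by (rule N_mult[OF zc zc])
    also have "\<dots> \<le> 1 * 1" using disc[OF that] zc by (intro mult_mono) auto
    finally show ?thesis by simp
  qed
  let ?X = "(p \<oplus> a \<odot> c) \<otimes> (p \<oplus> a \<odot> c)" and ?Y = "(p \<oplus> b \<odot> c) \<otimes> (p \<oplus> b \<odot> c)"
  have XY: "?X \<in> carrier A" "?Y \<in> carrier A" using p c scale_closed by auto
  let ?d = "(b * b) \<odot> (c \<otimes> c)"
  have d: "?d \<in> carrier A" using c scale_closed by simp
  have lc: "(a + a) \<odot> c \<in> carrier A" "(b + b) \<odot> c \<in> carrier A" using c scale_closed by auto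
  have "?X \<oplus> ?Y = (p \<oplus> (a + a) \<odot> c \<ominus> ?d) \<oplus> (p \<oplus> (b + b) \<odot> c \<oplus> ?d)"
    unfolding line_mult ab2(2) using c by (simp add: minus_eq scale_minus_left)
  also have "\<dots> = (p \<oplus> p) \<oplus> ((a + a) \<odot> c \<oplus> (b + b) \<odot> c)"
    using p(1) d lc by algebra
  also have "(a + a) \<odot> c \<oplus> (b + b) \<odot> c = (2 * l) \<odot> c"
  proof -
    have "(a + a) + (b + b) = 2 * l" by (simp add: ab2(1)[symmetric])
    then show ?thesis using scale_add_left[OF c(1), of "a + a" "b + b"] by simp
  qed
  also have "p \<oplus> p = 2 \<odot> p" using scale_add_left[OF p(1), of 1 1] p by (simp add: scale_one)
  finally have e: "?X \<oplus> ?Y = 2 \<odot> (p \<oplus> l \<odot> c)"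
    using p c by (simp add: scale_add_right scale_scale scale_closed)
  have "2 * N (p \<oplus> l \<odot> c) = N (?X \<oplus> ?Y)" unfolding e using p c by (simp add: N_scale scale_closed)
  also have "\<dots> \<le> 2" using N_triangle[OF XY] sq[OF ab(1)] sq[OF ab(2)] by linarith
  finally show ?thesis by simp
qed

text \<open>
  By repeated growth the whole complex line through \<open>p\<close> in the direction \<open>c\<close> stays in the unit ball.
\<close>
lemma disc_trivial:
  assumes "star A p = p" and r: "r > 0" and disc: "\<And>l. cmod l \<le> r \<Longrightarrow> N (p \<oplus> l \<odot> c) \<le> 1"
  shows "N c = 0"
proof (rule ccontr)
  assume "N c \<noteq> 0"
  then have Nc: "N c > 0" using N_nonneg[OF c(1)] by linarith
  have grow: "N (p \<oplus> l \<odot> c) \<le> 1" if "cmod l \<le> sqrt 2 ^ k * r" for k l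
    using that
  proof (induction k arbitrary: l)
    case 0 then show ?case using disc by simp
  next
    case (Suc k) then show ?case using disc_grows[of "sqrt 2 ^ k * r" l] by (simp add: mult.assoc)
  qed
  obtain k where k: "3 / (r * N c) < sqrt 2 ^ k" using real_arch_pow[of "sqrt 2"] by auto
  have *: "N (p \<oplus> complex_of_real (sqrt 2 ^ k * r) \<odot> c) \<le> 1"
    by (rule grow[of _ k]) (use r in \<open>simp del: of_real_mult of_real_power\<close>)
  let ?z = "complex_of_real (sqrt 2 ^ k * r) \<odot> c"
  have zc: "?z \<in> carrier A" using c scale_closed by simp
  have "?z = (p \<oplus> ?z) \<ominus> p" using zc p(1) by algebra
  then have "N ?z \<le> 2"
    using N_diff[of "p \<oplus> ?z" p] * N_projection[OF p(1) assms(1) p(2)] zc p(1) by simp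
  moreover have "N ?z = sqrt 2 ^ k * r * N c"
    using N_scale[OF c(1), of "complex_of_real (sqrt 2 ^ k * r)"] r by (simp add: norm_mult norm_power)
  moreover have "3 < sqrt 2 ^ k * (r * N c)" using k r Nc by (simp add: field_simps)
  ultimately show False by (simp add: mult.assoc)
qed

text \<open>
  The bound is extended from \<open>p \<plusminus> c\<close> to a disc of factors of \<open>c\<close>: to the real interval by convexity, to the
  imaginary one by the C*-identity \<open>(p + itc)\<^sup>*(p + itc) = p + t\<^sup>2c\<^sup>2\<close>, in which \<open>p + c\<^sup>2\<close> is the mean of the
  squares of \<open>p + c\<close> and \<open>p - c\<close>, and then to the disc by convexity again.
\<close>
lemma contractions_trivial:
  assumes star: "star A p = p" "star A c = c"
    and pm: "N (p \<oplus> c) \<le> 1" "N (p \<ominus> c) \<le> 1"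
  shows "N c = 0"
proof (rule disc_trivial[OF star(1), of "1/2"])
  have real: "N (p \<oplus> complex_of_real t \<odot> c) \<le> 1" if t: "\<bar>t\<bar> \<le> 1" for t
  proof -
    have "p \<oplus> complex_of_real t \<odot> c =
        complex_of_real ((1 + t) / 2) \<odot> (p \<oplus> c) \<oplus> complex_of_real (1 - (1 + t) / 2) \<odot> (p \<ominus> c)"
    proof -
      let ?a = "complex_of_real ((1 + t) / 2)" and ?b = "complex_of_real (1 - (1 + t) / 2)"
      have ab: "?a + ?b = 1" "?a - ?b = complex_of_real t"
        unfolding of_real_add[symmetric] of_real_diff[symmetric] by (simp_all add: field_simps)
      have "?a \<odot> (p \<oplus> c) \<oplus> ?b \<odot> (p \<ominus> c) = (?a \<odot> p \<oplus> ?b \<odot> p) \<oplus> (?a \<odot> c \<oplus> (- ?b) \<odot> c)"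
        using scale_closed[OF p(1), of ?a] scale_closed[OF p(1), of ?b] scale_closed[OF c(1), of ?a]
          scale_closed[OF c(1), of ?b] p(1) c(1)
        unfolding minus_eq
        by (simp del: of_real_diff of_real_divide of_real_add
            add: scale_add_right scale_minus_right scale_minus_left a_ac)
      also have "\<dots> = (?a + ?b) \<odot> p \<oplus> (?a - ?b) \<odot> c"
        using p(1) c(1) scale_add_left[of p ?a ?b] scale_add_left[of c ?a "- ?b"] by simp
      finally show ?thesis unfolding ab using p by (simp add: scale_one)
    qed
    moreover have "N \<dots> \<le> 1"
      using p(1) c(1) pm t by (intro N_midpoint) auto
    ultimately show ?thesis by simp
  qed
  have cc: "c \<otimes> c \<in> carrier A" using c by simp
  have "N (p \<oplus> 1 \<odot> (c \<otimes> c)) \<le> 1"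
  proof -
    let ?X = "(p \<oplus> 1 \<odot> c) \<otimes> (p \<oplus> 1 \<odot> c)" and ?Y = "(p \<oplus> (-1) \<odot> c) \<otimes> (p \<oplus> (-1) \<odot> c)"
    have XY: "?X \<in> carrier A" "?Y \<in> carrier A" using p c scale_closed by auto
    have "N ?X \<le> 1" "N ?Y \<le> 1"
      using N_mult[of "p \<oplus> c" "p \<oplus> c"] N_mult[of "p \<ominus> c" "p \<ominus> c"] pm p(1) c(1)
        mult_le_one[of "N (p \<oplus> c)" "N (p \<oplus> c)"] mult_le_one[of "N (p \<ominus> c)" "N (p \<ominus> c)"]
      by (simp_all add: scale_one scale_minus_one minus_eq)
    moreover have "?X \<oplus> ?Y = 2 \<odot> (p \<oplus> 1 \<odot> (c \<otimes> c))"
    proof -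
      have c2: "2 \<odot> c \<in> carrier A" using c scale_closed by simp
      have "?X \<oplus> ?Y = (p \<oplus> 2 \<odot> c \<oplus> (c \<otimes> c)) \<oplus> (p \<ominus> 2 \<odot> c \<oplus> (c \<otimes> c))"
        unfolding line_mult using cc c p(1) scale_minus_left[OF c(1), of 2] by (simp add: scale_one minus_eq)
      also have "\<dots> = (p \<oplus> c \<otimes> c) \<oplus> (p \<oplus> c \<otimes> c)"
        using p(1) cc c2 by algebra
      also have "\<dots> = 2 \<odot> (p \<oplus> c \<otimes> c)"
        using scale_add_left[of "p \<oplus> c \<otimes> c" 1 1] p(1) cc by (simp add: scale_one)
      finally show ?thesis using cc by (simp add: scale_one)
    qed
    ultimately have "N (2 \<odot> (p \<oplus> 1 \<odot> (c \<otimes> c))) \<le> 2" using N_triangle[OF XY] by simp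
    then show ?thesis using p(1) cc N_scale[of "p \<oplus> 1 \<odot> (c \<otimes> c)" 2] scale_closed by simp
  qed
  then have p2: "N (p \<oplus> c \<otimes> c) \<le> 1" using cc by (simp add: scale_one)
  have imag: "N (p \<oplus> (\<i> * complex_of_real t) \<odot> c) \<le> 1" if t: "\<bar>t\<bar> \<le> 1" for t
  proof -
    let ?z = "p \<oplus> (\<i> * complex_of_real t) \<odot> c"
    have zc: "?z \<in> carrier A" using p c scale_closed by simp
    have "star A ?z = p \<oplus> (- (\<i> * complex_of_real t)) \<odot> c"
      using p c star by (simp add: star_add star_scale scale_closed)
    then have "star A ?z \<otimes> ?z = p \<oplus> complex_of_real (t * t) \<odot> (c \<otimes> c)"
      using line_mult[of "- (\<i> * complex_of_real t)" "\<i> * complex_of_real t"] c p cc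
      by (simp add: mult.assoc mult.left_commute[of "complex_of_real t"])
    also have "\<dots> = complex_of_real (t * t) \<odot> (p \<oplus> c \<otimes> c) \<oplus> complex_of_real (1 - t * t) \<odot> p"
    proof -
      let ?a = "complex_of_real (t * t)" and ?b = "complex_of_real (1 - t * t)"
      have cl: "?a \<odot> p \<in> carrier A" "?b \<odot> p \<in> carrier A" "?a \<odot> (c \<otimes> c) \<in> carrier A"
        using scale_closed p(1) cc by auto
      have "?a \<odot> p \<oplus> ?b \<odot> p = p"
        using scale_add_left[OF p(1), of ?a ?b] p(1) by (simp add: scale_one)
      then have "p \<oplus> ?a \<odot> (c \<otimes> c) = (?a \<odot> p \<oplus> ?b \<odot> p) \<oplus> ?a \<odot> (c \<otimes> c)" by simp
      also have "\<dots> = (?a \<odot> p \<oplus> ?a \<odot> (c \<otimes> c)) \<oplus> ?b \<odot> p"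
        using cl by (simp only: a_ac a_closed)
      also have "?a \<odot> p \<oplus> ?a \<odot> (c \<otimes> c) = ?a \<odot> (p \<oplus> c \<otimes> c)"
        using scale_add_right[OF p(1) cc] by simp
      finally show ?thesis .
    qed
    finally have "N (star A ?z \<otimes> ?z) \<le> 1"
      using N_midpoint[of "p \<oplus> c \<otimes> c" p "t * t"] p2 N_projection[OF p(1) star(1) p(2)] p(1) cc t
      by (simp add: abs_square_le_1 power2_eq_square[symmetric])
    then show ?thesis using zc by (simp add: N_cstar power2_le_iff_abs_le[of 1, simplified])
  qed
  show "N (p \<oplus> l \<odot> c) \<le> 1" if "cmod l \<le> 1/2" for l
  proof -
    let ?x = "2 * Re l" and ?y = "2 * Im l"
    have xy: "\<bar>?x\<bar> \<le> 1" "\<bar>?y\<bar> \<le> 1"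
      using that abs_Re_le_cmod[of l] abs_Im_le_cmod[of l] by linarith+
    have l: "complex_of_real (1/2) * complex_of_real ?x + complex_of_real (1/2) * (\<i> * complex_of_real ?y) = l"
      by (simp add: complex_eq_iff)
    let ?h = "complex_of_real (1/2)"
    let ?X = "p \<oplus> complex_of_real ?x \<odot> c" and ?Y = "p \<oplus> (\<i> * complex_of_real ?y) \<odot> c"
    have XY: "?X \<in> carrier A" "?Y \<in> carrier A" using p c scale_closed by auto
    have "?h \<odot> ?X \<oplus> ?h \<odot> ?Y = (?h \<odot> p \<oplus> ?h \<odot> p) \<oplus>
        ((?h * complex_of_real ?x) \<odot> c \<oplus> (?h * (\<i> * complex_of_real ?y)) \<odot> c)"
    proof -
      let ?a = "(?h * complex_of_real ?x) \<odot> c" and ?b = "(?h * (\<i> * complex_of_real ?y)) \<odot> c"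
      have "?h \<odot> ?X \<oplus> ?h \<odot> ?Y = (?h \<odot> p \<oplus> ?a) \<oplus> (?h \<odot> p \<oplus> ?b)"
        using p(1) c(1) by (simp only: scale_add_right scale_scale scale_closed)
      also have "\<dots> = (?h \<odot> p \<oplus> ?h \<odot> p) \<oplus> (?a \<oplus> ?b)"
        using scale_closed[OF p(1), of ?h] scale_closed[OF c(1)] by (simp only: a_ac a_closed)
      finally show ?thesis .
    qed
    also have "?h \<odot> p \<oplus> ?h \<odot> p = p"
      using scale_add_left[OF p(1), of ?h ?h] p by (simp add: scale_one)
    also have "(?h * complex_of_real ?x) \<odot> c \<oplus> (?h * (\<i> * complex_of_real ?y)) \<odot> c = l \<odot> c"
      using scale_add_left[OF c(1), of "?h * complex_of_real ?x" "?h * (\<i> * complex_of_real ?y)"] l by simp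
    finally show ?thesis
      using N_midpoint[OF XY, of "1/2"] real[OF xy(1)] imag[OF xy(2)] by simp
  qed
qed simp

end

end

context cstar_algebra
begin

text \<open>
  For \<open>P = P i\<close> the elements \<open>P - P (P l) P\<close> are contractions in the corner of \<open>P\<close>.
  As the sum of the \<open>P (P l) P\<close> with \<open>l \<noteq> i\<close> is zero, convexity shows that \<open>P \<plusminus> c\<close> are contractions for
  a positive multiple \<open>c\<close> of \<open>P (P j) P\<close>, which forces \<open>c = 0\<close>.
\<close>
lemma projections_orthogonal:
  assumes fin: "finite I" and P: "\<And>l. l \<in> I \<Longrightarrow> P l \<in> carrier A \<and> star A (P l) = P l \<and> P l \<otimes> P l = P l"
    and sum: "(\<Oplus>l\<in>I. P l) = \<one>" and ij: "i \<in> I" "j \<in> I" "i \<noteq> j"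
  shows "P j \<otimes> P i = \<zero>"
proof -
  define p where "p = P i"
  define a where "a l = p \<otimes> P l \<otimes> p" for l
  have p: "p \<in> carrier A" "star A p = p" "p \<otimes> p = p" using P[OF ij(1)] by (auto simp: p_def)
  have Pc: "P l \<in> carrier A" if "l \<in> I" for l using P[OF that] by simp
  have ac: "a l \<in> carrier A" if "l \<in> I" for l using Pc[OF that] p by (simp add: a_def)
  have pa: "p \<otimes> a l = a l" "a l \<otimes> p = a l" if "l \<in> I" for l
  proof -
    have "p \<otimes> a l = (p \<otimes> p) \<otimes> P l \<otimes> p" "a l \<otimes> p = p \<otimes> P l \<otimes> (p \<otimes> p)"
      unfolding a_def using Pc[OF that] p(1) by (simp_all only: m_assoc m_closed)
    then show "p \<otimes> a l = a l" "a l \<otimes> p = a l" unfolding p(3) by (simp_all add: a_def)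
  qed
  have sa: "star A (a l) = a l" if "l \<in> I" for l
    using P[OF that] p by (simp add: a_def star_mult m_assoc)
  have con: "cnorm A (p \<ominus> a l) \<le> 1" if l: "l \<in> I" for l
  proof -
    let ?q = "\<one> \<ominus> P l"
    have q: "?q \<in> carrier A" "star A ?q = ?q" "?q \<otimes> ?q = ?q"
    proof -
      have "?q \<otimes> ?q = \<one> \<ominus> P l \<ominus> P l \<oplus> P l \<otimes> P l"
        using Pc[OF l] by (simp add: minus_eq l_distr r_distr l_minus r_minus a_assoc minus_add)
      also have "\<dots> = \<one> \<ominus> P l \<ominus> P l \<oplus> P l" using P[OF l] by simp
      also have "\<dots> = ?q" using Pc[OF l] by algebra
      finally show "?q \<otimes> ?q = ?q" .
    qed (use P[OF l] in \<open>auto simp: star_diff\<close>)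
    have "star A (?q \<otimes> p) = p \<otimes> ?q" using star_mult[OF q(1) p(1)] q(2) p(2) by simp
    then have "star A (?q \<otimes> p) \<otimes> (?q \<otimes> p) = p \<otimes> (?q \<otimes> ?q) \<otimes> p"
      using q(1) p(1) by (simp only: m_assoc m_closed)
    also have "\<dots> = p \<ominus> a l"
      unfolding q(3) a_def using Pc[OF l] p by (simp add: minus_eq l_distr r_distr l_minus r_minus)
    finally have "cnorm A (p \<ominus> a l) = (cnorm A (?q \<otimes> p))\<^sup>2"
      using N_cstar[of "?q \<otimes> p"] q(1) p(1) by simp
    moreover have "cnorm A (?q \<otimes> p) \<le> 1"
      using N_mult[OF q(1) p(1)] mult_le_one[OF N_projection[OF q] N_nonneg[OF p(1)] N_projection[OF p]]
      by simp
    ultimately show ?thesis using q(1) p(1) by (simp add: abs_square_le_1)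
  qed
  define J where "J = I - {i, j}"
  have J: "finite J" "J \<subseteq> I" using fin by (auto simp: J_def)
  have aJ: "a \<in> J \<rightarrow> carrier A" using ac J by auto
  have s0: "a j \<oplus> (\<Oplus>l\<in>J. a l) = \<zero>"
  proof -
    have "(\<Oplus>l\<in>I. a l) = p \<otimes> (\<Oplus>l\<in>I. P l) \<otimes> p"
      unfolding a_def using fin Pc p(1) by (simp add: finsum_rdistr finsum_ldistr Pi_iff finsum_closed)
    also have "\<dots> = p" using p by (simp add: sum)
    finally have "(\<Oplus>l\<in>I. a l) = p" .
    moreover have "I = insert i (insert j J)" using ij by (auto simp: J_def)
    moreover have "(\<Oplus>l\<in>insert i (insert j J). a l) = a i \<oplus> (a j \<oplus> (\<Oplus>l\<in>J. a l))"
      using J ij ac aJ by (simp add: J_def finsum_closed)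
    moreover have "a i = p" using p by (simp add: a_def p_def[symmetric])
    ultimately have "p \<oplus> (a j \<oplus> (\<Oplus>l\<in>J. a l)) = p" by simp
    then show ?thesis using p ac[OF ij(2)] finsum_closed[OF aJ] by simp
  qed
  have bound: "cnorm A (of_nat (card K + 1) \<odot> p \<ominus> (\<Oplus>l\<in>K. a l)) \<le> real (card K + 1)"
    if "finite K" "K \<subseteq> I" for K
    using that
  proof (induction K)
    case empty
    then show ?case using p N_projection[OF p] by (simp add: scale_one minus_eq)
  next
    case (insert l K)
    have aK: "a \<in> K \<rightarrow> carrier A" using insert ac by auto
    let ?m = "of_nat (card K + 1) :: complex"
    have m: "?m \<odot> p \<in> carrier A" using p scale_closed by simp
    have al: "a l \<in> carrier A" using insert.prems ac by simp
    have "(?m + 1) \<odot> p \<ominus> (a l \<oplus> (\<Oplus>l\<in>K. a l)) = (?m \<odot> p \<oplus> p) \<ominus> (a l \<oplus> (\<Oplus>l\<in>K. a l))"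
      using p scale_add_left[OF p(1), of ?m 1] by (simp add: scale_one)
    also have "\<dots> = (?m \<odot> p \<ominus> (\<Oplus>l\<in>K. a l)) \<oplus> (p \<ominus> a l)"
      using m p(1) finsum_closed[OF aK] al by algebra
    finally have e: "(?m + 1) \<odot> p \<ominus> (a l \<oplus> (\<Oplus>l\<in>K. a l)) = (?m \<odot> p \<ominus> (\<Oplus>l\<in>K. a l)) \<oplus> (p \<ominus> a l)" .
    have "cnorm A ((?m + 1) \<odot> p \<ominus> (a l \<oplus> (\<Oplus>l\<in>K. a l))) \<le> real (card K + 1) + 1"
    proof -
      have "cnorm A (?m \<odot> p \<ominus> (\<Oplus>l\<in>K. a l)) \<le> real (card K + 1)" using insert.IH insert.prems by blast
      moreover have "cnorm A (p \<ominus> a l) \<le> 1" using con insert.prems by simp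
      ultimately show ?thesis
        unfolding e using N_triangle[OF minus_closed[OF m finsum_closed[OF aK]] minus_closed[OF p(1) al]]
        by linarith
    qed
    moreover have "of_nat (card (insert l K) + 1) = ?m + 1" "real (card (insert l K) + 1) = real (card K + 1) + 1"
      using insert.hyps by simp_all
    moreover have "(\<Oplus>l\<in>insert l K. a l) = a l \<oplus> (\<Oplus>l\<in>K. a l)"
      using insert.hyps aK al by simp
    ultimately show ?case by (simp only:)
  qed
  define m where "m = card J + 1"
  define c where "c = (1 / of_nat m) \<odot> a j"
  have m0: "m \<noteq> 0" by (simp add: m_def)
  then have m: "m \<noteq> 0" "complex_of_nat m \<noteq> 0" by simp_all
  have c: "c \<in> carrier A" "p \<otimes> c = c" "c \<otimes> p = c" "star A c = c"
    using ac[OF ij(2)] pa[OF ij(2)] sa[OF ij(2)] p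
    by (simp_all add: c_def scale_closed scale_mult_left scale_mult_right star_scale)
  have "cnorm A c = 0"
  proof (rule contractions_trivial[OF p(1,3) c(1-3) p(2) c(4)])
    have "of_nat m \<odot> (p \<oplus> c) = of_nat m \<odot> p \<oplus> a j"
      using p c ac[OF ij(2)] m by (simp add: scale_add_right c_def scale_scale scale_one)
    also have "\<dots> = of_nat m \<odot> p \<ominus> (\<Oplus>l\<in>J. a l)"
      using s0 ac[OF ij(2)] finsum_closed[OF aJ] by (simp add: minus_eq minus_equality)
    finally have e: "of_nat m \<odot> (p \<oplus> c) = of_nat m \<odot> p \<ominus> (\<Oplus>l\<in>J. a l)" .
    have "cnorm A (of_nat m \<odot> (p \<oplus> c)) \<le> real m"
      unfolding e using bound[OF J] by (simp only: m_def)
    then have "real m * cnorm A (p \<oplus> c) \<le> real m * 1"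
      using N_scale[OF a_closed[OF p(1) c(1)], of "of_nat m"] by (simp only: norm_of_nat mult_1_right)
    then show "cnorm A (p \<oplus> c) \<le> 1" using m0 by simp
    have t: "complex_of_real (1 / real m) = 1 / of_nat m" by simp
    have "p \<ominus> c = complex_of_real (1 / real m) \<odot> (p \<ominus> a j) \<oplus> complex_of_real (1 - 1 / real m) \<odot> p"
    proof -
      let ?t = "complex_of_real (1 / real m)" and ?u = "complex_of_real (1 - 1 / real m)"
      have tu: "?t + ?u = 1" by simp
      have cl: "?t \<odot> p \<in> carrier A" "?u \<odot> p \<in> carrier A" "?t \<odot> a j \<in> carrier A"
        using p(1) ac[OF ij(2)] scale_closed by auto
      have "?t \<odot> (p \<ominus> a j) \<oplus> ?u \<odot> p = (?t \<odot> p \<ominus> ?t \<odot> a j) \<oplus> ?u \<odot> p"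
        using p(1) ac[OF ij(2)] by (simp only: scale_diff_right)
      also have "\<dots> = (?t \<odot> p \<oplus> ?u \<odot> p) \<ominus> ?t \<odot> a j" using cl by algebra
      also have "?t \<odot> p \<oplus> ?u \<odot> p = p" using scale_add_left[OF p(1), of ?t ?u] tu p(1) by (simp only: scale_one)
      finally show ?thesis unfolding c_def t by simp
    qed
    then show "cnorm A (p \<ominus> c) \<le> 1"
      using N_midpoint[of "p \<ominus> a j" p "1 / real m"] p(1) ac[OF ij(2)] con[OF ij(2)] N_projection[OF p] m
      by (simp add: field_simps)
  qed
  then have "cnorm A (a j) = 0" using ac[OF ij(2)] m unfolding c_def by (simp add: N_scale norm_divide)
  moreover have "star A (P j \<otimes> p) \<otimes> (P j \<otimes> p) = a j"
  proof -
    have "star A (P j \<otimes> p) = p \<otimes> P j" using star_mult[OF Pc[OF ij(2)] p(1)] P[OF ij(2)] p(2) by simp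
    then have "star A (P j \<otimes> p) \<otimes> (P j \<otimes> p) = p \<otimes> (P j \<otimes> P j) \<otimes> p"
      using Pc[OF ij(2)] p(1) by (simp only: m_assoc m_closed)
    then show ?thesis using P[OF ij(2)] by (simp add: a_def)
  qed
  ultimately have "cnorm A (P j \<otimes> p) = 0"
    using N_cstar[of "P j \<otimes> p"] Pc[OF ij(2)] p(1) by simp
  then show ?thesis using cnorm_eq_0 Pc[OF ij(2)] p(1) by (simp add: p_def)
qed

end

section \<open>Cuntz families\<close>

locale cuntz_family = cstar_algebra A for A :: "('a, 'm) cstar_ops_scheme" (structure) +
  fixes n :: nat and s :: "nat \<Rightarrow> 'a"
  assumes n: "2 \<le> n"
    and s_closed: "i < n \<Longrightarrow> s i \<in> carrier A"
    and s_isometry: "i < n \<Longrightarrow> star A (s i) \<otimes> s i = \<one>"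
    and s_sum: "(\<Oplus>i\<in>{..<n}. s i \<otimes> star A (s i)) = \<one>"
begin

lemma s_orthogonal: "i < n \<Longrightarrow> j < n \<Longrightarrow> star A (s i) \<otimes> s j = (if i = j then \<one> else \<zero>)"
proof (cases "i = j")
  case False
  assume ij: "i < n" "j < n"
  note c = s_closed[OF ij(1)] s_closed[OF ij(2)] star_closed[OF s_closed[OF ij(1)]]
    star_closed[OF s_closed[OF ij(2)]]
  have P: "s l \<otimes> star A (s l) \<in> carrier A \<and> star A (s l \<otimes> star A (s l)) = s l \<otimes> star A (s l) \<and>
      (s l \<otimes> star A (s l)) \<otimes> (s l \<otimes> star A (s l)) = s l \<otimes> star A (s l)" if "l \<in> {..<n}" for l
  proof -
    have l: "s l \<in> carrier A" "star A (s l) \<in> carrier A" using that s_closed star_closed by auto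
    have "(s l \<otimes> star A (s l)) \<otimes> (s l \<otimes> star A (s l)) = s l \<otimes> (star A (s l) \<otimes> s l) \<otimes> star A (s l)"
      using l by (simp only: m_assoc m_closed)
    then show ?thesis using l that s_isometry[of l] by (simp add: star_mult star_star)
  qed
  have "(s i \<otimes> star A (s i)) \<otimes> (s j \<otimes> star A (s j)) = \<zero>"
    using projections_orthogonal[OF finite_lessThan P s_sum, of j i] ij False by auto
  then have "star A (s i) \<otimes> ((s i \<otimes> star A (s i)) \<otimes> (s j \<otimes> star A (s j))) \<otimes> s j = \<zero>"
    using c by simp
  moreover have "star A (s i) \<otimes> ((s i \<otimes> star A (s i)) \<otimes> (s j \<otimes> star A (s j))) \<otimes> s j =
      (star A (s i) \<otimes> s i) \<otimes> (star A (s i) \<otimes> s j) \<otimes> (star A (s j) \<otimes> s j)"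
    using c by (simp only: m_assoc m_closed)
  ultimately show ?thesis using False c ij s_isometry by simp
qed (use s_isometry in simp)

text \<open>
  \<open>S M a\<close> is the product of the generators along the \<open>M\<close> digits of \<open>a\<close> in base \<open>n\<close>; it belongs to
  the n-adic interval from \<open>a / n\<^sup>M\<close> to \<open>(a + 1) / n\<^sup>M\<close>.
\<close>
primrec S :: "nat \<Rightarrow> nat \<Rightarrow> 'a" where
  "S 0 a = \<one>"
| "S (Suc M) a = S M (a div n) \<otimes> s (a mod n)"

lemma n_pos [simp]: "0 < n" using n by simp

lemma S_closed [simp, intro]: "S M a \<in> carrier A"
  by (induction M arbitrary: a) (auto intro!: s_closed)

lemma S_star_closed [simp, intro]: "star A (S M a) \<in> carrier A"
  by (rule star_closed[OF S_closed])

lemma S_orthonormal: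
  "a < n ^ M \<Longrightarrow> b < n ^ M \<Longrightarrow> star A (S M a) \<otimes> S M b = (if a = b then \<one> else \<zero>)"
proof (induction M arbitrary: a b)
  case (Suc M)
  have ab: "a div n < n ^ M" "b div n < n ^ M"
    using Suc.prems by (auto intro!: less_mult_imp_div_less simp: mult.commute)
  have c: "s (a mod n) \<in> carrier A" "s (b mod n) \<in> carrier A" "star A (s (a mod n)) \<in> carrier A"
    using s_closed star_closed by simp_all
  have "star A (S (Suc M) a) \<otimes> S (Suc M) b =
      star A (s (a mod n)) \<otimes> (star A (S M (a div n)) \<otimes> S M (b div n)) \<otimes> s (b mod n)"
    using c by (simp add: star_mult m_assoc)
  also have "\<dots> = (if a div n = b div n then star A (s (a mod n)) \<otimes> s (b mod n) else \<zero>)"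
    using Suc.IH[OF ab] c by simp
  also have "\<dots> = (if a div n = b div n \<and> a mod n = b mod n then \<one> else \<zero>)"
  proof -
    have "star A (s (a mod n)) \<otimes> s (b mod n) = (if a mod n = b mod n then \<one> else \<zero>)"
      by (rule s_orthogonal) simp_all
    then show ?thesis by (simp only:) simp
  qed
  also have "a div n = b div n \<and> a mod n = b mod n \<longleftrightarrow> a = b"
    by (metis div_mult_mod_eq)
  finally show ?case .
qed simp

text \<open>
  Summation over the last digit: the inner terms \<open>s d (s d)\<^sup>*\<close> add up to the unit.
\<close>
lemma S_refine:
  "(\<Oplus>d\<in>{..<n}. S (Suc M) (n * a + d) \<otimes> star A (S (Suc L) (n * b + d))) = S M a \<otimes> star A (S L b)"
proof -
  have "(\<Oplus>d\<in>{..<n}. S (Suc M) (n * a + d) \<otimes> star A (S (Suc L) (n * b + d))) =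
      (\<Oplus>d\<in>{..<n}. S M a \<otimes> (s d \<otimes> star A (s d)) \<otimes> star A (S L b))"
  proof (rule finsum_cong')
    fix d assume "d \<in> {..<n}"
    then have d: "d < n" "s d \<in> carrier A" "star A (s d) \<in> carrier A" using s_closed star_closed by auto
    have "(n * a + d) div n = a" "(n * a + d) mod n = d" "(n * b + d) div n = b" "(n * b + d) mod n = d"
      using d by simp_all
    then show "S (Suc M) (n * a + d) \<otimes> star A (S (Suc L) (n * b + d)) =
        S M a \<otimes> (s d \<otimes> star A (s d)) \<otimes> star A (S L b)"
      using d by (simp add: star_mult m_assoc)
  qed (use s_closed star_closed in auto)
  also have "\<dots> = S M a \<otimes> (\<Oplus>d\<in>{..<n}. s d \<otimes> star A (s d)) \<otimes> star A (S L b)"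
    using s_closed star_closed by (simp add: finsum_rdistr finsum_ldistr Pi_iff finsum_closed)
  finally show ?thesis by (simp add: s_sum)
qed

end

text \<open>
  The relators have seminorm zero, so the relations hold in the completion.
\<close>
lemma cuntz_family_cuntz_algebra:
  assumes n: "2 \<le> n"
  shows "cuntz_family (cuntz_algebra n) n
    (\<lambda>i. completion_embed (FA n) (cuntz_seminorm n) (cuntz_generator (Suc i)))"
proof -
  interpret F: seminormed_star_algebra "FA n" "cuntz_seminorm n" by (rule seminormed_cuntz)
  have C: "cuntz_algebra n = hausdorff_completion (FA n) (cuntz_seminorm n)"
    by (simp add: cuntz_algebra_def universal_cstar_def)
  interpret C: cstar_algebra "hausdorff_completion (FA n) (cuntz_seminorm n)"
    by (rule F.cstar_algebra_Com)
  let ?C = "hausdorff_completion (FA n) (cuntz_seminorm n)"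
  let ?e = "completion_embed (FA n) (cuntz_seminorm n)"
  note e = star_homD[OF F.star_hom_emb]
  have rel: "?e x = ?e y" if xy: "x \<in> carrier (FA n)" "y \<in> carrier (FA n)" "x \<ominus>\<^bsub>FA n\<^esub> y \<in> cuntz_relators n" for x y
  proof -
    have d: "x \<ominus>\<^bsub>FA n\<^esub> y \<in> carrier (FA n)" using xy by (intro F.minus_closed)
    have "cuntz_seminorm n (x \<ominus>\<^bsub>FA n\<^esub> y) = 0"
      using xy(3) d by (intro F.max_cstar_seminorm_relator cuntz_seminorms_bounded)
    then have "cnorm ?C (?e x \<ominus>\<^bsub>?C\<^esub> ?e y) = 0"
      using F.cnorm_emb[OF d] star_hom_diff[OF F.star_hom_emb star_algebra_FA C.star_algebra_axioms xy(1,2)] by simp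
    then have z: "?e x \<ominus>\<^bsub>?C\<^esub> ?e y = \<zero>\<^bsub>?C\<^esub>"
      using C.cnorm_eq_0 e(1)[OF xy(1)] e(1)[OF xy(2)] by simp
    have "?e x = (?e x \<ominus>\<^bsub>?C\<^esub> ?e y) \<oplus>\<^bsub>?C\<^esub> ?e y"
      using e(1)[OF xy(1)] e(1)[OF xy(2)] by (simp add: C.minus_eq C.a_assoc C.l_neg)
    then show ?thesis unfolding z using e(1)[OF xy(2)] by simp
  qed
  let ?S = cuntz_generator
  have Sc: "?S i \<in> carrier (FA n)" "star (FA n) (?S i) \<in> carrier (FA n)" if "i \<in> {1..n}" for i
    using generator_closed[OF that] F.star_closed by auto
  have iso: "star ?C (?e (?S i)) \<otimes>\<^bsub>?C\<^esub> ?e (?S i) = \<one>\<^bsub>?C\<^esub>" if i: "i \<in> {1..n}" for i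
  proof -
    have "?e (star (FA n) (?S i) \<otimes>\<^bsub>FA n\<^esub> ?S i) = ?e \<one>\<^bsub>FA n\<^esub>"
    proof (rule rel)
      show "star (FA n) (?S i) \<otimes>\<^bsub>FA n\<^esub> ?S i \<ominus>\<^bsub>FA n\<^esub> \<one>\<^bsub>FA n\<^esub> \<in> cuntz_relators n"
        unfolding cuntz_relators_def Let_def using i by blast
    qed (intro F.m_closed Sc[OF i] F.one_closed)+
    then show ?thesis
      unfolding F.emb_one e(5)[OF Sc(2)[OF i] Sc(1)[OF i]] e(2)[OF Sc(1)[OF i]] .
  qed
  have "?e (\<Oplus>\<^bsub>FA n\<^esub>i\<in>{1..n}. ?S i \<otimes>\<^bsub>FA n\<^esub> star (FA n) (?S i)) = ?e \<one>\<^bsub>FA n\<^esub>"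
  proof (rule rel)
    show "(\<Oplus>\<^bsub>FA n\<^esub>i\<in>{1..n}. ?S i \<otimes>\<^bsub>FA n\<^esub> star (FA n) (?S i)) \<ominus>\<^bsub>FA n\<^esub> \<one>\<^bsub>FA n\<^esub> \<in> cuntz_relators n"
      unfolding cuntz_relators_def Let_def by blast
    show "(\<Oplus>\<^bsub>FA n\<^esub>i\<in>{1..n}. ?S i \<otimes>\<^bsub>FA n\<^esub> star (FA n) (?S i)) \<in> carrier (FA n)"
      by (intro F.finsum_closed Pi_I F.m_closed Sc)
  qed (rule F.one_closed)
  moreover have "?e (\<Oplus>\<^bsub>FA n\<^esub>i\<in>{1..n}. ?S i \<otimes>\<^bsub>FA n\<^esub> star (FA n) (?S i)) =
      (\<Oplus>\<^bsub>?C\<^esub>i\<in>{1..n}. ?e (?S i \<otimes>\<^bsub>FA n\<^esub> star (FA n) (?S i)))"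
    by (intro star_hom_finsum[OF F.star_hom_emb star_algebra_FA C.star_algebra_axioms] finite_atLeastAtMost
        Pi_I F.m_closed Sc)
  ultimately have "(\<Oplus>\<^bsub>?C\<^esub>i\<in>{1..n}. ?e (?S i \<otimes>\<^bsub>FA n\<^esub> star (FA n) (?S i))) = \<one>\<^bsub>?C\<^esub>"
    by (simp only: F.emb_one)
  moreover have "(\<Oplus>\<^bsub>?C\<^esub>i\<in>{1..n}. ?e (?S i \<otimes>\<^bsub>FA n\<^esub> star (FA n) (?S i))) =
      (\<Oplus>\<^bsub>?C\<^esub>i\<in>{..<n}. ?e (?S (Suc i)) \<otimes>\<^bsub>?C\<^esub> star ?C (?e (?S (Suc i))))"
  proof -
    have "{1..n} = Suc ` {..<n}" by (simp add: lessThan_atLeast0 image_Suc_atLeastLessThan atLeastLessThanSuc_atLeastAtMost)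
    then have "(\<Oplus>\<^bsub>?C\<^esub>i\<in>{1..n}. ?e (?S i \<otimes>\<^bsub>FA n\<^esub> star (FA n) (?S i))) =
        (\<Oplus>\<^bsub>?C\<^esub>i\<in>Suc ` {..<n}. ?e (?S i \<otimes>\<^bsub>FA n\<^esub> star (FA n) (?S i)))" by (simp only:)
    also have "\<dots> = (\<Oplus>\<^bsub>?C\<^esub>i\<in>{..<n}. ?e (?S (Suc i) \<otimes>\<^bsub>FA n\<^esub> star (FA n) (?S (Suc i))))"
      by (rule C.finsum_reindex) (auto intro!: e(1) F.m_closed Sc simp del: FA_simps)
    also have "\<dots> = (\<Oplus>\<^bsub>?C\<^esub>i\<in>{..<n}. ?e (?S (Suc i)) \<otimes>\<^bsub>?C\<^esub> star ?C (?e (?S (Suc i))))"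
    proof (rule C.finsum_cong')
      fix i assume "i \<in> {..<n}"
      then have i: "Suc i \<in> {1..n}" by auto
      show "?e (?S (Suc i) \<otimes>\<^bsub>FA n\<^esub> star (FA n) (?S (Suc i))) = ?e (?S (Suc i)) \<otimes>\<^bsub>?C\<^esub> star ?C (?e (?S (Suc i)))"
        unfolding e(5)[OF Sc[OF i]] e(2)[OF Sc(1)[OF i]] ..
    next
      show "(\<lambda>i. ?e (?S (Suc i)) \<otimes>\<^bsub>?C\<^esub> star ?C (?e (?S (Suc i)))) \<in> {..<n} \<rightarrow> carrier ?C"
      proof
        fix i assume "i \<in> {..<n}"
        then have i: "Suc i \<in> {1..n}" by auto
        show "?e (?S (Suc i)) \<otimes>\<^bsub>?C\<^esub> star ?C (?e (?S (Suc i))) \<in> carrier ?C"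
          by (intro C.m_closed C.star_closed e(1) Sc[OF i])
      qed
    qed simp
    finally show ?thesis .
  qed
  ultimately have sum: "(\<Oplus>\<^bsub>?C\<^esub>i\<in>{..<n}. ?e (?S (Suc i)) \<otimes>\<^bsub>?C\<^esub> star ?C (?e (?S (Suc i)))) = \<one>\<^bsub>?C\<^esub>"
    by (simp only:)
  show ?thesis
    unfolding C
  proof unfold_locales
    show "?e (?S (Suc i)) \<in> carrier ?C" if "i < n" for i using that by (intro e(1) Sc) simp
    show "star ?C (?e (?S (Suc i))) \<otimes>\<^bsub>?C\<^esub> ?e (?S (Suc i)) = \<one>\<^bsub>?C\<^esub>" if "i < n" for i
      using that by (intro iso) simp
  qed (fact n sum)+
qed

section \<open>The n-adic Cantor space\<close>

text \<open>
  \<open>cyl_index n M y\<close> is the number \<open>a\<close> of the cylinder of level \<open>M\<close> that contains \<open>y\<close>, that is, of the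
  points between the upper copy of \<open>a / n\<^sup>M\<close> and the lower copy of \<open>(a + 1) / n\<^sup>M\<close>.
\<close>
definition cyl_index :: "nat \<Rightarrow> nat \<Rightarrow> point \<Rightarrow> int" where
  "cyl_index n M y = (if side y < 0 then \<lceil>val y * real n ^ M\<rceil> - 1 else \<lfloor>val y * real n ^ M\<rfloor>)"

definition cyl_base :: "nat \<Rightarrow> nat \<Rightarrow> int \<Rightarrow> point" where
  "cyl_base n M a = Pt (real_of_int a / real n ^ M) 1"

text \<open>The points of the line with its n-adic points doubled, of which the Cantor space is a part.\<close>
definition proper_point :: "nat \<Rightarrow> point \<Rightarrow> bool" where
  "proper_point n y \<longleftrightarrow> (if val y \<in> nadic n then side y = -1 \<or> side y = 1 else side y = 0)"

lemma cyl_index_ge: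
  "a \<le> cyl_index n M y \<longleftrightarrow>
     (if side y < 0 then real_of_int a < val y * real n ^ M else real_of_int a \<le> val y * real n ^ M)"
  by (auto simp: cyl_index_def le_floor_iff) linarith+

lemma cyl_index_le:
  "cyl_index n M y \<le> a \<longleftrightarrow>
     (if side y < 0 then val y * real n ^ M \<le> real_of_int (a + 1) else val y * real n ^ M < real_of_int (a + 1))"
  using cyl_index_ge[of "a + 1" n M y] by (auto simp: not_le not_less)

locale nadic_base =
  fixes n :: nat
  assumes n2: "2 \<le> n"
begin

lemma n_gt_1: "1 < real n" and n_pos: "0 < n" and npow_pos: "0 < real n ^ M"
  using n2 by auto

lemma nadic_iff: "x \<in> nadic n \<longleftrightarrow> (\<exists>M m. x * real n ^ M = of_int m)"
  using npow_pos unfolding nadic_def by (auto simp: field_simps)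

lemma nadic_of_int [simp]: "of_int m \<in> nadic n"
  unfolding nadic_iff by (rule exI[of _ 0]) auto

lemma nadic_common:
  assumes "x * real n ^ M = of_int m" "M \<le> L"
  shows "x * real n ^ L = of_int (m * int n ^ (L - M))"
proof -
  have "x * real n ^ L = (x * real n ^ M) * real n ^ (L - M)"
    using assms(2) by (simp flip: power_add add: mult.assoc)
  then show ?thesis using assms(1) by simp
qed

lemma nadic_add: "x \<in> nadic n \<Longrightarrow> y \<in> nadic n \<Longrightarrow> x + y \<in> nadic n"
proof -
  assume "x \<in> nadic n" "y \<in> nadic n"
  then obtain M m L l where 1: "x * real n ^ M = of_int m" "y * real n ^ L = of_int l"
    unfolding nadic_iff by blast
  have "(x + y) * real n ^ max M L = of_int (m * int n ^ (max M L - M) + l * int n ^ (max M L - L))"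
    using nadic_common[OF 1(1), of "max M L"] nadic_common[OF 1(2), of "max M L"]
    by (simp add: distrib_right)
  then show ?thesis unfolding nadic_iff by blast
qed

lemma nadic_uminus: "x \<in> nadic n \<Longrightarrow> - x \<in> nadic n"
  unfolding nadic_iff by (metis minus_mult_left of_int_minus)

lemma nadic_scale_nat: "x \<in> nadic n \<Longrightarrow> x * real n ^ L \<in> nadic n"
proof -
  assume "x \<in> nadic n"
  then obtain M m where "x * real n ^ M = of_int m" unfolding nadic_iff by blast
  then have "(x * real n ^ L) * real n ^ M = of_int (m * int n ^ L)"
    by (simp add: mult.assoc mult.left_commute mult.commute)
  then show ?thesis unfolding nadic_iff by blast
qed

lemma nadic_divide_nat: "x \<in> nadic n \<Longrightarrow> x / real n ^ L \<in> nadic n"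
proof -
  assume "x \<in> nadic n"
  then obtain M m where "x * real n ^ M = of_int m" unfolding nadic_iff by blast
  then have "(x / real n ^ L) * real n ^ (L + M) = of_int m"
    using npow_pos[of L] by (simp add: power_add field_simps)
  then show ?thesis unfolding nadic_iff by blast
qed

lemma nadic_scale: "x \<in> nadic n \<Longrightarrow> x * real n powi j \<in> nadic n"
  by (cases "0 \<le> j") (auto simp: power_int_def nadic_scale_nat nadic_divide_nat field_simps
      simp flip: divide_inverse power_inverse)

lemma nadic_scale_iff: "x * real n powi j \<in> nadic n \<longleftrightarrow> x \<in> nadic n"
proof
  assume "x * real n powi j \<in> nadic n"
  then have "(x * real n powi j) * real n powi (- j) \<in> nadic n" by (rule nadic_scale)
  moreover have "(x * real n powi j) * real n powi (- j) = x"
    using n_gt_1 by (simp add: power_int_minus field_simps)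
  ultimately show "x \<in> nadic n" by simp
qed (rule nadic_scale)

lemma nadic_add_iff: "r \<in> nadic n \<Longrightarrow> x + r \<in> nadic n \<longleftrightarrow> x \<in> nadic n"
  using nadic_add[of x r] nadic_add[of "x + r" "- r"] nadic_uminus[of r] by auto

lemma cyl_index_base: "cyl_index n (M + L) (cyl_base n M a) = a * int n ^ L"
proof -
  have "real_of_int a / real n ^ M * real n ^ (M + L) = of_int (a * int n ^ L)"
    using n_pos by (simp add: power_add)
  then show ?thesis
    by (simp add: cyl_index_def cyl_base_def del: of_int_mult of_int_power of_int_of_nat_eq)
qed

lemma proper_base: "proper_point n (cyl_base n M a)"
  unfolding proper_point_def cyl_base_def using nadic_divide_nat[OF nadic_of_int, of a M] by simp

lemma cyl_index_Suc: "cyl_index n (Suc M) y div int n = cyl_index n M y"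
proof -
  define k where "k = cyl_index n (Suc M) y"
  have np: "0 < real n" using n_pos by simp
  have a: "a \<le> cyl_index n M y \<longleftrightarrow> a * int n \<le> k" for a
  proof -
    have "real_of_int a < val y * real n ^ M \<longleftrightarrow> real_of_int a * real n < val y * real n ^ M * real n"
      "real_of_int a \<le> val y * real n ^ M \<longleftrightarrow> real_of_int a * real n \<le> val y * real n ^ M * real n"
      using np by simp_all
    then show ?thesis unfolding k_def cyl_index_ge by (simp add: mult_ac)
  qed
  have "a \<le> k div int n \<longleftrightarrow> a * int n \<le> k" for a
  proof
    assume "a \<le> k div int n"
    then have "a * int n \<le> (k div int n) * int n" by (rule mult_right_mono) simp
    also have "\<dots> \<le> k" using n_pos by (simp flip: minus_mod_eq_div_mult)
    finally show "a * int n \<le> k" .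
  next
    assume "a * int n \<le> k"
    then have "(a * int n) div int n \<le> k div int n" using n_pos by (intro zdiv_mono1) simp_all
    then show "a \<le> k div int n" using n_pos by simp
  qed
  then have "a \<le> cyl_index n M y \<longleftrightarrow> a \<le> k div int n" for a using a by blast
  then show ?thesis unfolding k_def by (metis order_antisym order_refl)
qed

lemma cyl_index_add: "cyl_index n (M + L) y div int n ^ L = cyl_index n M y"
proof (induction L)
  case (Suc L)
  have "cyl_index n (M + Suc L) y div int n ^ Suc L = (cyl_index n (Suc (M + L)) y div int n) div int n ^ L"
    by (simp add: zdiv_zmult2_eq)
  then show ?case using cyl_index_Suc[of "M + L" y] Suc by simp
qed simp

lemma cyl_index_mono:
  "cyl_index n L y = cyl_index n L y' \<Longrightarrow> M \<le> L \<Longrightarrow> cyl_index n M y = cyl_index n M y'"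
  using cyl_index_add[of M "L - M" y] cyl_index_add[of M "L - M" y'] by simp

lemma div_eq_0_iff_range: "(k::int) div int n ^ M = 0 \<longleftrightarrow> 0 \<le> k \<and> k < int n ^ M"
proof -
  define q where "q = int n ^ M"
  have "0 < q" using n_pos by (simp add: q_def)
  then show ?thesis unfolding q_def[symmetric] by (auto simp: zdiv_eq_0_iff)
qed

lemma cantor_points_iff: "y \<in> cantor_points n \<longleftrightarrow> proper_point n y \<and> cyl_index n 0 y = 0"
proof -
  obtain x s where y: "y = Pt x s" by (cases y)
  have 01: "0 \<in> nadic n" "1 \<in> nadic n" using nadic_of_int[of 0] nadic_of_int[of 1] by simp_all
  have c: "cyl_index n 0 y = 0 \<longleftrightarrow> (if s < 0 then 0 < x \<and> x \<le> 1 else 0 \<le> x \<and> x < 1)"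
    using cyl_index_ge[of 0 n 0 y] cyl_index_le[of n 0 y 0] y by auto
  show ?thesis
    unfolding c using 01
    by (cases "x = 0"; cases "x = 1") (auto simp: cantor_points_def proper_point_def y)
qed

lemma cantor_points_index:
  "y \<in> cantor_points n \<longleftrightarrow> proper_point n y \<and> 0 \<le> cyl_index n M y \<and> cyl_index n M y < int n ^ M"
  using cantor_points_iff cyl_index_add[of 0 M y] div_eq_0_iff_range[of "cyl_index n M y" M] by simp

lemma base_in_cantor: "cyl_base n M a \<in> cantor_points n \<longleftrightarrow> 0 \<le> a \<and> a < int n ^ M"
  using cantor_points_index[of "cyl_base n M a" M] proper_base cyl_index_base[of M 0 a] by simp

subsection \<open>Topology\<close>

lemma topspace_cantor: "topspace (cantor_space n) = cantor_points n"
proof -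
  have "\<Union> (insert (cantor_points n) ({{y \<in> cantor_points n. y < a} |a. a \<in> cantor_points n} \<union>
      {{y \<in> cantor_points n. a < y} |a. a \<in> cantor_points n})) = cantor_points n" by auto
  then show ?thesis by (simp add: cantor_space_def order_topology_on_def topology_generated_by_topspace)
qed

lemma same_index_close:
  assumes "cyl_index n M y = cyl_index n M y'"
  shows "\<bar>val y - val y'\<bar> \<le> 1 / real n ^ M"
proof -
  define k where "k = cyl_index n M y"
  have "of_int k \<le> val z * real n ^ M \<and> val z * real n ^ M \<le> of_int k + 1" if "cyl_index n M z = k" for z
    using cyl_index_ge[of k n M z] cyl_index_le[of n M z k] that by (auto split: if_splits)
  from this[of y] this[of y'] have "\<bar>val y * real n ^ M - val y' * real n ^ M\<bar> \<le> 1"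
    using assms by (auto simp: k_def)
  then have "\<bar>val y - val y'\<bar> * real n ^ M \<le> 1"
    using npow_pos[of M] by (simp add: abs_mult_pos' flip: left_diff_distrib)
  then show ?thesis using npow_pos[of M] by (simp add: field_simps)
qed

lemma npow_small: "0 < e \<Longrightarrow> \<exists>M. 1 / real n ^ M < e"
  using real_arch_pow_inv[of e "1 / real n"] n_gt_1 by (auto simp: power_one_over)

lemma proper_same_val:
  assumes "proper_point n y" "proper_point n y'" "val y = val y'" "side y < side y'"
  shows "side y = -1" "side y' = 1" "val y \<in> nadic n"
  using assms by (auto simp: proper_point_def split: if_splits)

lemma cylinder_below:
  assumes y: "y \<in> cantor_points n" and b: "b \<in> cantor_points n" and yb: "y < b"
  shows "\<exists>M. \<forall>z\<in>cantor_points n. cyl_index n M z = cyl_index n M y \<longrightarrow> z < b"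
proof (cases "val y < val b")
  case True
  then obtain M where M: "1 / real n ^ M < val b - val y" using npow_small[of "val b - val y"] by auto
  have "z < b" if "cyl_index n M z = cyl_index n M y" for z
    using same_index_close[OF that] M by (auto simp: less_point_def)
  then show ?thesis by blast
next
  case False
  then have e: "val y = val b" "side y < side b" using yb by (auto simp: less_point_def)
  have s: "side y = -1" "side b = 1" "val y \<in> nadic n"
    using proper_same_val[OF _ _ e] y b by (auto simp: cantor_points_iff)
  then obtain M m where m: "val y * real n ^ M = of_int m" unfolding nadic_iff by blast
  have "cyl_index n M y = m - 1" using s m by (simp add: cyl_index_def)
  have "z < b" if z: "cyl_index n M z = cyl_index n M y" "z \<in> cantor_points n" for z
  proof -
    have "cyl_index n M z \<le> m - 1" using z \<open>cyl_index n M y = m - 1\<close> by simp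
    then have *: "if side z < 0 then val z * real n ^ M \<le> val b * real n ^ M else val z * real n ^ M < val b * real n ^ M"
      unfolding cyl_index_le using m e by (simp split: if_splits)
    show ?thesis using * npow_pos[of M] s(2) by (auto simp: less_point_def split: if_splits)
  qed
  then show ?thesis by blast
qed

lemma cylinder_above:
  assumes y: "y \<in> cantor_points n" and b: "b \<in> cantor_points n" and yb: "b < y"
  shows "\<exists>M. \<forall>z\<in>cantor_points n. cyl_index n M z = cyl_index n M y \<longrightarrow> b < z"
proof (cases "val b < val y")
  case True
  then obtain M where M: "1 / real n ^ M < val y - val b" using npow_small[of "val y - val b"] by auto
  have "b < z" if "cyl_index n M z = cyl_index n M y" for z
    using same_index_close[OF that] M by (auto simp: less_point_def)
  then show ?thesis by blast
next
  case False
  then have e: "val b = val y" "side b < side y" using yb by (auto simp: less_point_def)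
  have s: "side b = -1" "side y = 1" "val b \<in> nadic n"
    using proper_same_val[OF _ _ e] y b by (auto simp: cantor_points_iff)
  then obtain M m where m: "val y * real n ^ M = of_int m" unfolding nadic_iff e by blast
  have "cyl_index n M y = m" using s m by (simp add: cyl_index_def)
  have "b < z" if z: "cyl_index n M z = cyl_index n M y" "z \<in> cantor_points n" for z
  proof -
    have "m \<le> cyl_index n M z" using z \<open>cyl_index n M y = m\<close> by simp
    then have *: "if side z < 0 then val b * real n ^ M < val z * real n ^ M else val b * real n ^ M \<le> val z * real n ^ M"
      unfolding cyl_index_ge using m e by (simp split: if_splits)
    show ?thesis using * npow_pos[of M] s(1) by (auto simp: less_point_def split: if_splits)
  qed
  then show ?thesis by blast
qed

text \<open>
  The cylinders form a basis of neighbourhoods; together with the next lemmas this replaces the order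
  topology by the tree of cylinders.
\<close>
lemma cylinder_nbhd:
  assumes "openin (cantor_space n) U" "y \<in> U"
  shows "\<exists>M. \<forall>z\<in>cantor_points n. cyl_index n M z = cyl_index n M y \<longrightarrow> z \<in> U"
proof -
  have "generate_topology_on (insert (cantor_points n) ({{y \<in> cantor_points n. y < a} |a. a \<in> cantor_points n} \<union>
      {{y \<in> cantor_points n. a < y} |a. a \<in> cantor_points n})) U"
    using assms(1) by (simp add: cantor_space_def order_topology_on_def openin_topology_generated_by_iff)
  then have "\<forall>y\<in>U. \<exists>M. \<forall>z\<in>cantor_points n. cyl_index n M z = cyl_index n M y \<longrightarrow> z \<in> U"
  proof (induction rule: generate_topology_on.induct)
    case (Int a b)
    show ?case
    proof
      fix y assume "y \<in> a \<inter> b"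
      then obtain M L where M: "\<forall>z\<in>cantor_points n. cyl_index n M z = cyl_index n M y \<longrightarrow> z \<in> a"
        and L: "\<forall>z\<in>cantor_points n. cyl_index n L z = cyl_index n L y \<longrightarrow> z \<in> b"
        using Int.IH by blast
      have "z \<in> a \<inter> b" if "z \<in> cantor_points n" "cyl_index n (max M L) z = cyl_index n (max M L) y" for z
        using M L that cyl_index_mono[OF that(2), of M] cyl_index_mono[OF that(2), of L] by simp
      then show "\<exists>M. \<forall>z\<in>cantor_points n. cyl_index n M z = cyl_index n M y \<longrightarrow> z \<in> a \<inter> b" by blast
    qed
  next
    case (UN K)
    show ?case
    proof
      fix y assume "y \<in> \<Union> K"
      then obtain U where U: "U \<in> K" "y \<in> U" by blast
      then obtain M where "\<forall>z\<in>cantor_points n. cyl_index n M z = cyl_index n M y \<longrightarrow> z \<in> U"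
        using UN.IH[OF U(1)] by blast
      then show "\<exists>M. \<forall>z\<in>cantor_points n. cyl_index n M z = cyl_index n M y \<longrightarrow> z \<in> \<Union> K"
        using U(1) by blast
    qed
  next
    case (Basis s)
    then consider "s = cantor_points n"
      | b where "b \<in> cantor_points n" "s = {y \<in> cantor_points n. y < b}"
      | b where "b \<in> cantor_points n" "s = {y \<in> cantor_points n. b < y}" by blast
    then show ?case
    proof cases
      case 1 then show ?thesis by blast
    next
      case 2 then show ?thesis using cylinder_below[OF _ 2(1)] by simp
    next
      case 3 then show ?thesis using cylinder_above[OF _ 3(1)] by simp
    qed
  qed simp
  then show ?thesis using assms(2) by blast
qed

lemma openin_below: "b \<in> cantor_points n \<Longrightarrow> openin (cantor_space n) {y \<in> cantor_points n. y < b}"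
  and openin_above: "b \<in> cantor_points n \<Longrightarrow> openin (cantor_space n) {y \<in> cantor_points n. b < y}"
  unfolding cantor_space_def order_topology_on_def
  by (auto intro!: topology_generated_by_Basis)

lemma openin_cylinder: "openin (cantor_space n) {y \<in> cantor_points n. cyl_index n M y = a}"
proof -
  have side: "side y = -1 \<or> side y = 0 \<or> side y = 1" if "y \<in> cantor_points n" for y
    using that by (auto simp: cantor_points_iff proper_point_def split: if_splits)
  have ge: "openin (cantor_space n) {y \<in> cantor_points n. a \<le> cyl_index n M y}" for a
  proof -
    consider "a \<le> 0" | "int n ^ M \<le> a" | "0 < a" "a < int n ^ M" by linarith
    then show ?thesis
    proof cases
      case 1
      then have "{y \<in> cantor_points n. a \<le> cyl_index n M y} = topspace (cantor_space n)"
        using cantor_points_index[of _ M] by (auto simp: topspace_cantor)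
      then show ?thesis by simp
    next
      case 2
      then have "{y \<in> cantor_points n. a \<le> cyl_index n M y} = {}"
        using cantor_points_index[of _ M] by fastforce
      then show ?thesis by (simp only: openin_empty)
    next
      case 3
      let ?b = "Pt (real_of_int a / real n ^ M) (-1)"
      have "cyl_index n M ?b = a - 1" using npow_pos[of M] by (simp add: cyl_index_def)
      moreover have "proper_point n ?b"
        unfolding proper_point_def using nadic_divide_nat[OF nadic_of_int, of a M] by simp
      ultimately have b: "?b \<in> cantor_points n" using 3 cantor_points_index[of ?b M] by simp
      have "a \<le> cyl_index n M y \<longleftrightarrow> ?b < y" if "y \<in> cantor_points n" for y
        unfolding cyl_index_ge less_point_def using side[OF that] npow_pos[of M]
        by (auto simp: field_simps)
      then have "{y \<in> cantor_points n. a \<le> cyl_index n M y} = {y \<in> cantor_points n. ?b < y}" by blast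
      then show ?thesis using openin_above[OF b] by simp
    qed
  qed
  have le: "openin (cantor_space n) {y \<in> cantor_points n. cyl_index n M y \<le> a}" for a
  proof -
    consider "a < 0" | "int n ^ M \<le> a + 1" | "0 \<le> a" "a + 1 < int n ^ M" by linarith
    then show ?thesis
    proof cases
      case 1
      then have "{y \<in> cantor_points n. cyl_index n M y \<le> a} = {}"
        using cantor_points_index[of _ M] by fastforce
      then show ?thesis by (simp only: openin_empty)
    next
      case 2
      have "cyl_index n M y \<le> a" if "y \<in> cantor_points n" for y
        using that 2 cantor_points_index[of y M] by linarith
      then have "{y \<in> cantor_points n. cyl_index n M y \<le> a} = topspace (cantor_space n)"
        by (auto simp: topspace_cantor)
      then show ?thesis by simp
    next
      case 3
      let ?b = "cyl_base n M (a + 1)"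
      have b: "?b \<in> cantor_points n" using 3 by (simp add: base_in_cantor)
      have "cyl_index n M y \<le> a \<longleftrightarrow> y < ?b" if y: "y \<in> cantor_points n" for y
      proof -
        have "val y * real n ^ M \<noteq> real_of_int (a + 1)" if "side y = 0"
        proof -
          have "val y \<notin> nadic n" using y that by (auto simp: cantor_points_iff proper_point_def split: if_splits)
          then show ?thesis unfolding nadic_iff by blast
        qed
        moreover have e: "val y < real_of_int (a + 1) / real n ^ M \<longleftrightarrow> val y * real n ^ M < real_of_int (a + 1)"
          "val y = real_of_int (a + 1) / real n ^ M \<longleftrightarrow> val y * real n ^ M = real_of_int (a + 1)"
          using npow_pos[of M] by (simp_all add: pos_less_divide_eq eq_divide_eq)
        ultimately show ?thesis
          using side[OF y] unfolding cyl_index_le less_point_def cyl_base_def point.sel e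
          by (elim disjE) (simp_all add: order.order_iff_strict del: of_int_add)
      qed
      then have "{y \<in> cantor_points n. cyl_index n M y \<le> a} = {y \<in> cantor_points n. y < ?b}" by blast
      then show ?thesis using openin_below[OF b] by simp
    qed
  qed
  have "{y \<in> cantor_points n. cyl_index n M y = a} =
      {y \<in> cantor_points n. a \<le> cyl_index n M y} \<inter> {y \<in> cantor_points n. cyl_index n M y \<le> a}" by auto
  then show ?thesis using openin_Int[OF ge le] by simp
qed

text \<open>
  A nested sequence of cylinders has a common point.  Its value is the supremum \<open>x\<close> of the left end
  points; if \<open>x\<close> is n-adic, the point is the lower copy of \<open>x\<close> exactly when some right end point is \<open>x\<close>.
\<close>
lemma nested_cylinders:
  assumes a0: "a 0 = 0" and a: "\<And>M. a (Suc M) div int n = a M"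
  obtains y where "y \<in> cantor_points n" "\<And>M. cyl_index n M y = a M"
proof -
  have step: "a M * int n \<le> a (Suc M) \<and> a (Suc M) + 1 \<le> (a M + 1) * int n" for M
  proof -
    have "a (Suc M) = a M * int n + a (Suc M) mod int n" using a[of M] by (metis div_mult_mod_eq)
    moreover have "0 \<le> a (Suc M) mod int n" "a (Suc M) mod int n < int n" using n_pos by auto
    ultimately show ?thesis by (auto simp: algebra_simps)
  qed
  define l where "l M = real_of_int (a M) / real n ^ M" for M
  define u where "u M = real_of_int (a M + 1) / real n ^ M" for M
  have np: "0 < real n" using n_pos by simp
  have l: "incseq l"
  proof (rule incseq_SucI)
    fix M
    have "real_of_int (a M * int n) \<le> real_of_int (a (Suc M))" using step[of M] by (simp only: of_int_le_iff)
    then have "real_of_int (a M) * real n \<le> real_of_int (a (Suc M))" by simp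
    then show "l M \<le> l (Suc M)" unfolding l_def using np by (simp add: field_simps)
  qed
  have u: "decseq u"
  proof (rule decseq_SucI)
    fix M
    have "real_of_int (a (Suc M) + 1) \<le> real_of_int ((a M + 1) * int n)" using step[of M] by (simp only: of_int_le_iff)
    then have "u (Suc M) \<le> real_of_int ((a M + 1) * int n) / real n ^ Suc M"
      unfolding u_def using npow_pos[of "Suc M"] by (intro divide_right_mono) auto
    also have "\<dots> = u M" unfolding u_def using np by simp
    finally show "u (Suc M) \<le> u M" .
  qed
  have lu: "l M < u L" for M L
  proof -
    have "l M \<le> l (max M L)" using l by (simp add: incseqD)
    also have "\<dots> < u (max M L)" unfolding l_def u_def by (rule divide_strict_right_mono[OF _ npow_pos]) simp
    also have "\<dots> \<le> u L" using u by (simp add: decseqD)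
    finally show ?thesis .
  qed
  define x where "x = (SUP M. l M)"
  have bdd: "bdd_above (range l)" using lu[of _ 0] by (auto intro!: bdd_aboveI[of _ "u 0"] less_imp_le)
  have lx: "l M \<le> x" for M unfolding x_def using bdd by (simp add: cSUP_upper)
  have xu: "x \<le> u M" for M unfolding x_def using lu less_imp_le by (intro cSUP_least) auto
  have lx': "real_of_int (a M) \<le> x * real n ^ M" and xu': "x * real n ^ M \<le> real_of_int (a M + 1)" for M
    using lx[of M] xu[of M] npow_pos[of M] by (simp_all add: l_def u_def field_simps)
  have strict: "l M < x" if "x = u L" for M L using lu[of M L] that by simp
  define \<sigma> :: int where "\<sigma> = (if x \<notin> nadic n then 0 else if \<exists>M. x = u M then -1 else 1)"
  define y where "y = Pt x \<sigma>"
  have idx: "cyl_index n M y = a M" for M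
  proof (cases "\<sigma> = -1")
    case True
    then obtain L where "x = u L" by (auto simp: \<sigma>_def split: if_splits)
    then have "real_of_int (a M) < x * real n ^ M"
      using strict[of L M] npow_pos[of M] by (simp add: l_def field_simps)
    then show ?thesis using xu'[of M] True by (simp add: cyl_index_def y_def) linarith
  next
    case False
    have "x \<noteq> u M"
    proof (cases "x \<in> nadic n")
      case True
      then have "\<not> (\<exists>M. x = u M)" using False unfolding \<sigma>_def by argo
      then show ?thesis by blast
    next
      case False2: False
      have "u M \<in> nadic n" unfolding u_def by (rule nadic_divide_nat[OF nadic_of_int])
      then show ?thesis using False2 by auto
    qed
    then have "x < u M" using xu[of M] by simp
    then have "x * real n ^ M < real_of_int (a M + 1)" using npow_pos[of M] by (simp add: u_def field_simps)
    moreover have "\<sigma> = -1 \<or> \<sigma> = 0 \<or> \<sigma> = 1" by (simp add: \<sigma>_def)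
    then have "\<not> \<sigma> < 0" using False by linarith
    ultimately show ?thesis using lx'[of M] by (simp add: cyl_index_def y_def) linarith
  qed
  moreover have "proper_point n y" by (auto simp: proper_point_def y_def \<sigma>_def)
  ultimately have "y \<in> cantor_points n" using a0 by (simp add: cantor_points_iff)
  then show thesis using idx that by blast
qed

definition oscillates_less :: "nat \<Rightarrow> (point \<times> int \<Rightarrow> complex) \<Rightarrow> nat \<Rightarrow> real \<Rightarrow> bool" where
  "oscillates_less k f M e \<longleftrightarrow> (\<forall>y\<in>cantor_points n. \<forall>y'\<in>cantor_points n. \<forall>t\<in>{0..<int k}.
     cyl_index n M y = cyl_index n M y' \<longrightarrow> cmod (f (y, t) - f (y', t)) < e)"

lemma oscillates_less_mono: "oscillates_less k f M e \<Longrightarrow> M \<le> L \<Longrightarrow> oscillates_less k f L e"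
  unfolding oscillates_less_def using cyl_index_mono by blast

lemma topspace_Y: "topspace (Y_space n k) = cantor_points n \<times> {0..<int k}"
  by (simp add: Y_space_def topspace_cantor)

text \<open>
  The space is compact, so continuous functions are uniformly continuous for the cylinders.  The
  proof is by bisection: a cylinder on which \<open>f\<close> oscillates too much at every level has a child of the
  same kind, and continuity at a common point of a nested sequence of such cylinders is violated.
\<close>
lemma continuous_oscillation_slice:
  assumes f: "continuous_map (Y_space n k) euclidean f" and e: "e > 0" and t: "t \<in> {0..<int k}"
  shows "\<exists>M. \<forall>y\<in>cantor_points n. \<forall>y'\<in>cantor_points n.
    cyl_index n M y = cyl_index n M y' \<longrightarrow> cmod (f (y, t) - f (y', t)) < e"
proof (rule ccontr)
  define tame where "tame M a L \<longleftrightarrow> (\<forall>y\<in>cantor_points n. \<forall>y'\<in>cantor_points n.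
    cyl_index n M y = a \<longrightarrow> cyl_index n M y' = a \<longrightarrow> cyl_index n L y = cyl_index n L y' \<longrightarrow>
    cmod (f (y, t) - f (y', t)) < e)" for M a L
  define good where "good M a \<longleftrightarrow> (\<exists>L. tame M a L)" for M a
  assume "\<not> ?thesis"
  then have bad0: "\<not> good 0 0" unfolding good_def tame_def using cantor_points_iff by blast
  have child: "\<exists>b. \<not> good (Suc M) b \<and> b div int n = a" if bad: "\<not> good M a" for M a
  proof (rule ccontr)
    assume "\<not> (\<exists>b. \<not> good (Suc M) b \<and> b div int n = a)"
    then have "\<forall>b. \<exists>L. b div int n = a \<longrightarrow> tame (Suc M) b L" unfolding good_def by blast
    then obtain L where L: "\<And>b. b div int n = a \<Longrightarrow> tame (Suc M) b (L b)" by metis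
    define K where "K = Suc M + (\<Sum>b\<in>{a * int n..<(a + 1) * int n}. L b)"
    have "cmod (f (y, t) - f (y', t)) < e"
      if y: "y \<in> cantor_points n" "y' \<in> cantor_points n" "cyl_index n M y = a" "cyl_index n M y' = a"
        "cyl_index n K y = cyl_index n K y'" for y y'
    proof -
      define b where "b = cyl_index n (Suc M) y"
      have b: "b div int n = a" using cyl_index_Suc y(3) by (simp add: b_def)
      have "b = a * int n + b mod int n" using b by (metis div_mult_mod_eq)
      moreover have "0 \<le> b mod int n" "b mod int n < int n" using n_pos by simp_all
      ultimately have "a * int n \<le> b" "b < a * int n + int n" by linarith+
      then have "b \<in> {a * int n..<(a + 1) * int n}" by (simp add: distrib_right)
      then have "L b \<le> (\<Sum>b\<in>{a * int n..<(a + 1) * int n}. L b)" by (intro member_le_sum) auto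
      then have K: "Suc M \<le> K" "L b \<le> K" by (auto simp: K_def)
      show ?thesis
        using L[OF b] cyl_index_mono[OF y(5) K(1)] cyl_index_mono[OF y(5) K(2)] y(1,2)
        unfolding tame_def b_def by simp
    qed
    then have "tame M a K" unfolding tame_def by blast
    then show False using bad unfolding good_def by blast
  qed
  then have "\<forall>M a. \<exists>b. \<not> good M a \<longrightarrow> \<not> good (Suc M) b \<and> b div int n = a" by blast
  then obtain c where c: "\<And>M a. \<not> good M a \<Longrightarrow> \<not> good (Suc M) (c M a) \<and> c M a div int n = a" by metis
  define a where "a = rec_nat 0 (\<lambda>M b. c M b)"
  have a0: "a 0 = 0" and aS: "a (Suc M) = c M (a M)" for M by (simp_all add: a_def)
  have bad: "\<not> good M (a M)" for M
  proof (induction M)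
    case (Suc M) then show ?case using c[OF Suc] by (simp add: aS)
  qed (use bad0 in \<open>simp add: a0\<close>)
  have "a (Suc M) div int n = a M" for M using c[OF bad] by (simp add: aS)
  then obtain y where y: "y \<in> cantor_points n" "\<And>M. cyl_index n M y = a M"
    using nested_cylinders[of a, OF a0] by blast
  have yt: "(y, t) \<in> topspace (Y_space n k)" using y t by (simp add: topspace_Y)
  have "openin (Y_space n k) {z \<in> topspace (Y_space n k). f z \<in> ball (f (y, t)) (e / 2)}"
  proof -
    have "openin euclidean (ball (f (y, t)) (e / 2))" by simp
    then show ?thesis using f unfolding continuous_map_def by blast
  qed
  moreover have "(y, t) \<in> {z \<in> topspace (Y_space n k). f z \<in> ball (f (y, t)) (e / 2)}" using yt e by simp
  ultimately obtain U V where UV: "openin (cantor_space n) U" "y \<in> U" "t \<in> V"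
    "U \<times> V \<subseteq> {z \<in> topspace (Y_space n k). f z \<in> ball (f (y, t)) (e / 2)}"
    unfolding Y_space_def openin_prod_topology_alt by blast
  obtain M where M: "\<forall>z\<in>cantor_points n. cyl_index n M z = cyl_index n M y \<longrightarrow> z \<in> U"
    using cylinder_nbhd[OF UV(1,2)] by blast
  have near: "dist (f (y, t)) (f (z, t)) < e / 2" if "z \<in> cantor_points n" "cyl_index n M z = a M" for z
    using M UV(3,4) that y(2) by (fastforce simp: mem_ball)
  have "cmod (f (z, t) - f (z', t)) < e"
    if "z \<in> cantor_points n" "z' \<in> cantor_points n" "cyl_index n M z = a M" "cyl_index n M z' = a M" for z z'
    using near[OF that(1,3)] near[OF that(2,4)] dist_triangle_half_r[of "f (y, t)" "f (z, t)" e "f (z', t)"]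
    by (simp add: dist_norm)
  then have "tame M (a M) M" unfolding tame_def by blast
  then have "good M (a M)" unfolding good_def by blast
  then show False using bad by blast
qed

lemma continuous_iff_oscillation:
  "continuous_map (Y_space n k) euclidean f \<longleftrightarrow> (\<forall>e>0. \<exists>M. oscillates_less k f M e)"
proof (intro iffI allI impI)
  fix e :: real assume f: "continuous_map (Y_space n k) euclidean f" and e: "e > 0"
  have "\<forall>t\<in>{0..<int k}. \<exists>M. \<forall>y\<in>cantor_points n. \<forall>y'\<in>cantor_points n.
    cyl_index n M y = cyl_index n M y' \<longrightarrow> cmod (f (y, t) - f (y', t)) < e"
    using continuous_oscillation_slice[OF f e] by blast
  then obtain L where L: "\<And>t. t \<in> {0..<int k} \<Longrightarrow> \<forall>y\<in>cantor_points n. \<forall>y'\<in>cantor_points n.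
    cyl_index n (L t) y = cyl_index n (L t) y' \<longrightarrow> cmod (f (y, t) - f (y', t)) < e"
    by metis
  have "L t \<le> (\<Sum>t\<in>{0..<int k}. L t)" if "t \<in> {0..<int k}" for t
    using that by (intro member_le_sum) auto
  then have "oscillates_less k f (\<Sum>t\<in>{0..<int k}. L t) e"
    unfolding oscillates_less_def using L cyl_index_mono by meson
  then show "\<exists>M. oscillates_less k f M e" by blast
next
  assume osc: "\<forall>e>0. \<exists>M. oscillates_less k f M e"
  show "continuous_map (Y_space n k) euclidean f"
    unfolding continuous_map_def
  proof (intro conjI allI impI)
    show "f \<in> topspace (Y_space n k) \<rightarrow> topspace euclidean" by simp
    fix U :: "complex set" assume "openin euclidean U"
    then have U: "open U" by simp
    show "openin (Y_space n k) {x \<in> topspace (Y_space n k). f x \<in> U}"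
    proof (subst openin_subopen, intro ballI)
      fix z assume "z \<in> {x \<in> topspace (Y_space n k). f x \<in> U}"
      then obtain y t where z: "z = (y, t)" "y \<in> cantor_points n" "t \<in> {0..<int k}" "f (y, t) \<in> U"
        by (auto simp: topspace_Y)
      obtain e where e: "e > 0" "ball (f (y, t)) e \<subseteq> U" using U z(4) open_contains_ball by blast
      obtain M where M: "oscillates_less k f M e" using osc e(1) by blast
      let ?T = "{y' \<in> cantor_points n. cyl_index n M y' = cyl_index n M y} \<times> {t}"
      have "openin (Y_space n k) ?T"
        unfolding Y_space_def using openin_cylinder z(3) by (simp add: openin_prod_Times_iff)
      moreover have "?T \<subseteq> {x \<in> topspace (Y_space n k). f x \<in> U}"
      proof
        fix w assume "w \<in> ?T"
        then obtain y' where w: "w = (y', t)" "y' \<in> cantor_points n" "cyl_index n M y' = cyl_index n M y" by auto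
        then have "cmod (f (y, t) - f (y', t)) < e" using M z unfolding oscillates_less_def by simp
        then have "f w \<in> U" using e(2) w by (auto simp: dist_norm)
        then show "w \<in> {x \<in> topspace (Y_space n k). f x \<in> U}" using w z by (simp add: topspace_Y)
      qed
      ultimately show "\<exists>T. openin (Y_space n k) T \<and> z \<in> T \<and> T \<subseteq> {x \<in> topspace (Y_space n k). f x \<in> U}"
        using z by blast
    qed
  qed
qed

end

section \<open>Recognition of matrix algebras\<close>

lemma matrix_closed_iff:
  "m \<in> carrier (matrix_star_algebra k A) \<longleftrightarrow>
     (\<forall>i<k. \<forall>j<k. m i j \<in> carrier A) \<and> m = mk_matrix k A m"
  by (auto simp: matrix_star_algebra_def mk_matrix_def fun_eq_iff)

lemma mk_matrix_closed:
  "(\<And>i j. i < k \<Longrightarrow> j < k \<Longrightarrow> f i j \<in> carrier A) \<Longrightarrow> mk_matrix k A f \<in> carrier (matrix_star_algebra k A)"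
  by (auto simp: matrix_star_algebra_def)

lemma mk_matrix_cong:
  "(\<And>i j. i < k \<Longrightarrow> j < k \<Longrightarrow> f i j = g i j) \<Longrightarrow> mk_matrix k A f = mk_matrix k A g"
  by (auto simp: mk_matrix_def fun_eq_iff)

text \<open>
  The map sends \<open>x\<close> to the matrix of the corner elements \<open>e\<^sub>i\<^sup>* x e\<^sub>j\<close>.
\<close>
theorem cstar_isomorphic_matrix_corner:
  fixes E :: "('e, 'f) cstar_ops_scheme" (structure) and A :: "('a, 'm) star_ops_scheme"
  assumes E: "cstar_algebra E" and A: "star_algebra A"
    and \<phi>: "star_hom A E \<phi>" and inj: "inj_on \<phi> (carrier A)" and \<phi>1: "\<phi> \<one>\<^bsub>A\<^esub> = p"
    and corner: "\<And>x. x \<in> carrier E \<Longrightarrow> p \<otimes> x \<otimes> p \<in> \<phi> ` carrier A"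
    and e: "\<And>i. i < k \<Longrightarrow> e i \<in> carrier E" "\<And>i. i < k \<Longrightarrow> e i \<otimes> p = e i"
    and orth: "\<And>i j. i < k \<Longrightarrow> j < k \<Longrightarrow> star E (e i) \<otimes> e j = (if i = j then p else \<zero>)"
    and sum: "(\<Oplus>i\<in>{..<k}. e i \<otimes> star E (e i)) = \<one>"
  shows "cstar_isomorphic E (matrix_cstar k A)"
proof -
  interpret E: cstar_algebra E by fact
  interpret A: star_algebra A by fact
  let ?M = "matrix_star_algebra k A"
  note \<phi>D = star_homD[OF \<phi>]
  define \<psi> where "\<psi> = inv_into (carrier A) \<phi>"
  have p: "p \<in> carrier E" "star E p = p"
    using \<phi>D(1)[OF A.one_closed] \<phi>D(2)[OF A.one_closed] by (simp_all add: \<phi>1)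
  note ec = e(1) E.star_closed[OF e(1)]
  have se: "p \<otimes> star E (e i) = star E (e i)" if "i < k" for i
    using E.star_mult[OF e(1)[OF that] p(1)] e(2)[OF that] p(2) by simp
  define c where "c x i j = star E (e i) \<otimes> x \<otimes> e j" for x i j
  have cc: "c x i j \<in> carrier E" if "x \<in> carrier E" "i < k" "j < k" for x i j
    using that ec by (simp add: c_def)
  have c_im: "c x i j \<in> \<phi> ` carrier A" if "x \<in> carrier E" "i < k" "j < k" for x i j
  proof -
    have "c x i j = (p \<otimes> star E (e i)) \<otimes> x \<otimes> (e j \<otimes> p)"
      using that by (simp add: c_def se e(2))
    also have "\<dots> = p \<otimes> c x i j \<otimes> p"
      using that ec p(1) unfolding c_def by (simp only: E.m_assoc E.m_closed)
    finally show ?thesis using corner[OF cc[OF that]] by simp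
  qed
  have \<psi>: "\<psi> y \<in> carrier A" "\<phi> (\<psi> y) = y" if "y \<in> \<phi> ` carrier A" for y
    using that inv_into_into[of y \<phi> "carrier A"] f_inv_into_f[of y \<phi> "carrier A"] by (simp_all add: \<psi>_def)
  have \<psi>\<phi>: "\<psi> (\<phi> a) = a" if "a \<in> carrier A" for a using inj that by (simp add: \<psi>_def)
  have \<psi>I: "\<psi> y = a" if "a \<in> carrier A" "y = \<phi> a" for y a using \<psi>\<phi> that by simp
  define F where "F x = mk_matrix k A (\<lambda>i j. \<psi> (c x i j))" for x
  have Fc: "F x \<in> carrier ?M" if "x \<in> carrier E" for x
    unfolding F_def using that by (intro mk_matrix_closed \<psi>(1) c_im)
  have split: "x = (\<Oplus>i\<in>{..<k}. \<Oplus>j\<in>{..<k}. e i \<otimes> c x i j \<otimes> star E (e j))" if x: "x \<in> carrier E" for x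
  proof -
    have "x = (\<Oplus>i\<in>{..<k}. e i \<otimes> star E (e i)) \<otimes> x \<otimes> (\<Oplus>j\<in>{..<k}. e j \<otimes> star E (e j))"
      using x by (simp add: sum)
    also have "\<dots> = (\<Oplus>i\<in>{..<k}. (e i \<otimes> star E (e i)) \<otimes> x \<otimes> (\<Oplus>j\<in>{..<k}. e j \<otimes> star E (e j)))"
      using x ec by (simp add: E.finsum_ldistr Pi_iff E.finsum_closed)
    also have "\<dots> = (\<Oplus>i\<in>{..<k}. \<Oplus>j\<in>{..<k}. e i \<otimes> c x i j \<otimes> star E (e j))"
    proof (rule E.finsum_cong')
      fix i assume i: "i \<in> {..<k}"
      have "(e i \<otimes> star E (e i)) \<otimes> x \<otimes> (\<Oplus>j\<in>{..<k}. e j \<otimes> star E (e j)) =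
          (\<Oplus>j\<in>{..<k}. (e i \<otimes> star E (e i)) \<otimes> x \<otimes> (e j \<otimes> star E (e j)))"
        using x i ec by (simp add: E.finsum_rdistr Pi_iff)
      also have "\<dots> = (\<Oplus>j\<in>{..<k}. e i \<otimes> c x i j \<otimes> star E (e j))"
        using x i ec by (intro E.finsum_cong') (auto simp: c_def E.m_assoc)
      finally show "(e i \<otimes> star E (e i)) \<otimes> x \<otimes> (\<Oplus>j\<in>{..<k}. e j \<otimes> star E (e j)) =
          (\<Oplus>j\<in>{..<k}. e i \<otimes> c x i j \<otimes> star E (e j))" .
    qed (use x ec cc in \<open>auto intro!: E.finsum_closed\<close>)
    finally show ?thesis .
  qed
  have Fij: "F x i j = \<psi> (c x i j)" if "i < k" "j < k" for x i j using that by (simp add: F_def mk_matrix_def)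
  have add: "F (x \<oplus> y) = F x \<oplus>\<^bsub>?M\<^esub> F y" if x: "x \<in> carrier E" and y: "y \<in> carrier E" for x y
  proof -
    have "\<psi> (c (x \<oplus> y) i j) = \<psi> (c x i j) \<oplus>\<^bsub>A\<^esub> \<psi> (c y i j)" if ij: "i < k" "j < k" for i j
    proof (rule \<psi>I)
      have "c (x \<oplus> y) i j = c x i j \<oplus> c y i j"
        using x y ij ec by (simp add: c_def E.l_distr E.r_distr)
      then show "c (x \<oplus> y) i j = \<phi> (\<psi> (c x i j) \<oplus>\<^bsub>A\<^esub> \<psi> (c y i j))"
        using \<psi>[OF c_im] x y ij by (simp add: \<phi>D)
    qed (use \<psi>(1)[OF c_im] x y ij in auto)
    then show ?thesis
      by (simp add: matrix_star_algebra_def Fij F_def[of "x \<oplus> y"] cong: mk_matrix_cong)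
  qed
  have mult: "F (x \<otimes> y) = F x \<otimes>\<^bsub>?M\<^esub> F y" if x: "x \<in> carrier E" and y: "y \<in> carrier E" for x y
  proof -
    have "\<psi> (c (x \<otimes> y) i j) = (\<Oplus>\<^bsub>A\<^esub>l\<in>{..<k}. \<psi> (c x i l) \<otimes>\<^bsub>A\<^esub> \<psi> (c y l j))" if ij: "i < k" "j < k" for i j
    proof (rule \<psi>I)
      have f: "(\<lambda>l. \<psi> (c x i l) \<otimes>\<^bsub>A\<^esub> \<psi> (c y l j)) \<in> {..<k} \<rightarrow> carrier A"
        using \<psi>(1)[OF c_im] x y ij by auto
      then show "(\<Oplus>\<^bsub>A\<^esub>l\<in>{..<k}. \<psi> (c x i l) \<otimes>\<^bsub>A\<^esub> \<psi> (c y l j)) \<in> carrier A" by (rule A.finsum_closed)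
      have "c (x \<otimes> y) i j = star E (e i) \<otimes> x \<otimes> (\<Oplus>l\<in>{..<k}. e l \<otimes> star E (e l)) \<otimes> y \<otimes> e j"
        using x y ij ec by (simp add: c_def sum E.m_assoc)
      also have "\<dots> = (\<Oplus>l\<in>{..<k}. star E (e i) \<otimes> x \<otimes> (e l \<otimes> star E (e l)) \<otimes> y \<otimes> e j)"
        using x y ij ec by (simp add: E.finsum_rdistr E.finsum_ldistr Pi_iff E.finsum_closed)
      also have "\<dots> = (\<Oplus>l\<in>{..<k}. \<phi> (\<psi> (c x i l) \<otimes>\<^bsub>A\<^esub> \<psi> (c y l j)))"
      proof (rule E.finsum_cong')
        fix l assume "l \<in> {..<k}"
        then have l: "l < k" by simp
        have "star E (e i) \<otimes> x \<otimes> (e l \<otimes> star E (e l)) \<otimes> y \<otimes> e j = c x i l \<otimes> c y l j"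
          using x y ij l ec by (simp add: c_def E.m_assoc)
        then show "star E (e i) \<otimes> x \<otimes> (e l \<otimes> star E (e l)) \<otimes> y \<otimes> e j = \<phi> (\<psi> (c x i l) \<otimes>\<^bsub>A\<^esub> \<psi> (c y l j))"
          using \<psi>[OF c_im] x y ij l by (simp add: \<phi>D)
      qed (use f \<phi>D(1) in auto)
      also have "\<dots> = \<phi> (\<Oplus>\<^bsub>A\<^esub>l\<in>{..<k}. \<psi> (c x i l) \<otimes>\<^bsub>A\<^esub> \<psi> (c y l j))"
        using star_hom_finsum[OF \<phi> A E.star_algebra_axioms _ f] by simp
      finally show "c (x \<otimes> y) i j = \<phi> (\<Oplus>\<^bsub>A\<^esub>l\<in>{..<k}. \<psi> (c x i l) \<otimes>\<^bsub>A\<^esub> \<psi> (c y l j))" .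
    qed
    moreover have "(\<Oplus>\<^bsub>A\<^esub>l\<in>{..<k}. F x i l \<otimes>\<^bsub>A\<^esub> F y l j) =
        (\<Oplus>\<^bsub>A\<^esub>l\<in>{..<k}. \<psi> (c x i l) \<otimes>\<^bsub>A\<^esub> \<psi> (c y l j))" if ij: "i < k" "j < k" for i j
      using \<psi>(1)[OF c_im] x y ij by (intro A.finsum_cong') (auto simp: Fij)
    ultimately show ?thesis
      by (simp add: matrix_star_algebra_def F_def[of "x \<otimes> y"] cong: mk_matrix_cong)
  qed
  have scale: "F (z \<odot> x) = z \<odot>\<^bsub>?M\<^esub> F x" if x: "x \<in> carrier E" for z x
  proof -
    have "\<psi> (c (z \<odot> x) i j) = z \<odot>\<^bsub>A\<^esub> \<psi> (c x i j)" if ij: "i < k" "j < k" for i j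
    proof (rule \<psi>I)
      have "c (z \<odot> x) i j = z \<odot> c x i j"
        using x ij ec by (simp add: c_def E.scale_mult_left E.scale_mult_right)
      then show "c (z \<odot> x) i j = \<phi> (z \<odot>\<^bsub>A\<^esub> \<psi> (c x i j))"
        using \<psi>[OF c_im] x ij by (simp add: \<phi>D)
    qed (use \<psi>(1)[OF c_im] x ij A.scale_closed in auto)
    then show ?thesis
      by (simp add: matrix_star_algebra_def Fij F_def[of "z \<odot> x"] cong: mk_matrix_cong)
  qed
  have star: "F (star E x) = star ?M (F x)" if x: "x \<in> carrier E" for x
  proof -
    have "\<psi> (c (star E x) i j) = star A (\<psi> (c x j i))" if ij: "i < k" "j < k" for i j
    proof (rule \<psi>I)
      have "c (star E x) i j = star E (c x j i)"
        using x ij ec by (simp add: c_def E.star_mult E.star_star E.star_closed E.m_assoc)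
      then show "c (star E x) i j = \<phi> (star A (\<psi> (c x j i)))"
        using \<psi>[OF c_im] x ij by (simp add: \<phi>D)
    qed (use \<psi>(1)[OF c_im] x ij A.star_closed in auto)
    then show ?thesis
      by (simp add: matrix_star_algebra_def Fij F_def[of "star E x"] cong: mk_matrix_cong)
  qed
  have one: "F \<one> = \<one>\<^bsub>?M\<^esub>"
  proof -
    have "\<psi> (c \<one> i j) = (if i = j then \<one>\<^bsub>A\<^esub> else \<zero>\<^bsub>A\<^esub>)" if ij: "i < k" "j < k" for i j
      using ij ec orth[OF ij] \<phi>1 star_hom_zero[OF \<phi> A E.star_algebra_axioms]
      by (intro \<psi>I) (auto simp: c_def)
    then show ?thesis
      by (simp add: matrix_star_algebra_def F_def cong: mk_matrix_cong)
  qed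
  have zero: "F \<zero> = \<zero>\<^bsub>?M\<^esub>"
  proof -
    have "\<psi> (c \<zero> i j) = \<zero>\<^bsub>A\<^esub>" if ij: "i < k" "j < k" for i j
      using ij ec star_hom_zero[OF \<phi> A E.star_algebra_axioms] by (intro \<psi>I) (auto simp: c_def)
    then show ?thesis
      by (simp add: matrix_star_algebra_def F_def cong: mk_matrix_cong)
  qed
  have inj_F: "inj_on F (carrier E)"
  proof (rule inj_onI)
    fix x y assume x: "x \<in> carrier E" and y: "y \<in> carrier E" and eq: "F x = F y"
    have c_eq: "c x i j = c y i j" if ij: "i < k" "j < k" for i j
    proof -
      have "F x i j = F y i j" by (simp only: eq)
      then have "\<psi> (c x i j) = \<psi> (c y i j)" by (simp only: Fij[OF ij])
      then have "\<phi> (\<psi> (c x i j)) = \<phi> (\<psi> (c y i j))" by (rule arg_cong)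
      then show ?thesis by (simp only: \<psi>(2)[OF c_im[OF x ij]] \<psi>(2)[OF c_im[OF y ij]])
    qed
    have "(\<Oplus>i\<in>{..<k}. \<Oplus>j\<in>{..<k}. e i \<otimes> c x i j \<otimes> star E (e j)) =
        (\<Oplus>i\<in>{..<k}. \<Oplus>j\<in>{..<k}. e i \<otimes> c y i j \<otimes> star E (e j))"
    proof (rule E.finsum_cong')
      fix i assume i: "i \<in> {..<k}"
      show "(\<Oplus>j\<in>{..<k}. e i \<otimes> c x i j \<otimes> star E (e j)) = (\<Oplus>j\<in>{..<k}. e i \<otimes> c y i j \<otimes> star E (e j))"
        using i y ec cc by (intro E.finsum_cong') (auto simp: c_eq)
    qed (use y ec cc in \<open>auto intro!: E.finsum_closed\<close>)
    then show "x = y" using split[OF x] split[OF y] by simp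
  qed
  have surj: "F ` carrier E = carrier ?M"
  proof (intro equalityI subsetI)
    fix m assume "m \<in> carrier ?M"
    then have m: "\<And>i j. i < k \<Longrightarrow> j < k \<Longrightarrow> m i j \<in> carrier A" "m = mk_matrix k A m"
      by (auto simp: matrix_closed_iff)
    define x where "x = (\<Oplus>i\<in>{..<k}. \<Oplus>j\<in>{..<k}. e i \<otimes> \<phi> (m i j) \<otimes> star E (e j))"
    have mc: "\<phi> (m i j) \<in> carrier E" if "i < k" "j < k" for i j using m(1)[OF that] \<phi>D(1) by simp
    have t: "e i \<otimes> \<phi> (m i j) \<otimes> star E (e j) \<in> carrier E" if "i < k" "j < k" for i j
      using that ec mc by simp
    have x: "x \<in> carrier E" unfolding x_def using t by (auto intro!: E.finsum_closed)
    have pm: "p \<otimes> \<phi> (m i j) = \<phi> (m i j)" "\<phi> (m i j) \<otimes> p = \<phi> (m i j)" if "i < k" "j < k" for i j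
      using \<phi>D(5)[OF A.one_closed m(1)[OF that]] \<phi>D(5)[OF m(1)[OF that] A.one_closed] m(1)[OF that]
      by (simp_all add: \<phi>1)
    have "c x a b = \<phi> (m a b)" if ab: "a < k" "b < k" for a b
    proof -
      have "c x a b = (\<Oplus>i\<in>{..<k}. \<Oplus>j\<in>{..<k}. star E (e a) \<otimes> (e i \<otimes> \<phi> (m i j) \<otimes> star E (e j)) \<otimes> e b)"
      proof -
        have "c x a b = (\<Oplus>i\<in>{..<k}. star E (e a) \<otimes> (\<Oplus>j\<in>{..<k}. e i \<otimes> \<phi> (m i j) \<otimes> star E (e j)) \<otimes> e b)"
          unfolding c_def x_def using ab ec t
          by (simp add: E.finsum_rdistr E.finsum_ldistr Pi_iff E.finsum_closed)
        also have "\<dots> = (\<Oplus>i\<in>{..<k}. \<Oplus>j\<in>{..<k}. star E (e a) \<otimes> (e i \<otimes> \<phi> (m i j) \<otimes> star E (e j)) \<otimes> e b)"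
          using ab ec t
          by (intro E.finsum_cong') (auto simp: E.finsum_rdistr E.finsum_ldistr Pi_iff intro!: E.finsum_closed)
        finally show ?thesis .
      qed
      also have "\<dots> = (\<Oplus>i\<in>{..<k}. \<Oplus>j\<in>{..<k}. if i = a \<and> j = b then \<phi> (m a b) else \<zero>)"
      proof (intro E.finsum_cong' refl Pi_I E.finsum_closed)
        fix i j assume "i \<in> {..<k}" "j \<in> {..<k}"
        then have ij: "i < k" "j < k" by auto
        have "star E (e a) \<otimes> (e i \<otimes> \<phi> (m i j) \<otimes> star E (e j)) \<otimes> e b =
            (star E (e a) \<otimes> e i) \<otimes> \<phi> (m i j) \<otimes> (star E (e j) \<otimes> e b)"
          using ij ab ec mc by (simp add: E.m_assoc)
        then show "star E (e a) \<otimes> (e i \<otimes> \<phi> (m i j) \<otimes> star E (e j)) \<otimes> e b =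
            (if i = a \<and> j = b then \<phi> (m a b) else \<zero>)"
          using orth[OF ab(1) ij(1)] orth[OF ij(2) ab(2)] pm[OF ij] mc[OF ij] p(1) by auto
      qed (use mc[OF ab] in auto)
      also have "\<dots> = (\<Oplus>j\<in>{..<k}. if a = a \<and> j = b then \<phi> (m a b) else \<zero>)"
      proof (rule E.finsum_single)
        show "(\<Oplus>j\<in>{..<k}. if a = a \<and> j = b then \<phi> (m a b) else \<zero>) \<in> carrier E"
          using mc[OF ab] by (intro E.finsum_closed) auto
      qed (use ab in auto)
      also have "\<dots> = (if a = a \<and> b = b then \<phi> (m a b) else \<zero>)"
        using ab mc[OF ab] by (intro E.finsum_single) auto
      finally show ?thesis by simp
    qed
    then have "F x = mk_matrix k A m"
      unfolding F_def using m(1) by (intro mk_matrix_cong) (simp add: \<psi>\<phi>)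
    then show "m \<in> F ` carrier E" using x m(2) by (intro image_eqI[of _ _ x]) simp_all
  qed (use Fc in auto)
  have bij: "bij_betw F (carrier E) (carrier ?M)" using inj_F surj by (simp add: bij_betw_def)
  show ?thesis
    unfolding matrix_cstar_def Let_def
    by (rule cstar_isomorphic_max_seminorm[OF E bij]) (fact add mult one zero scale star)+
qed

section \<open>Algebras of continuous functions\<close>

abbreviation "CF \<equiv> cont_fun_algebra"

lemma CF_simps [simp]:
  "f \<otimes>\<^bsub>CF Y\<^esub> g = (\<lambda>y. f y * g y)" "f \<oplus>\<^bsub>CF Y\<^esub> g = (\<lambda>y. f y + g y)"
  "\<zero>\<^bsub>CF Y\<^esub> = (\<lambda>y. 0)" "\<one>\<^bsub>CF Y\<^esub> = (\<lambda>y. if y \<in> topspace Y then 1 else 0)"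
  "c \<odot>\<^bsub>CF Y\<^esub> f = (\<lambda>y. c * f y)" "star (CF Y) f = (\<lambda>y. cnj (f y))"
  by (simp_all add: cont_fun_algebra_def)

lemma CF_carrier:
  "f \<in> carrier (CF Y) \<longleftrightarrow> continuous_map Y euclidean f \<and> (\<forall>y. y \<notin> topspace Y \<longrightarrow> f y = 0)"
  by (simp add: cont_fun_algebra_def)

lemma CF_apply:
  assumes f: "f \<in> carrier (CF Y)" and h: "continuous_on UNIV h" and 0: "h 0 = (0::complex)"
  shows "(\<lambda>y. h (f y)) \<in> carrier (CF Y)"
  using f continuous_map_compose[of Y euclidean f euclidean h] h 0
  by (auto simp: CF_carrier comp_def)

lemma CF_apply2:
  assumes f: "f \<in> carrier (CF Y)" "g \<in> carrier (CF Y)"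
    and h: "continuous_on UNIV (\<lambda>p. h (fst p) (snd p))" and 0: "h 0 0 = (0::complex)"
  shows "(\<lambda>y. h (f y) (g y)) \<in> carrier (CF Y)"
proof -
  have "continuous_map Y (prod_topology euclidean euclidean) (\<lambda>y. (f y, g y))"
    using f by (intro continuous_map_pairedI) (auto simp: CF_carrier)
  then have "continuous_map Y euclidean (\<lambda>y. (f y, g y))"
    by (simp add: euclidean_product_topology)
  then have "continuous_map Y euclidean ((\<lambda>p. h (fst p) (snd p)) \<circ> (\<lambda>y. (f y, g y)))"
    by (rule continuous_map_compose) (use h in simp)
  then show ?thesis using f 0 by (simp add: CF_carrier comp_def)
qed

lemma CF_mult: "f \<in> carrier (CF Y) \<Longrightarrow> g \<in> carrier (CF Y) \<Longrightarrow> (\<lambda>y. f y * g y) \<in> carrier (CF Y)"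
  by (rule CF_apply2[where h = "(*)"]) (auto intro!: continuous_intros)

lemma CF_add: "f \<in> carrier (CF Y) \<Longrightarrow> g \<in> carrier (CF Y) \<Longrightarrow> (\<lambda>y. f y + g y) \<in> carrier (CF Y)"
  by (rule CF_apply2[where h = "(+)"]) (auto intro!: continuous_intros)

lemma CF_cnj: "f \<in> carrier (CF Y) \<Longrightarrow> (\<lambda>y. cnj (f y)) \<in> carrier (CF Y)"
  by (rule CF_apply[where h = cnj]) (auto intro!: continuous_intros)

lemma CF_scale: "f \<in> carrier (CF Y) \<Longrightarrow> (\<lambda>y. c * f y) \<in> carrier (CF Y)"
  by (rule CF_apply[where h = "\<lambda>z. c * z"]) (auto intro!: continuous_intros)

lemma CF_zero: "(\<lambda>_. 0) \<in> carrier (CF Y)"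
  by (simp add: CF_carrier)

lemma CF_one: "(\<lambda>y. if y \<in> topspace Y then 1 else 0) \<in> carrier (CF Y)"
proof -
  have "continuous_map Y euclidean (\<lambda>y. 1::complex)" by simp
  then have "continuous_map Y euclidean (\<lambda>y. if y \<in> topspace Y then 1 else 0 :: complex)"
    by (rule continuous_map_eq) auto
  then show ?thesis by (simp add: CF_carrier)
qed

lemma star_algebra_CF: "star_algebra (CF Y)"
proof -
  have "ring (CF Y)"
  proof (rule ringI)
    show "abelian_group (CF Y)"
    proof (rule abelian_groupI)
      fix x assume "x \<in> carrier (CF Y)"
      then have "(\<lambda>y. (-1) * x y) \<in> carrier (CF Y)" by (rule CF_scale)
      then show "\<exists>y\<in>carrier (CF Y). y \<oplus>\<^bsub>CF Y\<^esub> x = \<zero>\<^bsub>CF Y\<^esub>" by (intro bexI) auto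
    qed (auto simp: CF_add CF_zero add_ac)
    show "monoid (CF Y)"
    proof (rule monoidI)
      fix x y z assume x: "x \<in> carrier (CF Y)" and y: "y \<in> carrier (CF Y)"
      show "x \<otimes>\<^bsub>CF Y\<^esub> y \<in> carrier (CF Y)" using CF_mult[OF x y] by simp
      show "x \<otimes>\<^bsub>CF Y\<^esub> y \<otimes>\<^bsub>CF Y\<^esub> z = x \<otimes>\<^bsub>CF Y\<^esub> (y \<otimes>\<^bsub>CF Y\<^esub> z)"
        by (simp add: mult.assoc)
    next
      fix x assume "x \<in> carrier (CF Y)"
      then show "\<one>\<^bsub>CF Y\<^esub> \<otimes>\<^bsub>CF Y\<^esub> x = x" "x \<otimes>\<^bsub>CF Y\<^esub> \<one>\<^bsub>CF Y\<^esub> = x"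
        by (auto simp: CF_carrier fun_eq_iff)
    qed (simp add: CF_one)
  qed (auto simp: algebra_simps)
  moreover have "star_algebra_axioms (CF Y)"
    by unfold_locales (auto simp: CF_scale CF_cnj algebra_simps)
  ultimately show ?thesis by (simp add: star_algebra_def)
qed

lemma CF_finsum:
  assumes "finite I" "\<And>i. i \<in> I \<Longrightarrow> F i \<in> carrier (CF Y)"
  shows "(\<Oplus>\<^bsub>CF Y\<^esub>i\<in>I. F i) = (\<lambda>y. \<Sum>i\<in>I. F i y) \<and> (\<lambda>y. \<Sum>i\<in>I. F i y) \<in> carrier (CF Y)"
proof -
  interpret C: star_algebra "CF Y" by (rule star_algebra_CF)
  show ?thesis
    using assms
  proof (induction I)
    case empty then show ?case by (simp add: CF_zero)
  next
    case (insert i I)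
    then have "F i \<in> carrier (CF Y)" "F \<in> I \<rightarrow> carrier (CF Y)" by auto
    then show ?case using insert CF_add[of "F i" Y "\<lambda>y. \<Sum>i\<in>I. F i y"] by simp
  qed
qed

text \<open>
  A real function \<open>r\<close> with \<open>0 \<le> r \<le> 1\<close> is the real part of the unitary \<open>r + i (1 - r\<^sup>2)\<^bsup>1/2\<^esup>\<close>.
\<close>
lemma cont_fun_seminorm_le:
  assumes q: "cstar_seminorm (CF Y) q" and f: "f \<in> carrier (CF Y)"
    and c: "0 \<le> c" "\<And>y. y \<in> topspace Y \<Longrightarrow> cmod (f y) \<le> c"
  shows "q f \<le> c"
proof -
  interpret Q: seminormed_star_algebra "CF Y" q
    by (intro seminormed_star_algebra.intro seminormed_star_algebra_axioms.intro star_algebra_CF q)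
  have one: "q f \<le> 1" if f: "f \<in> carrier (CF Y)" and le: "\<And>y. y \<in> topspace Y \<Longrightarrow> cmod (f y) \<le> 1" for f
  proof -
    define r where "r y = f y * cnj (f y)" for y
    have r: "r \<in> carrier (CF Y)" unfolding r_def by (intro CF_mult CF_cnj f)
    have rr: "r y = complex_of_real ((cmod (f y))\<^sup>2)" for y unfolding r_def by (rule complex_norm_square[symmetric])
    have r1: "(cmod (f y))\<^sup>2 \<le> 1" if "y \<in> topspace Y" for y using le[OF that] by (simp add: abs_square_le_1)
    define s where "s y = (if y \<in> topspace Y then \<i> * complex_of_real (sqrt \<bar>1 - (Re (r y))\<^sup>2\<bar>) else 0)" for y
    have s: "s \<in> carrier (CF Y)"
    proof -
      have "continuous_on UNIV (\<lambda>z. \<i> * complex_of_real (sqrt \<bar>1 - (Re z)\<^sup>2\<bar>))"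
        by (intro continuous_intros)
      then have "continuous_map Y euclidean ((\<lambda>z. \<i> * complex_of_real (sqrt \<bar>1 - (Re z)\<^sup>2\<bar>)) \<circ> r)"
        using r by (intro continuous_map_compose[of Y euclidean]) (auto simp: CF_carrier)
      then have "continuous_map Y euclidean s"
        by (rule continuous_map_eq) (simp add: s_def)
      then show ?thesis by (simp add: CF_carrier s_def)
    qed
    define u where "u y = r y + s y" for y
    have u: "u \<in> carrier (CF Y)" unfolding u_def by (intro CF_add r s)
    have "cnj (u y) * u y = (if y \<in> topspace Y then 1 else 0)" for y
    proof (cases "y \<in> topspace Y")
      case True
      define t where "t = (cmod (f y))\<^sup>2"
      have t: "0 \<le> t" "t \<le> 1" using r1[OF True] by (auto simp: t_def)
      then have t2: "t\<^sup>2 \<le> 1" by (simp add: abs_square_le_1)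
      have uy: "u y = Complex t (sqrt (1 - t\<^sup>2))"
        using True t2 by (simp add: u_def s_def rr t_def[symmetric] complex_eq_iff)
      have "cnj (u y) * u y = complex_of_real ((cmod (u y))\<^sup>2)" by (simp only: complex_norm_square mult.commute)
      also have "(cmod (u y))\<^sup>2 = 1" using t2 by (simp add: uy cmod_power2)
      finally show ?thesis using True by simp
    next
      case False
      then show ?thesis using u by (simp add: CF_carrier)
    qed
    then have uu: "star (CF Y) u \<otimes>\<^bsub>CF Y\<^esub> u = \<one>\<^bsub>CF Y\<^esub>" by simp
    have "q u \<le> 1"
      by (rule Q.N_partial_isometry[OF u Q.one_closed Q.star_one Q.l_one[OF Q.one_closed] uu])
    then have u': "q (\<lambda>y. cnj (u y)) \<le> 1" using Q.N_star[OF u] by simp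
    have "(\<lambda>y. 2 * r y) = (\<lambda>y. u y + cnj (u y))"
      by (auto simp: fun_eq_iff u_def s_def rr complex_eq_iff)
    then have "2 * q r \<le> 2"
      using Q.N_triangle[OF u CF_cnj[OF u]] Q.N_scale[OF r, of 2] \<open>q u \<le> 1\<close> u' by simp
    moreover have "q r = (q f)\<^sup>2" using Q.N_cstar'[OF f] by (simp add: r_def[abs_def])
    ultimately show ?thesis by (simp add: power2_le_iff_abs_le[of 1, simplified])
  qed
  show ?thesis
  proof (rule field_le_epsilon)
    fix e :: real assume e: "e > 0"
    define d where "d = c + e"
    have d: "d > 0" using c e by (simp add: d_def)
    have "q (\<lambda>y. complex_of_real (1 / d) * f y) \<le> 1"
    proof (rule one[OF CF_scale[OF f]])
      fix y assume "y \<in> topspace Y"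
      then have "cmod (f y) \<le> d" using c(2)[of y] e by (simp add: d_def)
      then show "cmod (complex_of_real (1 / d) * f y) \<le> 1" using d by (simp add: norm_mult norm_divide)
    qed
    then show "q f \<le> c + e"
      using Q.N_scale[OF f, of "complex_of_real (1 / d)"] d by (simp add: norm_divide d_def[symmetric])
  qed
qed

section \<open>Crossed products by restrictions of global actions\<close>

text \<open>
  A partial action obtained by restricting an action on a larger set to the space \<open>Y\<close>.  The domains
  are relatively clopen in the intended case, which is expressed by the continuity of the translates of
  continuous functions after extension by zero.
\<close>
locale restricted_action = group K for K :: "('g, 'k) monoid_scheme" (structure) +
  fixes act :: "'g \<Rightarrow> 'y \<Rightarrow> 'y" and Y :: "'y topology"
  assumes act_one: "act \<one> y = y"
    and act_mult: "\<lbrakk>g \<in> carrier K; h \<in> carrier K\<rbrakk> \<Longrightarrow> act (g \<otimes> h) y = act g (act h y)"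
    and translate_closed: "\<lbrakk>g \<in> carrier K; f \<in> carrier (CF Y)\<rbrakk> \<Longrightarrow>
      (\<lambda>y. if y \<in> topspace Y \<and> act (inv g) y \<in> topspace Y then f (act (inv g) y) else 0) \<in> carrier (CF Y)"
begin

definition dom where "dom g = {y \<in> topspace Y. act g y \<in> topspace Y}"

definition ran where "ran g = {y \<in> topspace Y. act (inv g) y \<in> topspace Y}"

definition B where "B = partial_crossed_star_algebra (CF Y) K (\<lambda>g. C0_ideal Y (act g ` dom g))
  (\<lambda>g. induced_map (dom g) (act g))"

lemma act_inv [simp]:
  "g \<in> carrier K \<Longrightarrow> act g (act (inv g) y) = y" "g \<in> carrier K \<Longrightarrow> act (inv g) (act g y) = y"
  by (simp_all add: act_one flip: act_mult)

lemma act_image_dom: "g \<in> carrier K \<Longrightarrow> act g ` dom g = ran g"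
  by (auto simp: dom_def ran_def image_iff intro!: exI[of _ "act (inv g) _"])

lemma inj_act: "g \<in> carrier K \<Longrightarrow> inj_on (act g) S"
  by (rule inj_on_inverseI[of _ "act (inv g)"]) simp

lemma induced_map_act:
  assumes g: "g \<in> carrier K"
  shows "induced_map (dom g) (act g) f y = (if y \<in> ran g then f (act (inv g) y) else 0)"
proof (cases "y \<in> ran g")
  case True
  then have "act (inv g) y \<in> dom g" using g by (auto simp: ran_def dom_def)
  then have "inv_into (dom g) (act g) y = act (inv g) y"
    using inv_into_f_f[OF inj_act[OF g], of "act (inv g) y" "dom g"] g by simp
  then show ?thesis using True by (simp add: induced_map_def act_image_dom[OF g])
qed (simp add: induced_map_def act_image_dom[OF g])

lemma ran_inv: "g \<in> carrier K \<Longrightarrow> act (inv g) y \<in> ran (inv g) \<longleftrightarrow> y \<in> ran g"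
  by (auto simp: ran_def)

lemma B_carrier:
  "a \<in> carrier B \<longleftrightarrow> (\<forall>g. a g \<in> carrier (CF Y)) \<and>
     (\<forall>g y. a g y \<noteq> 0 \<longrightarrow> g \<in> carrier K \<and> y \<in> ran g) \<and> finite {g. a g \<noteq> 0}"
  (is "?L = ?R")
proof
  assume L: ?L
  have K: "a g \<in> carrier (CF Y) \<and> (\<forall>y. y \<notin> ran g \<longrightarrow> a g y = 0)" if "g \<in> carrier K" for g
    using L that by (auto simp: B_def partial_crossed_star_algebra_def C0_ideal_def act_image_dom)
  have nK: "a g = (\<lambda>_. 0)" if "g \<notin> carrier K" for g
    using L that by (auto simp: B_def partial_crossed_star_algebra_def)
  have "a g \<in> carrier (CF Y)" for g using K nK CF_zero by (cases "g \<in> carrier K") auto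
  moreover have "g \<in> carrier K \<and> y \<in> ran g" if nz: "a g y \<noteq> 0" for g y
  proof -
    have "g \<in> carrier K" using nK[of g] nz by (cases "g \<in> carrier K") auto
    then show ?thesis using K[of g] nz by blast
  qed
  moreover have "finite {g. a g \<noteq> 0}" using L by (simp add: B_def partial_crossed_star_algebra_def zero_fun_def)
  ultimately show ?R by blast
next
  assume R: ?R
  then have "a g = (\<lambda>_. 0)" if "g \<notin> carrier K" for g using that by (auto simp: fun_eq_iff)
  then show ?L using R by (auto simp: B_def partial_crossed_star_algebra_def C0_ideal_def act_image_dom zero_fun_def)
qed

lemma B_carrierD:
  assumes "a \<in> carrier B"
  shows "a g \<in> carrier (CF Y)" "finite {g. a g \<noteq> 0}" "a g y \<noteq> 0 \<Longrightarrow> g \<in> carrier K"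
    "a g y \<noteq> 0 \<Longrightarrow> y \<in> ran g" "a g y \<noteq> 0 \<Longrightarrow> y \<in> topspace Y" "a g \<noteq> 0 \<Longrightarrow> g \<in> carrier K"
  using assms by (auto simp: B_carrier ran_def fun_eq_iff)

lemma B_simps [simp]:
  "\<one>\<^bsub>B\<^esub> = (\<lambda>g. if g = \<one> then (\<lambda>y. if y \<in> topspace Y then 1 else 0) else (\<lambda>_. 0))"
  "\<zero>\<^bsub>B\<^esub> = (\<lambda>g y. 0)" "a \<oplus>\<^bsub>B\<^esub> b = (\<lambda>g y. a g y + b g y)" "c \<odot>\<^bsub>B\<^esub> a = (\<lambda>g y. c * a g y)"
  by (auto simp: B_def partial_crossed_star_algebra_def fun_eq_iff)

lemma translate_mult_closed:
  assumes g: "g \<in> carrier K" and f: "f \<in> carrier (CF Y)" "\<And>y. f y \<noteq> 0 \<Longrightarrow> y \<in> ran g"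
    and h: "h \<in> carrier (CF Y)"
  shows "(\<lambda>y. f y * h (act (inv g) y)) \<in> carrier (CF Y)"
proof -
  have "(\<lambda>y. f y * h (act (inv g) y)) =
      (\<lambda>y. f y * (if y \<in> topspace Y \<and> act (inv g) y \<in> topspace Y then h (act (inv g) y) else 0))"
  proof
    fix y
    show "f y * h (act (inv g) y) =
        f y * (if y \<in> topspace Y \<and> act (inv g) y \<in> topspace Y then h (act (inv g) y) else 0)"
      using f(2)[of y] by (cases "f y = 0") (auto simp: ran_def)
  qed
  then show ?thesis using CF_mult[OF f(1) translate_closed[OF g h]] by simp
qed

text \<open>
  For a restricted action the coefficient \<open>\<alpha>\<^sub>g(\<alpha>\<^sub>g\<^sub>-\<^sub>1(e) f)\<close> of a product is the pointwise product of \<open>e(y)\<close> and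
  \<open>f(g\<^sup>-\<^sup>1y)\<close>, so that the multiplication becomes a convolution of scalar functions and the
  algebraic laws reduce to reindexing finite sums.
\<close>
lemma B_mult:
  assumes a: "a \<in> carrier B" and b: "b \<in> carrier B"
  shows "(a \<otimes>\<^bsub>B\<^esub> b) l y =
    (if l \<in> carrier K then \<Sum>g\<in>{g. a g \<noteq> 0}. a g y * b (inv g \<otimes> l) (act (inv g) y) else 0)"
proof (cases "l \<in> carrier K")
  case True
  note aD = B_carrierD[OF a] and bD = B_carrierD[OF b]
  let ?T = "\<lambda>g. induced_map (dom g) (act g) (\<lambda>y. induced_map (dom (inv g)) (act (inv g)) (a g) y * b (inv g \<otimes> l) y)"
  have T: "?T g = (\<lambda>y. a g y * b (inv g \<otimes> l) (act (inv g) y))" if "g \<in> carrier K" for g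
  proof
    fix y
    show "?T g y = a g y * b (inv g \<otimes> l) (act (inv g) y)"
      using that aD(4)[of g y] by (auto simp: induced_map_act ran_inv)
  qed
  have Tc: "?T g \<in> carrier (CF Y)" if "g \<in> {g. a g \<noteq> 0}" for g
    using that aD(6)[of g] translate_mult_closed[of g "a g" "b (inv g \<otimes> l)"] aD(1,4) bD(1) by (simp add: T)
  have "(a \<otimes>\<^bsub>B\<^esub> b) l = (\<Oplus>\<^bsub>CF Y\<^esub>g\<in>{g. a g \<noteq> 0}. ?T g)"
    using True by (simp add: B_def partial_crossed_star_algebra_def zero_fun_def)
  also have "\<dots> = (\<lambda>y. \<Sum>g\<in>{g. a g \<noteq> 0}. ?T g y)"
    using CF_finsum[of "{g. a g \<noteq> 0}" ?T Y] Tc aD(2) by blast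
  finally show ?thesis using True T aD(6) by simp
qed (simp add: B_def partial_crossed_star_algebra_def)

lemma B_mult_superset:
  assumes a: "a \<in> carrier B" and b: "b \<in> carrier B" and J: "finite J" "{g. a g \<noteq> 0} \<subseteq> J"
    and l: "l \<in> carrier K"
  shows "(a \<otimes>\<^bsub>B\<^esub> b) l y = (\<Sum>g\<in>J. a g y * b (inv g \<otimes> l) (act (inv g) y))"
  unfolding B_mult[OF a b] using l J by (auto intro!: sum.mono_neutral_left)

lemma B_star:
  assumes a: "a \<in> carrier B"
  shows "star B a g y = (if g \<in> carrier K then cnj (a (inv g) (act (inv g) y)) else 0)"
proof (cases "g \<in> carrier K")
  case True
  have "star B a g y = (if y \<in> ran g then cnj (a (inv g) (act (inv g) y)) else 0)"
    using True by (simp add: B_def partial_crossed_star_algebra_def induced_map_act)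
  moreover have "a (inv g) (act (inv g) y) = 0" if "y \<notin> ran g"
    using that B_carrierD(4)[OF a, of "inv g" "act (inv g) y"] ran_inv[OF True] by blast
  ultimately show ?thesis using True by auto
qed (simp add: B_def partial_crossed_star_algebra_def)

lemma B_add_closed: "a \<in> carrier B \<Longrightarrow> b \<in> carrier B \<Longrightarrow> (\<lambda>g y. a g y + b g y) \<in> carrier B"
proof -
  assume a: "a \<in> carrier B" and b: "b \<in> carrier B"
  have "{g. (\<lambda>y. a g y + b g y) \<noteq> 0} \<subseteq> {g. a g \<noteq> 0} \<union> {g. b g \<noteq> 0}" by (auto simp: fun_eq_iff)
  then have "finite {g. (\<lambda>y. a g y + b g y) \<noteq> 0}"
    using B_carrierD(2)[OF a] B_carrierD(2)[OF b] by (auto intro: finite_subset)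
  moreover have "g \<in> carrier K \<and> y \<in> ran g" if "a g y + b g y \<noteq> 0" for g y
  proof -
    have "a g y \<noteq> 0 \<or> b g y \<noteq> 0" using that by auto
    then show ?thesis using B_carrierD(3,4)[OF a] B_carrierD(3,4)[OF b] by blast
  qed
  moreover have "(\<lambda>y. a g y + b g y) \<in> carrier (CF Y)" for g
    by (intro CF_add B_carrierD(1) a b)
  ultimately show ?thesis unfolding B_carrier by blast
qed

lemma B_scale_closed: "a \<in> carrier B \<Longrightarrow> (\<lambda>g y. c * a g y) \<in> carrier B"
proof -
  assume a: "a \<in> carrier B"
  have "{g. (\<lambda>y. c * a g y) \<noteq> 0} \<subseteq> {g. a g \<noteq> 0}" by (auto simp: fun_eq_iff)
  then have "finite {g. (\<lambda>y. c * a g y) \<noteq> 0}"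
    using B_carrierD(2)[OF a] by (auto intro: finite_subset)
  moreover have "g \<in> carrier K \<and> y \<in> ran g" if "c * a g y \<noteq> 0" for g y
    using that B_carrierD(3,4)[OF a, of g y] by simp
  moreover have "(\<lambda>y. c * a g y) \<in> carrier (CF Y)" for g
    by (intro CF_scale B_carrierD(1) a)
  ultimately show ?thesis unfolding B_carrier by blast
qed

lemma B_zero_closed: "(\<lambda>_ _. 0) \<in> carrier B"
  unfolding B_carrier by (simp add: CF_zero zero_fun_def)

lemma B_mult_closed:
  assumes a: "a \<in> carrier B" and b: "b \<in> carrier B"
  shows "a \<otimes>\<^bsub>B\<^esub> b \<in> carrier B"
proof -
  note aD = B_carrierD[OF a] and bD = B_carrierD[OF b]
  have ex: "\<exists>g. a g y \<noteq> 0 \<and> b (inv g \<otimes> l) (act (inv g) y) \<noteq> 0 \<and> l \<in> carrier K"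
    if "(a \<otimes>\<^bsub>B\<^esub> b) l y \<noteq> 0" for l y
  proof -
    have l: "l \<in> carrier K" using that by (simp add: B_mult[OF a b] split: if_splits)
    then have "(\<Sum>g\<in>{g. a g \<noteq> 0}. a g y * b (inv g \<otimes> l) (act (inv g) y)) \<noteq> 0"
      using that by (simp add: B_mult[OF a b])
    then obtain g where "a g y * b (inv g \<otimes> l) (act (inv g) y) \<noteq> 0"
      by (meson sum.not_neutral_contains_not_neutral)
    then show ?thesis using l by auto
  qed
  have "{l. (a \<otimes>\<^bsub>B\<^esub> b) l \<noteq> 0} \<subseteq> (\<lambda>(g, h). g \<otimes> h) ` ({g. a g \<noteq> 0} \<times> {h. b h \<noteq> 0})"
  proof
    fix l assume "l \<in> {l. (a \<otimes>\<^bsub>B\<^esub> b) l \<noteq> 0}"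
    then obtain y where "(a \<otimes>\<^bsub>B\<^esub> b) l y \<noteq> 0" by (auto simp: fun_eq_iff)
    then obtain g where g: "a g y \<noteq> 0" "b (inv g \<otimes> l) (act (inv g) y) \<noteq> 0" "l \<in> carrier K" using ex by blast
    then have "l = g \<otimes> (inv g \<otimes> l)" using aD(3)[OF g(1)] by (simp flip: m_assoc)
    moreover have "a g \<noteq> 0" "b (inv g \<otimes> l) \<noteq> 0" using g by (auto simp: fun_eq_iff)
    ultimately show "l \<in> (\<lambda>(g, h). g \<otimes> h) ` ({g. a g \<noteq> 0} \<times> {h. b h \<noteq> 0})"
      by (intro image_eqI[of _ _ "(g, inv g \<otimes> l)"]) auto
  qed
  then have "finite {l. (a \<otimes>\<^bsub>B\<^esub> b) l \<noteq> 0}" using aD(2) bD(2) by (auto intro: finite_subset)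
  moreover have "l \<in> carrier K \<and> y \<in> ran l" if nz: "(a \<otimes>\<^bsub>B\<^esub> b) l y \<noteq> 0" for l y
  proof -
    obtain g where g: "a g y \<noteq> 0" "b (inv g \<otimes> l) (act (inv g) y) \<noteq> 0" "l \<in> carrier K" using ex[OF nz] by blast
    note gK = aD(3)[OF g(1)]
    have "act (inv g) y \<in> ran (inv g \<otimes> l)" by (rule bD(4)[OF g(2)])
    then have "act (inv (inv g \<otimes> l)) (act (inv g) y) \<in> topspace Y" by (simp add: ran_def)
    moreover have "inv (inv g \<otimes> l) = inv l \<otimes> g" using gK g(3) by (simp add: inv_mult_group)
    ultimately have "act (inv l) y \<in> topspace Y" using gK g(3) by (simp add: act_mult)
    then show ?thesis using g(3) aD(5)[OF g(1)] by (simp add: ran_def)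
  qed
  moreover have "(a \<otimes>\<^bsub>B\<^esub> b) l \<in> carrier (CF Y)" for l
  proof (cases "l \<in> carrier K")
    case True
    have "(\<lambda>y. \<Sum>g\<in>{g. a g \<noteq> 0}. a g y * b (inv g \<otimes> l) (act (inv g) y)) \<in> carrier (CF Y)"
    proof (rule CF_finsum[THEN conjunct2])
      fix g assume "g \<in> {g. a g \<noteq> 0}"
      then show "(\<lambda>y. a g y * b (inv g \<otimes> l) (act (inv g) y)) \<in> carrier (CF Y)"
        using aD(6)[of g] translate_mult_closed[of g "a g" "b (inv g \<otimes> l)"] aD(1,4) bD(1) by simp
    qed (rule aD(2))
    moreover have "(a \<otimes>\<^bsub>B\<^esub> b) l = (\<lambda>y. \<Sum>g\<in>{g. a g \<noteq> 0}. a g y * b (inv g \<otimes> l) (act (inv g) y))"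
      using True by (simp add: B_mult[OF a b] fun_eq_iff)
    ultimately show ?thesis by simp
  next
    case False
    then have "(a \<otimes>\<^bsub>B\<^esub> b) l = (\<lambda>_. 0)" by (simp add: B_mult[OF a b] fun_eq_iff)
    then show ?thesis by (simp add: CF_zero)
  qed
  ultimately show ?thesis unfolding B_carrier by blast
qed

lemma B_star_closed:
  assumes a: "a \<in> carrier B"
  shows "star B a \<in> carrier B"
proof -
  note aD = B_carrierD[OF a]
  have "{g. star B a g \<noteq> 0} \<subseteq> (\<lambda>g. inv g) ` {g. a g \<noteq> 0}"
  proof
    fix g assume "g \<in> {g. star B a g \<noteq> 0}"
    then obtain y where "star B a g y \<noteq> 0" by (auto simp: fun_eq_iff)
    then have "g \<in> carrier K" "a (inv g) (act (inv g) y) \<noteq> 0" by (auto simp: B_star[OF a] split: if_splits)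
    then show "g \<in> (\<lambda>g. inv g) ` {g. a g \<noteq> 0}" by (intro image_eqI[of _ _ "inv g"]) (auto simp: fun_eq_iff)
  qed
  then have "finite {g. star B a g \<noteq> 0}" using aD(2) by (auto intro: finite_subset)
  moreover have "g \<in> carrier K \<and> y \<in> ran g" if "star B a g y \<noteq> 0" for g y
    using that aD(4)[of "inv g" "act (inv g) y"] ran_inv[of g y] by (auto simp: B_star[OF a] split: if_splits)
  moreover have "star B a g \<in> carrier (CF Y)" for g
  proof (cases "g \<in> carrier K")
    case True
    have "star B a g = (\<lambda>y. cnj (if y \<in> topspace Y \<and> act (inv g) y \<in> topspace Y then a (inv g) (act (inv g) y) else 0))"
    proof
      fix y
      show "star B a g y = cnj (if y \<in> topspace Y \<and> act (inv g) y \<in> topspace Y then a (inv g) (act (inv g) y) else 0)"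
        using True aD(4)[of "inv g" "act (inv g) y"] ran_inv[OF True, of y]
        by (cases "a (inv g) (act (inv g) y) = 0") (auto simp: B_star[OF a] ran_def)
    qed
    then show ?thesis using CF_cnj[OF translate_closed[OF True aD(1)]] by simp
  next
    case False
    then have "star B a g = (\<lambda>_. 0)" by (simp add: B_star[OF a] fun_eq_iff)
    then show ?thesis by (simp add: CF_zero)
  qed
  ultimately show ?thesis unfolding B_carrier by blast
qed

lemma B_one_closed: "\<one>\<^bsub>B\<^esub> \<in> carrier B"
proof -
  have "{g. \<one>\<^bsub>B\<^esub> g \<noteq> 0} \<subseteq> {\<one>}" by (auto simp: zero_fun_def)
  then have "finite {g. \<one>\<^bsub>B\<^esub> g \<noteq> 0}" by (rule finite_subset) simp
  then show ?thesis using CF_one CF_zero by (auto simp: B_carrier ran_def act_one)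
qed

lemma B_assoc:
  assumes a: "a \<in> carrier B" and b: "b \<in> carrier B" and c: "c \<in> carrier B"
  shows "(a \<otimes>\<^bsub>B\<^esub> b) \<otimes>\<^bsub>B\<^esub> c = a \<otimes>\<^bsub>B\<^esub> (b \<otimes>\<^bsub>B\<^esub> c)"
proof (intro ext)
  fix l y
  note aD = B_carrierD[OF a] and bD = B_carrierD[OF b]
  note ab = B_mult_closed[OF a b] and bc = B_mult_closed[OF b c]
  show "((a \<otimes>\<^bsub>B\<^esub> b) \<otimes>\<^bsub>B\<^esub> c) l y = (a \<otimes>\<^bsub>B\<^esub> (b \<otimes>\<^bsub>B\<^esub> c)) l y"
  proof (cases "l \<in> carrier K")
    case l: True
    define H where "H = {h. (a \<otimes>\<^bsub>B\<^esub> b) h \<noteq> 0} \<union> (\<lambda>(g, h). g \<otimes> h) ` ({g. a g \<noteq> 0} \<times> {h. b h \<noteq> 0})"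
    have H: "finite H" "{h. (a \<otimes>\<^bsub>B\<^esub> b) h \<noteq> 0} \<subseteq> H"
      using B_carrierD(2)[OF ab] aD(2) bD(2) by (auto simp: H_def)
    have HK: "h \<in> carrier K" if "h \<in> H" for h
      using that B_carrierD(6)[OF ab] aD(6) bD(6) by (auto simp: H_def)
    have "((a \<otimes>\<^bsub>B\<^esub> b) \<otimes>\<^bsub>B\<^esub> c) l y = (\<Sum>h\<in>H. (a \<otimes>\<^bsub>B\<^esub> b) h y * c (inv h \<otimes> l) (act (inv h) y))"
      by (rule B_mult_superset[OF ab c H l])
    also have "\<dots> = (\<Sum>h\<in>H. \<Sum>g\<in>{g. a g \<noteq> 0}.
        a g y * (b (inv g \<otimes> h) (act (inv g) y) * c (inv h \<otimes> l) (act (inv h) y)))"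
      using HK by (intro sum.cong refl) (simp add: B_mult[OF a b] sum_distrib_right mult.assoc)
    also have "\<dots> = (\<Sum>g\<in>{g. a g \<noteq> 0}. a g y *
        (\<Sum>h\<in>H. b (inv g \<otimes> h) (act (inv g) y) * c (inv h \<otimes> l) (act (inv h) y)))"
      by (subst sum.swap) (simp add: sum_distrib_left)
    also have "\<dots> = (\<Sum>g\<in>{g. a g \<noteq> 0}. a g y * (b \<otimes>\<^bsub>B\<^esub> c) (inv g \<otimes> l) (act (inv g) y))"
    proof (intro sum.cong refl arg_cong2[of _ _ _ _ "(*)"])
      fix g assume "g \<in> {g. a g \<noteq> 0}"
      then have g: "a g \<noteq> 0" "g \<in> carrier K" using aD(6) by auto
      have "(\<Sum>h\<in>H. b (inv g \<otimes> h) (act (inv g) y) * c (inv h \<otimes> l) (act (inv h) y)) =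
        (\<Sum>h\<in>{h. b h \<noteq> 0}. b h (act (inv g) y) * c (inv h \<otimes> (inv g \<otimes> l)) (act (inv h) (act (inv g) y)))"
      proof (rule sum.reindex_bij_witness_not_neutral[where i = "\<lambda>h. g \<otimes> h" and j = "\<lambda>h. inv g \<otimes> h"
            and S' = "{h \<in> H. b (inv g \<otimes> h) = 0}" and T' = "{}"])
        show "finite {h \<in> H. b (inv g \<otimes> h) = 0}" using H by simp
        fix h assume h: "h \<in> H - {h \<in> H. b (inv g \<otimes> h) = 0}"
        then have hK: "h \<in> carrier K" using HK by blast
        show "g \<otimes> (inv g \<otimes> h) = h" using g hK by (simp flip: m_assoc)
        show "inv g \<otimes> h \<in> {h. b h \<noteq> 0} - {}" using h by simp
      next
        fix h assume "h \<in> {h. b h \<noteq> 0} - {}"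
        then have h: "b h \<noteq> 0" "h \<in> carrier K" using bD(6) by auto
        show e: "inv g \<otimes> (g \<otimes> h) = h" using g h by (simp flip: m_assoc)
        show "g \<otimes> h \<in> H - {h \<in> H. b (inv g \<otimes> h) = 0}" using g(1) h(1) e by (auto simp: H_def)
      next
        fix h assume "h \<in> H"
        then have hK: "h \<in> carrier K" using HK by blast
        have i: "inv (inv g \<otimes> h) = inv h \<otimes> g" using g hK by (simp add: inv_mult_group)
        have "inv (inv g \<otimes> h) \<otimes> (inv g \<otimes> l) = inv h \<otimes> l"
          unfolding i using g hK l by (simp add: m_assoc) (simp flip: m_assoc)
        moreover have "act (inv (inv g \<otimes> h)) (act (inv g) y) = act (inv h) y"
          unfolding i using g hK by (simp add: act_mult)
        ultimately show "b (inv g \<otimes> h) (act (inv g) y) *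
            c (inv (inv g \<otimes> h) \<otimes> (inv g \<otimes> l)) (act (inv (inv g \<otimes> h)) (act (inv g) y)) =
            b (inv g \<otimes> h) (act (inv g) y) * c (inv h \<otimes> l) (act (inv h) y)" by simp
      qed simp_all
      also have "\<dots> = (b \<otimes>\<^bsub>B\<^esub> c) (inv g \<otimes> l) (act (inv g) y)"
        using g l by (simp add: B_mult[OF b c])
      finally show "(\<Sum>h\<in>H. b (inv g \<otimes> h) (act (inv g) y) * c (inv h \<otimes> l) (act (inv h) y)) =
        (b \<otimes>\<^bsub>B\<^esub> c) (inv g \<otimes> l) (act (inv g) y)" .
    qed
    also have "\<dots> = (a \<otimes>\<^bsub>B\<^esub> (b \<otimes>\<^bsub>B\<^esub> c)) l y" using l by (simp add: B_mult[OF a bc])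
    finally show ?thesis .
  qed (simp add: B_mult[OF ab c] B_mult[OF a bc])
qed

lemma B_star_mult:
  assumes a: "a \<in> carrier B" and b: "b \<in> carrier B"
  shows "star B (a \<otimes>\<^bsub>B\<^esub> b) = star B b \<otimes>\<^bsub>B\<^esub> star B a"
proof (intro ext)
  fix l y
  note aD = B_carrierD[OF a]
  note sa = B_star_closed[OF a] and sb = B_star_closed[OF b] and ab = B_mult_closed[OF a b]
  show "star B (a \<otimes>\<^bsub>B\<^esub> b) l y = (star B b \<otimes>\<^bsub>B\<^esub> star B a) l y"
  proof (cases "l \<in> carrier K")
    case l: True
    have "star B (a \<otimes>\<^bsub>B\<^esub> b) l y = (\<Sum>g\<in>{g. a g \<noteq> 0}. cnj (a g (act (inv l) y)) *
        cnj (b (inv g \<otimes> inv l) (act (inv g) (act (inv l) y))))"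
      using l by (simp add: B_star[OF ab] B_mult[OF a b])
    also have "\<dots> = (\<Sum>h\<in>{h. star B b h \<noteq> 0}. star B b h y * star B a (inv h \<otimes> l) (act (inv h) y))"
    proof (rule sum.reindex_bij_witness_not_neutral[where i = "\<lambda>h. inv l \<otimes> h" and j = "\<lambda>g. l \<otimes> g"
          and S' = "{g \<in> {g. a g \<noteq> 0}. star B b (l \<otimes> g) = 0}"
          and T' = "{h \<in> {h. star B b h \<noteq> 0}. a (inv l \<otimes> h) = 0}"])
      show "finite {g \<in> {g. a g \<noteq> 0}. star B b (l \<otimes> g) = 0}" using aD(2) by simp
      show "finite {h \<in> {h. star B b h \<noteq> 0}. a (inv l \<otimes> h) = 0}" using B_carrierD(2)[OF sb] by simp
    next
      fix g assume g: "g \<in> {g. a g \<noteq> 0} - {g \<in> {g. a g \<noteq> 0}. star B b (l \<otimes> g) = 0}"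
      then have gK: "g \<in> carrier K" using aD(6) by blast
      show e: "inv l \<otimes> (l \<otimes> g) = g" using l gK by (simp flip: m_assoc)
      show "l \<otimes> g \<in> {h. star B b h \<noteq> 0} - {h \<in> {h. star B b h \<noteq> 0}. a (inv l \<otimes> h) = 0}" using g e by auto
    next
      fix h assume h: "h \<in> {h. star B b h \<noteq> 0} - {h \<in> {h. star B b h \<noteq> 0}. a (inv l \<otimes> h) = 0}"
      then have hK: "h \<in> carrier K" using B_carrierD(6)[OF sb] by blast
      show e: "l \<otimes> (inv l \<otimes> h) = h" using l hK by (simp flip: m_assoc)
      show "inv l \<otimes> h \<in> {g. a g \<noteq> 0} - {g \<in> {g. a g \<noteq> 0}. star B b (l \<otimes> g) = 0}" using h e by auto
    next
      fix g assume "g \<in> {g. a g \<noteq> 0}"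
      then have gK: "g \<in> carrier K" using aD(6) by blast
      have i: "inv (l \<otimes> g) = inv g \<otimes> inv l" using l gK by (simp add: inv_mult_group)
      have j: "inv (l \<otimes> g) \<otimes> l = inv g" unfolding i using l gK by (simp add: m_assoc)
      show "star B b (l \<otimes> g) y * star B a (inv (l \<otimes> g) \<otimes> l) (act (inv (l \<otimes> g)) y) =
          cnj (a g (act (inv l) y)) * cnj (b (inv g \<otimes> inv l) (act (inv g) (act (inv l) y)))"
        unfolding j using l gK by (simp add: B_star[OF a] B_star[OF b] i act_mult)
      assume "g \<in> {g \<in> {g. a g \<noteq> 0}. star B b (l \<otimes> g) = 0}"
    next
      fix g assume g: "g \<in> {g \<in> {g. a g \<noteq> 0}. star B b (l \<otimes> g) = 0}"
      then have gK: "g \<in> carrier K" using aD(6) by blast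
      have "star B b (l \<otimes> g) y = 0" using g by (simp add: fun_eq_iff)
      then have "cnj (b (inv g \<otimes> inv l) (act (inv g) (act (inv l) y))) = 0"
        using l gK by (simp add: B_star[OF b] inv_mult_group act_mult)
      then show "cnj (a g (act (inv l) y)) * cnj (b (inv g \<otimes> inv l) (act (inv g) (act (inv l) y))) = 0" by simp
    next
      fix h assume h: "h \<in> {h \<in> {h. star B b h \<noteq> 0}. a (inv l \<otimes> h) = 0}"
      then have hK: "h \<in> carrier K" using B_carrierD(6)[OF sb] by blast
      have "inv (inv h \<otimes> l) = inv l \<otimes> h" using l hK by (simp add: inv_mult_group)
      then have "star B a (inv h \<otimes> l) (act (inv h) y) = 0"
        using h l hK by (simp add: B_star[OF a])
      then show "star B b h y * star B a (inv h \<otimes> l) (act (inv h) y) = 0" by simp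
    qed
    also have "\<dots> = (star B b \<otimes>\<^bsub>B\<^esub> star B a) l y" using l by (simp add: B_mult[OF sb sa])
    finally show ?thesis .
  qed (simp add: B_star[OF ab] B_mult[OF sb sa])
qed

lemma B_one_left: assumes a: "a \<in> carrier B" shows "\<one>\<^bsub>B\<^esub> \<otimes>\<^bsub>B\<^esub> a = a"
proof (intro ext)
  fix l y
  have s: "{g. \<one>\<^bsub>B\<^esub> g \<noteq> 0} \<subseteq> {\<one>}" by (auto simp: zero_fun_def)
  show "(\<one>\<^bsub>B\<^esub> \<otimes>\<^bsub>B\<^esub> a) l y = a l y"
  proof (cases "l \<in> carrier K")
    case True
    then have "(\<one>\<^bsub>B\<^esub> \<otimes>\<^bsub>B\<^esub> a) l y = (if y \<in> topspace Y then 1 else 0) * a l y"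
      using B_mult_superset[OF B_one_closed a _ s True] by (simp add: act_one)
    then show ?thesis using B_carrierD(5)[OF a, of l y] by auto
  next
    case False
    then show ?thesis using B_carrierD(3)[OF a, of l y] B_mult[OF B_one_closed a, of l y] by auto
  qed
qed

lemma B_one_right: assumes a: "a \<in> carrier B" shows "a \<otimes>\<^bsub>B\<^esub> \<one>\<^bsub>B\<^esub> = a"
proof (intro ext)
  fix l y
  note aD = B_carrierD[OF a]
  show "(a \<otimes>\<^bsub>B\<^esub> \<one>\<^bsub>B\<^esub>) l y = a l y"
  proof (cases "l \<in> carrier K")
    case l: True
    have "(a \<otimes>\<^bsub>B\<^esub> \<one>\<^bsub>B\<^esub>) l y = (\<Sum>g\<in>{g. a g \<noteq> 0}. a g y * \<one>\<^bsub>B\<^esub> (inv g \<otimes> l) (act (inv g) y))"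
      using l by (simp only: B_mult[OF a B_one_closed] if_True)
    also have "\<dots> = (\<Sum>g\<in>{g. a g \<noteq> 0}. if g = l then a l y else 0)"
    proof (rule sum.cong[OF refl])
      fix g assume "g \<in> {g. a g \<noteq> 0}"
      then have g: "g \<in> carrier K" using aD(6) by blast
      have "inv g \<otimes> l = \<one> \<longleftrightarrow> g = l"
        using g l by (metis inv_closed inv_equality inv_inv l_inv)
      moreover have "a g y = 0 \<or> act (inv g) y \<in> topspace Y" using aD(4)[of g y] by (auto simp: ran_def)
      ultimately show "a g y * \<one>\<^bsub>B\<^esub> (inv g \<otimes> l) (act (inv g) y) = (if g = l then a l y else 0)" by auto
    qed
    also have "\<dots> = a l y" using aD(2) by (auto simp: fun_eq_iff zero_fun_def)
    finally show ?thesis .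
  next
    case False
    then show ?thesis using aD(3)[of l y] B_mult[OF a B_one_closed, of l y] by auto
  qed
qed

lemma B_star_star: assumes a: "a \<in> carrier B" shows "star B (star B a) = a"
proof (intro ext)
  fix l y
  show "star B (star B a) l y = a l y"
    using B_carrierD(3)[OF a, of l y] by (cases "l \<in> carrier K") (auto simp: B_star[OF a] B_star[OF B_star_closed[OF a]])
qed

lemma star_algebra_B: "star_algebra B"
proof -
  have ext: "a = b" if "\<And>g y. a g y = b g y" for a b :: "'g \<Rightarrow> 'y \<Rightarrow> complex" using that by blast
  note ac = B_add_closed and sc = B_scale_closed
  have "ring B"
  proof (rule ringI)
    show "abelian_group B"
    proof (rule abelian_groupI)
      fix x assume "x \<in> carrier B"
      then have "(\<lambda>g y. (-1) * x g y) \<in> carrier B" by (rule sc)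
      then show "\<exists>y\<in>carrier B. y \<oplus>\<^bsub>B\<^esub> x = \<zero>\<^bsub>B\<^esub>" by (intro bexI) auto
    qed (simp_all add: ac add_ac B_zero_closed)
    show "monoid B"
      by (rule monoidI) (fact B_mult_closed B_one_closed B_assoc B_one_left B_one_right)+
    fix x y z assume x: "x \<in> carrier B" and y: "y \<in> carrier B" and z: "z \<in> carrier B"
    show "(x \<oplus>\<^bsub>B\<^esub> y) \<otimes>\<^bsub>B\<^esub> z = x \<otimes>\<^bsub>B\<^esub> z \<oplus>\<^bsub>B\<^esub> y \<otimes>\<^bsub>B\<^esub> z"
    proof (rule ext)
      fix l w
      let ?J = "{g. x g \<noteq> 0} \<union> {g. y g \<noteq> 0}"
      have J: "finite ?J" "{g. x g \<noteq> 0} \<subseteq> ?J" "{g. y g \<noteq> 0} \<subseteq> ?J" "{g. (x \<oplus>\<^bsub>B\<^esub> y) g \<noteq> 0} \<subseteq> ?J"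
        using B_carrierD(2)[OF x] B_carrierD(2)[OF y] by (auto simp: fun_eq_iff)
      have xy: "x \<oplus>\<^bsub>B\<^esub> y \<in> carrier B" using ac[OF x y] by simp
      show "((x \<oplus>\<^bsub>B\<^esub> y) \<otimes>\<^bsub>B\<^esub> z) l w = (x \<otimes>\<^bsub>B\<^esub> z \<oplus>\<^bsub>B\<^esub> y \<otimes>\<^bsub>B\<^esub> z) l w"
        using B_mult_superset[OF xy z J(1,4)] B_mult_superset[OF x z J(1,2)] B_mult_superset[OF y z J(1,3)]
          B_mult[OF xy z] B_mult[OF x z] B_mult[OF y z]
        by (cases "l \<in> carrier K") (simp_all add: distrib_right sum.distrib)
    qed
    show "z \<otimes>\<^bsub>B\<^esub> (x \<oplus>\<^bsub>B\<^esub> y) = z \<otimes>\<^bsub>B\<^esub> x \<oplus>\<^bsub>B\<^esub> z \<otimes>\<^bsub>B\<^esub> y"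
    proof (rule ext)
      fix l w
      have xy: "x \<oplus>\<^bsub>B\<^esub> y \<in> carrier B" using ac[OF x y] by simp
      show "(z \<otimes>\<^bsub>B\<^esub> (x \<oplus>\<^bsub>B\<^esub> y)) l w = (z \<otimes>\<^bsub>B\<^esub> x \<oplus>\<^bsub>B\<^esub> z \<otimes>\<^bsub>B\<^esub> y) l w"
        using B_mult[OF z xy] B_mult[OF z x] B_mult[OF z y]
        by (simp add: distrib_left sum.distrib)
    qed
  qed
  moreover have "star_algebra_axioms B"
  proof
    fix x y assume x: "x \<in> carrier B" and y: "y \<in> carrier B"
    show "star B (x \<otimes>\<^bsub>B\<^esub> y) = star B y \<otimes>\<^bsub>B\<^esub> star B x" by (rule B_star_mult[OF x y])
    show "star B (x \<oplus>\<^bsub>B\<^esub> y) = star B x \<oplus>\<^bsub>B\<^esub> star B y"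
    proof (rule ext)
      have xy: "x \<oplus>\<^bsub>B\<^esub> y \<in> carrier B" using ac[OF x y] by simp
      show "star B (x \<oplus>\<^bsub>B\<^esub> y) l w = (star B x \<oplus>\<^bsub>B\<^esub> star B y) l w" for l w
        using B_star[OF xy] B_star[OF x] B_star[OF y] by simp
    qed
    fix c
    have cx: "c \<odot>\<^bsub>B\<^esub> x \<in> carrier B" and cy: "c \<odot>\<^bsub>B\<^esub> y \<in> carrier B" using sc[OF x] sc[OF y] by simp_all
    show "c \<odot>\<^bsub>B\<^esub> x \<otimes>\<^bsub>B\<^esub> y = c \<odot>\<^bsub>B\<^esub> (x \<otimes>\<^bsub>B\<^esub> y)"
    proof (rule ext)
      have J: "{g. (c \<odot>\<^bsub>B\<^esub> x) g \<noteq> 0} \<subseteq> {g. x g \<noteq> 0}" by (auto simp: fun_eq_iff)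
      show "(c \<odot>\<^bsub>B\<^esub> x \<otimes>\<^bsub>B\<^esub> y) l w = (c \<odot>\<^bsub>B\<^esub> (x \<otimes>\<^bsub>B\<^esub> y)) l w" for l w
        using B_mult_superset[OF cx y B_carrierD(2)[OF x] J] B_mult[OF cx y] B_mult[OF x y]
        by (cases "l \<in> carrier K") (simp_all add: sum_distrib_left mult.assoc)
    qed
    show "x \<otimes>\<^bsub>B\<^esub> (c \<odot>\<^bsub>B\<^esub> y) = c \<odot>\<^bsub>B\<^esub> (x \<otimes>\<^bsub>B\<^esub> y)"
    proof (rule ext)
      show "(x \<otimes>\<^bsub>B\<^esub> (c \<odot>\<^bsub>B\<^esub> y)) l w = (c \<odot>\<^bsub>B\<^esub> (x \<otimes>\<^bsub>B\<^esub> y)) l w" for l w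
        using B_mult[OF x cy] B_mult[OF x y]
        by (simp add: sum_distrib_left mult.left_commute)
    qed
  next
    fix x c assume x: "x \<in> carrier B"
    have cx: "c \<odot>\<^bsub>B\<^esub> x \<in> carrier B" using sc[OF x] by simp
    show "star B (c \<odot>\<^bsub>B\<^esub> x) = cnj c \<odot>\<^bsub>B\<^esub> star B x"
    proof (rule ext)
      show "star B (c \<odot>\<^bsub>B\<^esub> x) l w = (cnj c \<odot>\<^bsub>B\<^esub> star B x) l w" for l w
        using B_star[OF cx] B_star[OF x] by simp
    qed
    show "star B x \<in> carrier B" by (rule B_star_closed[OF x])
    show "star B (star B x) = x" by (rule B_star_star[OF x])
  qed (auto simp: sc algebra_simps)
  ultimately show ?thesis by (simp add: star_algebra_def)
qed

subsection \<open>Monomials\<close>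

definition mono :: "'g \<Rightarrow> ('y \<Rightarrow> complex) \<Rightarrow> 'g \<Rightarrow> 'y \<Rightarrow> complex" where
  "mono g f = (\<lambda>h. if h = g then f else 0)"

definition coeffs :: "'g \<Rightarrow> ('y \<Rightarrow> complex) set" where
  "coeffs g = {f \<in> carrier (CF Y). \<forall>y. f y \<noteq> 0 \<longrightarrow> y \<in> ran g}"

lemma mono_closed: "g \<in> carrier K \<Longrightarrow> f \<in> coeffs g \<Longrightarrow> mono g f \<in> carrier B"
proof -
  assume g: "g \<in> carrier K" "f \<in> coeffs g"
  have "{h. mono g f h \<noteq> 0} \<subseteq> {g}" by (auto simp: mono_def)
  then have "finite {h. mono g f h \<noteq> 0}" by (rule finite_subset) simp
  then show ?thesis using g CF_zero by (auto simp: B_carrier mono_def coeffs_def zero_fun_def)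
qed

lemma coeffs_B: "a \<in> carrier B \<Longrightarrow> a g \<in> coeffs g"
  unfolding coeffs_def using B_carrierD(1,4) by blast

lemma coeffs_mult:
  assumes g: "g \<in> carrier K" "f \<in> coeffs g" and h: "h \<in> carrier K" "f' \<in> coeffs h"
  shows "(\<lambda>y. f y * f' (act (inv g) y)) \<in> coeffs (g \<otimes> h)"
proof -
  have "y \<in> ran (g \<otimes> h)" if "f y * f' (act (inv g) y) \<noteq> 0" for y
  proof -
    have "y \<in> ran g" "act (inv g) y \<in> ran h" using that g h by (auto simp: coeffs_def)
    then show ?thesis using g h by (simp add: ran_def inv_mult_group act_mult)
  qed
  then show ?thesis using translate_mult_closed[of g f f'] g h by (auto simp: coeffs_def)
qed

lemma coeffs_star:
  assumes g: "g \<in> carrier K" "f \<in> coeffs g"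
  shows "(\<lambda>y. cnj (f (act g y))) \<in> coeffs (inv g)"
proof -
  have "star B (mono g f) (inv g) = (\<lambda>y. cnj (f (act g y)))"
    using B_star[OF mono_closed[OF g]] g by (simp add: mono_def fun_eq_iff)
  then show ?thesis using coeffs_B[OF B_star_closed[OF mono_closed[OF g]], of "inv g"] by simp
qed

lemma coeffs_add: "f \<in> coeffs g \<Longrightarrow> f' \<in> coeffs g \<Longrightarrow> (\<lambda>y. f y + f' y) \<in> coeffs g"
  unfolding coeffs_def using CF_add[of f Y f'] by force

lemma coeffs_scale: "f \<in> coeffs g \<Longrightarrow> (\<lambda>y. c * f y) \<in> coeffs g"
  unfolding coeffs_def using CF_scale[of f Y c] by simp

lemma coeffs_one: "f \<in> coeffs \<one> \<longleftrightarrow> f \<in> carrier (CF Y)"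
  by (auto simp: coeffs_def ran_def act_one CF_carrier)

lemma mono_mult:
  assumes g: "g \<in> carrier K" "f \<in> coeffs g" and h: "h \<in> carrier K" "f' \<in> coeffs h"
  shows "mono g f \<otimes>\<^bsub>B\<^esub> mono h f' = mono (g \<otimes> h) (\<lambda>y. f y * f' (act (inv g) y))"
proof (intro ext)
  fix l y
  have J: "{k. mono g f k \<noteq> 0} \<subseteq> {g}" by (auto simp: mono_def)
  show "(mono g f \<otimes>\<^bsub>B\<^esub> mono h f') l y = mono (g \<otimes> h) (\<lambda>y. f y * f' (act (inv g) y)) l y"
  proof (cases "l \<in> carrier K")
    case l: True
    have "inv g \<otimes> l = h \<longleftrightarrow> l = g \<otimes> h"
      using g h l by (metis inv_closed inv_solve_left)
    then show ?thesis
      using B_mult_superset[OF mono_closed[OF g] mono_closed[OF h] _ J l] by (simp add: mono_def)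
  next
    case False
    then have "l \<noteq> g \<otimes> h" using g h by auto
    then show ?thesis using False B_mult[OF mono_closed[OF g] mono_closed[OF h], of l y] by (simp add: mono_def)
  qed
qed

lemma mono_star:
  assumes g: "g \<in> carrier K" "f \<in> coeffs g"
  shows "star B (mono g f) = mono (inv g) (\<lambda>y. cnj (f (act g y)))"
proof (intro ext)
  fix l y
  have "inv l = g \<longleftrightarrow> l = inv g" if "l \<in> carrier K" using that g by (metis inv_inv)
  then show "star B (mono g f) l y = mono (inv g) (\<lambda>y. cnj (f (act g y))) l y"
    using g B_star[OF mono_closed[OF g], of l y] by (auto simp: mono_def)
qed

lemma B_induct [consumes 1, case_names zero add]:
  assumes "b \<in> carrier B" "P (\<lambda>_ _. 0)"
    and step: "\<And>g f b. g \<in> carrier K \<Longrightarrow> f \<in> coeffs g \<Longrightarrow> b \<in> carrier B \<Longrightarrow> P b \<Longrightarrow> P (mono g f \<oplus>\<^bsub>B\<^esub> b)"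
  shows "P b"
proof -
  have "finite {g. b g \<noteq> 0}" using B_carrierD(2)[OF assms(1)] .
  then have "b \<in> carrier B \<longrightarrow> P b"
  proof (induction rule: finite_support_induct)
    case zero then show ?case using assms by (simp add: zero_fun_def)
  next
    case (update b g f)
    show ?case
    proof
      assume c: "b(g := f) \<in> carrier B"
      have f: "f \<in> coeffs g" using coeffs_B[OF c, of g] by simp
      have g: "g \<in> carrier K" using B_carrierD(6)[OF c, of g] update by simp
      have b: "b \<in> carrier B"
        unfolding B_carrier
      proof (intro conjI allI impI)
        show "b h \<in> carrier (CF Y)" for h
          using B_carrierD(1)[OF c, of h] update(2) CF_zero by (cases "h = g") (auto simp: zero_fun_def)
        show "h \<in> carrier K" "y \<in> ran h" if "b h y \<noteq> 0" for h y
          using B_carrierD(3,4)[OF c, of h y] that update(2) by (cases "h = g", auto simp: zero_fun_def)+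
      qed (rule update(1))
      have "b(g := f) = mono g f \<oplus>\<^bsub>B\<^esub> b" using update(2) by (auto simp: mono_def fun_eq_iff zero_fun_def)
      then show "P (b(g := f))" using step[OF g f b] update b by simp
    qed
  qed
  then show ?thesis using assms(1) by blast
qed

lemma mono_zero: "mono g (\<lambda>_. 0) = \<zero>\<^bsub>B\<^esub>"
  by (auto simp: mono_def fun_eq_iff)

lemma mono_add: "mono g (\<lambda>y. f y + f' y) = mono g f \<oplus>\<^bsub>B\<^esub> mono g f'"
  by (auto simp: mono_def fun_eq_iff)

lemma mono_scale: "mono g (\<lambda>y. c * f y) = c \<odot>\<^bsub>B\<^esub> mono g f"
  by (auto simp: mono_def fun_eq_iff)

lemma mono_one_hom: "star_hom (CF Y) B (mono \<one>)"
  unfolding star_hom_def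
  using mono_mult[of \<one> _ \<one>] mono_star[of \<one>] mono_closed[of \<one>]
  by (simp add: coeffs_one mono_add mono_scale act_one del: B_simps)

text \<open>
  By the C*-identity the seminorm of \<open>f U\<^sup>g\<close> is determined by \<open>f f\<^sup>*\<close> in the algebra of continuous functions,
  where every C*-seminorm is bounded by the supremum.
\<close>
lemma mono_seminorm_le:
  assumes p: "cstar_seminorm B p" and g: "g \<in> carrier K" "f \<in> coeffs g"
    and c: "0 \<le> c" "\<And>y. y \<in> topspace Y \<Longrightarrow> cmod (f y) \<le> c"
  shows "p (mono g f) \<le> c"
proof -
  interpret P: seminormed_star_algebra B p
    by (intro seminormed_star_algebra.intro seminormed_star_algebra_axioms.intro star_algebra_B p)
  have q: "cstar_seminorm (CF Y) (\<lambda>f. p (mono \<one> f))"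
    by (rule cstar_seminorm_pullback[OF mono_one_hom p star_algebra_CF])
  define r where "r y = f y * cnj (f y)" for y
  have r: "r \<in> carrier (CF Y)" unfolding r_def using g by (intro CF_mult CF_cnj) (auto simp: coeffs_def)
  have "mono g f \<otimes>\<^bsub>B\<^esub> star B (mono g f) = mono \<one> r"
    using g mono_mult[OF g inv_closed[OF g(1)] coeffs_star[OF g]] by (simp add: mono_star r_def[abs_def])
  then have "(p (mono g f))\<^sup>2 = p (mono \<one> r)"
    using P.N_cstar'[OF mono_closed[OF g]] by simp
  also have "\<dots> \<le> c\<^sup>2"
  proof (rule cont_fun_seminorm_le[OF q r])
    fix y assume "y \<in> topspace Y"
    then show "cmod (r y) \<le> c\<^sup>2"
      using mult_mono[OF c(2) c(2) c(1)] by (simp add: r_def norm_mult power2_eq_square)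
  qed simp
  finally show ?thesis using c(1) by (rule power2_le_imp_le)
qed

end

subsection \<open>Universal property\<close>

lemma (in restricted_action) crossed_hom_exists:
  fixes A :: "('a, 'm) star_ops_scheme"
  assumes A: "star_algebra A"
    and closed: "\<And>g f. g \<in> carrier K \<Longrightarrow> f \<in> coeffs g \<Longrightarrow> \<Theta> g f \<in> carrier A"
    and add: "\<And>g f f'. g \<in> carrier K \<Longrightarrow> f \<in> coeffs g \<Longrightarrow> f' \<in> coeffs g \<Longrightarrow>
      \<Theta> g (\<lambda>y. f y + f' y) = \<Theta> g f \<oplus>\<^bsub>A\<^esub> \<Theta> g f'"
    and scale: "\<And>g f c. g \<in> carrier K \<Longrightarrow> f \<in> coeffs g \<Longrightarrow> \<Theta> g (\<lambda>y. c * f y) = c \<odot>\<^bsub>A\<^esub> \<Theta> g f"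
    and mult: "\<And>g f h f'. g \<in> carrier K \<Longrightarrow> f \<in> coeffs g \<Longrightarrow> h \<in> carrier K \<Longrightarrow> f' \<in> coeffs h \<Longrightarrow>
      \<Theta> (g \<otimes> h) (\<lambda>y. f y * f' (act (inv g) y)) = \<Theta> g f \<otimes>\<^bsub>A\<^esub> \<Theta> h f'"
    and star: "\<And>g f. g \<in> carrier K \<Longrightarrow> f \<in> coeffs g \<Longrightarrow>
      \<Theta> (inv g) (\<lambda>y. cnj (f (act g y))) = star A (\<Theta> g f)"
  obtains \<theta> where "star_hom B A \<theta>"
    "\<And>g f. g \<in> carrier K \<Longrightarrow> f \<in> coeffs g \<Longrightarrow> \<theta> (mono g f) = \<Theta> g f"
proof -
  interpret A: star_algebra A by fact
  interpret B: star_algebra B by (rule star_algebra_B)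
  define T where "T g f = (if g \<in> carrier K \<and> f \<in> coeffs g then \<Theta> g f else \<zero>\<^bsub>A\<^esub>)" for g f
  have Tc: "T g f \<in> carrier A" for g f using closed by (simp add: T_def)
  have T0: "T g 0 = \<zero>\<^bsub>A\<^esub>" for g
  proof (cases "g \<in> carrier K \<and> 0 \<in> coeffs g")
    case True
    then have "\<Theta> g (\<lambda>y. 0 * 0 y) = 0 \<odot>\<^bsub>A\<^esub> \<Theta> g 0" using scale[of g 0 0] by simp
    then show ?thesis using True closed by (simp add: T_def zero_fun_def)
  qed (auto simp: T_def)
  define \<theta> where "\<theta> b = A.fin_ext T b" for b
  have \<theta>c: "\<theta> b \<in> carrier A" for b unfolding \<theta>_def using Tc by (intro A.fin_ext_closed)
  have \<theta>m: "\<theta> (mono g f) = \<Theta> g f" if "g \<in> carrier K" "f \<in> coeffs g" for g f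
  proof -
    have "\<theta> (mono g f) = T g f"
      unfolding \<theta>_def mono_def by (rule A.fin_ext_single[of T g f, OF T0 Tc])
    then show ?thesis using that by (simp add: T_def)
  qed
  have \<theta>0: "\<theta> (\<lambda>_ _. 0) = \<zero>\<^bsub>A\<^esub>" by (simp add: \<theta>_def A.fin_ext_def zero_fun_def)
  have \<theta>a: "\<theta> (a \<oplus>\<^bsub>B\<^esub> b) = \<theta> a \<oplus>\<^bsub>A\<^esub> \<theta> b" if a: "a \<in> carrier B" and b: "b \<in> carrier B" for a b
  proof -
    have "T g (a g + b g) = T g (a g) \<oplus>\<^bsub>A\<^esub> T g (b g)" for g
      using add[of g "a g" "b g"] coeffs_B[OF a] coeffs_B[OF b] coeffs_add[of "a g" g "b g"]
      by (simp add: T_def plus_fun_def)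
    then have "A.fin_ext T (\<lambda>g. a g + b g) = A.fin_ext T a \<oplus>\<^bsub>A\<^esub> A.fin_ext T b"
      using B_carrierD(2)[OF a] B_carrierD(2)[OF b] T0 Tc by (intro A.fin_ext_add)
    moreover have "a \<oplus>\<^bsub>B\<^esub> b = (\<lambda>g. a g + b g)" by (simp add: plus_fun_def)
    ultimately show ?thesis by (simp add: \<theta>_def)
  qed
  have \<theta>s: "\<theta> (c \<odot>\<^bsub>B\<^esub> b) = c \<odot>\<^bsub>A\<^esub> \<theta> b" if "b \<in> carrier B" for c b
    using that
  proof (induction b rule: B_induct)
    case zero then show ?case by (simp add: \<theta>0)
  next
    case (add g f b)
    note m = mono_closed[OF add(1,2)]
    have "c \<odot>\<^bsub>B\<^esub> (mono g f \<oplus>\<^bsub>B\<^esub> b) = mono g (\<lambda>y. c * f y) \<oplus>\<^bsub>B\<^esub> c \<odot>\<^bsub>B\<^esub> b"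
      unfolding mono_scale by (rule B.scale_add_right[OF m add(3)])
    then show ?case
      using add \<theta>a[OF mono_closed[OF add(1) coeffs_scale[OF add(2)]] B.scale_closed[OF add(3)]]
        \<theta>a[OF m add(3)] \<theta>m[OF add(1,2)] \<theta>m[OF add(1) coeffs_scale[OF add(2)]] scale[OF add(1,2)] closed[OF add(1,2)] \<theta>c
      by (simp del: B_simps add: A.scale_add_right)
  qed
  have \<theta>star: "\<theta> (star B b) = star A (\<theta> b)" if "b \<in> carrier B" for b
    using that
  proof (induction b rule: B_induct)
    case zero
    then show ?case using B.star_zero by (simp add: \<theta>0)
  next
    case (add g f b)
    note m = mono_closed[OF add(1,2)]
    show ?case
      unfolding B.star_add[OF m add(3)] \<theta>a[OF B.star_closed[OF m] B.star_closed[OF add(3)]] \<theta>a[OF m add(3)]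
        A.star_add[OF \<theta>c \<theta>c] add(4)
      unfolding mono_star[OF add(1,2)] \<theta>m[OF inv_closed[OF add(1)] coeffs_star[OF add(1,2)]] \<theta>m[OF add(1,2)] star[OF add(1,2)] ..
  qed
  have \<theta>mult1: "\<theta> (mono g f \<otimes>\<^bsub>B\<^esub> b) = \<Theta> g f \<otimes>\<^bsub>A\<^esub> \<theta> b"
    if g: "g \<in> carrier K" "f \<in> coeffs g" and b: "b \<in> carrier B" for g f b
    using b
  proof (induction b rule: B_induct)
    case zero
    then show ?case using B.r_null[OF mono_closed[OF g]] A.r_null[OF closed[OF g]] by (simp add: \<theta>0)
  next
    case (add h f' b)
    note m = mono_closed[OF add(1,2)] and mg = mono_closed[OF g]
    show ?case
      unfolding B.r_distr[OF m add(3) mg] \<theta>a[OF B.m_closed[OF mg m] B.m_closed[OF mg add(3)]]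
        \<theta>a[OF m add(3)] A.r_distr[OF \<theta>c \<theta>c closed[OF g]] add(4)
      unfolding mono_mult[OF g add(1,2)] \<theta>m[OF m_closed[OF g(1) add(1)] coeffs_mult[OF g add(1,2)]] \<theta>m[OF add(1,2)] mult[OF g add(1,2)] ..
  qed
  have \<theta>mult: "\<theta> (a \<otimes>\<^bsub>B\<^esub> b) = \<theta> a \<otimes>\<^bsub>A\<^esub> \<theta> b" if a: "a \<in> carrier B" and b: "b \<in> carrier B" for a b
    using a
  proof (induction a rule: B_induct)
    case zero
    then show ?case using B.l_null[OF b] A.l_null[OF \<theta>c] by (simp add: \<theta>0)
  next
    case (add g f a)
    note m = mono_closed[OF add(1,2)]
    show ?case
      unfolding B.l_distr[OF m add(3) b] \<theta>a[OF B.m_closed[OF m b] B.m_closed[OF add(3) b]]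
        \<theta>a[OF m add(3)] A.l_distr[OF closed[OF add(1,2)] \<theta>c \<theta>c] add(4) \<theta>mult1[OF add(1,2) b] \<theta>m[OF add(1,2)] ..
  qed
  have "star_hom B A \<theta>"
    unfolding star_hom_def by (intro ballI conjI allI) (rule \<theta>c \<theta>star \<theta>s \<theta>a \<theta>mult; assumption)+
  then show thesis using that \<theta>m by blast
qed

lemma (in restricted_action) crossed_seminorms_bounded:
  assumes bounded: "\<And>f. f \<in> carrier (CF Y) \<Longrightarrow> \<exists>c\<ge>0. \<forall>y\<in>topspace Y. cmod (f y) \<le> c"
    and b: "b \<in> carrier B"
  shows "\<exists>C. \<forall>p. cstar_seminorm B p \<longrightarrow> (\<forall>r\<in>{}. p r = 0) \<longrightarrow> p b \<le> C"
  using b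
proof (induction b rule: B_induct)
  case zero
  have "p (\<lambda>_ _. 0) \<le> 0" if p: "cstar_seminorm B p" for p
  proof -
    interpret P: seminormed_star_algebra B p
      by (intro seminormed_star_algebra.intro seminormed_star_algebra_axioms.intro star_algebra_B p)
    show ?thesis using P.N_zero by simp
  qed
  then show ?case by blast
next
  case (add g f b)
  then obtain C where C: "\<And>p. cstar_seminorm B p \<Longrightarrow> p b \<le> C" by auto
  obtain c where c: "c \<ge> 0" "\<And>y. y \<in> topspace Y \<Longrightarrow> cmod (f y) \<le> c"
    using bounded[of f] add(2) by (auto simp: coeffs_def)
  have "p (mono g f \<oplus>\<^bsub>B\<^esub> b) \<le> c + C" if p: "cstar_seminorm B p" for p
  proof -
    interpret P: seminormed_star_algebra B p
      by (intro seminormed_star_algebra.intro seminormed_star_algebra_axioms.intro star_algebra_B p)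
    show ?thesis
      using P.N_triangle[OF mono_closed[OF add(1,2)] add(3)] C[OF p] mono_seminorm_le[OF p add(1,2) c] by linarith
  qed
  then show ?case by blast
qed

section \<open>The partial action on the Cantor space\<close>

definition shift :: "(real \<times> int) \<times> int \<Rightarrow> real" where "shift g = fst (fst g)"
definition scaling :: "(real \<times> int) \<times> int \<Rightarrow> int" where "scaling g = snd (fst g)"
definition sheet_shift :: "(real \<times> int) \<times> int \<Rightarrow> int" where "sheet_shift g = snd g"

lemma group_elem_simps [simp]:
  "shift ((r, j), p) = r" "scaling ((r, j), p) = j" "sheet_shift ((r, j), p) = p"
  by (simp_all add: shift_def scaling_def sheet_shift_def)

lemma beta_eq:
  "beta n g y = (Pt (val (fst y) / real n powi scaling g + shift g) (side (fst y)), snd y + sheet_shift g)"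
  by (cases g rule: prod.exhaust; cases "fst g"; cases y; cases "fst y") auto

locale cantor_action = nadic_base n for n :: nat +
  fixes k :: nat
  assumes k1: "1 \<le> k"
begin

abbreviation "H \<equiv> H_group n"
abbreviation "Y \<equiv> Y_space n k"

lemma H_carrier: "g \<in> carrier H \<longleftrightarrow> shift g \<in> nadic n"
  by (cases g rule: prod.exhaust; cases "fst g")
    (auto simp: H_group_def G_group_def DirProd_def integer_group_def)

lemma H_mult:
  "g \<otimes>\<^bsub>H\<^esub> h = ((shift h / real n powi scaling g + shift g, scaling g + scaling h),
     sheet_shift g + sheet_shift h)"
  by (cases g rule: prod.exhaust; cases "fst g"; cases h rule: prod.exhaust; cases "fst h")
    (auto simp: H_group_def G_group_def DirProd_def integer_group_def)

lemma H_one: "\<one>\<^bsub>H\<^esub> = ((0, 0), 0)"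
  by (simp add: H_group_def G_group_def DirProd_def integer_group_def)

lemma npowi_pos: "0 < real n powi j"
  using n_pos by (simp add: zero_less_power_int)

lemma npowi_add: "real n powi (i + j) = real n powi i * real n powi j"
  using n_pos by (intro power_int_add) simp

lemma npowi_uminus: "real n powi (- j) = 1 / real n powi j"
  by (simp add: power_int_minus divide_inverse)

lemma nadic_div_powi: "x \<in> nadic n \<Longrightarrow> x / real n powi j \<in> nadic n"
  using nadic_scale[of x "- j"] by (simp add: npowi_uminus)

definition H_inv :: "(real \<times> int) \<times> int \<Rightarrow> (real \<times> int) \<times> int" where
  "H_inv g = ((- (shift g * real n powi scaling g), - scaling g), - sheet_shift g)"

lemma H_inv_left: "H_inv g \<otimes>\<^bsub>H\<^esub> g = \<one>\<^bsub>H\<^esub>"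
  by (simp add: H_inv_def H_mult H_one npowi_uminus)

lemma H_inv_closed: "g \<in> carrier H \<Longrightarrow> H_inv g \<in> carrier H"
  by (simp add: H_carrier H_inv_def nadic_uminus nadic_scale)

lemma group_H: "group H"
proof (rule groupI)
  fix x y z assume "x \<in> carrier H" "y \<in> carrier H"
  then show "x \<otimes>\<^bsub>H\<^esub> y \<in> carrier H"
    by (simp add: H_carrier H_mult nadic_add nadic_div_powi)
  show "x \<otimes>\<^bsub>H\<^esub> y \<otimes>\<^bsub>H\<^esub> z = x \<otimes>\<^bsub>H\<^esub> (y \<otimes>\<^bsub>H\<^esub> z)"
    using npowi_pos[of "scaling x"] npowi_pos[of "scaling y"]
    by (simp add: H_mult npowi_add add_divide_distrib ac_simps)
next
  show "\<one>\<^bsub>H\<^esub> \<in> carrier H" using nadic_of_int[of 0] by (simp add: H_carrier H_one)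
next
  fix x assume "x \<in> carrier H"
  show "\<one>\<^bsub>H\<^esub> \<otimes>\<^bsub>H\<^esub> x = x" by (cases x rule: prod.exhaust; cases "fst x") (auto simp: H_mult H_one)
  show "\<exists>y\<in>carrier H. y \<otimes>\<^bsub>H\<^esub> x = \<one>\<^bsub>H\<^esub>"
    using H_inv_left H_inv_closed \<open>x \<in> carrier H\<close> by blast
qed

lemma inv_H: "g \<in> carrier H \<Longrightarrow> inv\<^bsub>H\<^esub> g = H_inv g"
  using group.inv_equality[OF group_H H_inv_left] H_inv_closed by blast

lemma beta_one: "beta n \<one>\<^bsub>H\<^esub> y = y"
  by (cases y; cases "fst y") (auto simp: beta_eq H_one)

lemma beta_mult: "beta n (g \<otimes>\<^bsub>H\<^esub> h) y = beta n g (beta n h y)"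
  using npowi_pos[of "scaling g"] npowi_pos[of "scaling h"]
  by (simp add: beta_eq H_mult npowi_add add_divide_distrib ac_simps)

text \<open>
  \<open>g\<close> is adapted to level \<open>M\<close> if it carries cylinders of level \<open>M - scaling g\<close> to cylinders of level \<open>M\<close>;
  every element of the group is adapted to all large levels.
\<close>
definition adapted :: "(real \<times> int) \<times> int \<Rightarrow> nat \<Rightarrow> bool" where
  "adapted g M \<longleftrightarrow> scaling g \<le> int M \<and> (\<exists>m. shift g * real n ^ M = of_int m)"

definition src_level :: "(real \<times> int) \<times> int \<Rightarrow> nat \<Rightarrow> nat" where
  "src_level g M = nat (int M - scaling g)"

definition offset :: "(real \<times> int) \<times> int \<Rightarrow> nat \<Rightarrow> int" where
  "offset g M = \<lfloor>shift g * real n ^ M\<rfloor>"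

lemma offset: "adapted g M \<Longrightarrow> shift g * real n ^ M = of_int (offset g M)"
  by (auto simp: adapted_def offset_def)

lemma npow_src_level:
  assumes "adapted g M" shows "real n ^ src_level g M = real n ^ M / real n powi scaling g"
proof -
  have e: "int (src_level g M) = int M + - scaling g" using assms by (simp add: src_level_def adapted_def)
  have "real n ^ src_level g M = real n powi (int (src_level g M))" by simp
  also have "\<dots> = real n ^ M / real n powi scaling g" unfolding e npowi_add npowi_uminus by simp
  finally show ?thesis .
qed

lemma adapted_mono: "adapted g M \<Longrightarrow> M \<le> L \<Longrightarrow> adapted g L"
  using nadic_common unfolding adapted_def by fastforce

lemma adapted_exists:
  assumes "g \<in> carrier H" shows "\<exists>M0. \<forall>M\<ge>M0. adapted g M"
proof -
  obtain M m where "shift g * real n ^ M = of_int m" using assms unfolding H_carrier nadic_iff by blast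
  then have "shift g * real n ^ max M (nat (scaling g)) = of_int (m * int n ^ (max M (nat (scaling g)) - M))"
    by (rule nadic_common) simp
  moreover have "scaling g \<le> int (max M (nat (scaling g)))" by linarith
  ultimately have "adapted g (max M (nat (scaling g)))" unfolding adapted_def by blast
  then show ?thesis using adapted_mono by blast
qed

lemma adapted_one: "adapted \<one>\<^bsub>H\<^esub> M" and src_level_one: "src_level \<one>\<^bsub>H\<^esub> M = M"
  using exI[of "\<lambda>m. 0 = real_of_int m" 0] by (auto simp: adapted_def src_level_def H_one)

lemma offset_inv:
  assumes g: "g \<in> carrier H" and M: "adapted g M"
  shows "shift (inv\<^bsub>H\<^esub> g) * real n ^ src_level g M = of_int (- offset g M)"
proof -
  have cancel: "(a * p) * (q / p) = a * q" if "p > 0" for a p q :: real using that by simp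
  have "shift (inv\<^bsub>H\<^esub> g) * real n ^ src_level g M =
      - ((shift g * real n powi scaling g) * (real n ^ M / real n powi scaling g))"
    by (simp only: inv_H[OF g] H_inv_def npow_src_level[OF M] group_elem_simps minus_mult_left)
  then show ?thesis by (simp only: cancel[OF npowi_pos] offset[OF M] of_int_minus)
qed

lemma adapted_inv:
  assumes g: "g \<in> carrier H" and M: "adapted g M"
  shows "adapted (inv\<^bsub>H\<^esub> g) (src_level g M)" "src_level (inv\<^bsub>H\<^esub> g) (src_level g M) = M"
    "offset (inv\<^bsub>H\<^esub> g) (src_level g M) = - offset g M"
proof -
  have s: "scaling (inv\<^bsub>H\<^esub> g) = - scaling g" by (simp add: inv_H[OF g] H_inv_def)
  show "adapted (inv\<^bsub>H\<^esub> g) (src_level g M)"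
    unfolding adapted_def s using offset_inv[OF g M] M
    by (intro conjI exI[of _ "- offset g M"]) (auto simp: src_level_def adapted_def)
  show "src_level (inv\<^bsub>H\<^esub> g) (src_level g M) = M"
    unfolding src_level_def s using M by (simp add: adapted_def)
  show "offset (inv\<^bsub>H\<^esub> g) (src_level g M) = - offset g M"
    unfolding offset_def[of "inv\<^bsub>H\<^esub> g"] offset_inv[OF g M] by (rule floor_of_int)
qed

lemma adapted_mult:
  assumes g: "adapted g M" and h: "adapted h (src_level g M)"
  shows "adapted (g \<otimes>\<^bsub>H\<^esub> h) M" "src_level (g \<otimes>\<^bsub>H\<^esub> h) M = src_level h (src_level g M)"
proof -
  have "shift (g \<otimes>\<^bsub>H\<^esub> h) * real n ^ M = shift h * real n ^ src_level g M + shift g * real n ^ M"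
    using npowi_pos[of "scaling g"] by (simp add: H_mult npow_src_level[OF g] field_simps)
  also have "\<dots> = of_int (offset h (src_level g M) + offset g M)" using offset[OF g] offset[OF h] by simp
  finally show "adapted (g \<otimes>\<^bsub>H\<^esub> h) M"
    using g h unfolding adapted_def
    by (intro conjI exI[of _ "offset h (src_level g M) + offset g M"]) (simp_all add: H_mult src_level_def)
  show "src_level (g \<otimes>\<^bsub>H\<^esub> h) M = src_level h (src_level g M)"
    using g h by (simp add: src_level_def H_mult adapted_def)
qed

lemma src_level_Suc: "adapted g M \<Longrightarrow> src_level g (Suc M) = Suc (src_level g M)"
  by (simp add: src_level_def adapted_def nat_diff_distrib' Suc_nat_eq_nat_zadd1)

lemma offset_Suc: "adapted g M \<Longrightarrow> offset g (Suc M) = int n * offset g M"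
proof -
  assume M: "adapted g M"
  have "shift g * real n ^ Suc M = of_int (int n * offset g M)" using offset[OF M] by simp
  then show ?thesis unfolding offset_def[of g "Suc M"] by (simp only: floor_of_int)
qed

lemma proper_beta: "g \<in> carrier H \<Longrightarrow> proper_point n (fst (beta n g y)) \<longleftrightarrow> proper_point n (fst y)"
  using nadic_scale_iff[of "val (fst y)" "- scaling g"]
  by (simp add: proper_point_def beta_eq H_carrier nadic_add_iff npowi_uminus)

lemma cyl_index_beta:
  assumes M: "adapted g M"
  shows "cyl_index n M (fst (beta n g y)) = cyl_index n (src_level g M) (fst y) + offset g M"
proof -
  have "(val (fst y) / real n powi scaling g + shift g) * real n ^ M =
      val (fst y) * real n ^ src_level g M + of_int (offset g M)"
    using offset[OF M] npow_src_level[OF M] by (simp add: field_simps)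
  then show ?thesis by (simp add: cyl_index_def beta_eq)
qed

lemma beta_inv_index:
  assumes g: "g \<in> carrier H" and M: "adapted g M"
  shows "cyl_index n (src_level g M) (fst (beta n (inv\<^bsub>H\<^esub> g) y)) = cyl_index n M (fst y) - offset g M"
  using cyl_index_beta[OF adapted_inv(1)[OF g M]] adapted_inv(2,3)[OF g M] by simp

lemma snd_beta: "snd (beta n g y) = snd y + sheet_shift g"
  by (simp add: beta_eq)

lemma sheet_shift_inv: "g \<in> carrier H \<Longrightarrow> sheet_shift (inv\<^bsub>H\<^esub> g) = - sheet_shift g"
  by (simp add: inv_H H_inv_def)

lemma in_Y: "y \<in> topspace Y \<longleftrightarrow> fst y \<in> cantor_points n \<and> 0 \<le> snd y \<and> snd y < int k"
  by (cases y) (auto simp: topspace_Y)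

lemma in_Y_index:
  "y \<in> topspace Y \<longleftrightarrow> proper_point n (fst y) \<and> 0 \<le> cyl_index n M (fst y) \<and>
     cyl_index n M (fst y) < int n ^ M \<and> 0 \<le> snd y \<and> snd y < int k"
  unfolding in_Y cantor_points_index[of _ M] by blast

text \<open>The left end point of the cylinder of level \<open>M\<close> that contains the given point.\<close>
definition base :: "nat \<Rightarrow> point \<times> int \<Rightarrow> point \<times> int" where
  "base M y = (cyl_base n M (cyl_index n M (fst y)), snd y)"

lemma index_base: "cyl_index n (M + L) (fst (base M y)) = cyl_index n M (fst y) * int n ^ L"
  by (simp add: base_def cyl_index_base)

lemma index_base0: "cyl_index n M (fst (base M y)) = cyl_index n M (fst y)"
  using index_base[of M 0 y] by simp

lemma snd_base [simp]: "snd (base M y) = snd y"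
  by (simp add: base_def)

lemma base_base [simp]: "base M (base M y) = base M y"
  by (simp add: base_def cyl_index_base[of M 0, simplified])

lemma base_in_Y: "y \<in> topspace Y \<Longrightarrow> base M y \<in> topspace Y"
  unfolding in_Y_index[of _ M] index_base0 by (simp add: base_def proper_base)

lemma base_Y_iff: "proper_point n (fst y) \<Longrightarrow> base M y \<in> topspace Y \<longleftrightarrow> y \<in> topspace Y"
  unfolding in_Y_index[of _ M] index_base0 by (simp add: base_def proper_base)

lemma base_refine: "base M (base (Suc M) y) = base M y"
proof -
  have "cyl_index n M (fst (base (Suc M) y)) = cyl_index n (Suc M) (fst (base (Suc M) y)) div int n"
    by (simp add: cyl_index_Suc)
  then show ?thesis by (simp add: base_def[of M] index_base0 cyl_index_Suc)
qed

lemma beta_inv_base: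
  assumes g: "g \<in> carrier H" and M: "adapted g M"
  shows "beta n (inv\<^bsub>H\<^esub> g) (base M y) = base (src_level g M) (beta n (inv\<^bsub>H\<^esub> g) y)"
proof -
  let ?a = "cyl_index n M (fst y)"
  have "real_of_int ?a / real n ^ M / real n powi (- scaling g) + - (shift g * real n powi scaling g) =
      real_of_int (?a - offset g M) / real n ^ src_level g M"
    using npow_src_level[OF M] offset[OF M, symmetric] npowi_pos[of "scaling g"] npow_pos[of M]
    by (simp add: npowi_uminus field_simps)
  then have "fst (beta n (inv\<^bsub>H\<^esub> g) (base M y)) = cyl_base n (src_level g M) (?a - offset g M)"
    by (simp add: beta_eq inv_H[OF g] H_inv_def base_def cyl_base_def)
  then show ?thesis
    by (simp add: prod_eq_iff base_def[of "src_level g M"] beta_inv_index[OF g M] snd_beta)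
qed

text \<open>
  The formula for \<open>\<beta>\<close> makes sense on the whole doubled line, where it defines an action of the group.
  A translate of \<open>f\<close> by \<open>g\<close> oscillates on the cylinders of level \<open>L\<close> as little as \<open>f\<close> does on those of
  level \<open>src_level g L\<close>.
\<close>
lemma H_restricted_action: "restricted_action H (beta n) Y"
proof (intro restricted_action.intro restricted_action_axioms.intro)
  show "group H" by (rule group_H)
  show "beta n \<one>\<^bsub>H\<^esub> y = y" for y by (rule beta_one)
  show "beta n (g \<otimes>\<^bsub>H\<^esub> h) y = beta n g (beta n h y)" for g h y by (rule beta_mult)
  fix g f assume g: "g \<in> carrier H" and f: "f \<in> carrier (CF Y)"
  let ?f = "\<lambda>y. if y \<in> topspace Y \<and> beta n (inv\<^bsub>H\<^esub> g) y \<in> topspace Y then f (beta n (inv\<^bsub>H\<^esub> g) y) else 0"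
  have "continuous_map Y euclidean ?f"
    unfolding continuous_iff_oscillation
  proof (intro allI impI)
    fix e :: real assume e: "e > 0"
    obtain M where M: "oscillates_less k f M e"
      using f e by (auto simp: CF_carrier continuous_iff_oscillation)
    obtain M0 where M0: "\<forall>M\<ge>M0. adapted g M" using adapted_exists[OF g] by blast
    define L where "L = max M0 (M + nat (scaling g))"
    have L: "adapted g L" "M \<le> src_level g L" using M0 by (auto simp: L_def src_level_def)
    have osc: "oscillates_less k f (src_level g L) e" by (rule oscillates_less_mono[OF M L(2)])
    have "oscillates_less k ?f L e"
      unfolding oscillates_less_def
    proof (intro ballI impI)
      fix x x' t assume x: "x \<in> cantor_points n" "x' \<in> cantor_points n" "t \<in> {0..<int k}"
        and eq: "cyl_index n L x = cyl_index n L x'"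
      let ?b = "\<lambda>x. beta n (inv\<^bsub>H\<^esub> g) (x, t)"
      have Y: "(x, t) \<in> topspace Y" "(x', t) \<in> topspace Y" using x by (auto simp: topspace_Y)
      have i: "cyl_index n (src_level g L) (fst (?b x)) = cyl_index n (src_level g L) (fst (?b x'))"
        using eq by (simp add: beta_inv_index[OF g L(1)])
      have s: "snd (?b x) = snd (?b x')" by (simp add: snd_beta)
      have p: "proper_point n (fst (?b x))" "proper_point n (fst (?b x'))"
        using x group.inv_closed[OF group_H g] by (simp_all add: proper_beta cantor_points_iff)
      have iff: "?b x \<in> topspace Y \<longleftrightarrow> ?b x' \<in> topspace Y"
        unfolding in_Y_index[of _ "src_level g L"] using i s p by simp
      show "cmod (?f (x, t) - ?f (x', t)) < e"
      proof (cases "?b x \<in> topspace Y")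
        case True
        have "cmod (f (fst (?b x), snd (?b x)) - f (fst (?b x'), snd (?b x))) < e"
          using i True iff[THEN iffD1, OF True] unfolding in_Y
          by (intro osc[unfolded oscillates_less_def, rule_format]) simp_all
        moreover have "(fst (?b x'), snd (?b x)) = ?b x'" unfolding s by (rule prod.collapse)
        ultimately have "cmod (f (?b x) - f (?b x')) < e" by (simp only: prod.collapse)
        then show ?thesis using True iff[THEN iffD1, OF True] Y by (simp only: simp_thms if_True)
      next
        case False
        then have "?b x' \<notin> topspace Y" using iff by (simp only: simp_thms)
        then show ?thesis using False e by (simp only: simp_thms if_False diff_self norm_zero)
      qed
    qed
    then show "\<exists>M. oscillates_less k ?f M e" by blast
  qed
  then show "?f \<in> carrier (CF Y)" by (simp add: CF_carrier)
qed

end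

sublocale cantor_action \<subseteq> RA: restricted_action "H_group n" "beta n" "Y_space n k"
  by (rule H_restricted_action)

context cantor_action
begin

lemma B_eq: "RA.B = partial_crossed_star_algebra (CF Y) H (alpha_ran n k) (alpha n k)"
proof -
  have "alpha_ran n k = (\<lambda>g. C0_ideal Y (beta n g ` RA.dom g))" "alpha n k = (\<lambda>g. induced_map (RA.dom g) (beta n g))"
    by (simp_all add: fun_eq_iff alpha_ran_def alpha_def beta_domain_def RA.dom_def)
  then show ?thesis by (simp add: RA.B_def)
qed

lemma in_ran_proper:
  "g \<in> carrier H \<Longrightarrow> y \<in> topspace Y \<Longrightarrow> proper_point n (fst (beta n (inv\<^bsub>H\<^esub> g) y))"
  using proper_beta[OF RA.inv_closed] by (simp add: in_Y cantor_points_iff)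

lemma base_ran_iff:
  assumes g: "g \<in> carrier H" and M: "adapted g M" and y: "y \<in> topspace Y"
  shows "base M y \<in> RA.ran g \<longleftrightarrow> y \<in> RA.ran g"
  using y base_in_Y[OF y] base_Y_iff[OF in_ran_proper[OF g y]] by (simp add: RA.ran_def beta_inv_base[OF g M])

lemma coeffs_ran: "f \<in> RA.coeffs g \<Longrightarrow> f y \<noteq> 0 \<Longrightarrow> y \<in> RA.ran g"
  unfolding RA.coeffs_def by blast

lemma coeffs_diff: "f \<in> RA.coeffs g \<Longrightarrow> f' \<in> RA.coeffs g \<Longrightarrow> (\<lambda>y. f y - f' y) \<in> RA.coeffs g"
  using RA.coeffs_add[of f g "\<lambda>y. (-1) * f' y"] RA.coeffs_scale[of f' g "-1"] by simp

text \<open>Functions that are constant on the cylinders of level \<open>M\<close>.\<close>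
definition step_fun :: "nat \<Rightarrow> (point \<times> int \<Rightarrow> complex) \<Rightarrow> bool" where
  "step_fun M f \<longleftrightarrow> (\<forall>y. f y = (if y \<in> topspace Y then f (base M y) else 0))"

lemma step_funD: "step_fun M f \<Longrightarrow> y \<in> topspace Y \<Longrightarrow> f (base M y) = f y"
  and step_fun_zero: "step_fun M f \<Longrightarrow> y \<notin> topspace Y \<Longrightarrow> f y = 0"
  by (metis step_fun_def)+

lemma step_fun_Suc: "step_fun M f \<Longrightarrow> step_fun (Suc M) f"
  unfolding step_fun_def[of "Suc M"]
  using step_funD[of M f] step_fun_zero[of M f] base_refine[of M] base_in_Y[of _ "Suc M"] by metis

lemma step_fun_closed: "step_fun M f \<Longrightarrow> f \<in> carrier (CF Y)"
proof -
  assume f: "step_fun M f"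
  have "oscillates_less k f M e" if "e > 0" for e
    unfolding oscillates_less_def
  proof (intro ballI impI)
    fix x x' t assume x: "x \<in> cantor_points n" "x' \<in> cantor_points n" "t \<in> {0..<int k}"
      "cyl_index n M x = cyl_index n M x'"
    then have "base M (x, t) = base M (x', t)" by (simp add: base_def)
    moreover have "(x, t) \<in> topspace Y" "(x', t) \<in> topspace Y" using x by (auto simp: topspace_Y)
    ultimately have "f (x, t) = f (x', t)"
      using step_funD[OF f, of "(x, t)"] step_funD[OF f, of "(x', t)"] by (simp only:)
    then show "cmod (f (x, t) - f (x', t)) < e" using that by simp
  qed
  then have "continuous_map Y euclidean f" unfolding continuous_iff_oscillation by blast
  then show ?thesis using step_fun_zero[OF f] by (simp add: CF_carrier)
qed

definition approx :: "nat \<Rightarrow> (point \<times> int \<Rightarrow> complex) \<Rightarrow> point \<times> int \<Rightarrow> complex" where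
  "approx M f y = (if y \<in> topspace Y then f (base M y) else 0)"

lemma step_fun_approx: "step_fun M (approx M f)"
  unfolding step_fun_def approx_def using base_in_Y by simp

lemma approx_coeffs:
  assumes g: "g \<in> carrier H" "adapted g M" and f: "f \<in> RA.coeffs g"
  shows "approx M f \<in> RA.coeffs g"
  unfolding RA.coeffs_def
proof (intro CollectI conjI allI impI)
  show "approx M f \<in> carrier (CF Y)" by (rule step_fun_closed[OF step_fun_approx])
  fix y assume "approx M f y \<noteq> 0"
  then have y: "y \<in> topspace Y" "f (base M y) \<noteq> 0" by (auto simp: approx_def split: if_splits)
  then have "base M y \<in> RA.ran g" using f unfolding RA.coeffs_def by blast
  then show "y \<in> RA.ran g" using base_ran_iff[OF g y(1)] by simp
qed

lemma approx_close:
  assumes f: "f \<in> carrier (CF Y)" and e: "e > 0"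
  shows "\<exists>M0. \<forall>M\<ge>M0. \<forall>y\<in>topspace Y. cmod (f y - approx M f y) \<le> e"
proof -
  obtain M0 where M0: "oscillates_less k f M0 e"
    using f e by (auto simp: CF_carrier continuous_iff_oscillation)
  have "cmod (f y - approx M f y) \<le> e" if M: "M0 \<le> M" and y: "y \<in> topspace Y" for M y
  proof -
    have osc: "oscillates_less k f M e" by (rule oscillates_less_mono[OF M0 M])
    have "cmod (f (fst y, snd y) - f (fst (base M y), snd y)) < e"
      using y base_in_Y[OF y, of M] index_base0[of M y] unfolding in_Y
      by (intro osc[unfolded oscillates_less_def, rule_format]) simp_all
    moreover have "(fst (base M y), snd y) = base M y" by (simp add: base_def)
    ultimately show ?thesis using y by (simp add: approx_def)
  qed
  then show ?thesis by blast
qed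

text \<open>The points of level \<open>M\<close>: one left end point for every cylinder.\<close>
definition level_pts :: "nat \<Rightarrow> (point \<times> int) set" where
  "level_pts M = {y \<in> topspace Y. base M y = y}"

lemma level_ptsD: "y \<in> level_pts M \<Longrightarrow> y \<in> topspace Y" "y \<in> level_pts M \<Longrightarrow> base M y = y"
  by (simp_all add: level_pts_def)

lemma base_level: "y \<in> topspace Y \<Longrightarrow> base M y \<in> level_pts M"
  by (simp add: level_pts_def base_in_Y)

lemma finite_level_pts: "finite (level_pts M)"
proof (rule finite_subset)
  show "level_pts M \<subseteq> (\<lambda>(a, t). (cyl_base n M a, t)) ` ({0..<int n ^ M} \<times> {0..<int k})"
  proof
    fix y assume y: "y \<in> level_pts M"
    then have "y = (cyl_base n M (cyl_index n M (fst y)), snd y)" using level_ptsD(2)[OF y] by (simp add: base_def)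
    moreover have "cyl_index n M (fst y) \<in> {0..<int n ^ M}" "snd y \<in> {0..<int k}"
      using level_ptsD(1)[OF y] by (simp_all add: in_Y_index[of _ M])
    ultimately show "y \<in> (\<lambda>(a, t). (cyl_base n M a, t)) ` ({0..<int n ^ M} \<times> {0..<int k})"
      by (intro image_eqI[of _ _ "(cyl_index n M (fst y), snd y)"]) auto
  qed
qed simp

lemma level_pts_eqI:
  assumes "y \<in> level_pts M" "z \<in> level_pts M" "cyl_index n M (fst y) = cyl_index n M (fst z)" "snd y = snd z"
  shows "y = z"
  using level_ptsD(2)[OF assms(1)] level_ptsD(2)[OF assms(2)] assms(3,4) unfolding base_def by metis

lemma beta_inv_level:
  assumes g: "g \<in> carrier H" "adapted g M" and y: "y \<in> level_pts M" "y \<in> RA.ran g"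
  shows "beta n (inv\<^bsub>H\<^esub> g) y \<in> level_pts (src_level g M)"
  using y(2) beta_inv_base[OF g, of y] level_ptsD[OF y(1)] unfolding level_pts_def RA.ran_def by simp

text \<open>
  A continuous function is uniformly close to a step function, which has finitely many values.
\<close>
lemma bounded_CF: "f \<in> carrier (CF Y) \<Longrightarrow> \<exists>c\<ge>0. \<forall>y\<in>topspace Y. cmod (f y) \<le> c"
proof -
  assume f: "f \<in> carrier (CF Y)"
  obtain M where M: "\<forall>y\<in>topspace Y. cmod (f y - approx M f y) \<le> 1" using approx_close[OF f, of 1] by auto
  define c where "c = 1 + (\<Sum>z\<in>level_pts M. cmod (f z))"
  have "cmod (f y) \<le> c" if y: "y \<in> topspace Y" for y
  proof -
    have "cmod (f y) \<le> cmod (f y - approx M f y) + cmod (approx M f y)"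
      using norm_triangle_ineq[of "f y - approx M f y" "approx M f y"] by simp
    also have "cmod (approx M f y) \<le> (\<Sum>z\<in>level_pts M. cmod (f z))"
      using y finite_level_pts base_level[OF y] member_le_sum[of "base M y" "level_pts M" "\<lambda>z. cmod (f z)"]
      by (simp add: approx_def)
    finally show ?thesis using M y by (auto simp: c_def)
  qed
  moreover have "c \<ge> 0" unfolding c_def by (intro add_nonneg_nonneg sum_nonneg) auto
  ultimately show ?thesis by blast
qed

lemma crossed_bounded:
  "b \<in> carrier RA.B \<Longrightarrow> \<exists>C. \<forall>p. cstar_seminorm RA.B p \<longrightarrow> (\<forall>r\<in>{}. p r = 0) \<longrightarrow> p b \<le> C"
  using RA.crossed_seminorms_bounded bounded_CF by blast

lemma level_child:
  assumes y: "y \<in> level_pts M" and d: "d < n"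
  defines "z \<equiv> (cyl_base n (Suc M) (int n * cyl_index n M (fst y) + int d), snd y)"
  shows "z \<in> level_pts (Suc M)" "base M z = y" "cyl_index n (Suc M) (fst z) = int n * cyl_index n M (fst y) + int d"
proof -
  show i: "cyl_index n (Suc M) (fst z) = int n * cyl_index n M (fst y) + int d"
    using cyl_index_base[of "Suc M" 0] by (simp add: z_def)
  have "cyl_index n M (fst z) = (int n * cyl_index n M (fst y) + int d) div int n"
    using cyl_index_Suc[of M "fst z"] i by simp
  also have "\<dots> = cyl_index n M (fst y)" using d by simp
  finally have j: "cyl_index n M (fst z) = cyl_index n M (fst y)" .
  show b: "base M z = y" using j level_ptsD(2)[OF y] by (simp add: base_def z_def)
  have "proper_point n (fst z)" by (simp add: z_def proper_base)
  then have "z \<in> topspace Y" using base_Y_iff[of z M] b level_ptsD(1)[OF y] by simp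
  moreover have "base (Suc M) z = z" using i by (simp add: base_def z_def)
  ultimately show "z \<in> level_pts (Suc M)" by (simp add: level_pts_def)
qed

lemma level_pts_Suc:
  "bij_betw (\<lambda>(y, d). (cyl_base n (Suc M) (int n * cyl_index n M (fst y) + int d), snd y))
     (level_pts M \<times> {..<n}) (level_pts (Suc M))" (is "bij_betw ?c _ _")
  unfolding bij_betw_def
proof (intro conjI equalityI subsetI)
  show "inj_on ?c (level_pts M \<times> {..<n})"
  proof (rule inj_onI)
    fix p p' assume pp: "p \<in> level_pts M \<times> {..<n}" "p' \<in> level_pts M \<times> {..<n}" and eq: "?c p = ?c p'"
    obtain y d y' d' where p: "p = (y, d)" "p' = (y', d')" by (cases p, cases p') blast
    have y: "y \<in> level_pts M" "d < n" and y': "y' \<in> level_pts M" "d' < n" using pp p by auto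
    have eq': "(cyl_base n (Suc M) (int n * cyl_index n M (fst y) + int d), snd y) =
        (cyl_base n (Suc M) (int n * cyl_index n M (fst y') + int d'), snd y')"
      using eq by (simp only: p prod.case)
    have yy: "y = y'"
      using level_child(2)[OF y] level_child(2)[OF y'] unfolding eq' by (rule trans[OF sym])
    have "int n * cyl_index n M (fst y) + int d = int n * cyl_index n M (fst y') + int d'"
      using level_child(3)[OF y] level_child(3)[OF y'] unfolding eq' by (rule trans[OF sym])
    then have "d = d'" unfolding yy by simp
    then show "p = p'" using yy p by simp
  qed
  show "z \<in> level_pts (Suc M)" if "z \<in> ?c ` (level_pts M \<times> {..<n})" for z
    using that level_child(1) by auto
  fix z assume z: "z \<in> level_pts (Suc M)"
  let ?a = "cyl_index n (Suc M) (fst z)"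
  have "int n * cyl_index n M (fst z) + ?a mod int n = ?a"
    unfolding cyl_index_Suc[of M "fst z", symmetric] by (rule mult_div_mod_eq)
  then have "z = ?c (base M z, nat (?a mod int n))"
    using level_ptsD(2)[OF z] n_pos index_base0[of M z] by (simp add: base_def[of "Suc M"])
  moreover have "nat (?a mod int n) < n" using n_pos by (simp add: nat_less_iff)
  ultimately show "z \<in> ?c ` (level_pts M \<times> {..<n})"
    using base_level[OF level_ptsD(1)[OF z], of M] by blast
qed

end

section \<open>The homomorphism into the Cuntz algebra\<close>

locale cantor_cuntz = cantor_action n k + C: cuntz_family A n s
  for A :: "('a, 'm) cstar_ops_scheme" (structure) and n k :: nat and s :: "nat \<Rightarrow> 'a"
begin

text \<open>
  Since \<open>k \<le> n\<^sup>k\<close>, the isometries \<open>S k t\<close> with \<open>t < k\<close> have orthogonal ranges, and they embed the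
  \<open>k\<close> sheets of the space into one.
\<close>
definition W :: "nat \<Rightarrow> point \<times> int \<Rightarrow> 'a" where
  "W M y = C.S k (nat (snd y)) \<otimes> C.S M (nat (cyl_index n M (fst y)))"

lemma W_closed [simp, intro]: "W M y \<in> carrier A" "star A (W M y) \<in> carrier A"
  by (auto simp: W_def C.star_closed)

lemma W_orthonormal:
  assumes y: "y \<in> level_pts M" and z: "z \<in> level_pts M"
  shows "star A (W M y) \<otimes> W M z = (if y = z then \<one> else \<zero>)"
proof -
  have kn: "k \<le> n ^ k" using less_exp[of k] power_mono[OF n2, of k] by linarith
  have rng: "nat (snd x) < n ^ k" "nat (cyl_index n M (fst x)) < n ^ M" "0 \<le> snd x" "0 \<le> cyl_index n M (fst x)"
    if "x \<in> level_pts M" for x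
  proof -
    have x: "0 \<le> snd x" "snd x < int k" "0 \<le> cyl_index n M (fst x)" "cyl_index n M (fst x) < int n ^ M"
      using level_ptsD(1)[OF that] unfolding in_Y_index[of _ M] by simp_all
    have "nat (snd x) < k" using x(1,2) by linarith
    then show "nat (snd x) < n ^ k" using kn by linarith
    show "nat (cyl_index n M (fst x)) < n ^ M" using x(3,4) by (simp add: nat_less_iff)
  qed (use level_ptsD(1)[OF that] in \<open>simp_all add: in_Y_index[of _ M]\<close>)
  have "star A (W M y) \<otimes> W M z = star A (C.S M (nat (cyl_index n M (fst y)))) \<otimes>
      (star A (C.S k (nat (snd y))) \<otimes> C.S k (nat (snd z))) \<otimes> C.S M (nat (cyl_index n M (fst z)))"
    unfolding W_def by (simp add: C.star_mult C.m_assoc)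
  also have "\<dots> = (if nat (snd y) = nat (snd z) \<and>
      nat (cyl_index n M (fst y)) = nat (cyl_index n M (fst z)) then \<one> else \<zero>)"
    unfolding C.S_orthonormal[OF rng(1)[OF y] rng(1)[OF z]]
    using C.S_orthonormal[OF rng(2)[OF y] rng(2)[OF z]] by (cases "nat (snd y) = nat (snd z)") simp_all
  also have "nat (snd y) = nat (snd z) \<and> nat (cyl_index n M (fst y)) = nat (cyl_index n M (fst z)) \<longleftrightarrow> y = z"
    using level_pts_eqI[OF y z] rng(3,4)[OF y] rng(3,4)[OF z] by auto
  finally show ?thesis .
qed

abbreviation child :: "nat \<Rightarrow> point \<times> int \<Rightarrow> nat \<Rightarrow> point \<times> int" where
  "child M y d \<equiv> (cyl_base n (Suc M) (int n * cyl_index n M (fst y) + int d), snd y)"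

text \<open>
  Cutting two cylinders into their children replaces the matrix unit \<open>W M y (W L z)\<^sup>*\<close> by the sum of the
  matrix units of corresponding children, which is the relation between the generators.
\<close>
lemma W_refine:
  assumes y: "y \<in> level_pts M" and z: "z \<in> level_pts L"
  shows "(\<Oplus>d\<in>{..<n}. W (Suc M) (child M y d) \<otimes> star A (W (Suc L) (child L z d))) = W M y \<otimes> star A (W L z)"
proof -
  let ?a = "nat (cyl_index n M (fst y))" and ?b = "nat (cyl_index n L (fst z))"
  let ?T = "C.S k (nat (snd y))" and ?U = "C.S k (nat (snd z))"
  have nn: "0 \<le> cyl_index n M (fst y)" "0 \<le> cyl_index n L (fst z)"
    using level_ptsD(1)[OF y] level_ptsD(1)[OF z] by (simp_all add: in_Y_index[of y M] in_Y_index[of z L])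
  have nat_digit: "nat (int n * a + int d) = n * nat a + d" if "0 \<le> a" for a d
  proof -
    have "int n * a + int d = int (n * nat a + d)" using that by simp
    then show ?thesis by (simp only: nat_int)
  qed
  have "(\<Oplus>d\<in>{..<n}. W (Suc M) (child M y d) \<otimes> star A (W (Suc L) (child L z d))) =
      (\<Oplus>d\<in>{..<n}. ?T \<otimes> (C.S (Suc M) (n * ?a + d) \<otimes> star A (C.S (Suc L) (n * ?b + d))) \<otimes> star A ?U)"
  proof (rule C.finsum_cong')
    fix d assume "d \<in> {..<n}"
    then have d: "d < n" by simp
    have i: "nat (cyl_index n (Suc M) (fst (child M y d))) = n * ?a + d"
      "nat (cyl_index n (Suc L) (fst (child L z d))) = n * ?b + d"
      unfolding level_child(3)[OF y d] level_child(3)[OF z d] by (rule nat_digit[OF nn(1)], rule nat_digit[OF nn(2)])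
    show "W (Suc M) (child M y d) \<otimes> star A (W (Suc L) (child L z d)) =
        ?T \<otimes> (C.S (Suc M) (n * ?a + d) \<otimes> star A (C.S (Suc L) (n * ?b + d))) \<otimes> star A ?U"
      unfolding W_def i snd_conv by (simp add: C.star_mult C.m_assoc del: C.S.simps)
  qed (auto simp del: C.S.simps)
  also have "\<dots> = ?T \<otimes> (\<Oplus>d\<in>{..<n}. C.S (Suc M) (n * ?a + d) \<otimes> star A (C.S (Suc L) (n * ?b + d))) \<otimes> star A ?U"
    by (simp add: C.finsum_rdistr C.finsum_ldistr Pi_iff C.finsum_closed del: C.S.simps)
  also have "\<dots> = W M y \<otimes> star A (W L z)"
    unfolding C.S_refine W_def by (simp add: C.star_mult C.m_assoc)
  finally show ?thesis .
qed

text \<open>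
  The level \<open>M\<close> approximation to the image of \<open>f U\<^sup>g\<close>: \<open>g\<close> carries the cylinder of \<open>g\<^sup>-\<^sup>1y\<close> onto the cylinder of
  \<open>y\<close>, and so do the corresponding isometries of the Cuntz algebra with their ranges.
\<close>
definition Theta :: "nat \<Rightarrow> (real \<times> int) \<times> int \<Rightarrow> (point \<times> int \<Rightarrow> complex) \<Rightarrow> 'a" where
  "Theta M g f = (\<Oplus>y\<in>level_pts M. f y \<odot> (W M y \<otimes> star A (W (src_level g M) (beta n (inv\<^bsub>H\<^esub> g) y))))"

lemma Theta_summand [simp]: "c \<odot> (W M y \<otimes> star A (W L z)) \<in> carrier A"
  by (intro C.scale_closed C.m_closed W_closed)

lemma Theta_closed [simp]: "Theta M g f \<in> carrier A"
  unfolding Theta_def by (intro C.finsum_closed) auto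

lemma Theta_cong:
  "(\<And>y. y \<in> level_pts M \<Longrightarrow> f y = f' y) \<Longrightarrow> Theta M g f = Theta M g f'"
  unfolding Theta_def by (intro C.finsum_cong') auto

lemma Theta_add: "Theta M g (\<lambda>y. f y + f' y) = Theta M g f \<oplus> Theta M g f'"
  unfolding Theta_def using C.scale_add_left[OF C.m_closed[OF W_closed(1) W_closed(2)]]
  by (simp add: C.finsum_addf)

lemma Theta_scale: "Theta M g (\<lambda>y. c * f y) = c \<odot> Theta M g f"
  unfolding Theta_def
  by (simp add: C.scale_finsum[OF finite_level_pts] C.scale_scale)

lemma Theta_diff: "Theta M g (\<lambda>y. f y - f' y) = Theta M g f \<ominus> Theta M g f'"
proof -
  have "(\<lambda>y. f y - f' y) = (\<lambda>y. f y + (-1) * f' y)" by auto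
  then show ?thesis
    using Theta_add[of M g f "\<lambda>y. (-1) * f' y"] Theta_scale[of M g "-1" f']
    by (simp only: C.scale_minus_one[OF Theta_closed] C.minus_eq)
qed

text \<open>
  By orthonormality only the terms with matching inner cylinders survive in the product of the two sums.
\<close>
lemma Theta_mult:
  assumes g: "g \<in> carrier H" "adapted g M" "f \<in> RA.coeffs g"
    and h: "h \<in> carrier H" "adapted h (src_level g M)" "f' \<in> RA.coeffs h"
  shows "Theta M g f \<otimes> Theta (src_level g M) h f' =
    Theta M (g \<otimes>\<^bsub>H\<^esub> h) (\<lambda>y. f y * f' (beta n (inv\<^bsub>H\<^esub> g) y))"
proof -
  let ?L = "src_level g M" and ?J = "src_level h (src_level g M)"
  let ?b = "beta n (inv\<^bsub>H\<^esub> g)" and ?c = "beta n (inv\<^bsub>H\<^esub> h)"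
  let ?F = "\<lambda>y. f y \<odot> (W M y \<otimes> star A (W ?L (?b y)))"
  let ?G = "\<lambda>z. f' z \<odot> (W ?L z \<otimes> star A (W ?J (?c z)))"
  have "Theta M g f \<otimes> Theta ?L h f' = (\<Oplus>y\<in>level_pts M. ?F y \<otimes> Theta ?L h f')"
    unfolding Theta_def[of M g f] by (rule C.finsum_ldistr) (auto simp: finite_level_pts)
  also have "\<dots> = (\<Oplus>y\<in>level_pts M. (f y * f' (?b y)) \<odot> (W M y \<otimes> star A (W ?J (?c (?b y)))))"
  proof (rule C.finsum_cong')
    fix y assume y: "y \<in> level_pts M"
    show "?F y \<otimes> Theta ?L h f' = (f y * f' (?b y)) \<odot> (W M y \<otimes> star A (W ?J (?c (?b y))))"
    proof (cases "f y = 0")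
      case True
      then show ?thesis by (simp add: C.scale_zero_left)
    next
      case False
      then have "y \<in> RA.ran g" by (rule coeffs_ran[OF g(3)])
      then have bL: "?b y \<in> level_pts ?L" using beta_inv_level[OF g(1,2) y] by simp
      have "?F y \<otimes> Theta ?L h f' = (\<Oplus>z\<in>level_pts ?L. ?F y \<otimes> ?G z)"
        unfolding Theta_def by (rule C.finsum_rdistr) (auto simp: finite_level_pts)
      also have "\<dots> = ?F y \<otimes> ?G (?b y)"
      proof (rule C.finsum_single[OF finite_level_pts bL])
        fix z assume z: "z \<in> level_pts ?L" "z \<noteq> ?b y"
        have "?F y \<otimes> ?G z = (f' z * f y) \<odot> (W M y \<otimes> (star A (W ?L (?b y)) \<otimes> W ?L z) \<otimes> star A (W ?J (?c z)))"
          by (simp add: C.scale_mult_left C.scale_mult_right C.scale_scale C.m_assoc)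
        then show "?F y \<otimes> ?G z = \<zero>" using W_orthonormal[OF bL z(1)] z(2) by simp
      qed simp
      also have "\<dots> = (f' (?b y) * f y) \<odot> (W M y \<otimes> (star A (W ?L (?b y)) \<otimes> W ?L (?b y)) \<otimes> star A (W ?J (?c (?b y))))"
        by (simp add: C.scale_mult_left C.scale_mult_right C.scale_scale C.m_assoc)
      also have "\<dots> = (f y * f' (?b y)) \<odot> (W M y \<otimes> star A (W ?J (?c (?b y))))"
        using W_orthonormal[OF bL bL] by (simp add: mult.commute)
      finally show ?thesis .
    qed
  qed auto
  also have "\<dots> = Theta M (g \<otimes>\<^bsub>H\<^esub> h) (\<lambda>y. f y * f' (?b y))"
    unfolding Theta_def adapted_mult(2)[OF g(2) h(2)] RA.inv_mult_group[OF g(1) h(1)] beta_mult ..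
  finally show ?thesis .
qed

lemma Theta_star:
  assumes g: "g \<in> carrier H" "adapted g M" "f \<in> RA.coeffs g"
  shows "star A (Theta M g f) = Theta (src_level g M) (inv\<^bsub>H\<^esub> g) (\<lambda>y. cnj (f (beta n g y)))"
proof -
  let ?L = "src_level g M"
  let ?b = "beta n (inv\<^bsub>H\<^esub> g)"
  let ?G = "\<lambda>z. cnj (f (beta n g z)) \<odot> (W ?L z \<otimes> star A (W M (beta n g z)))"
  define I where "I = {y \<in> level_pts M. f y \<noteq> 0}"
  define J where "J = {z \<in> level_pts ?L. f (beta n g z) \<noteq> 0}"
  have inj: "inj_on ?b I" by (rule RA.inj_act[OF RA.inv_closed[OF g(1)]])
  have J: "J = ?b ` I"
  proof (intro equalityI subsetI)
    fix z assume z: "z \<in> J"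
    let ?y = "beta n g z"
    have ran: "?y \<in> RA.ran g" using z by (intro coeffs_ran[OF g(3)]) (simp add: J_def)
    have zy: "?b ?y = z" using g(1) by simp
    have "?b (base M ?y) = z" unfolding beta_inv_base[OF g(1,2)] zy using z level_ptsD(2) by (simp add: J_def)
    then have "base M ?y = ?y" using RA.act_inv(1)[OF g(1), of "base M ?y"] by simp
    then have "?y \<in> I" using ran z by (simp add: I_def J_def level_pts_def RA.ran_def)
    then show "z \<in> ?b ` I" using zy by (intro image_eqI[of _ _ ?y]) simp_all
  next
    fix z assume "z \<in> ?b ` I"
    then obtain y where y: "z = ?b y" "y \<in> level_pts M" "f y \<noteq> 0" by (auto simp: I_def)
    then have "y \<in> RA.ran g" by (intro coeffs_ran[OF g(3)])
    then show "z \<in> J" using beta_inv_level[OF g(1,2) y(2)] y g(1) by (simp add: J_def)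
  qed
  have "star A (Theta M g f) = (\<Oplus>y\<in>level_pts M. cnj (f y) \<odot> (W ?L (?b y) \<otimes> star A (W M y)))"
    unfolding Theta_def
    by (simp add: C.star_finsum[OF finite_level_pts] C.star_scale C.star_mult C.star_star)
  also have "\<dots> = (\<Oplus>y\<in>I. cnj (f y) \<odot> (W ?L (?b y) \<otimes> star A (W M y)))"
    by (rule C.finsum_mono_neutral[symmetric]) (auto simp: I_def finite_level_pts)
  also have "\<dots> = (\<Oplus>y\<in>I. ?G (?b y))"
    using g(1) by (intro C.finsum_cong') auto
  also have "\<dots> = (\<Oplus>z\<in>J. ?G z)"
    unfolding J by (rule C.finsum_reindex[symmetric, OF _ inj]) auto
  also have "\<dots> = (\<Oplus>z\<in>level_pts ?L. ?G z)"
    by (rule C.finsum_mono_neutral) (auto simp: J_def finite_level_pts)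
  also have "\<dots> = Theta ?L (inv\<^bsub>H\<^esub> g) (\<lambda>y. cnj (f (beta n g y)))"
    unfolding Theta_def adapted_inv(2)[OF g(1,2)] using g(1) by simp
  finally show ?thesis .
qed

text \<open>
  A step function has the same value at all children of a cylinder, so the refinement of the matrix
  units does not change the sum.
\<close>
lemma Theta_step_Suc:
  assumes f: "step_fun M f" and g: "g \<in> carrier H" "adapted g M" "f \<in> RA.coeffs g"
  shows "Theta (Suc M) g f = Theta M g f"
proof -
  let ?L = "src_level g M"
  let ?b = "beta n (inv\<^bsub>H\<^esub> g)"
  let ?F = "\<lambda>y. f y \<odot> (W (Suc M) y \<otimes> star A (W (Suc ?L) (?b y)))"
  let ?c = "\<lambda>(y, d). child M y d"
  note bij = level_pts_Suc[of M, unfolded bij_betw_def]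
  have "Theta (Suc M) g f = (\<Oplus>y\<in>level_pts (Suc M). ?F y)"
    unfolding Theta_def src_level_Suc[OF g(2)] ..
  also have "\<dots> = (\<Oplus>y\<in>?c ` (level_pts M \<times> {..<n}). ?F y)"
    using bij by simp
  also have "\<dots> = (\<Oplus>p\<in>level_pts M \<times> {..<n}. ?F (?c p))"
    using bij by (intro C.finsum_reindex) auto
  also have "\<dots> = (\<Oplus>y\<in>level_pts M. \<Oplus>d\<in>{..<n}. ?F (child M y d))"
    by (subst C.finsum_Times) (auto simp: finite_level_pts case_prod_beta)
  also have "\<dots> = (\<Oplus>y\<in>level_pts M. f y \<odot> (W M y \<otimes> star A (W ?L (?b y))))"
  proof (rule C.finsum_cong')
    fix y assume y: "y \<in> level_pts M"
    have fc: "f (child M y d) = f y" if "d < n" for d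
      using step_funD[OF f level_ptsD(1)[OF level_child(1)[OF y that]]] level_child(2)[OF y that] by simp
    show "(\<Oplus>d\<in>{..<n}. ?F (child M y d)) = f y \<odot> (W M y \<otimes> star A (W ?L (?b y)))"
    proof (cases "f y = 0")
      case True
      then have "(\<Oplus>d\<in>{..<n}. ?F (child M y d)) = (\<Oplus>d\<in>{..<n}. \<zero>)"
        using fc by (intro C.finsum_cong') auto
      then show ?thesis using True by simp
    next
      case False
      then have "y \<in> RA.ran g" by (rule coeffs_ran[OF g(3)])
      then have bL: "?b y \<in> level_pts ?L" using beta_inv_level[OF g(1,2) y] by simp
      have bc: "?b (child M y d) = child ?L (?b y) d" if d: "d < n" for d
      proof -
        let ?z = "child M y d"
        have ad: "adapted g (Suc M)" using adapted_mono[OF g(2)] by simp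
        have i: "cyl_index n (Suc ?L) (fst (?b ?z)) = int n * cyl_index n ?L (fst (?b y)) + int d"
          using beta_inv_index[OF g(1) ad, of ?z] beta_inv_index[OF g(1,2), of y] level_child(3)[OF y d]
          by (simp add: src_level_Suc[OF g(2)] offset_Suc[OF g(2)] right_diff_distrib)
        have "?b ?z = ?b (base (Suc M) ?z)" using level_ptsD(2)[OF level_child(1)[OF y d]] by simp
        also have "\<dots> = base (Suc ?L) (?b ?z)"
          using beta_inv_base[OF g(1) ad] src_level_Suc[OF g(2)] by simp
        also have "\<dots> = child ?L (?b y) d"
          unfolding base_def i by (simp add: snd_beta)
        finally show ?thesis .
      qed
      have "(\<Oplus>d\<in>{..<n}. ?F (child M y d)) =
          (\<Oplus>d\<in>{..<n}. f y \<odot> (W (Suc M) (child M y d) \<otimes> star A (W (Suc ?L) (child ?L (?b y) d))))"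
      proof (rule C.finsum_cong')
        fix d assume "d \<in> {..<n}"
        then have d: "d < n" by simp
        show "?F (child M y d) = f y \<odot> (W (Suc M) (child M y d) \<otimes> star A (W (Suc ?L) (child ?L (?b y) d)))"
          unfolding fc[OF d] bc[OF d] ..
      qed auto
      also have "\<dots> = f y \<odot> (\<Oplus>d\<in>{..<n}. W (Suc M) (child M y d) \<otimes> star A (W (Suc ?L) (child ?L (?b y) d)))"
        by (subst C.scale_finsum) auto
      finally show ?thesis unfolding W_refine[OF y bL] .
    qed
  qed auto
  finally show ?thesis unfolding Theta_def .
qed

lemma Theta_step:
  assumes f: "step_fun M f" and g: "g \<in> carrier H" "adapted g M" "f \<in> RA.coeffs g" and L: "M \<le> L"
  shows "Theta L g f = Theta M g f"
proof -
  have "step_fun L f \<and> Theta L g f = Theta M g f"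
    using L
  proof (induction L rule: dec_induct)
    case base then show ?case using f by simp
  next
    case (step i)
    have "adapted g i" using adapted_mono[OF g(2) step(1)] .
    then show ?case using step step_fun_Suc Theta_step_Suc[OF _ g(1) _ g(3), of i] by simp
  qed
  then show ?thesis by simp
qed

lemma Theta_hom_CF: "star_hom (CF Y) A (Theta M \<one>\<^bsub>H\<^esub>)"
  unfolding star_hom_def
proof (intro ballI conjI allI)
  fix f assume f: "f \<in> carrier (CF Y)"
  have f1: "f \<in> RA.coeffs \<one>\<^bsub>H\<^esub>" using f by (simp add: RA.coeffs_one)
  show "Theta M \<one>\<^bsub>H\<^esub> (star (CF Y) f) = star A (Theta M \<one>\<^bsub>H\<^esub> f)"
    using Theta_star[OF RA.one_closed adapted_one f1, of M] by (simp add: src_level_one beta_one)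
  show "Theta M \<one>\<^bsub>H\<^esub> (c \<odot>\<^bsub>CF Y\<^esub> f) = c \<odot> Theta M \<one>\<^bsub>H\<^esub> f" for c
    by (simp add: Theta_scale)
  fix f' assume "f' \<in> carrier (CF Y)"
  then have f'1: "f' \<in> RA.coeffs \<one>\<^bsub>H\<^esub>" by (simp add: RA.coeffs_one)
  show "Theta M \<one>\<^bsub>H\<^esub> (f \<oplus>\<^bsub>CF Y\<^esub> f') = Theta M \<one>\<^bsub>H\<^esub> f \<oplus> Theta M \<one>\<^bsub>H\<^esub> f'"
    by (simp add: Theta_add)
  show "Theta M \<one>\<^bsub>H\<^esub> (f \<otimes>\<^bsub>CF Y\<^esub> f') = Theta M \<one>\<^bsub>H\<^esub> f \<otimes> Theta M \<one>\<^bsub>H\<^esub> f'"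
    using Theta_mult[OF RA.one_closed adapted_one f1 RA.one_closed adapted_one f'1, of M]
    by (simp add: src_level_one beta_one)
qed simp

text \<open>
  By the C*-identity it is enough to estimate the image of \<open>f f\<^sup>*\<close> under the homomorphism that the level
  \<open>M\<close> approximation induces on the continuous functions.
\<close>
lemma Theta_norm:
  assumes g: "g \<in> carrier H" "adapted g M" "f \<in> RA.coeffs g"
    and c: "0 \<le> c" "\<And>y. y \<in> topspace Y \<Longrightarrow> cmod (f y) \<le> c"
  shows "cnorm A (Theta M g f) \<le> c"
proof -
  define r where "r y = f y * cnj (f y)" for y
  have f: "f \<in> carrier (CF Y)" using g(3) by (simp add: RA.coeffs_def)
  have r: "r \<in> carrier (CF Y)" unfolding r_def by (intro CF_mult CF_cnj f)
  have "Theta M g f \<otimes> star A (Theta M g f) = Theta M \<one>\<^bsub>H\<^esub> r"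
    unfolding Theta_star[OF g]
      Theta_mult[OF g RA.inv_closed[OF g(1)] adapted_inv(1)[OF g(1,2)] RA.coeffs_star[OF g(1,3)]]
    using g(1) by (simp add: r_def[abs_def])
  then have "(cnorm A (Theta M g f))\<^sup>2 = cnorm A (Theta M \<one>\<^bsub>H\<^esub> r)"
    using C.N_cstar'[OF Theta_closed[of M g f]] by (simp only:)
  also have "\<dots> \<le> c\<^sup>2"
  proof (rule cont_fun_seminorm_le[OF cstar_seminorm_pullback[OF Theta_hom_CF C.cstar_seminorm_cnorm star_algebra_CF] r])
    fix y assume "y \<in> topspace Y"
    then show "cmod (r y) \<le> c\<^sup>2"
      using mult_mono[OF c(2) c(2) c(1)] by (simp add: r_def norm_mult power2_eq_square)
  qed simp
  finally show ?thesis using c(1) by (rule power2_le_imp_le)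
qed

text \<open>
  On a step function close to \<open>f\<close> the approximations are eventually constant, and by the norm estimate the
  error is uniform in the level.
\<close>
lemma Theta_cauchy:
  assumes g: "g \<in> carrier H" "f \<in> RA.coeffs g"
  shows "cauchy_in A (cnorm A) (\<lambda>M. Theta M g f)"
proof (rule C.cauchy_inI)
  fix e :: real assume e: "e > 0"
  have f: "f \<in> carrier (CF Y)" using g(2) by (simp add: RA.coeffs_def)
  obtain M0 where M0: "\<forall>M\<ge>M0. \<forall>y\<in>topspace Y. cmod (f y - approx M f y) \<le> e / 3"
    using approx_close[OF f, of "e / 3"] e by auto
  obtain M1 where M1: "\<forall>M\<ge>M1. adapted g M" using adapted_exists[OF g(1)] by blast
  define M where "M = max M0 M1"
  have M: "adapted g M" "\<And>y. y \<in> topspace Y \<Longrightarrow> cmod (f y - approx M f y) \<le> e / 3"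
    using M0 M1 by (auto simp: M_def)
  note ac = approx_coeffs[OF g(1) M(1) g(2)]
  have near: "cnorm A (Theta L g f \<ominus> Theta M g f) \<le> e / 3" if L: "M \<le> L" for L
  proof -
    have "Theta M g f = Theta M g (approx M f)"
    proof (rule Theta_cong)
      fix y assume y: "y \<in> level_pts M"
      show "f y = approx M f y" using level_ptsD[OF y] by (simp add: approx_def)
    qed
    also have "\<dots> = Theta L g (approx M f)"
      using Theta_step[OF step_fun_approx g(1) M(1) ac L] by simp
    finally have "Theta L g f \<ominus> Theta M g f = Theta L g (\<lambda>y. f y - approx M f y)"
      by (simp add: Theta_diff)
    then show ?thesis
      using Theta_norm[OF g(1) adapted_mono[OF M(1) L] coeffs_diff[OF g(2) ac], of "e / 3"] M(2) e by simp
  qed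
  have "cnorm A (Theta i g f \<ominus> Theta j g f) < e" if "M \<le> i" "M \<le> j" for i j
    using C.N_diff_triangle[OF Theta_closed Theta_closed Theta_closed, of i g f j g f M g f]
      C.N_diff_commute[OF Theta_closed Theta_closed, of M g f j g f] near[OF that(1)] near[OF that(2)] e
    by linarith
  then show "\<exists>M. \<forall>i\<ge>M. \<forall>j\<ge>M. cnorm A (Theta i g f \<ominus> Theta j g f) < e" by blast
qed simp

definition Theta_lim :: "(real \<times> int) \<times> int \<Rightarrow> (point \<times> int \<Rightarrow> complex) \<Rightarrow> 'a" where
  "Theta_lim g f = (SOME x. C.tends (\<lambda>M. Theta M g f) x)"

lemma Theta_tends:
  assumes "g \<in> carrier H" "f \<in> RA.coeffs g"
  shows "C.tends (\<lambda>M. Theta M g f) (Theta_lim g f)"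
  unfolding Theta_lim_def using C.cauchy_tends[OF Theta_cauchy[OF assms]] by (rule someI_ex)

lemma Theta_lim_step:
  assumes f: "step_fun M f" and g: "g \<in> carrier H" "adapted g M" "f \<in> RA.coeffs g"
  shows "Theta_lim g f = Theta M g f"
proof -
  have "C.tends (\<lambda>i. Theta i g f) (Theta M g f)"
  proof (rule C.tends_cong[where s = "\<lambda>i. Theta M g f" and M = M])
    show "C.tends (\<lambda>i. Theta M g f) (Theta M g f)" by (rule C.tends_const[OF Theta_closed])
    show "Theta i g f = Theta M g f" if "M \<le> i" for i by (rule Theta_step[OF f g that])
  qed (rule Theta_closed)
  then show ?thesis by (rule C.tends_eq[OF Theta_tends[OF g(1,3)]])
qed

lemma src_level_at_top: "filterlim (src_level g) sequentially sequentially"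
  unfolding filterlim_at_top
proof
  fix K
  show "\<forall>\<^sub>F M in sequentially. K \<le> src_level g M"
    using eventually_ge_at_top[of "K + nat (scaling g)"]
    by eventually_elim (auto simp: src_level_def)
qed

text \<open>
  In the product and the adjoint one of the factors is taken at the level \<open>src_level g M\<close>, which
  tends to infinity with \<open>M\<close>, so the algebraic identities at finite level pass to the limit.
\<close>
theorem crossed_to_cuntz:
  obtains \<theta> where "star_hom RA.B A \<theta>"
    "\<And>M g f. step_fun M f \<Longrightarrow> g \<in> carrier H \<Longrightarrow> adapted g M \<Longrightarrow> f \<in> RA.coeffs g \<Longrightarrow> \<theta> (RA.mono g f) = Theta M g f"
proof (rule RA.crossed_hom_exists[OF C.star_algebra_axioms, of Theta_lim])
  fix g f assume g: "g \<in> carrier H" "f \<in> RA.coeffs g"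
  note t = Theta_tends[OF g]
  show "Theta_lim g f \<in> carrier A" by (rule C.tendsD(2)[OF t])
  show "Theta_lim g (\<lambda>y. c * f y) = c \<odot> Theta_lim g f" for c
    using C.tends_eq[OF Theta_tends[OF g(1) RA.coeffs_scale[OF g(2)]]] C.tends_scale[OF t]
    by (simp add: Theta_scale)
  show "Theta_lim g (\<lambda>y. f y + f' y) = Theta_lim g f \<oplus> Theta_lim g f'" if f': "f' \<in> RA.coeffs g" for f'
    using C.tends_eq[OF Theta_tends[OF g(1) RA.coeffs_add[OF g(2) f']]] C.tends_add[OF t Theta_tends[OF g(1) f']]
    by (simp add: Theta_add)
  obtain M0 where M0: "\<forall>M\<ge>M0. adapted g M" using adapted_exists[OF g(1)] by blast
  show "Theta_lim (inv\<^bsub>H\<^esub> g) (\<lambda>y. cnj (f (beta n g y))) = star A (Theta_lim g f)"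
  proof (rule C.tends_eq)
    show "C.tends (\<lambda>M. Theta (src_level g M) (inv\<^bsub>H\<^esub> g) (\<lambda>y. cnj (f (beta n g y))))
        (Theta_lim (inv\<^bsub>H\<^esub> g) (\<lambda>y. cnj (f (beta n g y))))"
      by (rule C.tends_subseq[OF Theta_tends[OF RA.inv_closed[OF g(1)] RA.coeffs_star[OF g]] src_level_at_top])
    show "C.tends (\<lambda>M. Theta (src_level g M) (inv\<^bsub>H\<^esub> g) (\<lambda>y. cnj (f (beta n g y)))) (star A (Theta_lim g f))"
      by (rule C.tends_cong[OF C.tends_star[OF t], of _ M0]) (use M0 Theta_star[OF g(1) _ g(2)] in simp_all)
  qed
  fix h f' assume h: "h \<in> carrier H" "f' \<in> RA.coeffs h"
  obtain L0 where L0: "\<forall>M\<ge>L0. adapted h M" using adapted_exists[OF h(1)] by blast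
  show "Theta_lim (g \<otimes>\<^bsub>H\<^esub> h) (\<lambda>y. f y * f' (beta n (inv\<^bsub>H\<^esub> g) y)) = Theta_lim g f \<otimes> Theta_lim h f'"
  proof (rule C.tends_eq)
    show "C.tends (\<lambda>M. Theta M (g \<otimes>\<^bsub>H\<^esub> h) (\<lambda>y. f y * f' (beta n (inv\<^bsub>H\<^esub> g) y)))
        (Theta_lim (g \<otimes>\<^bsub>H\<^esub> h) (\<lambda>y. f y * f' (beta n (inv\<^bsub>H\<^esub> g) y)))"
      by (rule Theta_tends[OF RA.m_closed[OF g(1) h(1)] RA.coeffs_mult[OF g h]])
    show "C.tends (\<lambda>M. Theta M (g \<otimes>\<^bsub>H\<^esub> h) (\<lambda>y. f y * f' (beta n (inv\<^bsub>H\<^esub> g) y)))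
        (Theta_lim g f \<otimes> Theta_lim h f')"
    proof (rule C.tends_cong[OF C.tends_mult[OF t C.tends_subseq[OF Theta_tends[OF h] src_level_at_top[of g]]], of _ "max M0 (L0 + nat (scaling g))"])
      fix i assume "max M0 (L0 + nat (scaling g)) \<le> i"
      then have "adapted g i" "adapted h (src_level g i)" using M0 L0 by (auto simp: src_level_def)
      then show "Theta i (g \<otimes>\<^bsub>H\<^esub> h) (\<lambda>y. f y * f' (beta n (inv\<^bsub>H\<^esub> g) y)) = Theta i g f \<otimes> Theta (src_level g i) h f'"
        using Theta_mult[OF g(1) _ g(2) h(1) _ h(2), of i] by simp
    qed simp
  qed
next
  fix \<theta> assume \<theta>: "star_hom RA.B A \<theta>"
    and m: "\<And>g f. g \<in> carrier H \<Longrightarrow> f \<in> RA.coeffs g \<Longrightarrow> \<theta> (RA.mono g f) = Theta_lim g f"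
  show thesis
    by (rule that[OF \<theta>]) (simp add: m Theta_lim_step)
qed

end

section \<open>Cylinder monomials\<close>

context cantor_action
begin

definition cyl_ind :: "nat \<Rightarrow> int \<Rightarrow> int \<Rightarrow> point \<times> int \<Rightarrow> complex" where
  "cyl_ind M a t y = (if y \<in> topspace Y \<and> cyl_index n M (fst y) = a \<and> snd y = t then 1 else 0)"

lemma step_fun_cyl_ind: "step_fun M (cyl_ind M a t)"
  unfolding step_fun_def cyl_ind_def using base_in_Y by (simp add: index_base0)

lemma cyl_ind_closed: "cyl_ind M a t \<in> carrier (CF Y)"
  by (rule step_fun_closed[OF step_fun_cyl_ind])

text \<open>The affine map that carries the whole space onto the cylinder number \<open>a\<close> of level \<open>M\<close>.\<close>
definition cyl_elem :: "nat \<Rightarrow> int \<Rightarrow> (real \<times> int) \<times> int" where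
  "cyl_elem M a = ((real_of_int a / real n ^ M, int M), 0)"

lemma cyl_elem_closed [simp]: "cyl_elem M a \<in> carrier H"
  by (simp add: H_carrier cyl_elem_def nadic_divide_nat)

lemma cyl_elem_adapted:
  "adapted (cyl_elem M a) (M + L)" "src_level (cyl_elem M a) (M + L) = L"
  "offset (cyl_elem M a) (M + L) = a * int n ^ L"
proof -
  have e: "shift (cyl_elem M a) * real n ^ (M + L) = of_int (a * int n ^ L)"
    using n_pos by (simp add: cyl_elem_def power_add)
  show "adapted (cyl_elem M a) (M + L)"
    unfolding adapted_def by (intro conjI exI[of _ "a * int n ^ L"] e) (simp add: cyl_elem_def)
  show "src_level (cyl_elem M a) (M + L) = L" by (simp add: src_level_def cyl_elem_def)
  show "offset (cyl_elem M a) (M + L) = a * int n ^ L" unfolding offset_def e by (rule floor_of_int)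
qed

lemma sheet_shift_cyl_elem [simp]: "sheet_shift (cyl_elem M a) = 0"
  by (simp add: cyl_elem_def)

lemma cyl_elem_index:
  "cyl_index n (M + L) (fst (beta n (cyl_elem M a) y)) = cyl_index n L (fst y) + a * int n ^ L"
  using cyl_index_beta[OF cyl_elem_adapted(1)[of M a L], of y] cyl_elem_adapted(2,3)[of M a L] by simp

lemma cyl_elem_inv_index:
  "cyl_index n L (fst (beta n (inv\<^bsub>H\<^esub> (cyl_elem M a)) y)) = cyl_index n (M + L) (fst y) - a * int n ^ L"
  using beta_inv_index[OF cyl_elem_closed cyl_elem_adapted(1), of M a L y] cyl_elem_adapted(2,3)[of M a L] by simp

lemma cyl_elem_inv_in_Y:
  assumes "y \<in> topspace Y" "cyl_index n M (fst y) = a"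
  shows "beta n (inv\<^bsub>H\<^esub> (cyl_elem M a)) y \<in> topspace Y"
  using assms cyl_elem_inv_index[of 0 M a y] in_ran_proper[OF cyl_elem_closed assms(1), of M a]
  unfolding in_Y_index[of _ 0] by (simp add: snd_beta sheet_shift_inv)

lemma cyl_ind_coeffs: "cyl_ind M a 0 \<in> RA.coeffs (cyl_elem M a)"
  unfolding RA.coeffs_def RA.ran_def
  using cyl_ind_closed cyl_elem_inv_in_Y by (auto simp: cyl_ind_def split: if_splits)

text \<open>
  Inside the sheet \<open>0\<close> these monomials are the words in the generators of a Cuntz algebra: the digits of
  \<open>a\<close> in base \<open>n\<close> are the letters.
\<close>
definition cyl_mono :: "nat \<Rightarrow> int \<Rightarrow> (real \<times> int) \<times> int \<Rightarrow> point \<times> int \<Rightarrow> complex" where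
  "cyl_mono M a = RA.mono (cyl_elem M a) (cyl_ind M a 0)"

lemma cyl_mono_closed: "cyl_mono M a \<in> carrier RA.B"
  unfolding cyl_mono_def by (rule RA.mono_closed[OF cyl_elem_closed cyl_ind_coeffs])

lemma div_shift: "0 \<le> b \<Longrightarrow> b < int n ^ L \<Longrightarrow> (a * int n ^ L + b) div int n ^ L = a"
proof -
  assume b: "0 \<le> b" "b < int n ^ L"
  then have nz: "int n ^ L \<noteq> 0" by linarith
  show ?thesis unfolding div_mult_self3[OF nz] div_pos_pos_trivial[OF b] by simp
qed

lemma cyl_mono_mult:
  assumes b: "0 \<le> b" "b < int n ^ L"
  shows "cyl_mono M a \<otimes>\<^bsub>RA.B\<^esub> cyl_mono L b = cyl_mono (M + L) (a * int n ^ L + b)"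
proof -
  have "cyl_elem M a \<otimes>\<^bsub>H\<^esub> cyl_elem L b = cyl_elem (M + L) (a * int n ^ L + b)"
    using n_pos by (simp add: H_mult cyl_elem_def power_add field_simps)
  moreover have "(\<lambda>y. cyl_ind M a 0 y * cyl_ind L b 0 (beta n (inv\<^bsub>H\<^esub> (cyl_elem M a)) y)) =
      cyl_ind (M + L) (a * int n ^ L + b) 0"
  proof
    fix y
    show "cyl_ind M a 0 y * cyl_ind L b 0 (beta n (inv\<^bsub>H\<^esub> (cyl_elem M a)) y) =
        cyl_ind (M + L) (a * int n ^ L + b) 0 y"
    proof (cases "y \<in> topspace Y \<and> cyl_index n M (fst y) = a")
      case True
      then show ?thesis
        using cyl_elem_inv_in_Y[of y M a] cyl_elem_inv_index[of L M a y]
        by (auto simp: cyl_ind_def snd_beta sheet_shift_inv)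
    next
      case False
      then have "\<not> (y \<in> topspace Y \<and> cyl_index n (M + L) (fst y) = a * int n ^ L + b)"
        using cyl_index_add[of M L "fst y"] div_shift[OF b, of a] by auto
      then show ?thesis using False by (auto simp: cyl_ind_def)
    qed
  qed
  ultimately show ?thesis
    unfolding cyl_mono_def
    by (simp add: RA.mono_mult[OF cyl_elem_closed cyl_ind_coeffs cyl_elem_closed cyl_ind_coeffs])
qed

lemma cyl_elem_00: "cyl_elem 0 0 = \<one>\<^bsub>H\<^esub>"
  by (simp add: cyl_elem_def H_one)

lemma cyl_mono_star_self:
  assumes a: "0 \<le> a" "a < int n ^ M"
  shows "star RA.B (cyl_mono M a) \<otimes>\<^bsub>RA.B\<^esub> cyl_mono M a = cyl_mono 0 0"
proof -
  let ?g = "cyl_elem M a"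
  have ind: "cyl_ind M a 0 (beta n ?g y) = cyl_ind 0 0 0 y" for y
  proof -
    have "beta n ?g y \<in> topspace Y \<and> cyl_index n M (fst (beta n ?g y)) = a \<longleftrightarrow>
        y \<in> topspace Y \<and> cyl_index n 0 (fst y) = 0"
      using cyl_elem_index[of M 0 a y] a proper_beta[OF cyl_elem_closed, of M a y]
      unfolding in_Y_index[of "beta n ?g y" M] in_Y_index[of y 0] by (auto simp: snd_beta)
    then show ?thesis by (auto simp: cyl_ind_def snd_beta)
  qed
  have "star RA.B (cyl_mono M a) \<otimes>\<^bsub>RA.B\<^esub> cyl_mono M a =
      RA.mono (inv\<^bsub>H\<^esub> ?g \<otimes>\<^bsub>H\<^esub> ?g) (\<lambda>y. cnj (cyl_ind M a 0 (beta n ?g y)) * cyl_ind M a 0 (beta n (inv\<^bsub>H\<^esub> (inv\<^bsub>H\<^esub> ?g)) y))"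
    unfolding cyl_mono_def RA.mono_star[OF cyl_elem_closed cyl_ind_coeffs]
    by (rule RA.mono_mult[OF RA.inv_closed[OF cyl_elem_closed] RA.coeffs_star[OF cyl_elem_closed cyl_ind_coeffs]
          cyl_elem_closed cyl_ind_coeffs])
  also have "(\<lambda>y. cnj (cyl_ind M a 0 (beta n ?g y)) * cyl_ind M a 0 (beta n (inv\<^bsub>H\<^esub> (inv\<^bsub>H\<^esub> ?g)) y)) = cyl_ind 0 0 0"
    by (simp add: ind) (auto simp: cyl_ind_def)
  also have "inv\<^bsub>H\<^esub> ?g \<otimes>\<^bsub>H\<^esub> ?g = cyl_elem 0 0" by (simp add: cyl_elem_00)
  finally show ?thesis by (simp only: cyl_mono_def)
qed

lemma cyl_mono_star_right:
  "cyl_mono M a \<otimes>\<^bsub>RA.B\<^esub> star RA.B (cyl_mono M a) = RA.mono \<one>\<^bsub>H\<^esub> (cyl_ind M a 0)"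
proof -
  let ?g = "cyl_elem M a"
  have "cyl_mono M a \<otimes>\<^bsub>RA.B\<^esub> star RA.B (cyl_mono M a) =
      RA.mono (?g \<otimes>\<^bsub>H\<^esub> inv\<^bsub>H\<^esub> ?g) (\<lambda>y. cyl_ind M a 0 y * cnj (cyl_ind M a 0 (beta n ?g (beta n (inv\<^bsub>H\<^esub> ?g) y))))"
    unfolding cyl_mono_def RA.mono_star[OF cyl_elem_closed cyl_ind_coeffs]
    by (rule RA.mono_mult[OF cyl_elem_closed cyl_ind_coeffs
          RA.inv_closed[OF cyl_elem_closed] RA.coeffs_star[OF cyl_elem_closed cyl_ind_coeffs]])
  also have "(\<lambda>y. cyl_ind M a 0 y * cnj (cyl_ind M a 0 (beta n ?g (beta n (inv\<^bsub>H\<^esub> ?g) y)))) = cyl_ind M a 0"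
    by (auto simp: cyl_ind_def)
  finally show ?thesis by simp
qed

lemma cyl_mono_00_projection: "star RA.B (cyl_mono 0 0) = cyl_mono 0 0"
  unfolding cyl_mono_def RA.mono_star[OF cyl_elem_closed cyl_ind_coeffs]
  by (simp add: cyl_elem_00 beta_one) (auto simp: RA.mono_def cyl_ind_def fun_eq_iff)

text \<open>
  On the cylinder of \<open>y\<close> an adapted \<open>g\<close> factors through the whole space: its source cylinder is first spread
  out over the space and then contracted to the cylinder of \<open>y\<close>.
\<close>
lemma cyl_mono_pair:
  assumes g: "g \<in> carrier H" "adapted g M" "sheet_shift g = 0" and y: "y \<in> level_pts M" "y \<in> RA.ran g"
  defines "a \<equiv> cyl_index n M (fst y)" and "L \<equiv> src_level g M"
  shows "cyl_mono M a \<otimes>\<^bsub>RA.B\<^esub> star RA.B (cyl_mono L (a - offset g M)) = RA.mono g (cyl_ind M a 0)"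
proof -
  let ?b = "a - offset g M"
  let ?g = "cyl_elem M a" and ?h = "cyl_elem L ?b"
  have b: "0 \<le> ?b" "?b < int n ^ L"
    using y(2) beta_inv_index[OF g(1,2), of y] by (simp_all add: RA.ran_def in_Y_index[of _ L] a_def L_def)
  have sh: "shift g = real_of_int (offset g M) / real n ^ M"
    using offset[OF g(2)] npow_pos[of M] by (simp add: field_simps)
  have sc: "scaling g = int M - int L" using g(2) by (simp add: L_def src_level_def adapted_def)
  have "?g \<otimes>\<^bsub>H\<^esub> inv\<^bsub>H\<^esub> ?h = ((shift g, scaling g), sheet_shift g)"
    unfolding H_mult inv_H[OF cyl_elem_closed] H_inv_def
    using g n_pos sc by (simp add: cyl_elem_def sh field_simps)
  then have gh: "?g \<otimes>\<^bsub>H\<^esub> inv\<^bsub>H\<^esub> ?h = g" by (simp add: shift_def scaling_def sheet_shift_def)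
  have "cyl_ind M a 0 z * cnj (cyl_ind L ?b 0 (beta n ?h (beta n (inv\<^bsub>H\<^esub> ?g) z))) = cyl_ind M a 0 z" for z
  proof (cases "z \<in> topspace Y \<and> cyl_index n M (fst z) = a \<and> snd z = 0")
    case True
    let ?z = "beta n (inv\<^bsub>H\<^esub> ?g) z"
    have z: "?z \<in> topspace Y" using cyl_elem_inv_in_Y True by blast
    then have "cyl_index n 0 (fst ?z) = 0" "proper_point n (fst ?z)" by (auto simp: in_Y_index[of _ 0])
    then have "cyl_index n L (fst (beta n ?h ?z)) = ?b" "proper_point n (fst (beta n ?h ?z))"
      using cyl_elem_index[of L 0 ?b ?z] proper_beta[OF cyl_elem_closed] by simp_all
    moreover have "snd (beta n ?h ?z) = 0" using True by (simp add: snd_beta sheet_shift_inv)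
    ultimately have "beta n ?h ?z \<in> topspace Y \<and> cyl_index n L (fst (beta n ?h ?z)) = ?b \<and> snd (beta n ?h ?z) = 0"
      using b k1 unfolding in_Y_index[of _ L] by simp
    then show ?thesis by (simp add: cyl_ind_def)
  qed (auto simp: cyl_ind_def)
  then show ?thesis
    unfolding cyl_mono_def RA.mono_star[OF cyl_elem_closed cyl_ind_coeffs]
      RA.mono_mult[OF cyl_elem_closed cyl_ind_coeffs
        RA.inv_closed[OF cyl_elem_closed] RA.coeffs_star[OF cyl_elem_closed cyl_ind_coeffs]] gh
    by (simp only:)
qed

text \<open>The matrix unit that moves the sheet \<open>0\<close> to the sheet \<open>t\<close>.\<close>
definition sheet_elem :: "nat \<Rightarrow> (real \<times> int) \<times> int" where "sheet_elem t = ((0, 0), int t)"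

definition sheet_mono :: "nat \<Rightarrow> (real \<times> int) \<times> int \<Rightarrow> point \<times> int \<Rightarrow> complex" where
  "sheet_mono t = RA.mono (sheet_elem t) (cyl_ind 0 0 (int t))"

lemma sheet_elem_closed [simp]: "sheet_elem t \<in> carrier H"
  using nadic_of_int[of 0] by (simp add: H_carrier sheet_elem_def)

lemma beta_sheet: "beta n (sheet_elem t) y = (fst y, snd y + int t)"
  by (simp add: beta_eq sheet_elem_def)

lemma beta_sheet_inv: "beta n (inv\<^bsub>H\<^esub> (sheet_elem t)) y = (fst y, snd y - int t)"
  unfolding inv_H[OF sheet_elem_closed] by (simp add: beta_eq H_inv_def sheet_elem_def)

lemma sheet_ind: "y \<in> topspace Y \<Longrightarrow> cyl_index n 0 (fst y) = 0"
  by (simp add: in_Y cantor_points_iff)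

lemma sheet_coeffs: "cyl_ind 0 0 (int t) \<in> RA.coeffs (sheet_elem t)"
proof -
  have "y \<in> RA.ran (sheet_elem t)" if "cyl_ind 0 0 (int t) y \<noteq> 0" for y
    using that k1 by (auto simp: cyl_ind_def RA.ran_def beta_sheet_inv in_Y split: if_splits)
  then show ?thesis using cyl_ind_closed by (auto simp: RA.coeffs_def)
qed

lemma sheet_mono_closed: "sheet_mono t \<in> carrier RA.B"
  unfolding sheet_mono_def by (rule RA.mono_closed[OF sheet_elem_closed sheet_coeffs])

lemma sheet_mono_corner: "sheet_mono t \<otimes>\<^bsub>RA.B\<^esub> cyl_mono 0 0 = sheet_mono t"
proof -
  have "(\<lambda>y. cyl_ind 0 0 (int t) y * cyl_ind 0 0 0 (beta n (inv\<^bsub>H\<^esub> (sheet_elem t)) y)) = cyl_ind 0 0 (int t)"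
    using k1 by (auto simp: cyl_ind_def beta_sheet_inv in_Y fun_eq_iff)
  then show ?thesis
    unfolding sheet_mono_def cyl_mono_def RA.mono_mult[OF sheet_elem_closed sheet_coeffs cyl_elem_closed cyl_ind_coeffs]
    by (simp add: cyl_elem_00)
qed

lemma sheet_mono_orth:
  assumes ij: "i < k" "j < k"
  shows "star RA.B (sheet_mono i) \<otimes>\<^bsub>RA.B\<^esub> sheet_mono j = (if i = j then cyl_mono 0 0 else \<zero>\<^bsub>RA.B\<^esub>)"
proof -
  have "(\<lambda>y. cnj (cyl_ind 0 0 (int i) (beta n (sheet_elem i) y)) *
      cyl_ind 0 0 (int j) (beta n (inv\<^bsub>H\<^esub> (inv\<^bsub>H\<^esub> (sheet_elem i))) y)) = (if i = j then cyl_ind 0 0 0 else (\<lambda>_. 0))"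
    using ij k1 by (auto simp: cyl_ind_def beta_sheet in_Y fun_eq_iff)
  then have "star RA.B (sheet_mono i) \<otimes>\<^bsub>RA.B\<^esub> sheet_mono j =
      RA.mono (inv\<^bsub>H\<^esub> (sheet_elem i) \<otimes>\<^bsub>H\<^esub> sheet_elem j) (if i = j then cyl_ind 0 0 0 else (\<lambda>_. 0))"
    unfolding sheet_mono_def RA.mono_star[OF sheet_elem_closed sheet_coeffs]
      RA.mono_mult[OF RA.inv_closed[OF sheet_elem_closed] RA.coeffs_star[OF sheet_elem_closed sheet_coeffs]
        sheet_elem_closed sheet_coeffs] by simp
  then show ?thesis using RA.mono_zero by (simp add: cyl_mono_def cyl_elem_00)
qed

lemma sheet_mono_right:
  "sheet_mono t \<otimes>\<^bsub>RA.B\<^esub> star RA.B (sheet_mono t) = RA.mono \<one>\<^bsub>H\<^esub> (cyl_ind 0 0 (int t))"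
proof -
  have "(\<lambda>y. cyl_ind 0 0 (int t) y * cnj (cyl_ind 0 0 (int t) (beta n (sheet_elem t) (beta n (inv\<^bsub>H\<^esub> (sheet_elem t)) y)))) =
      cyl_ind 0 0 (int t)"
    by (auto simp: cyl_ind_def)
  then show ?thesis
    unfolding sheet_mono_def RA.mono_star[OF sheet_elem_closed sheet_coeffs]
      RA.mono_mult[OF sheet_elem_closed sheet_coeffs RA.inv_closed[OF sheet_elem_closed]
        RA.coeffs_star[OF sheet_elem_closed sheet_coeffs]] by simp
qed

lemma mono_one_finsum:
  assumes "finite I" "\<And>i. i \<in> I \<Longrightarrow> F i \<in> carrier (CF Y)"
  shows "(\<Oplus>\<^bsub>RA.B\<^esub>i\<in>I. RA.mono \<one>\<^bsub>H\<^esub> (F i)) = RA.mono \<one>\<^bsub>H\<^esub> (\<lambda>y. \<Sum>i\<in>I. F i y)"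
  using star_hom_finsum[OF RA.mono_one_hom star_algebra_CF RA.star_algebra_B assms(1), of F]
    CF_finsum[OF assms(1), of F Y] assms(2) by simp

lemma sheet_mono_sum: "(\<Oplus>\<^bsub>RA.B\<^esub>t\<in>{..<k}. sheet_mono t \<otimes>\<^bsub>RA.B\<^esub> star RA.B (sheet_mono t)) = \<one>\<^bsub>RA.B\<^esub>"
proof -
  have "(\<lambda>y. \<Sum>t<k. cyl_ind 0 0 (int t) y) = (\<lambda>y. if y \<in> topspace Y then 1 else 0)"
  proof
    fix y
    show "(\<Sum>t<k. cyl_ind 0 0 (int t) y) = (if y \<in> topspace Y then 1 else 0)"
    proof (cases "y \<in> topspace Y")
      case True
      then have "(\<Sum>t<k. cyl_ind 0 0 (int t) y) = (\<Sum>t<k. if t = nat (snd y) then 1 else 0)"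
        by (intro sum.cong) (auto simp: cyl_ind_def sheet_ind in_Y)
      then show ?thesis using True by (simp add: in_Y nat_less_iff)
    qed (simp add: cyl_ind_def)
  qed
  moreover have "RA.mono \<one>\<^bsub>H\<^esub> (\<lambda>y. if y \<in> topspace Y then 1 else 0) = \<one>\<^bsub>RA.B\<^esub>"
    by (auto simp: RA.mono_def fun_eq_iff)
  ultimately show ?thesis
    unfolding sheet_mono_right by (simp only: mono_one_finsum[OF finite_lessThan cyl_ind_closed])
qed

lemma cyl_mono_sum:
  "(\<Oplus>\<^bsub>RA.B\<^esub>i\<in>{1..n}. cyl_mono 1 (int i - 1) \<otimes>\<^bsub>RA.B\<^esub> star RA.B (cyl_mono 1 (int i - 1))) = cyl_mono 0 0"
proof -
  have "(\<lambda>y. \<Sum>i\<in>{1..n}. cyl_ind 1 (int i - 1) 0 y) = cyl_ind 0 0 0"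
  proof
    fix y
    show "(\<Sum>i\<in>{1..n}. cyl_ind 1 (int i - 1) 0 y) = cyl_ind 0 0 0 y"
    proof (cases "y \<in> topspace Y \<and> snd y = 0")
      case True
      let ?a = "cyl_index n 1 (fst y)"
      have a: "0 \<le> ?a" "?a < int n" using True in_Y_index[of y 1] by auto
      have "(\<Sum>i\<in>{1..n}. cyl_ind 1 (int i - 1) 0 y) = (\<Sum>i\<in>{1..n}. if i = nat (?a + 1) then 1 else 0)"
        using True a by (intro sum.cong) (auto simp: cyl_ind_def)
      moreover have "nat (?a + 1) \<in> {1..n}" using a by auto
      ultimately show ?thesis using True by (simp add: cyl_ind_def sheet_ind)
    qed (auto simp: cyl_ind_def)
  qed
  then show ?thesis
    unfolding cyl_mono_star_right using mono_one_finsum[of "{1..n}" "\<lambda>i. cyl_ind 1 (int i - 1) 0"] cyl_ind_closed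
    by (simp add: cyl_mono_def cyl_elem_00)
qed

lemma corner_mono:
  assumes g: "g \<in> carrier H" "f \<in> RA.coeffs g"
  defines "f' \<equiv> (\<lambda>y. cyl_ind 0 0 0 y * f y * cyl_ind 0 0 0 (beta n (inv\<^bsub>H\<^esub> g) y))"
  shows "cyl_mono 0 0 \<otimes>\<^bsub>RA.B\<^esub> RA.mono g f \<otimes>\<^bsub>RA.B\<^esub> cyl_mono 0 0 = RA.mono g f'" "f' \<in> RA.coeffs g"
proof -
  have p: "cyl_ind 0 0 0 \<in> RA.coeffs \<one>\<^bsub>H\<^esub>" using cyl_ind_closed by (simp add: RA.coeffs_one)
  have 1: "cyl_mono 0 0 \<otimes>\<^bsub>RA.B\<^esub> RA.mono g f = RA.mono g (\<lambda>y. cyl_ind 0 0 0 y * f y)"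
    unfolding cyl_mono_def cyl_elem_00 using RA.mono_mult[OF RA.one_closed p g] g by (simp add: beta_one)
  have c: "(\<lambda>y. cyl_ind 0 0 0 y * f y) \<in> RA.coeffs g"
    using RA.coeffs_mult[OF RA.one_closed p g] g by (simp add: beta_one)
  show "cyl_mono 0 0 \<otimes>\<^bsub>RA.B\<^esub> RA.mono g f \<otimes>\<^bsub>RA.B\<^esub> cyl_mono 0 0 = RA.mono g f'"
    unfolding 1 unfolding cyl_mono_def cyl_elem_00 f'_def using RA.mono_mult[OF g(1) c RA.one_closed p] g by simp
  show "f' \<in> RA.coeffs g"
    unfolding f'_def using RA.coeffs_mult[OF g(1) c RA.one_closed p] g by simp
qed

end

section \<open>The Cuntz algebra as a corner of the crossed product\<close>

lemma isometric_range_closed: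
  fixes A :: "('a, 'm) cstar_ops_scheme" and E :: "('e, 'f) cstar_ops_scheme"
  assumes A: "cstar_algebra A" and E: "cstar_algebra E" and \<phi>: "star_hom A E \<phi>"
    and iso: "\<And>a. a \<in> carrier A \<Longrightarrow> cnorm E (\<phi> a) = cnorm A a" and X: "X \<in> carrier E"
    and dense: "\<And>e. e > 0 \<Longrightarrow> \<exists>Z\<in>\<phi> ` carrier A. cnorm E (Z \<ominus>\<^bsub>E\<^esub> X) \<le> e"
  shows "X \<in> \<phi> ` carrier A"
proof -
  interpret A: cstar_algebra A by fact
  interpret E: cstar_algebra E by fact
  have "\<exists>a\<in>carrier A. cnorm E (\<phi> a \<ominus>\<^bsub>E\<^esub> X) \<le> inverse (real (Suc i))" for i
    using dense[of "inverse (real (Suc i))"] by auto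
  then obtain a where a: "\<And>i. a i \<in> carrier A" "\<And>i. cnorm E (\<phi> (a i) \<ominus>\<^bsub>E\<^esub> X) \<le> inverse (real (Suc i))"
    by metis
  note \<phi>c = star_homD(1)[OF \<phi>]
  have d: "cnorm E (\<phi> x \<ominus>\<^bsub>E\<^esub> \<phi> y) = cnorm A (x \<ominus>\<^bsub>A\<^esub> y)" if "x \<in> carrier A" "y \<in> carrier A" for x y
    using iso[OF A.minus_closed[OF that]] star_hom_diff[OF \<phi> A.star_algebra_axioms E.star_algebra_axioms that] by simp
  have lim: "E.tends (\<lambda>i. \<phi> (a i)) X"
    by (rule E.tendsI[OF _ X a(2) LIMSEQ_inverse_real_of_nat]) (rule \<phi>c[OF a(1)])
  have "cauchy_in A (cnorm A) a"
    using E.tends_cauchy[OF lim] a(1) unfolding cauchy_in_def d[OF a(1) a(1)] by blast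
  then obtain x where x: "A.tends a x" using A.cauchy_tends by blast
  note xc = A.tendsD(2)[OF x]
  have "E.tends (\<lambda>i. \<phi> (a i)) (\<phi> x)"
    using x \<phi>c[OF a(1)] \<phi>c[OF xc] unfolding E.tends_def A.tends_def d[OF a(1) xc] by blast
  then have "X = \<phi> x" using E.tends_eq[OF lim] by blast
  then show ?thesis using xc by blast
qed

text \<open>
  The homomorphism \<open>h\<close> from the free algebra to the corner cut out by the sheet \<open>0\<close>, which sends the
  generators to the monomials of the maps onto the cylinders of level \<open>1\<close>.
\<close>
locale cantor_corner = cantor_action n k for n k +
  fixes h
  assumes h: "star_hom (FA n) RA.B h" "h \<one>\<^bsub>FA n\<^esub> = cyl_mono 0 0"
    "\<And>i. i \<in> {1..n} \<Longrightarrow> h (cuntz_generator i) = cyl_mono 1 (int i - 1)"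
begin

abbreviation "N \<equiv> max_cstar_seminorm RA.B {}"

interpretation F: seminormed_star_algebra "FA n" "cuntz_seminorm n" by (rule seminormed_cuntz)
interpretation B: star_algebra RA.B by (rule RA.star_algebra_B)

lemmas hD = star_homD[OF h(1)]

lemma digit: "i \<in> {1..n} \<Longrightarrow> 0 \<le> int i - 1" "i \<in> {1..n} \<Longrightarrow> int i - 1 < int n ^ 1"
  by auto

lemma cstar_seminorm_N: "cstar_seminorm RA.B N"
  by (rule B.cstar_seminorm_max[OF crossed_bounded])

interpretation BN: seminormed_star_algebra RA.B N by unfold_locales (rule cstar_seminorm_N)

text \<open>The images of the generators satisfy the Cuntz relations in the corner.\<close>
lemma corner_norm_le:
  assumes x: "x \<in> carrier (FA n)" shows "N (h x) \<le> cuntz_seminorm n x"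
proof (rule F.max_cstar_seminorm_upper[OF cuntz_seminorms_bounded _ _ x])
  show "cstar_seminorm (FA n) (\<lambda>x. N (h x))" by (rule cstar_seminorm_pullback[OF h(1) cstar_seminorm_N star_algebra_FA])
  fix r assume "r \<in> cuntz_relators n"
  then consider i where "i \<in> {1..n}" "r = star (FA n) (cuntz_generator i) \<otimes>\<^bsub>FA n\<^esub> cuntz_generator i \<ominus>\<^bsub>FA n\<^esub> \<one>\<^bsub>FA n\<^esub>"
    | "r = (\<Oplus>\<^bsub>FA n\<^esub>i\<in>{1..n}. cuntz_generator i \<otimes>\<^bsub>FA n\<^esub> star (FA n) (cuntz_generator i)) \<ominus>\<^bsub>FA n\<^esub> \<one>\<^bsub>FA n\<^esub>"
    unfolding cuntz_relators_def Let_def by blast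
  then have "h r = (cyl_mono 0 0) \<ominus>\<^bsub>RA.B\<^esub> (cyl_mono 0 0)"
  proof cases
    case 1
    note c = generator_closed[OF 1(1)] F.star_closed[OF generator_closed[OF 1(1)]]
    show ?thesis
      unfolding 1(2) star_hom_diff[OF h(1) star_algebra_FA RA.star_algebra_B F.m_closed[OF c(2,1)] F.one_closed]
        hD(5)[OF c(2,1)] hD(2)[OF c(1)] h(2) h(3)[OF 1(1)] cyl_mono_star_self[OF digit[OF 1(1)]] ..
  next
    case 2
    have c: "(\<lambda>i. cuntz_generator i \<otimes>\<^bsub>FA n\<^esub> star (FA n) (cuntz_generator i)) \<in> {1..n} \<rightarrow> carrier (FA n)"
      using generator_closed F.star_closed F.m_closed by blast
    have "h (\<Oplus>\<^bsub>FA n\<^esub>i\<in>{1..n}. cuntz_generator i \<otimes>\<^bsub>FA n\<^esub> star (FA n) (cuntz_generator i)) =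
        (\<Oplus>\<^bsub>RA.B\<^esub>i\<in>{1..n}. h (cuntz_generator i \<otimes>\<^bsub>FA n\<^esub> star (FA n) (cuntz_generator i)))"
      by (rule star_hom_finsum[OF h(1) star_algebra_FA RA.star_algebra_B _ c]) simp
    also have "\<dots> = (\<Oplus>\<^bsub>RA.B\<^esub>i\<in>{1..n}. cyl_mono 1 (int i - 1) \<otimes>\<^bsub>RA.B\<^esub> star RA.B (cyl_mono 1 (int i - 1)))"
    proof (rule B.finsum_cong')
      fix i assume i: "i \<in> {1..n}"
      note ci = generator_closed[OF i] F.star_closed[OF generator_closed[OF i]]
      show "h (cuntz_generator i \<otimes>\<^bsub>FA n\<^esub> star (FA n) (cuntz_generator i)) =
          cyl_mono 1 (int i - 1) \<otimes>\<^bsub>RA.B\<^esub> star RA.B (cyl_mono 1 (int i - 1))"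
        unfolding hD(5)[OF ci] hD(2)[OF ci(1)] h(3)[OF i] ..
    qed (use cyl_mono_closed B.star_closed in \<open>auto intro!: B.m_closed\<close>)
    also have "\<dots> = (cyl_mono 0 0)" by (rule cyl_mono_sum)
    finally show ?thesis
      unfolding 2 star_hom_diff[OF h(1) star_algebra_FA RA.star_algebra_B F.finsum_closed[OF c] F.one_closed] h(2)
      by simp
  qed
  then show "N (h r) = 0" using cyl_mono_closed[of 0 0] BN.N_zero by (simp add: B.minus_eq B.r_neg del: RA.B_simps)
qed

text \<open>
  The homomorphism from the crossed product into the Cuntz algebra restricts to the compression
  \<open>x \<mapsto> T x T\<^sup>*\<close> by an isometry on the corner, so the norm does not drop.
\<close>
lemma corner_norm_ge:
  assumes x: "x \<in> carrier (FA n)" shows "cuntz_seminorm n x \<le> N (h x)"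
proof -
  let ?A = "cuntz_algebra n" and ?eA = "completion_embed (FA n) (cuntz_seminorm n)"
  have Aeq: "?A = hausdorff_completion (FA n) (cuntz_seminorm n)"
    by (simp add: cuntz_algebra_def universal_cstar_def)
  have eA: "star_hom (FA n) ?A ?eA" unfolding Aeq by (rule F.star_hom_emb)
  have nA: "cnorm ?A (?eA x) = cuntz_seminorm n x" if "x \<in> carrier (FA n)" for x
    unfolding Aeq by (rule F.cnorm_emb[OF that])
  interpret R: cantor_cuntz ?A n k "\<lambda>i. ?eA (cuntz_generator (Suc i))"
    by (intro cantor_cuntz.intro cantor_action_axioms cuntz_family_cuntz_algebra n2)
  obtain \<theta> where \<theta>: "star_hom RA.B ?A \<theta>"
    "\<And>M g f. step_fun M f \<Longrightarrow> g \<in> carrier H \<Longrightarrow> adapted g M \<Longrightarrow> f \<in> RA.coeffs g \<Longrightarrow> \<theta> (RA.mono g f) = R.Theta M g f"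
    using R.crossed_to_cuntz by blast
  define T where "T = R.C.S k 0"
  have T: "T \<in> carrier ?A" "star ?A T \<in> carrier ?A" unfolding T_def by auto
  have TT: "star ?A T \<otimes>\<^bsub>?A\<^esub> T = \<one>\<^bsub>?A\<^esub>" unfolding T_def using n_pos by (simp add: R.C.S_orthonormal)
  let ?c = "\<lambda>x. T \<otimes>\<^bsub>?A\<^esub> ?eA x \<otimes>\<^bsub>?A\<^esub> star ?A T"
  note eAD = star_homD[OF eA]
  have c_hom: "star_hom (FA n) ?A ?c"
    unfolding star_hom_def
  proof (intro ballI conjI allI)
    fix a assume a: "a \<in> carrier (FA n)"
    note ea = eAD(1)[OF a]
    show "?c a \<in> carrier ?A" using T ea by simp
    show "?c (star (FA n) a) = star ?A (?c a)"
      unfolding eAD(2)[OF a] using T ea by (simp add: R.C.star_mult R.C.star_star R.C.star_closed R.C.m_assoc)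
    show "?c (z \<odot>\<^bsub>FA n\<^esub> a) = z \<odot>\<^bsub>?A\<^esub> ?c a" for z
      unfolding eAD(3)[OF a] using T ea by (simp add: R.C.scale_mult_left R.C.scale_mult_right)
    fix b assume b: "b \<in> carrier (FA n)"
    note eb = eAD(1)[OF b]
    show "?c (a \<oplus>\<^bsub>FA n\<^esub> b) = ?c a \<oplus>\<^bsub>?A\<^esub> ?c b"
      unfolding eAD(4)[OF a b] using T ea eb by (simp add: R.C.l_distr R.C.r_distr)
    have "?c a \<otimes>\<^bsub>?A\<^esub> ?c b = T \<otimes>\<^bsub>?A\<^esub> ?eA a \<otimes>\<^bsub>?A\<^esub> (star ?A T \<otimes>\<^bsub>?A\<^esub> T) \<otimes>\<^bsub>?A\<^esub> ?eA b \<otimes>\<^bsub>?A\<^esub> star ?A T"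
      using T ea eb by (simp only: R.C.m_assoc R.C.m_closed)
    then show "?c (a \<otimes>\<^bsub>FA n\<^esub> b) = ?c a \<otimes>\<^bsub>?A\<^esub> ?c b"
      unfolding eAD(5)[OF a b] TT using T ea eb by (simp add: R.C.m_assoc)
  qed
  have level: "y = (cyl_base n M a, 0)" if "y \<in> level_pts M" "cyl_ind M a 0 y \<noteq> 0" for M a y
    using that level_ptsD(2)[of y M] by (auto simp: cyl_ind_def base_def split: if_splits)
  have pt: "(cyl_base n M a, 0) \<in> level_pts M \<and> cyl_ind M a 0 (cyl_base n M a, 0) = 1"
    if "0 \<le> a" "a < int n ^ M" for M a
    using that k1 cyl_index_base[of M 0 a]
    by (simp add: level_pts_def in_Y base_in_cantor base_def cyl_ind_def)
  have Theta_ind: "R.Theta M g (cyl_ind M a 0) = R.W M (cyl_base n M a, 0) \<otimes>\<^bsub>?A\<^esub>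
      star ?A (R.W (src_level g M) (beta n (inv\<^bsub>H\<^esub> g) (cyl_base n M a, 0)))"
    if a: "0 \<le> a" "a < int n ^ M" for M g a
  proof -
    have "R.Theta M g (cyl_ind M a 0) = cyl_ind M a 0 (cyl_base n M a, 0) \<odot>\<^bsub>?A\<^esub> (R.W M (cyl_base n M a, 0) \<otimes>\<^bsub>?A\<^esub>
      star ?A (R.W (src_level g M) (beta n (inv\<^bsub>H\<^esub> g) (cyl_base n M a, 0))))"
      unfolding R.Theta_def
    proof (rule R.C.finsum_single[OF finite_level_pts])
      fix y assume y: "y \<in> level_pts M" "y \<noteq> (cyl_base n M a, 0)"
      then have "cyl_ind M a 0 y = 0" using level by blast
      then show "cyl_ind M a 0 y \<odot>\<^bsub>?A\<^esub> (R.W M y \<otimes>\<^bsub>?A\<^esub> star ?A (R.W (src_level g M) (beta n (inv\<^bsub>H\<^esub> g) y))) = \<zero>\<^bsub>?A\<^esub>"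
        by simp
    qed (use pt[OF a] in auto)
    then show ?thesis using pt[OF a] by (simp add: R.C.scale_one)
  qed
  have \<theta>_cyl: "\<theta> (cyl_mono M a) = R.W M (cyl_base n M a, 0) \<otimes>\<^bsub>?A\<^esub>
      star ?A (R.W 0 (beta n (inv\<^bsub>H\<^esub> (cyl_elem M a)) (cyl_base n M a, 0)))"
    if a: "0 \<le> a" "a < int n ^ M" for M a
    unfolding cyl_mono_def using \<theta>(2)[OF step_fun_cyl_ind cyl_elem_closed _ cyl_ind_coeffs] Theta_ind[OF a]
      cyl_elem_adapted(1,2)[of M a 0] by simp
  have W0: "R.W 0 (beta n (inv\<^bsub>H\<^esub> (cyl_elem M a)) (cyl_base n M a, 0)) = T" if a: "0 \<le> a" "a < int n ^ M" for M a
    unfolding R.W_def T_def by (simp add: snd_beta sheet_shift_inv)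
  have "\<theta> (h x) = ?c x"
  proof (rule free_star_hom_unique[OF R.C.star_algebra_axioms star_hom_compose[OF h(1) \<theta>(1)] c_hom _ _ x])
    have "R.W 0 (cyl_base n 0 0, 0) = T" by (simp add: R.W_def T_def)
    then have "\<theta> (h \<one>\<^bsub>FA n\<^esub>) = T \<otimes>\<^bsub>?A\<^esub> star ?A T"
      using \<theta>_cyl[of 0 0] W0[of 0 0] by (simp add: h(2) del: FA_simps)
    moreover have "?eA \<one>\<^bsub>FA n\<^esub> = \<one>\<^bsub>?A\<^esub>" unfolding Aeq by (rule F.emb_one)
    ultimately show "\<theta> (h \<one>\<^bsub>FA n\<^esub>) = ?c \<one>\<^bsub>FA n\<^esub>" using T by (simp del: FA_simps)
  next
    fix i assume i: "i \<in> {1..n}"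
    have idx: "nat (int i - 1) div n = 0" "nat (int i - 1) mod n = i - 1" "Suc (i - 1) = i" using i by auto
    have "cyl_index n (Suc 0) (cyl_base n (Suc 0) (int i - 1)) = int i - 1"
      using cyl_index_base[of "Suc 0" 0 "int i - 1"] by simp
    then have "R.W 1 (cyl_base n 1 (int i - 1), 0) = T \<otimes>\<^bsub>?A\<^esub> ?eA (cuntz_generator i)"
      using eAD(1)[OF generator_closed[OF i]] idx by (simp add: R.W_def T_def)
    then show "\<theta> (h (cuntz_generator i)) = ?c (cuntz_generator i)"
      unfolding h(3)[OF i] \<theta>_cyl[OF digit[OF i]] W0[OF digit[OF i]] by simp
  qed
  have "?eA x = star ?A T \<otimes>\<^bsub>?A\<^esub> ?c x \<otimes>\<^bsub>?A\<^esub> T"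
  proof -
    have "star ?A T \<otimes>\<^bsub>?A\<^esub> ?c x \<otimes>\<^bsub>?A\<^esub> T = (star ?A T \<otimes>\<^bsub>?A\<^esub> T) \<otimes>\<^bsub>?A\<^esub> ?eA x \<otimes>\<^bsub>?A\<^esub> (star ?A T \<otimes>\<^bsub>?A\<^esub> T)"
      using T eAD(1)[OF x] by (simp only: R.C.m_assoc R.C.m_closed)
    then show ?thesis unfolding TT using eAD(1)[OF x] by simp
  qed
  moreover have "cnorm ?A T \<le> 1" by (rule R.C.N_partial_isometry[OF T(1) R.C.one_closed R.C.star_one _ TT]) simp
  moreover have "cnorm ?A (star ?A T \<otimes>\<^bsub>?A\<^esub> ?c x \<otimes>\<^bsub>?A\<^esub> T) \<le> cnorm ?A T * cnorm ?A (?c x) * cnorm ?A T"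
  proof -
    have cx: "?c x \<in> carrier ?A" using T eAD(1)[OF x] by simp
    have "cnorm ?A (star ?A T \<otimes>\<^bsub>?A\<^esub> ?c x \<otimes>\<^bsub>?A\<^esub> T) \<le> cnorm ?A (star ?A T \<otimes>\<^bsub>?A\<^esub> ?c x) * cnorm ?A T"
      by (rule R.C.N_mult[OF R.C.m_closed[OF T(2) cx] T(1)])
    also have "\<dots> \<le> (cnorm ?A T * cnorm ?A (?c x)) * cnorm ?A T"
      using R.C.N_mult[OF T(2) cx] R.C.N_star[OF T(1)] R.C.N_nonneg[OF T(1)] by (intro mult_right_mono) simp_all
    finally show ?thesis .
  qed
  moreover have "cnorm ?A (?c x) \<ge> 0" using T eAD(1)[OF x] by simp
  ultimately have "cnorm ?A (?eA x) \<le> cnorm ?A (?c x)"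
    using R.C.N_nonneg[OF T(1)] mult_mono[of "cnorm ?A T" 1 "cnorm ?A T" 1]
      mult_right_mono[of "cnorm ?A T * cnorm ?A T" 1 "cnorm ?A (?c x)"] by (simp add: mult_ac)
  also have "\<dots> \<le> N (h x)"
    unfolding \<open>\<theta> (h x) = ?c x\<close>[symmetric]
    by (rule B.max_cstar_seminorm_upper[OF crossed_bounded
          cstar_seminorm_pullback[OF \<theta>(1) R.C.cstar_seminorm_cnorm RA.star_algebra_B] _ hD(1)[OF x]]) auto
  finally show ?thesis using nA[OF x] by simp
qed

subsection \<open>Step functions on the corner\<close>

lemma corner_range_closed:
  assumes a: "a \<in> h ` carrier (FA n)"
  shows "b \<in> h ` carrier (FA n) \<Longrightarrow> a \<oplus>\<^bsub>RA.B\<^esub> b \<in> h ` carrier (FA n)"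
    "b \<in> h ` carrier (FA n) \<Longrightarrow> a \<otimes>\<^bsub>RA.B\<^esub> b \<in> h ` carrier (FA n)"
    "star RA.B a \<in> h ` carrier (FA n)" "c \<odot>\<^bsub>RA.B\<^esub> a \<in> h ` carrier (FA n)"
proof -
  obtain x where x: "x \<in> carrier (FA n)" "a = h x" using a by blast
  show "star RA.B a \<in> h ` carrier (FA n)"
    unfolding x(2) hD(2)[OF x(1), symmetric] by (rule imageI[OF F.star_closed[OF x(1)]])
  show "c \<odot>\<^bsub>RA.B\<^esub> a \<in> h ` carrier (FA n)"
    unfolding x(2) hD(3)[OF x(1), symmetric] by (rule imageI[OF F.scale_closed[OF x(1)]])
  assume "b \<in> h ` carrier (FA n)"
  then obtain y where y: "y \<in> carrier (FA n)" "b = h y" by blast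
  show "a \<oplus>\<^bsub>RA.B\<^esub> b \<in> h ` carrier (FA n)"
    unfolding x(2) y(2) hD(4)[OF x(1) y(1), symmetric] by (rule imageI[OF F.a_closed[OF x(1) y(1)]])
  show "a \<otimes>\<^bsub>RA.B\<^esub> b \<in> h ` carrier (FA n)"
    unfolding x(2) y(2) hD(5)[OF x(1) y(1), symmetric] by (rule imageI[OF F.m_closed[OF x(1) y(1)]])
qed

lemma corner_range_zero: "RA.mono g (\<lambda>_. 0) \<in> h ` carrier (FA n)"
proof -
  have "RA.mono g (\<lambda>_. 0) = h \<zero>\<^bsub>FA n\<^esub>"
    using RA.mono_zero[of g] star_hom_zero[OF h(1) star_algebra_FA RA.star_algebra_B] by simp
  then show ?thesis using F.zero_closed by blast
qed

lemma cyl_mono_in_range: "0 \<le> a \<Longrightarrow> a < int n ^ M \<Longrightarrow> cyl_mono M a \<in> h ` carrier (FA n)"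
proof (induction M arbitrary: a)
  case 0
  then have "a = 0" by simp
  then have "cyl_mono 0 a = h \<one>\<^bsub>FA n\<^esub>" by (simp only: h(2))
  then show ?case using F.one_closed by blast
next
  case (Suc M)
  have r: "0 \<le> a mod int n" "a mod int n < int n ^ 1" using n_pos by simp_all
  have "int n * (a div int n) \<le> a" using mult_div_mod_eq[of "int n" a] r(1) by linarith
  then have "int n * (a div int n) < int n * int n ^ M" using Suc.prems by simp
  then have "a div int n < int n ^ M" using n_pos by (simp only: mult_less_cancel_left_pos of_nat_0_less_iff)
  moreover have "0 \<le> a div int n" using Suc.prems n_pos by (simp add: pos_imp_zdiv_nonneg_iff)
  ultimately have q: "0 \<le> a div int n" "a div int n < int n ^ M" by simp_all
  have "cyl_mono M (a div int n) \<otimes>\<^bsub>RA.B\<^esub> cyl_mono 1 (a mod int n) = cyl_mono (Suc M) a"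
    using cyl_mono_mult[OF r, of M "a div int n"] by simp
  moreover have "cyl_mono 1 (a mod int n) \<in> h ` carrier (FA n)"
  proof -
    have i: "nat (a mod int n) + 1 \<in> {1..n}" using r by (simp add: Suc_le_eq nat_less_iff)
    have "h (cuntz_generator (nat (a mod int n) + 1)) = cyl_mono 1 (a mod int n)"
      using h(3)[OF i] r by simp
    then show ?thesis using generator_closed[OF i] by (metis image_eqI)
  qed
  ultimately show ?case using corner_range_closed(2)[OF Suc.IH[OF q]] by metis
qed

lemma step_fun_in_range:
  assumes g: "g \<in> carrier H" "adapted g M" "sheet_shift g = 0" and f: "f \<in> RA.coeffs g"
    and f0: "\<And>y. f y \<noteq> 0 \<Longrightarrow> snd y = 0"
  shows "RA.mono g (approx M f) \<in> h ` carrier (FA n)"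
proof -
  have term_I: "RA.mono g (\<lambda>z. f y * cyl_ind M (cyl_index n M (fst y)) 0 z) \<in> h ` carrier (FA n)" if y: "y \<in> level_pts M" for y
  proof (cases "f y = 0")
    case True
    then have "RA.mono g (\<lambda>z. f y * cyl_ind M (cyl_index n M (fst y)) 0 z) = h \<zero>\<^bsub>FA n\<^esub>"
      using RA.mono_zero[of g] star_hom_zero[OF h(1) star_algebra_FA RA.star_algebra_B] by simp
    then show ?thesis using F.zero_closed by blast
  next
    case False
    then have yr: "y \<in> RA.ran g" by (rule coeffs_ran[OF f])
    let ?a = "cyl_index n M (fst y)"
    have a: "0 \<le> ?a" "?a < int n ^ M" using level_ptsD(1)[OF y] by (simp_all add: in_Y_index[of _ M])
    have b: "0 \<le> ?a - offset g M" "?a - offset g M < int n ^ src_level g M"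
      using yr beta_inv_index[OF g(1,2), of y] by (simp_all add: RA.ran_def in_Y_index[of _ "src_level g M"])
    show ?thesis
      unfolding RA.mono_scale
      by (subst cyl_mono_pair[OF g y yr, symmetric]) (intro corner_range_closed(2-4) cyl_mono_in_range a b)
  qed
  have "RA.mono g (\<lambda>z. \<Sum>y\<in>J. f y * cyl_ind M (cyl_index n M (fst y)) 0 z) \<in> h ` carrier (FA n)"
    if "finite J" "J \<subseteq> level_pts M" for J
    using that
  proof (induction J)
    case empty
    then have "RA.mono g (\<lambda>z. \<Sum>y\<in>{}. f y * cyl_ind M (cyl_index n M (fst y)) 0 z) = h \<zero>\<^bsub>FA n\<^esub>"
      using RA.mono_zero[of g] star_hom_zero[OF h(1) star_algebra_FA RA.star_algebra_B] by simp
    then show ?case using F.zero_closed by blast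
  next
    case (insert y J)
    have "RA.mono g (\<lambda>z. \<Sum>y\<in>insert y J. f y * cyl_ind M (cyl_index n M (fst y)) 0 z) =
        RA.mono g (\<lambda>z. f y * cyl_ind M (cyl_index n M (fst y)) 0 z) \<oplus>\<^bsub>RA.B\<^esub>
        RA.mono g (\<lambda>z. \<Sum>y\<in>J. f y * cyl_ind M (cyl_index n M (fst y)) 0 z)"
      unfolding RA.mono_add[symmetric] using insert.hyps by simp
    then show ?case using corner_range_closed(1)[OF term_I insert.IH] insert.prems by simp
  qed
  then have "RA.mono g (\<lambda>z. \<Sum>y\<in>level_pts M. f y * cyl_ind M (cyl_index n M (fst y)) 0 z) \<in> h ` carrier (FA n)"
    using finite_level_pts by blast
  moreover have "(\<lambda>z. \<Sum>y\<in>level_pts M. f y * cyl_ind M (cyl_index n M (fst y)) 0 z) = approx M f"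
  proof
    fix z
    show "(\<Sum>y\<in>level_pts M. f y * cyl_ind M (cyl_index n M (fst y)) 0 z) = approx M f z"
    proof (cases "z \<in> topspace Y")
      case True
      have "f y * cyl_ind M (cyl_index n M (fst y)) 0 z = (if y = base M z then f (base M z) else 0)"
        if y: "y \<in> level_pts M" for y
      proof (cases "f y = 0")
        case True
        then show ?thesis by auto
      next
        case False
        then have s: "snd y = 0" by (rule f0)
        have "cyl_index n M (fst z) = cyl_index n M (fst y) \<and> snd z = 0 \<longleftrightarrow> y = base M z"
          using level_pts_eqI[OF y base_level[OF True]] s index_base0[of M z] snd_base[of M z] by (metis)
        then have "cyl_ind M (cyl_index n M (fst y)) 0 z = (if y = base M z then 1 else 0)"
          unfolding cyl_ind_def using True by (simp only: simp_thms)
        then show ?thesis by (cases "y = base M z") simp_all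
      qed
      then have "(\<Sum>y\<in>level_pts M. f y * cyl_ind M (cyl_index n M (fst y)) 0 z) =
          (\<Sum>y\<in>level_pts M. if y = base M z then f (base M z) else 0)" by (rule sum.cong[OF refl])
      then show ?thesis using True finite_level_pts base_level[OF True] by (simp add: approx_def)
    qed (simp add: approx_def cyl_ind_def)
  qed
  ultimately show ?thesis by simp
qed

text \<open>
  An element that moves the sheet \<open>0\<close> has no part in the corner.  For the others, the coefficient
  is uniformly close to a step function, which is a combination of words in the images of the generators.
\<close>
lemma corner_approx:
  assumes "b \<in> carrier RA.B" and "e > 0"
  shows "\<exists>x\<in>carrier (FA n). N (h x \<ominus>\<^bsub>RA.B\<^esub> cyl_mono 0 0 \<otimes>\<^bsub>RA.B\<^esub> b \<otimes>\<^bsub>RA.B\<^esub> cyl_mono 0 0) \<le> e"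
proof -
  have mono: "\<exists>x\<in>carrier (FA n). N (h x \<ominus>\<^bsub>RA.B\<^esub> RA.mono g f) \<le> e"
    if g: "g \<in> carrier H" "f \<in> RA.coeffs g" and e: "e > 0"
      and f0: "\<And>y. f y \<noteq> 0 \<Longrightarrow> snd y = 0 \<and> snd (beta n (inv\<^bsub>H\<^esub> g) y) = 0" for g f e
  proof (cases "sheet_shift g = 0")
    case False
    have "f y = 0" for y
    proof (rule ccontr)
      assume "f y \<noteq> 0"
      then show False using f0[of y] False sheet_shift_inv[OF g(1)] by (simp add: snd_beta)
    qed
    then have "f = (\<lambda>_. 0)" by (rule ext)
    then have "RA.mono g f \<in> h ` carrier (FA n)" by (simp only: corner_range_zero)
    then obtain x where x: "x \<in> carrier (FA n)" "RA.mono g f = h x" by blast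
    have "N (h x \<ominus>\<^bsub>RA.B\<^esub> h x) \<le> e"
      using hD(1)[OF x(1)] e by (simp add: B.minus_eq B.r_neg del: RA.B_simps)
    then show ?thesis using x by auto
  next
    case True
    have fC: "f \<in> carrier (CF Y)" using g(2) by (simp add: RA.coeffs_def)
    obtain M0 where M0: "\<forall>M\<ge>M0. \<forall>y\<in>topspace Y. cmod (f y - approx M f y) \<le> e"
      using approx_close[OF fC e] by blast
    obtain M1 where M1: "\<forall>M\<ge>M1. adapted g M" using adapted_exists[OF g(1)] by blast
    define M where "M = max M0 M1"
    have M: "adapted g M" "\<And>y. y \<in> topspace Y \<Longrightarrow> cmod (f y - approx M f y) \<le> e"
      using M0 M1 by (auto simp: M_def)
    note ac = approx_coeffs[OF g(1) M(1) g(2)]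
    have "RA.mono g (approx M f) \<in> h ` carrier (FA n)"
      by (rule step_fun_in_range[OF g(1) M(1) True g(2)]) (use f0 in blast)
    then obtain x where x: "x \<in> carrier (FA n)" "h x = RA.mono g (approx M f)" by auto
    have "RA.mono g (\<lambda>y. approx M f y - f y) = RA.mono g (\<lambda>y. approx M f y + (-1) * f y)" by simp
    also have "\<dots> = RA.mono g (approx M f) \<oplus>\<^bsub>RA.B\<^esub> (-1) \<odot>\<^bsub>RA.B\<^esub> RA.mono g f"
      unfolding RA.mono_add RA.mono_scale ..
    also have "\<dots> = h x \<ominus>\<^bsub>RA.B\<^esub> RA.mono g f"
      by (simp only: B.scale_minus_one[OF RA.mono_closed[OF g]] B.minus_eq x(2))
    finally have "N (h x \<ominus>\<^bsub>RA.B\<^esub> RA.mono g f) = N (RA.mono g (\<lambda>y. approx M f y - f y))" by (simp only:)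
    also have "\<dots> \<le> e"
    proof (rule RA.mono_seminorm_le[OF cstar_seminorm_N g(1)])
      show "(\<lambda>y. approx M f y - f y) \<in> RA.coeffs g" by (rule coeffs_diff[OF ac g(2)])
      show "cmod (approx M f y - f y) \<le> e" if "y \<in> topspace Y" for y
        using M(2)[OF that] by (simp only: norm_minus_commute)
    qed (use e in simp)
    finally show ?thesis using x(1) by blast
  qed
  note Pc = cyl_mono_closed[of 0 0]
  show ?thesis
    using assms
  proof (induction b arbitrary: e rule: RA.B_induct)
    case zero
    have "cyl_mono 0 0 \<otimes>\<^bsub>RA.B\<^esub> \<zero>\<^bsub>RA.B\<^esub> \<otimes>\<^bsub>RA.B\<^esub> cyl_mono 0 0 = \<zero>\<^bsub>RA.B\<^esub>"
      using Pc by (simp del: RA.B_simps)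
    then have "N (h \<zero>\<^bsub>FA n\<^esub> \<ominus>\<^bsub>RA.B\<^esub> cyl_mono 0 0 \<otimes>\<^bsub>RA.B\<^esub> \<zero>\<^bsub>RA.B\<^esub> \<otimes>\<^bsub>RA.B\<^esub> cyl_mono 0 0) = 0"
      using star_hom_zero[OF h(1) star_algebra_FA RA.star_algebra_B]
      by (simp add: B.minus_eq del: RA.B_simps FA_simps)
    then have le: "N (h \<zero>\<^bsub>FA n\<^esub> \<ominus>\<^bsub>RA.B\<^esub> cyl_mono 0 0 \<otimes>\<^bsub>RA.B\<^esub> \<zero>\<^bsub>RA.B\<^esub> \<otimes>\<^bsub>RA.B\<^esub> cyl_mono 0 0) \<le> e"
      using zero by linarith
    have Bz: "\<zero>\<^bsub>RA.B\<^esub> = (\<lambda>_ _. 0)" by simp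
    show ?case by (rule bexI[where x = "\<zero>\<^bsub>FA n\<^esub>"]) (use le[unfolded Bz] F.zero_closed in \<open>simp_all only:\<close>)
  next
    case (add g f b)
    note m = RA.mono_closed[OF add(1,2)]
    let ?f = "\<lambda>y. cyl_ind 0 0 0 y * f y * cyl_ind 0 0 0 (beta n (inv\<^bsub>H\<^esub> g) y)"
    let ?b = "cyl_mono 0 0 \<otimes>\<^bsub>RA.B\<^esub> b \<otimes>\<^bsub>RA.B\<^esub> cyl_mono 0 0"
    note fc = corner_mono(2)[OF add(1,2)]
    note mf = RA.mono_closed[OF add(1) fc]
    have e2: "e / 2 > 0" using add.prems by simp
    have "\<exists>x\<in>carrier (FA n). N (h x \<ominus>\<^bsub>RA.B\<^esub> RA.mono g ?f) \<le> e / 2"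
      by (rule mono[OF add(1) fc e2]) (auto simp: cyl_ind_def split: if_splits)
    then obtain x where x: "x \<in> carrier (FA n)" "N (h x \<ominus>\<^bsub>RA.B\<^esub> RA.mono g ?f) \<le> e / 2" by blast
    obtain y where y: "y \<in> carrier (FA n)" "N (h y \<ominus>\<^bsub>RA.B\<^esub> ?b) \<le> e / 2" using add.IH[OF e2] by blast
    note hx = hD(1)[OF x(1)] and hy = hD(1)[OF y(1)]
    have bc: "?b \<in> carrier RA.B" by (rule B.m_closed[OF B.m_closed[OF Pc add(3)] Pc])
    have "cyl_mono 0 0 \<otimes>\<^bsub>RA.B\<^esub> (RA.mono g f \<oplus>\<^bsub>RA.B\<^esub> b) \<otimes>\<^bsub>RA.B\<^esub> cyl_mono 0 0 = RA.mono g ?f \<oplus>\<^bsub>RA.B\<^esub> ?b"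
      unfolding corner_mono(1)[OF add(1,2), symmetric]
      using Pc m add(3) by (simp add: B.l_distr B.r_distr del: RA.B_simps)
    moreover have "h (x \<oplus>\<^bsub>FA n\<^esub> y) \<ominus>\<^bsub>RA.B\<^esub> (RA.mono g ?f \<oplus>\<^bsub>RA.B\<^esub> ?b) =
        (h x \<ominus>\<^bsub>RA.B\<^esub> RA.mono g ?f) \<oplus>\<^bsub>RA.B\<^esub> (h y \<ominus>\<^bsub>RA.B\<^esub> ?b)"
      unfolding hD(4)[OF x(1) y(1)] using hx hy mf bc
      by (simp add: B.minus_eq B.minus_add B.a_ac del: RA.B_simps)
    moreover have "N ((h x \<ominus>\<^bsub>RA.B\<^esub> RA.mono g ?f) \<oplus>\<^bsub>RA.B\<^esub> (h y \<ominus>\<^bsub>RA.B\<^esub> ?b)) \<le> e"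
      using BN.N_triangle[OF B.minus_closed[OF hx mf] B.minus_closed[OF hy bc]] x(2) y(2) by linarith
    ultimately have "N (h (x \<oplus>\<^bsub>FA n\<^esub> y) \<ominus>\<^bsub>RA.B\<^esub>
        cyl_mono 0 0 \<otimes>\<^bsub>RA.B\<^esub> (RA.mono g f \<oplus>\<^bsub>RA.B\<^esub> b) \<otimes>\<^bsub>RA.B\<^esub> cyl_mono 0 0) \<le> e" by (simp only:)
    then show ?case using F.a_closed[OF x(1) y(1)] by blast
  qed
qed

end

text \<open>
  The isometric copy of the Cuntz algebra is the whole corner of the sheet \<open>0\<close>, and the monomials that move
  the sheet \<open>0\<close> to the other sheets are a set of matrix units with this corner.
\<close>
lemma (in cantor_action) crossed_product_isomorphic:
  "cstar_isomorphic (enveloping_cstar RA.B) (matrix_cstar k (cuntz_algebra n))"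
proof -
  let ?F = "FA n" and ?P = "cyl_mono 0 0"
  let ?N = "max_cstar_seminorm RA.B {}"
  let ?A = "cuntz_algebra n"
  interpret F: seminormed_star_algebra ?F "cuntz_seminorm n" by (rule seminormed_cuntz)
  interpret B: star_algebra RA.B by (rule RA.star_algebra_B)
  have N: "cstar_seminorm RA.B ?N" by (rule B.cstar_seminorm_max[OF crossed_bounded])
  interpret BN: seminormed_star_algebra RA.B ?N by unfold_locales (rule N)
  define E where "E = hausdorff_completion RA.B ?N"
  interpret E: cstar_algebra E unfolding E_def by (rule BN.cstar_algebra_Com)
  have Aeq: "?A = hausdorff_completion ?F (cuntz_seminorm n)"
    by (simp add: cuntz_algebra_def universal_cstar_def)
  let ?eA = "completion_embed ?F (cuntz_seminorm n)"
  let ?eE = "completion_embed RA.B ?N"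
  have eA: "star_hom ?F ?A ?eA" unfolding Aeq by (rule F.star_hom_emb)
  have eE: "star_hom RA.B E ?eE" unfolding E_def by (rule BN.star_hom_emb)
  have nE: "cnorm E (?eE b) = ?N b" if "b \<in> carrier RA.B" for b unfolding E_def by (rule BN.cnorm_emb[OF that])
  interpret R: cantor_cuntz ?A n k "\<lambda>i. ?eA (cuntz_generator (Suc i))"
    by (intro cantor_cuntz.intro cantor_action_axioms cuntz_family_cuntz_algebra n2)
  note Pc = cyl_mono_closed[of 0 0]
  have PP: "?P \<otimes>\<^bsub>RA.B\<^esub> ?P = ?P" using cyl_mono_mult[of 0 0 0 0] by simp
  have digit: "0 \<le> int i - 1" "int i - 1 < int n ^ 1" if "i \<in> {1..n}" for i using that by auto
  obtain h where h: "star_hom ?F RA.B h" "h \<one>\<^bsub>?F\<^esub> = ?P"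
    "\<And>i. i \<in> {1..n} \<Longrightarrow> h (cuntz_generator i) = cyl_mono 1 (int i - 1)"
  proof (rule free_star_hom_exists[OF RA.star_algebra_B Pc cyl_mono_00_projection PP, of n "\<lambda>i. cyl_mono 1 (int i - 1)"])
    fix i assume i: "i \<in> {1..n}"
    show "cyl_mono 1 (int i - 1) \<in> carrier RA.B \<and> ?P \<otimes>\<^bsub>RA.B\<^esub> cyl_mono 1 (int i - 1) = cyl_mono 1 (int i - 1) \<and>
        cyl_mono 1 (int i - 1) \<otimes>\<^bsub>RA.B\<^esub> ?P = cyl_mono 1 (int i - 1)"
      using cyl_mono_mult[OF digit[OF i], of 0 0] cyl_mono_mult[of 0 0 1 "int i - 1"] cyl_mono_closed by simp
  qed (rule that)
  interpret C: cantor_corner n k h by unfold_locales (rule h(1), rule h(2), rule h(3))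
  note hD = star_homD[OF h(1)]
  have norm_h: "cnorm E (?eE (h x)) = cuntz_seminorm n x" if x: "x \<in> carrier ?F" for x
    using nE[OF hD(1)[OF x]] C.corner_norm_le[OF x] C.corner_norm_ge[OF x] by simp
  obtain \<phi> where \<phi>: "star_hom ?A E \<phi>" "\<And>x. x \<in> carrier ?F \<Longrightarrow> \<phi> (?eA x) = ?eE (h x)"
    "\<And>X. X \<in> carrier ?A \<Longrightarrow> cnorm E (\<phi> X) = cnorm ?A X"
    using F.extend_to_completion[OF E.cstar_algebra_axioms star_hom_compose[OF h(1) eE] norm_h]
    unfolding Aeq[symmetric] by blast
  note \<phi>D = star_homD[OF \<phi>(1)] and eED = star_homD[OF eE]
  let ?R = "\<phi> ` carrier ?A"
  have R_closed: "X \<in> ?R" if "X \<in> carrier E" "\<And>e. e > 0 \<Longrightarrow> \<exists>Z\<in>?R. cnorm E (Z \<ominus>\<^bsub>E\<^esub> X) \<le> e" for X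
    by (rule isometric_range_closed[OF R.C.cstar_algebra_axioms E.cstar_algebra_axioms \<phi>(1,3) that])
  have h_R: "?eE (h x) \<in> ?R" if "x \<in> carrier ?F" for x
    using \<phi>(2)[OF that] star_homD(1)[OF eA that] by (intro image_eqI[of _ _ "?eA x"]) simp_all
  let ?p = "?eE ?P"
  have pc: "?p \<in> carrier E" by (rule eED(1)[OF Pc])
  have pE: "?eE (?P \<otimes>\<^bsub>RA.B\<^esub> b \<otimes>\<^bsub>RA.B\<^esub> ?P) = ?p \<otimes>\<^bsub>E\<^esub> ?eE b \<otimes>\<^bsub>E\<^esub> ?p" if "b \<in> carrier RA.B" for b
    using Pc that by (simp add: eED(5))
  have corner: "?p \<otimes>\<^bsub>E\<^esub> X \<otimes>\<^bsub>E\<^esub> ?p \<in> ?R" if X: "X \<in> carrier E" for X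
  proof (rule R_closed)
    show pXp: "?p \<otimes>\<^bsub>E\<^esub> X \<otimes>\<^bsub>E\<^esub> ?p \<in> carrier E" using pc X by simp
    fix e :: real assume e: "e > 0"
    obtain b where b: "b \<in> carrier RA.B" "cnorm E (?eE b \<ominus>\<^bsub>E\<^esub> X) < e / 2"
      using BN.emb_dense[of X "e / 2"] X e unfolding E_def by auto
    let ?b = "?P \<otimes>\<^bsub>RA.B\<^esub> b \<otimes>\<^bsub>RA.B\<^esub> ?P"
    have bc: "?b \<in> carrier RA.B" by (rule B.m_closed[OF B.m_closed[OF Pc b(1)] Pc])
    obtain x where x: "x \<in> carrier ?F" "?N (h x \<ominus>\<^bsub>RA.B\<^esub> ?b) \<le> e / 2"
      using C.corner_approx[OF b(1), of "e / 2"] e by auto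
    have near: "cnorm E (?eE (h x) \<ominus>\<^bsub>E\<^esub> ?eE ?b) \<le> e / 2"
      using nE[OF B.minus_closed[OF hD(1)[OF x(1)] bc]] x(2)
        star_hom_diff[OF eE RA.star_algebra_B E.star_algebra_axioms hD(1)[OF x(1)] bc] by simp
    note eb = eED(1)[OF b(1)]
    let ?d = "?eE b \<ominus>\<^bsub>E\<^esub> X"
    have d: "?d \<in> carrier E" using eb X by simp
    have split: "?p \<otimes>\<^bsub>E\<^esub> ?eE b \<otimes>\<^bsub>E\<^esub> ?p \<ominus>\<^bsub>E\<^esub> ?p \<otimes>\<^bsub>E\<^esub> X \<otimes>\<^bsub>E\<^esub> ?p = ?p \<otimes>\<^bsub>E\<^esub> ?d \<otimes>\<^bsub>E\<^esub> ?p"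
      using pc eb X by (simp add: E.minus_eq E.l_distr E.r_distr E.l_minus E.r_minus)
    have p1: "cnorm E ?p \<le> 1"
    proof (rule E.N_projection[OF pc])
      show "star E ?p = ?p" using eED(2)[OF Pc] by (simp add: cyl_mono_00_projection)
      show "?p \<otimes>\<^bsub>E\<^esub> ?p = ?p" using eED(5)[OF Pc Pc] by (simp add: PP)
    qed
    have "cnorm E (?p \<otimes>\<^bsub>E\<^esub> ?d \<otimes>\<^bsub>E\<^esub> ?p) \<le> cnorm E (?p \<otimes>\<^bsub>E\<^esub> ?d) * cnorm E ?p"
      by (rule E.N_mult[OF E.m_closed[OF pc d] pc])
    also have "\<dots> \<le> cnorm E (?p \<otimes>\<^bsub>E\<^esub> ?d)"
      using p1 E.N_nonneg[OF E.m_closed[OF pc d]] by (rule mult_left_le)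
    also have "\<dots> \<le> cnorm E ?p * cnorm E ?d" by (rule E.N_mult[OF pc d])
    also have "\<dots> \<le> cnorm E ?d" by (rule mult_left_le_one_le[OF E.N_nonneg[OF d] E.N_nonneg[OF pc] p1])
    also have "\<dots> \<le> e / 2" using b(2) by simp
    finally have "cnorm E (?p \<otimes>\<^bsub>E\<^esub> ?d \<otimes>\<^bsub>E\<^esub> ?p) \<le> e / 2" .
    then have "cnorm E (?eE ?b \<ominus>\<^bsub>E\<^esub> ?p \<otimes>\<^bsub>E\<^esub> X \<otimes>\<^bsub>E\<^esub> ?p) \<le> e / 2" by (simp only: split pE[OF b(1)])
    then have "cnorm E (?eE (h x) \<ominus>\<^bsub>E\<^esub> ?p \<otimes>\<^bsub>E\<^esub> X \<otimes>\<^bsub>E\<^esub> ?p) \<le> e"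
      using E.N_diff_triangle[OF eED(1)[OF hD(1)[OF x(1)]] pXp eED(1)[OF bc]] near by linarith
    then show "\<exists>Z\<in>?R. cnorm E (Z \<ominus>\<^bsub>E\<^esub> (?p \<otimes>\<^bsub>E\<^esub> X \<otimes>\<^bsub>E\<^esub> ?p)) \<le> e" using h_R[OF x(1)] by blast
  qed
  have inj: "inj_on \<phi> (carrier ?A)"
  proof (rule inj_onI)
    fix a b assume a: "a \<in> carrier ?A" and b: "b \<in> carrier ?A" and eq: "\<phi> a = \<phi> b"
    have "\<phi> (a \<ominus>\<^bsub>?A\<^esub> b) = \<phi> a \<ominus>\<^bsub>E\<^esub> \<phi> b"
      by (rule star_hom_diff[OF \<phi>(1) R.C.star_algebra_axioms E.star_algebra_axioms a b])
    also have "\<dots> = \<zero>\<^bsub>E\<^esub>" unfolding eq using \<phi>D(1)[OF b] by (simp add: E.minus_eq E.r_neg)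
    finally have "cnorm ?A (a \<ominus>\<^bsub>?A\<^esub> b) = 0" using \<phi>(3)[of "a \<ominus>\<^bsub>?A\<^esub> b"] a b by simp
    then have "a \<ominus>\<^bsub>?A\<^esub> b = \<zero>\<^bsub>?A\<^esub>" using R.C.cnorm_eq_0 a b by simp
    moreover have "a = (a \<ominus>\<^bsub>?A\<^esub> b) \<oplus>\<^bsub>?A\<^esub> b" using a b by (simp add: R.C.minus_eq R.C.a_assoc R.C.l_neg)
    ultimately show "a = b" using b by simp
  qed
  have "cstar_isomorphic E (matrix_cstar k ?A)"
  proof (rule cstar_isomorphic_matrix_corner[OF E.cstar_algebra_axioms R.C.star_algebra_axioms \<phi>(1) inj _ corner])
    have "\<one>\<^bsub>?A\<^esub> = ?eA \<one>\<^bsub>?F\<^esub>" unfolding Aeq by (rule F.emb_one[symmetric])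
    then show "\<phi> \<one>\<^bsub>?A\<^esub> = ?p" using \<phi>(2)[OF F.one_closed] h(2) by simp
    show "?eE (sheet_mono i) \<in> carrier E" if "i < k" for i by (rule eED(1)[OF sheet_mono_closed])
    show "?eE (sheet_mono i) \<otimes>\<^bsub>E\<^esub> ?p = ?eE (sheet_mono i)" if "i < k" for i
      using eED(5)[OF sheet_mono_closed Pc, of i] by (simp add: sheet_mono_corner)
    show "star E (?eE (sheet_mono i)) \<otimes>\<^bsub>E\<^esub> ?eE (sheet_mono j) = (if i = j then ?p else \<zero>\<^bsub>E\<^esub>)"
      if ij: "i < k" "j < k" for i j
      using eED(5)[OF B.star_closed[OF sheet_mono_closed] sheet_mono_closed, of i j] eED(2)[OF sheet_mono_closed, of i]
        sheet_mono_orth[OF ij] star_hom_zero[OF eE RA.star_algebra_B E.star_algebra_axioms]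
      by (simp only: if_distrib[of ?eE])
    have "(\<Oplus>\<^bsub>E\<^esub>i\<in>{..<k}. ?eE (sheet_mono i) \<otimes>\<^bsub>E\<^esub> star E (?eE (sheet_mono i))) =
        (\<Oplus>\<^bsub>E\<^esub>i\<in>{..<k}. ?eE (sheet_mono i \<otimes>\<^bsub>RA.B\<^esub> star RA.B (sheet_mono i)))"
      using eED(5)[OF sheet_mono_closed B.star_closed[OF sheet_mono_closed]] eED(2)[OF sheet_mono_closed] by simp
    also have "\<dots> = ?eE (\<Oplus>\<^bsub>RA.B\<^esub>i\<in>{..<k}. sheet_mono i \<otimes>\<^bsub>RA.B\<^esub> star RA.B (sheet_mono i))"
      by (rule star_hom_finsum[OF eE RA.star_algebra_B E.star_algebra_axioms, symmetric])
        (auto intro!: B.m_closed B.star_closed sheet_mono_closed)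
    also have "\<dots> = \<one>\<^bsub>E\<^esub>" unfolding sheet_mono_sum E_def by (rule BN.emb_one)
    finally show "(\<Oplus>\<^bsub>E\<^esub>i\<in>{..<k}. ?eE (sheet_mono i) \<otimes>\<^bsub>E\<^esub> star E (?eE (sheet_mono i))) = \<one>\<^bsub>E\<^esub>" .
  qed
  then show ?thesis by (simp add: universal_cstar_def E_def)
qed

theorem mainTheorem2:
  fixes n k :: nat
  assumes "n \<ge> 2" and "k \<ge> 1"
  shows "cstar_isomorphic
    (partial_crossed_product (cont_fun_algebra (Y_space n k)) (H_group n) (alpha_ran n k) (alpha n k))
    (matrix_cstar k (cuntz_algebra n))"
proof -
  interpret cantor_action n k by unfold_locales (use assms in auto)
  show ?thesis
    using crossed_product_isomorphic unfolding partial_crossed_product_def B_eq .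
qed

end
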